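(* Let $(M,g)$ be an oriented space-time admitting a null conformal Killing-Yano tensor $A$ such that $Z_1\equiv\delta A$ and $Z_2\equiv\delta{*A}$ are Killing vectors verifying $Z_1\wedge Z_2\neq 0$. Then (locally) there are coordinates $\{u,v,\xi,\bar\xi\}$ ($u,v$ real, $\xi$ complex with conjugate $\bar\xi$) and a real function $f(u)$ such that the metric line element is $$ds^2=\frac{1}{[v+f(u)]^2}\left[-2\,du\,dv+2\,d\xi\,d\bar\xi\right],$$ and the Ricci tensor takes the expression $$Ric=\sigma\,\ell\otimes\ell+\Lambda g,\qquad \sigma=2f''(u)[v+f(u)]^3,\qquad \Lambda=6f'(u),$$ where $\ell=[v+f(u)]^{-2}\,du$ is the fundamental vector (as a 1-form) of $A$.
   Context: A space-time is an oriented 4-dimensional smooth manifold with metric $g$ of signature $(-,+,+,+)$ and volume element $\eta$; vectors and 1-forms are identified through $g$; all considerations are local. $\nabla$ is the Levi-Civita connection, $*$ the Hodge dual, $( *A)_{\alpha\beta}=\frac12\eta_{\alpha\beta\gamma\delta}A^{\gamma\delta}$, and the codifferential is $(\delta\omega)_{\underline p}=-\nabla_\alpha\omega^{\alpha}{}_{\underline p}$. The Ricci tensor has the sign for which round spheres have positive Ricci curvature. For a real two-form $A$ put $\mathcal A=\frac1{\sqrt2}(A-\mathrm i*A)$ (self-dual: $*\mathcal A=\mathrm i\mathcal A$). $A$ is a conformal Killing-Yano (CKY) tensor if $3\nabla_\alpha\mathcal A_{\beta\gamma}=2\mathcal Z^\mu\mathcal G_{\mu\alpha\beta\gamma}$,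 with $\mathcal Z=\delta\mathcal A$, $\mathcal G=\frac12(G-\mathrm i\eta)$, $G_{\alpha\beta\gamma\delta}=g_{\alpha\gamma}g_{\beta\delta}-g_{\alpha\delta}g_{\beta\gamma}$. $A$ is null if $A\neq0$ and $\mathcal A_{\alpha\beta}\mathcal A^{\alpha\beta}=0$. Then $\mathcal A=\ell\wedge m$ with $\ell$ a real null vector (the fundamental vector of $A$) and $m$ a complex null vector with $(m,\ell)=0$, $(m,\bar m)=1$.
   Formalization: When the fundamental vector of A is twisting (e.g. Robinson congruences in flat space), it cannot be a multiple of du; there f''=0 and ℓ is instead the fundamental vector of another null CKY tensor A' meeting the same hypotheses. Otherwise ℓ belongs to A itself. *)

theory Defs
  imports "HOL-Analysis.Analysis"
begin

text \<open>
  The geometry is local, so a space-time is an open set \<open>M\<close> of \<open>real ^ 4\<close>, the domain of a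
  positively oriented chart. Its metric is given by the component matrix \<open>g x $ a $ b\<close>.
  Vectors and 1-forms are identified through the metric, and all tensor fields are given by their
  covariant components.
\<close>

primrec Ck_on :: "nat \<Rightarrow> 'a::euclidean_space set \<Rightarrow> ('a \<Rightarrow> 'b::real_normed_vector) \<Rightarrow> bool" where
  "Ck_on 0 S f \<longleftrightarrow> continuous_on S f"
| "Ck_on (Suc k) S f \<longleftrightarrow>
     (\<forall>x\<in>S. f differentiable (at x)) \<and>
     (\<forall>e\<in>Basis. Ck_on k S (\<lambda>x. frechet_derivative f (at x) e))"

definition smooth_on :: "'a::euclidean_space set \<Rightarrow> ('a \<Rightarrow> 'b::real_normed_vector) \<Rightarrow> bool" where
  "smooth_on S f \<longleftrightarrow> (\<forall>k. Ck_on k S f)"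

definition pd :: "4 \<Rightarrow> (real ^ 4 \<Rightarrow> 'b::real_normed_vector) \<Rightarrow> real ^ 4 \<Rightarrow> 'b" where
  "pd a f x = frechet_derivative f (at x) (axis a 1)"

definition differential ::
  "(real ^ 4 \<Rightarrow> 'b::real_normed_vector) \<Rightarrow> real ^ 4 \<Rightarrow> real ^ 4 \<Rightarrow> 'b" where
  "differential f x w = frechet_derivative f (at x) w"


subsection \<open>Metric, connection, curvature\<close>

definition minkowski :: "real ^ 4 ^ 4" where
  "minkowski = (\<chi> a b. if a \<noteq> b then 0 else if a = 0 then - 1 else 1)"

definition spacetime :: "(real ^ 4) set \<Rightarrow> (real ^ 4 \<Rightarrow> real ^ 4 ^ 4) \<Rightarrow> bool" where
  "spacetime M g \<longleftrightarrow> open M \<and> smooth_on M g \<and>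
     (\<forall>x\<in>M. transpose (g x) = g x \<and>
        (\<exists>e :: 4 \<Rightarrow> real ^ 4. \<forall>a b. e a \<bullet> (g x *v e b) = minkowski $ a $ b))"

definition ginv :: "(real ^ 4 \<Rightarrow> real ^ 4 ^ 4) \<Rightarrow> real ^ 4 \<Rightarrow> real ^ 4 ^ 4" where
  "ginv g x = matrix_inv (g x)"

definition christoffel :: "(real ^ 4 \<Rightarrow> real ^ 4 ^ 4) \<Rightarrow> 4 \<Rightarrow> 4 \<Rightarrow> 4 \<Rightarrow> real ^ 4 \<Rightarrow> real" where
  "christoffel g c a b x = (\<Sum>d\<in>UNIV. ginv g x $ c $ d *
     (pd a (\<lambda>y. g y $ b $ d) x + pd b (\<lambda>y. g y $ a $ d) x - pd d (\<lambda>y. g y $ a $ b) x)) / 2"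

definition ricci :: "(real ^ 4 \<Rightarrow> real ^ 4 ^ 4) \<Rightarrow> real ^ 4 \<Rightarrow> real ^ 4 ^ 4" where
  "ricci g x = (\<chi> a b.
     (\<Sum>c\<in>UNIV. pd c (christoffel g c a b) x - pd b (christoffel g c a c) x) +
     (\<Sum>c\<in>UNIV. \<Sum>d\<in>UNIV. christoffel g c c d x * christoffel g d a b x
                         - christoffel g c b d x * christoffel g d a c x))"

text \<open>In the following two definitions the first index is the index of the derivative.\<close>

definition nabla1 ::
  "(real ^ 4 \<Rightarrow> real ^ 4 ^ 4) \<Rightarrow> (real ^ 4 \<Rightarrow> real ^ 4) \<Rightarrow> real ^ 4 \<Rightarrow> 4 \<Rightarrow> 4 \<Rightarrow> real" where
  "nabla1 g Z x a b = pd a (\<lambda>y. Z y $ b) x - (\<Sum>k\<in>UNIV. christoffel g k a b x * Z x $ k)"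

definition nabla2 ::
  "(real ^ 4 \<Rightarrow> real ^ 4 ^ 4) \<Rightarrow> (real ^ 4 \<Rightarrow> 'b::real_normed_vector ^ 4 ^ 4) \<Rightarrow> real ^ 4 \<Rightarrow>
     4 \<Rightarrow> 4 \<Rightarrow> 4 \<Rightarrow> 'b" where
  "nabla2 g T x a b c = pd a (\<lambda>y. T y $ b $ c) x
     - (\<Sum>k\<in>UNIV. christoffel g k a b x *\<^sub>R T x $ k $ c)
     - (\<Sum>k\<in>UNIV. christoffel g k a c x *\<^sub>R T x $ b $ k)"

definition codiff ::
  "(real ^ 4 \<Rightarrow> real ^ 4 ^ 4) \<Rightarrow> (real ^ 4 \<Rightarrow> 'b::real_normed_vector ^ 4 ^ 4) \<Rightarrow> real ^ 4 \<Rightarrow> 'b ^ 4"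
  where
  "codiff g T x = (\<chi> c. - (\<Sum>a\<in>UNIV. \<Sum>b\<in>UNIV. ginv g x $ a $ b *\<^sub>R nabla2 g T x a b c))"

definition Killing_on ::
  "(real ^ 4) set \<Rightarrow> (real ^ 4 \<Rightarrow> real ^ 4 ^ 4) \<Rightarrow> (real ^ 4 \<Rightarrow> real ^ 4) \<Rightarrow> bool" where
  "Killing_on M g Z \<longleftrightarrow> (\<forall>x\<in>M. \<forall>a b. nabla1 g Z x a b + nabla1 g Z x b a = 0)"


subsection \<open>Two-forms\<close>

definition wedge :: "'b::comm_ring ^ 4 \<Rightarrow> 'b ^ 4 \<Rightarrow> 'b ^ 4 ^ 4" where
  "wedge p q = (\<chi> a b. p $ a * q $ b - p $ b * q $ a)"

definition levi_civita :: "4 \<Rightarrow> 4 \<Rightarrow> 4 \<Rightarrow> 4 \<Rightarrow> real" where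
  "levi_civita a b c d =
     det (\<chi> r. axis (if r = 0 then a else if r = 1 then b else if r = 2 then c else d) 1)"

definition vol :: "(real ^ 4 \<Rightarrow> real ^ 4 ^ 4) \<Rightarrow> real ^ 4 \<Rightarrow> 4 \<Rightarrow> 4 \<Rightarrow> 4 \<Rightarrow> 4 \<Rightarrow> real" where
  "vol g x a b c d = sqrt (- det (g x)) * levi_civita a b c d"

definition hodge ::
  "(real ^ 4 \<Rightarrow> real ^ 4 ^ 4) \<Rightarrow> (real ^ 4 \<Rightarrow> real ^ 4 ^ 4) \<Rightarrow> real ^ 4 \<Rightarrow> real ^ 4 ^ 4" where
  "hodge g A x = (\<chi> a b. (\<Sum>c\<in>UNIV. \<Sum>d\<in>UNIV.
     vol g x a b c d * (ginv g x ** A x ** transpose (ginv g x)) $ c $ d) / 2)"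

definition selfdual ::
  "(real ^ 4 \<Rightarrow> real ^ 4 ^ 4) \<Rightarrow> (real ^ 4 \<Rightarrow> real ^ 4 ^ 4) \<Rightarrow> real ^ 4 \<Rightarrow> complex ^ 4 ^ 4" where
  "selfdual g A x = (\<chi> a b.
     (complex_of_real (A x $ a $ b) - \<i> * complex_of_real (hodge g A x $ a $ b))
       / complex_of_real (sqrt 2))"

definition two_form_on :: "(real ^ 4) set \<Rightarrow> (real ^ 4 \<Rightarrow> real ^ 4 ^ 4) \<Rightarrow> bool" where
  "two_form_on M A \<longleftrightarrow> smooth_on M A \<and> (\<forall>x\<in>M. transpose (A x) = - A x)"

definition calG ::
  "(real ^ 4 \<Rightarrow> real ^ 4 ^ 4) \<Rightarrow> real ^ 4 \<Rightarrow> 4 \<Rightarrow> 4 \<Rightarrow> 4 \<Rightarrow> 4 \<Rightarrow> complex" where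
  "calG g x a b c d =
     (complex_of_real (g x $ a $ c * g x $ b $ d - g x $ a $ d * g x $ b $ c)
       - \<i> * complex_of_real (vol g x a b c d)) / 2"

definition CKY_on ::
  "(real ^ 4) set \<Rightarrow> (real ^ 4 \<Rightarrow> real ^ 4 ^ 4) \<Rightarrow> (real ^ 4 \<Rightarrow> real ^ 4 ^ 4) \<Rightarrow> bool" where
  "CKY_on M g A \<longleftrightarrow> two_form_on M A \<and>
     (\<forall>x\<in>M. \<forall>a b c. 3 * nabla2 g (selfdual g A) x a b c =
        2 * (\<Sum>m\<in>UNIV. (\<Sum>n\<in>UNIV. complex_of_real (ginv g x $ m $ n)
                          * codiff g (selfdual g A) x $ n) * calG g x m a b c))"

definition null_on ::
  "(real ^ 4) set \<Rightarrow> (real ^ 4 \<Rightarrow> real ^ 4 ^ 4) \<Rightarrow> (real ^ 4 \<Rightarrow> real ^ 4 ^ 4) \<Rightarrow> bool" where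
  "null_on M g A \<longleftrightarrow> (\<forall>x\<in>M. A x \<noteq> 0 \<and>
     (\<Sum>a\<in>UNIV. \<Sum>b\<in>UNIV. \<Sum>c\<in>UNIV. \<Sum>d\<in>UNIV.
        complex_of_real (ginv g x $ a $ c) * complex_of_real (ginv g x $ b $ d)
        * selfdual g A x $ a $ b * selfdual g A x $ c $ d) = 0)"

definition independent_Killing_codiffs_on ::
  "(real ^ 4) set \<Rightarrow> (real ^ 4 \<Rightarrow> real ^ 4 ^ 4) \<Rightarrow> (real ^ 4 \<Rightarrow> real ^ 4 ^ 4) \<Rightarrow> bool" where
  "independent_Killing_codiffs_on M g A \<longleftrightarrow>
     Killing_on M g (codiff g A) \<and> Killing_on M g (codiff g (hodge g A)) \<and>
     (\<forall>x\<in>M. wedge (codiff g A x) (codiff g (hodge g A) x) \<noteq> 0)"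


subsection \<open>The fundamental vector of a null two-form\<close>

text \<open>The inner product of 1-forms, extended complex-bilinearly.\<close>

definition cinner ::
  "(real ^ 4 \<Rightarrow> real ^ 4 ^ 4) \<Rightarrow> real ^ 4 \<Rightarrow> complex ^ 4 \<Rightarrow> complex ^ 4 \<Rightarrow> complex" where
  "cinner g x p q = (\<Sum>a\<in>UNIV. \<Sum>b\<in>UNIV. complex_of_real (ginv g x $ a $ b) * p $ a * q $ b)"

definition cvec :: "real ^ 4 \<Rightarrow> complex ^ 4" where
  "cvec l = (\<chi> a. complex_of_real (l $ a))"

text \<open>The 1-form \<open>l\<close> is determined at each point up to sign.\<close>

definition fundamental_at ::
  "(real ^ 4 \<Rightarrow> real ^ 4 ^ 4) \<Rightarrow> (real ^ 4 \<Rightarrow> real ^ 4 ^ 4) \<Rightarrow> real ^ 4 \<Rightarrow> real ^ 4 \<Rightarrow> bool" where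
  "fundamental_at g A x l \<longleftrightarrow> cinner g x (cvec l) (cvec l) = 0 \<and>
     (\<exists>m :: complex ^ 4. cinner g x m m = 0 \<and> cinner g x m (cvec l) = 0 \<and>
        cinner g x m (\<chi> a. cnj (m $ a)) = 1 \<and> selfdual g A x = wedge (cvec l) m)"

text \<open>
  A null two-form is twisting if its fundamental 1-form \<open>l\<close> is nowhere hypersurface-orthogonal:
  \<open>l\<close> wedge \<open>dl\<close> vanishes at no point. Such forms exist: on Minkowski space with metric
  \<open>- 2 du dv + 2 dz dz*\<close> and a nonzero real \<open>c\<close>, the self-dual form
  \<open>(a du - z dz*) wedge (a dz - z dv)\<close>, \<open>a = v + i c\<close>, is the self-dual part of a null
  CKY tensor with independent Killing codifferentials (a Robinson congruence). Its fundamental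
  1-form is not proportional to any \<open>du\<close>.
\<close>

definition twisting_on ::
  "(real ^ 4) set \<Rightarrow> (real ^ 4 \<Rightarrow> real ^ 4 ^ 4) \<Rightarrow> (real ^ 4 \<Rightarrow> real ^ 4 ^ 4) \<Rightarrow> bool" where
  "twisting_on M g A \<longleftrightarrow> (\<exists>l :: real ^ 4 \<Rightarrow> real ^ 4. smooth_on M l \<and>
     (\<forall>x\<in>M. fundamental_at g A x (l x) \<and>
        (\<exists>a b c. l x $ a * (pd b (\<lambda>y. l y $ c) x - pd c (\<lambda>y. l y $ b) x)
               + l x $ b * (pd c (\<lambda>y. l y $ a) x - pd a (\<lambda>y. l y $ c) x)
               + l x $ c * (pd a (\<lambda>y. l y $ b) x - pd b (\<lambda>y. l y $ a) x) \<noteq> 0)))"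


subsection \<open>Coordinates\<close>

definition coordinates_on ::
  "(real ^ 4) set \<Rightarrow> (real ^ 4 \<Rightarrow> real) \<Rightarrow> (real ^ 4 \<Rightarrow> real) \<Rightarrow> (real ^ 4 \<Rightarrow> complex) \<Rightarrow> bool" where
  "coordinates_on U u v \<xi> \<longleftrightarrow> (let \<phi> = (\<lambda>x. (u x, v x, \<xi> x)) in
     smooth_on U \<phi> \<and> open (\<phi> ` U) \<and>
     (\<exists>\<psi>. smooth_on (\<phi> ` U) \<psi> \<and> (\<forall>x\<in>U. \<psi> (\<phi> x) = x)))"

end

(*
  A null self-dual form is kappa_A kappa_B epsilon_XY, and the conformal Killing-Yano equation
  says that the spinor kappa satisfies the twistor equation, with derivative part pi_X. The Killing
  condition forces d pi = lam kappa for a real function lam with d lam parallel to the fundamental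
  1-form l, so that the tetrad l = kappa kappa', n = pi pi', Z = kappa pi (primes denoting conjugates),
  together with s = kappa_A pi'^A, has a connection that is algebraic in l, n, Z, s and lam. Hence Im s is constant.

  If s is real, then l/s^2, n/s^2 and Z/s^2 are closed; their potentials are u, v and xi. As
  d(1/s) = dv - lam du, the difference 1/s - v is a function f(u) with f' = -lam, and the Ricci
  tensor follows by commuting covariant derivatives of the tetrad.

  If Im s is not zero, then l is twisting and lam is constant. Then (pi', lam kappa') satisfies
  the same equations as (kappa, pi), and a combination of the two solutions whose coefficients are
  parallel for a flat connection has real s.
*)

theory Submission
  imports Defs
begin

section \<open>Smooth maps\<close>

text \<open>No spinor occurs among the formal objects. A \<open>spinor_frame\<close> records only
  the products \<open>l\<close>, \<open>n\<close>, \<open>Z\<close> and the scalar \<open>s\<close>,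
  so each spinor identity becomes a comparison of coefficients in a null tetrad normalised by |s|^2,
  and no sign of kappa has to be chosen smoothly. The obstacle is twist. If Im s is not zero, the
  1-form \<open>l\<close> of the given tensor is proportional to no gradient, so no coordinates turn
  it into a multiple of du. The metric still has the normal form, but with the fundamental 1-form of
  another null CKY tensor on the same region. The coefficients that produce it solve an
  overdetermined linear system whose solvability is the vanishing of a curvature. Hence the
  existence theorem for parallel sections of flat connections, by Picard iteration along rays. It
  serves twice: for these coefficients and, with a nilpotent connection, for the potentials of
  closed 1-forms. The linear algebra at single points gives no regularity; smooth objects are
  obtained by explicit formulas in the components of \<open>A\<close> and its derivatives.\<close>

named_theorems smooth_intros

lemma Ck_on_cong:
  assumes "open S" "\<And>x. x \<in> S \<Longrightarrow> f x = g x"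
  shows "Ck_on k S f \<longleftrightarrow> Ck_on k S g"
  using assms(2)
proof (induction k arbitrary: f g)
  case 0
  then show ?case by (auto intro: continuous_on_cong[THEN iffD1])
next
  case (Suc k)
  have d: "(f has_derivative D) (at x) \<longleftrightarrow> (g has_derivative D) (at x)" if "x \<in> S" for x D
    using has_derivative_transform_within_open[OF _ assms(1) that, of f D UNIV g]
      has_derivative_transform_within_open[OF _ assms(1) that, of g D UNIV f] Suc.prems by auto
  then have f: "frechet_derivative f (at x) = frechet_derivative g (at x)" if "x \<in> S" for x
    using that by (simp add: frechet_derivative_def)
  have "f differentiable at x \<longleftrightarrow> g differentiable at x" if "x \<in> S" for x
    using d[OF that] by (simp add: differentiable_def)
  moreover have "Ck_on k S (\<lambda>x. frechet_derivative f (at x) e) \<longleftrightarrow>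
      Ck_on k S (\<lambda>x. frechet_derivative g (at x) e)" for e
    by (intro Suc.IH) (simp add: f)
  ultimately show ?case by auto
qed

text \<open>Frees the recursion from \<open>frechet_derivative\<close>: any formula for the
  derivative may be supplied, so the usual differentiation rules apply directly.\<close>

lemma Ck_on_SucI:
  assumes "open S" "\<And>x. x \<in> S \<Longrightarrow> (f has_derivative f' x) (at x)"
    and "\<And>e. e \<in> Basis \<Longrightarrow> Ck_on k S (\<lambda>x. f' x e)"
  shows "Ck_on (Suc k) S f"
proof -
  have f: "frechet_derivative f (at x) = f' x" if "x \<in> S" for x
    using assms(2)[OF that] frechet_derivative_at by metis
  have "Ck_on k S (\<lambda>x. frechet_derivative f (at x) e)" if "e \<in> Basis" for e
    using Ck_on_cong[OF assms(1), of "\<lambda>x. frechet_derivative f (at x) e" "\<lambda>x. f' x e"]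
      assms(3)[OF that] f by simp
  then show ?thesis using assms(2) by (auto simp: differentiable_def)
qed

lemma Ck_on_derivative:
  assumes "Ck_on (Suc k) S f" "x \<in> S"
  shows "(f has_derivative frechet_derivative f (at x)) (at x)"
  using assms frechet_derivative_works by auto

lemma Ck_on_lower: "open S \<Longrightarrow> Ck_on (Suc k) S f \<Longrightarrow> Ck_on k S f"
proof (induction k arbitrary: f)
  case 0
  then show ?case
    by (auto intro!: continuous_at_imp_continuous_on differentiable_imp_continuous_within)
next
  case (Suc k)
  have "\<forall>x\<in>S. f differentiable at x"
    and D: "e \<in> Basis \<Longrightarrow> Ck_on (Suc k) S (\<lambda>x. frechet_derivative f (at x) e)" for e
    using Suc.prems(2) unfolding Ck_on.simps(2)[of "Suc k"] by blast+
  then show ?case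
    using Suc.IH[OF Suc.prems(1) D] unfolding Ck_on.simps(2)[of k] by blast
qed

lemma Ck_on_const: "open S \<Longrightarrow> Ck_on k S (\<lambda>x. c)"
proof (induction k arbitrary: c)
  case (Suc k)
  show ?case
    by (rule Ck_on_SucI[OF Suc.prems has_derivative_const]) (rule Suc.IH[OF Suc.prems])
qed (simp add: continuous_on_const)

lemma Ck_on_bounded_linear:
  assumes "bounded_linear L" "open S"
  shows "Ck_on k S f \<Longrightarrow> Ck_on k S (\<lambda>x. L (f x))"
proof (induction k arbitrary: f)
  case 0
  then show ?case using bounded_linear.continuous_on[OF assms(1)] by auto
next
  case (Suc k)
  show ?case
    by (rule Ck_on_SucI[OF assms(2) bounded_linear.has_derivative[OF assms(1) Ck_on_derivative[OF Suc.prems]]])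
       (use Suc assms in auto)
qed

lemma Ck_on_add:
  assumes "open S"
  shows "Ck_on k S f \<Longrightarrow> Ck_on k S g \<Longrightarrow> Ck_on k S (\<lambda>x. f x + g x)"
proof (induction k arbitrary: f g)
  case 0
  then show ?case by (auto intro: continuous_intros)
next
  case (Suc k)
  show ?case
    by (rule Ck_on_SucI[OF assms has_derivative_add[OF Ck_on_derivative[OF Suc.prems(1)] Ck_on_derivative[OF Suc.prems(2)]]])
       (use Suc in auto)
qed

lemma Ck_on_bilinear:
  assumes "bounded_bilinear B" "open S"
  shows "Ck_on k S f \<Longrightarrow> Ck_on k S g \<Longrightarrow> Ck_on k S (\<lambda>x. B (f x) (g x))"
proof (induction k arbitrary: f g)
  case 0
  then show ?case using bounded_bilinear.continuous_on[OF assms(1)] by auto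
next
  case (Suc k)
  have lower: "Ck_on k S f" "Ck_on k S g" using Suc.prems Ck_on_lower[OF assms(2)] by auto
  show ?case
    by (rule Ck_on_SucI[OF assms(2) bounded_bilinear.FDERIV[OF assms(1) Ck_on_derivative[OF Suc.prems(1)] Ck_on_derivative[OF Suc.prems(2)]]])
       (use Suc lower in \<open>auto intro!: Ck_on_add assms\<close>)
qed

lemma smooth_onD: "smooth_on S f \<Longrightarrow> Ck_on k S f"
  by (simp add: smooth_on_def)

lemma smooth_on_cong:
  assumes "smooth_on S f" "open S" "\<And>x. x \<in> S \<Longrightarrow> g x = f x"
  shows "smooth_on S g"
  using assms Ck_on_cong[of S g f] by (auto simp: smooth_on_def)

lemma smooth_on_subset:
  assumes "smooth_on S f" "T \<subseteq> S"
  shows "smooth_on T f"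
proof -
  have "Ck_on k S f \<Longrightarrow> Ck_on k T f" for k
    by (induction k arbitrary: f) (use assms(2) continuous_on_subset in auto)
  then show ?thesis using assms(1) by (auto simp: smooth_on_def)
qed

lemma smooth_on_const [smooth_intros]: "open S \<Longrightarrow> smooth_on S (\<lambda>x. c)"
  by (simp add: smooth_on_def Ck_on_const)

lemma smooth_on_bounded_linear:
  "bounded_linear L \<Longrightarrow> open S \<Longrightarrow> smooth_on S f \<Longrightarrow> smooth_on S (\<lambda>x. L (f x))"
  by (simp add: smooth_on_def Ck_on_bounded_linear)

lemma smooth_on_bilinear:
  "bounded_bilinear B \<Longrightarrow> open S \<Longrightarrow> smooth_on S f \<Longrightarrow> smooth_on S g \<Longrightarrow>
    smooth_on S (\<lambda>x. B (f x) (g x))"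
  by (simp add: smooth_on_def Ck_on_bilinear)

lemma smooth_on_add [smooth_intros]:
  "open S \<Longrightarrow> smooth_on S f \<Longrightarrow> smooth_on S g \<Longrightarrow> smooth_on S (\<lambda>x. f x + g x)"
  by (simp add: smooth_on_def Ck_on_add)

lemma smooth_on_mult [smooth_intros]:
  fixes f g :: "_ \<Rightarrow> 'b::real_normed_algebra"
  shows "open S \<Longrightarrow> smooth_on S f \<Longrightarrow> smooth_on S g \<Longrightarrow> smooth_on S (\<lambda>x. f x * g x)"
  by (rule smooth_on_bilinear[OF bounded_bilinear_mult])

lemma smooth_on_scaleR [smooth_intros]:
  "open S \<Longrightarrow> smooth_on S f \<Longrightarrow> smooth_on S g \<Longrightarrow> smooth_on S (\<lambda>x. f x *\<^sub>R g x)"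
  by (rule smooth_on_bilinear[OF bounded_bilinear_scaleR])

lemma smooth_on_minus [smooth_intros]:
  "open S \<Longrightarrow> smooth_on S f \<Longrightarrow> smooth_on S (\<lambda>x. - f x)"
  by (rule smooth_on_bounded_linear[OF bounded_linear_minus[OF bounded_linear_ident]])

lemma smooth_on_diff [smooth_intros]:
  "open S \<Longrightarrow> smooth_on S f \<Longrightarrow> smooth_on S g \<Longrightarrow> smooth_on S (\<lambda>x. f x - g x)"
  using smooth_on_add[of S f "\<lambda>x. - g x"] smooth_on_minus[of S g] by simp

lemma smooth_on_sum [smooth_intros]:
  assumes "open S" "\<And>i. i \<in> I \<Longrightarrow> smooth_on S (f i)"
  shows "smooth_on S (\<lambda>x. \<Sum>i\<in>I. f i x)"
  using assms(2)
  by (induction I rule: infinite_finite_induct) (auto intro!: smooth_intros assms(1))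

lemma smooth_on_prod [smooth_intros]:
  fixes f :: "'i \<Rightarrow> 'a::euclidean_space \<Rightarrow> 'b::real_normed_field"
  assumes "open S" "\<And>i. i \<in> I \<Longrightarrow> smooth_on S (f i)"
  shows "smooth_on S (\<lambda>x. \<Prod>i\<in>I. f i x)"
  using assms(2)
  by (induction I rule: infinite_finite_induct) (auto intro!: smooth_intros assms(1))

lemma smooth_on_linear:
  assumes "bounded_linear L" "open S"
  shows "smooth_on S L"
proof -
  have "Ck_on k S L" for k
  proof (cases k)
    case 0
    then show ?thesis using linear_continuous_on[OF assms(1)] by auto
  next
    case (Suc m)
    show ?thesis unfolding Suc
      by (rule Ck_on_SucI[OF assms(2) bounded_linear_imp_has_derivative[OF assms(1)]])
         (simp add: Ck_on_const assms)
  qed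
  then show ?thesis by (simp add: smooth_on_def)
qed

text \<open>By the chain rule the derivative is that of \<open>g\<close> in the moving direction
  Df(e). Expanding this direction in the basis leaves finitely many products of a component of Df(e)
  with a basis derivative of \<open>g\<close> composed with \<open>f\<close>. The induction
  hypothesis is applied to these derivatives of \<open>g\<close>, hence
  \<open>arbitrary: g\<close>.\<close>

lemma Ck_on_compose:
  fixes f :: "'a::euclidean_space \<Rightarrow> 'b::euclidean_space" and g :: "'b \<Rightarrow> 'c::real_normed_vector"
  assumes "f ` S \<subseteq> T" "open S"
  shows "Ck_on k S f \<Longrightarrow> Ck_on k T g \<Longrightarrow> Ck_on k S (\<lambda>x. g (f x))"
proof (induction k arbitrary: g)
  case 0
  then show ?case using continuous_on_compose2[of T g S f] assms(1) by auto
next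
  case (Suc k)
  have f: "Ck_on k S f" using Ck_on_lower[OF assms(2) Suc.prems(1)] .
  have d: "((\<lambda>x. g (f x)) has_derivative
      (\<lambda>e. frechet_derivative g (at (f x)) (frechet_derivative f (at x) e))) (at x)"
    if "x \<in> S" for x
    by (rule has_derivative_compose[OF Ck_on_derivative[OF Suc.prems(1) that]])
       (use Suc.prems(2) Ck_on_derivative assms(1) that in blast)
  have exp: "frechet_derivative g (at (f x)) w =
      (\<Sum>b\<in>Basis. (w \<bullet> b) *\<^sub>R frechet_derivative g (at (f x)) b)" if "x \<in> S" for x w
  proof -
    interpret linear "frechet_derivative g (at (f x))"
      using Ck_on_derivative[OF Suc.prems(2), of "f x"] assms(1) that has_derivative_linear by blast
    show ?thesis
      by (subst euclidean_representation[of w, symmetric]) (simp add: sum scaleR)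
  qed
  show ?case
  proof (rule Ck_on_SucI[OF assms(2) d])
    fix e :: 'a assume e: "e \<in> Basis"
    have "Ck_on k S (\<lambda>x. frechet_derivative g (at (f x)) b)" if "b \<in> Basis" for b
      using Suc.IH[of "\<lambda>y. frechet_derivative g (at y) b"] Suc.prems that f by auto
    moreover have "Ck_on k S (\<lambda>x. frechet_derivative f (at x) e \<bullet> b)" for b
      using Suc.prems(1) e by (auto intro!: Ck_on_bounded_linear[OF bounded_linear_inner_left] assms(2))
    ultimately have *: "Ck_on k S (\<lambda>x. (frechet_derivative f (at x) e \<bullet> b) *\<^sub>R
        frechet_derivative g (at (f x)) b)" if "b \<in> Basis" for b
      using that by (intro Ck_on_bilinear[OF bounded_bilinear_scaleR] assms(2))
    have "Ck_on k S (\<lambda>x. \<Sum>b\<in>B. (frechet_derivative f (at x) e \<bullet> b) *\<^sub>R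
        frechet_derivative g (at (f x)) b)" if "B \<subseteq> Basis" for B
      using finite_subset[OF that finite_Basis] that
      by (induction B rule: finite_induct) (auto intro!: Ck_on_add Ck_on_const assms(2) *)
    then show "Ck_on k S (\<lambda>x. frechet_derivative g (at (f x)) (frechet_derivative f (at x) e))"
      by (subst Ck_on_cong[OF assms(2) exp]) auto
  qed
qed

lemma smooth_on_compose:
  fixes f :: "'a::euclidean_space \<Rightarrow> 'b::euclidean_space" and g :: "'b \<Rightarrow> 'c::real_normed_vector"
  assumes "smooth_on S f" "smooth_on T g" "f ` S \<subseteq> T" "open S"
  shows "smooth_on S (\<lambda>x. g (f x))"
  unfolding smooth_on_def
  using Ck_on_compose[OF assms(3,4) smooth_onD[OF assms(1)] smooth_onD[OF assms(2)]] by blast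

text \<open>The derivative of 1/f is a product of 1/f and Df, so the class of 1/f improves itself by
  induction.\<close>

lemma smooth_on_inverse [smooth_intros]:
  fixes f :: "'a::euclidean_space \<Rightarrow> 'b::real_normed_field"
  assumes "open S" "smooth_on S f" "\<And>x. x \<in> S \<Longrightarrow> f x \<noteq> 0"
  shows "smooth_on S (\<lambda>x. inverse (f x))"
proof -
  have "Ck_on k S (\<lambda>x. inverse (f x))" for k
  proof (induction k)
    case 0
    then show ?case using smooth_onD[OF assms(2), of 0] assms(3)
      by (auto intro!: continuous_intros)
  next
    case (Suc k)
    have f: "Ck_on (Suc k) S f" for k using assms(2) by (rule smooth_onD)
    show ?case
    proof (rule Ck_on_SucI[OF assms(1)])
      show "((\<lambda>x. inverse (f x)) has_derivative
          (\<lambda>h. - (inverse (f x) * frechet_derivative f (at x) h * inverse (f x)))) (at x)"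
        if "x \<in> S" for x
        using Deriv.has_derivative_inverse[OF assms(3)[OF that] Ck_on_derivative[OF f that]] .
      show "Ck_on k S (\<lambda>x. - (inverse (f x) * frechet_derivative f (at x) e * inverse (f x)))"
        if "e \<in> Basis" for e
        using f[of k] that Suc.IH
        by (auto intro!: Ck_on_bounded_linear[OF bounded_linear_minus[OF bounded_linear_ident]]
            Ck_on_bilinear[OF bounded_bilinear_mult] assms(1))
    qed
  qed
  then show ?thesis by (simp add: smooth_on_def)
qed

lemma smooth_on_divide [smooth_intros]:
  fixes f g :: "'a::euclidean_space \<Rightarrow> 'b::real_normed_field"
  assumes "open S" "smooth_on S f" "smooth_on S g" "\<And>x. x \<in> S \<Longrightarrow> g x \<noteq> 0"
  shows "smooth_on S (\<lambda>x. f x / g x)"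
  unfolding divide_inverse by (intro smooth_intros assms)

text \<open>The induction is run for 1/sqrt f, because its derivative -Df (1/sqrt f)^3 / 2 contains
  only itself and Df. Multiplication by f then gives sqrt f.\<close>

lemma smooth_on_sqrt [smooth_intros]:
  assumes "open S" "smooth_on S f" "\<And>x. x \<in> S \<Longrightarrow> f x > 0"
  shows "smooth_on S (\<lambda>x. sqrt (f x))"
proof -
  have "Ck_on k S (\<lambda>x. inverse (sqrt (f x)))" for k
  proof (induction k)
    case 0
    then show ?case using smooth_onD[OF assms(2), of 0] assms(3)
      by (force intro!: continuous_intros)
  next
    case (Suc k)
    have f: "Ck_on (Suc k) S f" for k using assms(2) by (rule smooth_onD)
    show ?case
    proof (rule Ck_on_SucI[OF assms(1)])
      show "((\<lambda>x. inverse (sqrt (f x))) has_derivative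
          (\<lambda>h. - (frechet_derivative f (at x) h *
            (inverse (sqrt (f x)) * (inverse (sqrt (f x)) * (inverse (sqrt (f x)) / 2)))))) (at x)"
        if "x \<in> S" for x
        by (rule derivative_eq_intros Ck_on_derivative[OF f that] refl | use assms(3)[OF that] in force)+
      show "Ck_on k S (\<lambda>x. - (frechet_derivative f (at x) e *
            (inverse (sqrt (f x)) * (inverse (sqrt (f x)) * (inverse (sqrt (f x)) / 2)))))"
        if "e \<in> Basis" for e
        using f[of k] that Suc.IH
        by (auto intro!: Ck_on_bounded_linear[OF bounded_linear_minus[OF bounded_linear_ident]]
            Ck_on_bounded_linear[OF bounded_linear_divide]
            Ck_on_bilinear[OF bounded_bilinear_mult] assms(1))
    qed
  qed
  then have "smooth_on S (\<lambda>x. inverse (sqrt (f x)))" by (simp add: smooth_on_def)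
  then have "smooth_on S (\<lambda>x. f x * inverse (sqrt (f x)))" by (rule smooth_on_mult[OF assms(1,2)])
  then show ?thesis
    by (rule smooth_on_cong[OF _ assms(1)])
       (use assms(3) in \<open>simp add: real_div_sqrt less_imp_le flip: divide_inverse\<close>)
qed

lemmas smooth_on_of_real [smooth_intros] = smooth_on_bounded_linear[OF bounded_linear_of_real]
lemmas smooth_on_Re [smooth_intros] = smooth_on_bounded_linear[OF bounded_linear_Re]
lemmas smooth_on_Im [smooth_intros] = smooth_on_bounded_linear[OF bounded_linear_Im]
lemmas smooth_on_cnj [smooth_intros] = smooth_on_bounded_linear[OF bounded_linear_cnj]
lemmas smooth_on_nth [smooth_intros] = smooth_on_bounded_linear[OF bounded_linear_vec_nth]

lemma smooth_on_complex_iff: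
  assumes "open S"
  shows "smooth_on S f \<longleftrightarrow> smooth_on S (\<lambda>x. Re (f x)) \<and> smooth_on S (\<lambda>x. Im (f x))"
proof
  assume "smooth_on S (\<lambda>x. Re (f x)) \<and> smooth_on S (\<lambda>x. Im (f x))"
  then have "smooth_on S (\<lambda>x. of_real (Re (f x)) + \<i> * of_real (Im (f x)))"
    by (intro smooth_on_add smooth_on_mult smooth_on_const smooth_on_of_real assms) auto
  then show "smooth_on S f" by (simp add: complex_eq[symmetric])
qed (use smooth_on_Re smooth_on_Im assms in blast)

lemma smooth_on_vec [smooth_intros]:
  fixes f :: "'n::finite \<Rightarrow> 'a::euclidean_space \<Rightarrow> 'b::real_normed_vector"
  assumes "open S" "\<And>i. smooth_on S (f i)"
  shows "smooth_on S (\<lambda>x. \<chi> i. f i x)"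
proof -
  have "norm (axis i z :: 'b^'n) = norm z" for i z
    by (simp add: norm_vec_def L2_set_def axis_def if_distrib[of norm] if_distrib[of "\<lambda>x. x^2"]
        cong: if_cong)
  then have "bounded_linear (axis i :: 'b \<Rightarrow> 'b^'n)" for i
    by (intro bounded_linear_intro[where K=1]) (simp_all add: vec_eq_iff axis_def)
  then have "smooth_on S (\<lambda>x. \<Sum>i\<in>UNIV. axis i (f i x))"
    by (intro smooth_on_sum assms(1) smooth_on_bounded_linear[of "axis _"] assms(2))
  moreover have "(\<chi> i. y i) = (\<Sum>i\<in>UNIV. axis i (y i))" for y :: "'n \<Rightarrow> 'b"
    by (simp add: vec_eq_iff axis_def if_distrib cong: if_cong)
  ultimately show ?thesis by simp
qed

lemma smooth_on_vec_iff:
  fixes f :: "'a::euclidean_space \<Rightarrow> 'b::real_normed_vector ^ 'n"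
  assumes "open S"
  shows "smooth_on S f \<longleftrightarrow> (\<forall>i. smooth_on S (\<lambda>x. f x $ i))"
proof
  assume "\<forall>i. smooth_on S (\<lambda>x. f x $ i)"
  then have "smooth_on S (\<lambda>x. \<chi> i. f x $ i)" by (intro smooth_on_vec assms) auto
  then show "smooth_on S f" by simp
qed (use smooth_on_nth assms in blast)

lemma smooth_on_has_derivative:
  assumes "smooth_on S f" "x \<in> S"
  shows "(f has_derivative frechet_derivative f (at x)) (at x)"
  using Ck_on_derivative smooth_onD assms by blast

lemma smooth_on_differentiable: "smooth_on S f \<Longrightarrow> x \<in> S \<Longrightarrow> f differentiable at x"
  using smooth_on_has_derivative differentiable_def by blast

lemma smooth_on_continuous_on: "smooth_on S f \<Longrightarrow> continuous_on S f"
  using smooth_onD[of S f 0] by simp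

lemma smooth_on_frechet_derivative:
  assumes "smooth_on S f" "open S"
  shows "smooth_on S (\<lambda>x. frechet_derivative f (at x) w)"
proof -
  have "smooth_on S (\<lambda>x. frechet_derivative f (at x) b)" if "b \<in> Basis" for b
    unfolding smooth_on_def
  proof
    fix k
    have "Ck_on (Suc k) S f" by (rule smooth_onD[OF assms(1)])
    then show "Ck_on k S (\<lambda>x. frechet_derivative f (at x) b)" using that by simp
  qed
  then have 1: "smooth_on S (\<lambda>x. \<Sum>b\<in>Basis. (w \<bullet> b) *\<^sub>R frechet_derivative f (at x) b)"
    by (intro smooth_on_sum smooth_on_scaleR smooth_on_const assms(2))
  have 2: "frechet_derivative f (at x) w =
      (\<Sum>b\<in>Basis. (w \<bullet> b) *\<^sub>R frechet_derivative f (at x) b)" if "x \<in> S" for x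
  proof -
    interpret linear "frechet_derivative f (at x)"
      using smooth_on_has_derivative[OF assms(1) that] has_derivative_linear by blast
    show ?thesis
      by (subst euclidean_representation[of w, symmetric]) (simp add: sum scaleR)
  qed
  show ?thesis by (rule smooth_on_cong[OF 1 assms(2) 2])
qed

section \<open>Partial derivatives\<close>

lemma pd_eqI: "(f has_derivative f') (at x) \<Longrightarrow> pd a f x = f' (axis a 1)"
  unfolding pd_def using frechet_derivative_at by metis

lemma smooth_on_pd [smooth_intros]: "open S \<Longrightarrow> smooth_on S f \<Longrightarrow> smooth_on S (pd a f)"
  unfolding pd_def by (rule smooth_on_frechet_derivative)

lemma pd_cong:
  assumes "open S" "x \<in> S" "\<And>y. y \<in> S \<Longrightarrow> f y = g y"
  shows "pd a f x = pd a g x"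
proof -
  have "(f has_derivative D) (at x) \<longleftrightarrow> (g has_derivative D) (at x)" for D
    using has_derivative_transform_within_open[OF _ assms(1,2), of f D UNIV g]
      has_derivative_transform_within_open[OF _ assms(1,2), of g D UNIV f] assms(3) by auto
  then show ?thesis by (simp add: pd_def frechet_derivative_def)
qed

lemma frechet_derivative_pd:
  assumes "f differentiable at x"
  shows "frechet_derivative f (at x) w = (\<Sum>a\<in>UNIV. w $ a *\<^sub>R pd a f x)"
proof -
  interpret linear "frechet_derivative f (at x)"
    using assms linear_frechet_derivative by blast
  have "w = (\<Sum>a\<in>UNIV. w $ a *\<^sub>R axis a 1)"
    by (simp add: vec_eq_iff axis_def if_distrib cong: if_cong)
  then show ?thesis by (simp add: pd_def flip: sum scaleR)
qed

lemma has_derivative_pd: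
  assumes "f differentiable at x"
  shows "(f has_derivative (\<lambda>w. \<Sum>a\<in>UNIV. w $ a *\<^sub>R pd a f x)) (at x)"
proof -
  have "(\<lambda>w. \<Sum>a\<in>UNIV. w $ a *\<^sub>R pd a f x) = frechet_derivative f (at x)"
    using frechet_derivative_pd[OF assms] by auto
  then show ?thesis using assms frechet_derivative_works by metis
qed

section \<open>Calculus rules for partial derivatives\<close>

lemma pd_bounded_linear:
  assumes "bounded_linear L" "f differentiable at x"
  shows "pd a (\<lambda>y. L (f y)) x = L (pd a f x)"
  by (rule pd_eqI[OF bounded_linear.has_derivative[OF assms(1)], THEN trans])
     (use assms(2) frechet_derivative_works in \<open>auto simp: pd_def\<close>)

lemmas pd_of_real = pd_bounded_linear[OF bounded_linear_of_real]
lemmas pd_Re = pd_bounded_linear[OF bounded_linear_Re]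
lemmas pd_Im = pd_bounded_linear[OF bounded_linear_Im]
lemmas pd_cnj = pd_bounded_linear[OF bounded_linear_cnj]
lemmas pd_nth = pd_bounded_linear[OF bounded_linear_vec_nth]

lemma pd_const: "pd a (\<lambda>y. c) x = 0"
  by (rule pd_eqI[OF has_derivative_const])

lemma pd_add:
  assumes "f differentiable at x" "g differentiable at x"
  shows "pd a (\<lambda>y. f y + g y) x = pd a f x + pd a g x"
  by (rule pd_eqI[OF has_derivative_add, THEN trans])
     (use assms frechet_derivative_works in \<open>auto simp: pd_def\<close>)

lemma pd_diff:
  assumes "f differentiable at x" "g differentiable at x"
  shows "pd a (\<lambda>y. f y - g y) x = pd a f x - pd a g x"
  by (rule pd_eqI[OF has_derivative_diff, THEN trans])
     (use assms frechet_derivative_works in \<open>auto simp: pd_def\<close>)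

lemma pd_minus:
  assumes "f differentiable at x"
  shows "pd a (\<lambda>y. - f y) x = - pd a f x"
  by (rule pd_eqI[OF has_derivative_minus, THEN trans])
     (use assms frechet_derivative_works in \<open>auto simp: pd_def\<close>)

lemma pd_mult:
  fixes f g :: "real ^ 4 \<Rightarrow> 'b::real_normed_algebra"
  assumes "f differentiable at x" "g differentiable at x"
  shows "pd a (\<lambda>y. f y * g y) x = f x * pd a g x + pd a f x * g x"
  by (rule pd_eqI[OF has_derivative_mult, THEN trans])
     (use assms frechet_derivative_works in \<open>auto simp: pd_def\<close>)

lemma pd_sum:
  assumes "\<And>i. i \<in> I \<Longrightarrow> f i differentiable at x"
  shows "pd a (\<lambda>y. \<Sum>i\<in>I. f i y) x = (\<Sum>i\<in>I. pd a (f i) x)"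
  by (rule pd_eqI[OF has_derivative_sum, THEN trans])
     (use assms frechet_derivative_works in \<open>auto simp: pd_def\<close>)

lemma pd_inverse:
  fixes f :: "real ^ 4 \<Rightarrow> 'b::real_normed_field"
  assumes "f differentiable at x" "f x \<noteq> 0"
  shows "pd a (\<lambda>y. inverse (f y)) x = - pd a f x / (f x)\<^sup>2"
  by (rule pd_eqI[OF Deriv.has_derivative_inverse, THEN trans])
     (use assms frechet_derivative_works in \<open>auto simp: pd_def field_simps power2_eq_square\<close>)

text \<open>The second difference over a small parallelogram, by two applications of the mean value
  theorem: along \<open>e\<close> to the difference of \<open>f\<close> on opposite sides, then
  along \<open>k\<close> to the derivative in direction \<open>e\<close>.\<close>

lemma Schwarz_points:
  fixes f :: "'a::euclidean_space \<Rightarrow> real"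
  assumes f: "smooth_on S f" "open S" and h: "h > 0"
    and S: "\<And>s t. 0 \<le> s \<Longrightarrow> s \<le> h \<Longrightarrow> 0 \<le> t \<Longrightarrow> t \<le> h \<Longrightarrow> x + s *\<^sub>R e + t *\<^sub>R k \<in> S"
  shows "\<exists>s t. 0 < s \<and> s < h \<and> 0 < t \<and> t < h \<and>
    f (x + h *\<^sub>R e + h *\<^sub>R k) - f (x + h *\<^sub>R e) - f (x + h *\<^sub>R k) + f x =
    h\<^sup>2 * frechet_derivative (\<lambda>y. frechet_derivative f (at y) e) (at (x + s *\<^sub>R e + t *\<^sub>R k)) k"
proof -
  have line: "((\<lambda>s. F (z + s *\<^sub>R e)) has_real_derivative frechet_derivative F (at (z + s *\<^sub>R e)) e) (at s)"
    if "smooth_on S F" "z + s *\<^sub>R e \<in> S" for F :: "'a \<Rightarrow> real" and z e s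
  proof -
    have F: "(F has_derivative frechet_derivative F (at (z + s *\<^sub>R e))) (at (z + s *\<^sub>R e))"
      using that smooth_on_has_derivative by blast
    interpret linear "frechet_derivative F (at (z + s *\<^sub>R e))"
      using F has_derivative_linear by blast
    have "((\<lambda>s. F (z + s *\<^sub>R e)) has_derivative
        (\<lambda>u. frechet_derivative F (at (z + s *\<^sub>R e)) (u *\<^sub>R e))) (at s)"
      by (rule has_derivative_compose[where f="\<lambda>s. z + s *\<^sub>R e" and x=s and s=UNIV, OF _ F])
         (auto intro!: derivative_eq_intros)
    then show ?thesis by (simp add: has_field_derivative_def scaleR mult_commute_abs)
  qed
  define F where "F = (\<lambda>y. frechet_derivative f (at y) e)"
  have F: "smooth_on S F" unfolding F_def by (intro smooth_on_frechet_derivative f)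
  have "\<exists>s>0. s < h \<and> (f (x + h *\<^sub>R k + h *\<^sub>R e) - f (x + h *\<^sub>R e)) - (f (x + h *\<^sub>R k + 0 *\<^sub>R e) - f (x + 0 *\<^sub>R e))
      = (h - 0) * (F (x + h *\<^sub>R k + s *\<^sub>R e) - F (x + s *\<^sub>R e))"
    unfolding F_def using S[of _ h] S[of _ 0] h
    by (intro MVT2 DERIV_diff line f(1)) (auto simp: algebra_simps)
  then obtain s where s: "0 < s" "s < h" and 1: "f (x + h *\<^sub>R e + h *\<^sub>R k) - f (x + h *\<^sub>R e) - f (x + h *\<^sub>R k) + f x
      = h * (F (x + s *\<^sub>R e + h *\<^sub>R k) - F (x + s *\<^sub>R e))"
    by (auto simp: algebra_simps)
  have "\<exists>t>0. t < h \<and> F (x + s *\<^sub>R e + h *\<^sub>R k) - F (x + s *\<^sub>R e + 0 *\<^sub>R k)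
      = (h - 0) * frechet_derivative F (at (x + s *\<^sub>R e + t *\<^sub>R k)) k"
    using S[of s] s h by (intro MVT2 line F) auto
  then show ?thesis using s 1 by (force simp: F_def power2_eq_square)
qed

text \<open>The second difference is symmetric in \<open>e\<close> and \<open>k\<close>. Evaluated
  in both orders it shows that the two mixed derivatives agree at some pair of points arbitrarily
  close to \<open>x\<close>; continuity moves the equality to \<open>x\<close>.\<close>

lemma frechet_derivative_commute_real:
  fixes f :: "'a::euclidean_space \<Rightarrow> real"
  assumes f: "smooth_on S f" "open S" "x \<in> S"
  shows "frechet_derivative (\<lambda>y. frechet_derivative f (at y) e) (at x) k =
    frechet_derivative (\<lambda>y. frechet_derivative f (at y) k) (at x) e" (is "?P x = ?Q x")
proof -
  have "smooth_on S ?P" "smooth_on S ?Q" by (intro smooth_on_frechet_derivative f)+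
  then have c: "continuous (at x) ?P" "continuous (at x) ?Q"
    using smooth_on_continuous_on f continuous_on_eq_continuous_at by blast+
  have close: "\<exists>y\<in>ball x d. \<exists>z\<in>ball x d. ?P y = ?Q z" if d: "d > 0" "ball x d \<subseteq> S" for d
  proof -
    \<comment> \<open>With h = d/(2c) the whole parallelogram stays within d/2 of \<open>x\<close>;
      the summand 1 keeps c positive when both directions vanish.\<close>
    define c where "c = norm e + norm k + 1"
    have c0: "c > 0" by (simp add: c_def add_nonneg_pos)
    define h where "h = d / (2 * c)"
    have h: "h > 0" using d c0 by (simp add: h_def)
    have near: "x + s *\<^sub>R e + t *\<^sub>R k \<in> ball x d" if "0 \<le> s" "s \<le> h" "0 \<le> t" "t \<le> h" for s t
    proof -
      have "norm (s *\<^sub>R e + t *\<^sub>R k) \<le> h * norm e + h * norm k"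
        using that by (intro norm_triangle_le add_mono) (auto intro!: mult_right_mono)
      also have "\<dots> < h * c" using h by (simp add: c_def algebra_simps)
      also have "\<dots> = d / 2" using c0 by (simp add: h_def)
      finally have "norm (s *\<^sub>R e + t *\<^sub>R k) < d" using d by simp
      moreover have "dist x (x + s *\<^sub>R e + t *\<^sub>R k) = norm (s *\<^sub>R e + t *\<^sub>R k)"
        by (metis add.assoc add_diff_cancel_left' dist_commute dist_norm)
      ultimately show ?thesis by simp
    qed
    obtain s t where 1: "0 < s" "s < h" "0 < t" "t < h" "f (x + h *\<^sub>R e + h *\<^sub>R k) - f (x + h *\<^sub>R e) - f (x + h *\<^sub>R k) + f x =
      h\<^sup>2 * ?P (x + s *\<^sub>R e + t *\<^sub>R k)"
      using Schwarz_points[OF f(1,2) h, of x e k] near d by blast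
    obtain s' t' where 2: "0 < s'" "s' < h" "0 < t'" "t' < h" "f (x + h *\<^sub>R k + h *\<^sub>R e) - f (x + h *\<^sub>R k) - f (x + h *\<^sub>R e) + f x =
      h\<^sup>2 * ?Q (x + s' *\<^sub>R k + t' *\<^sub>R e)"
      using Schwarz_points[OF f(1,2) h, of x k e] near d by (smt (verit) add.assoc add.commute subsetD)
    have "h\<^sup>2 * ?P (x + s *\<^sub>R e + t *\<^sub>R k) = h\<^sup>2 * ?Q (x + s' *\<^sub>R k + t' *\<^sub>R e)"
      using 1(5) 2(5) by (simp add: algebra_simps)
    then have "?P (x + s *\<^sub>R e + t *\<^sub>R k) = ?Q (x + t' *\<^sub>R e + s' *\<^sub>R k)"
      using h by (simp add: algebra_simps)
    then show ?thesis using near[of s t] near[of t' s'] 1 2 by force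
  qed
  show ?thesis
  proof (rule ccontr)
    assume ne: "?P x \<noteq> ?Q x"
    define eps where "eps = dist (?P x) (?Q x) / 2"
    have eps: "eps > 0" using ne by (simp add: eps_def)
    obtain d1 where d1: "d1 > 0" "\<And>y. dist y x < d1 \<Longrightarrow> dist (?P y) (?P x) < eps"
      using c(1) eps unfolding continuous_at_eps_delta by blast
    obtain d2 where d2: "d2 > 0" "\<And>y. dist y x < d2 \<Longrightarrow> dist (?Q y) (?Q x) < eps"
      using c(2) eps unfolding continuous_at_eps_delta by blast
    obtain d3 where d3: "d3 > 0" "ball x d3 \<subseteq> S" using f openE by blast
    obtain y z where yz: "y \<in> ball x (min d3 (min d1 d2))" "z \<in> ball x (min d3 (min d1 d2))" "?P y = ?Q z"
    proof -
      have "min d3 (min d1 d2) > 0" "ball x (min d3 (min d1 d2)) \<subseteq> S" using d1 d2 d3 by auto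
      from close[OF this] show ?thesis using that by blast
    qed
    have "dist (?P y) (?P x) < eps" "dist (?Q z) (?Q x) < eps"
      using d1(2)[of y] d2(2)[of z] yz by (auto simp: dist_commute)
    moreover have "dist (?P x) (?Q x) \<le> dist (?P y) (?P x) + dist (?Q z) (?Q x)"
      using yz(3) by (metis dist_commute dist_triangle)
    ultimately show False unfolding eps_def by linarith
  qed
qed

lemma pd_commute_real:
  fixes f :: "real ^ 4 \<Rightarrow> real"
  assumes "smooth_on S f" "open S" "x \<in> S"
  shows "pd a (pd b f) x = pd b (pd a f) x"
  unfolding pd_def using frechet_derivative_commute_real[OF assms] by blast

lemma pd_commute:
  fixes f :: "real ^ 4 \<Rightarrow> complex"
  assumes f: "smooth_on S f" "open S" "x \<in> S"
  shows "pd a (pd b f) x = pd b (pd a f) x"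
proof -
  have Re: "Re (pd a (pd b f) x) = pd a (pd b (\<lambda>y. Re (f y))) x" for a b
  proof -
    have "Re (pd a (pd b f) x) = pd a (\<lambda>y. Re (pd b f y)) x"
      by (rule pd_Re[symmetric])
         (use f smooth_on_pd smooth_on_differentiable in blast)
    also have "\<dots> = pd a (pd b (\<lambda>y. Re (f y))) x"
      by (rule pd_cong[OF f(2,3)]) (use f smooth_on_differentiable pd_Re in metis)
    finally show ?thesis .
  qed
  have Im: "Im (pd a (pd b f) x) = pd a (pd b (\<lambda>y. Im (f y))) x" for a b
  proof -
    have "Im (pd a (pd b f) x) = pd a (\<lambda>y. Im (pd b f y)) x"
      by (rule pd_Im[symmetric])
         (use f smooth_on_pd smooth_on_differentiable in blast)
    also have "\<dots> = pd a (pd b (\<lambda>y. Im (f y))) x"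
      by (rule pd_cong[OF f(2,3)]) (use f smooth_on_differentiable pd_Im in metis)
    finally show ?thesis .
  qed
  have "smooth_on S (\<lambda>y. Re (f y))" "smooth_on S (\<lambda>y. Im (f y))"
    using f smooth_on_complex_iff by blast+
  then show ?thesis
    using Re[of a b] Re[of b a] Im[of a b] Im[of b a] pd_commute_real[OF _ f(2,3), of _ a b]
    by (simp add: complex_eq_iff)
qed

section \<open>Flat connections have parallel sections\<close>

lemma has_derivative_parametric_integral:
  fixes F :: "'a::euclidean_space \<times> real \<Rightarrow> 'c::euclidean_space"
  assumes F: "smooth_on W F" "open W" and U: "open U" "convex U" "U \<times> {0..1} \<subseteq> W" and x: "x \<in> U"
  shows "((\<lambda>x. integral {0..1} (\<lambda>t. F (x, t))) has_derivative
    (\<lambda>h. integral {0..1} (\<lambda>t. frechet_derivative F (at (x, t)) (h, 0)))) (at x)"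
proof -
  \<comment> \<open>\<open>leibniz_rule\<close> asks for the partial derivative as a
    \<open>blinfun\<close>-valued map that is continuous in both variables; continuity is tested on
    basis vectors.\<close>
  define fx where "fx = (\<lambda>x t. Blinfun (\<lambda>h. frechet_derivative F (at (x, t)) (h, 0)))"
  have W: "(x, t) \<in> W" if "x \<in> U" "t \<in> {0..1}" for x t using that U by auto
  have d: "((\<lambda>x. F (x, t)) has_derivative (\<lambda>h. frechet_derivative F (at (x, t)) (h, 0))) (at x)"
    if "x \<in> U" "t \<in> {0..1}" for x t
    by (rule has_derivative_compose[where f="\<lambda>x. (x, t)" and x=x and s=UNIV,
          OF _ smooth_on_has_derivative[OF F(1) W[OF that]]])
       (auto intro!: derivative_eq_intros)
  have fx: "blinfun_apply (fx x t) = (\<lambda>h. frechet_derivative F (at (x, t)) (h, 0))"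
    if "x \<in> U" "t \<in> {0..1}" for x t
    unfolding fx_def by (intro bounded_linear_Blinfun_apply has_derivative_bounded_linear[OF d[OF that]])
  have cF: "continuous_on (U \<times> {0..1}) F"
    using smooth_on_continuous_on[OF F(1)] U(3) continuous_on_subset by blast
  have cfx: "continuous_on (U \<times> {0..1}) (\<lambda>(x, t). fx x t)"
  proof (rule continuous_on_blinfun_componentwise)
    fix i :: 'a
    have "continuous_on (U \<times> {0..1}) (\<lambda>z. frechet_derivative F (at z) (i, 0))"
      using smooth_on_continuous_on[OF smooth_on_frechet_derivative[OF F]] U(3)
        continuous_on_subset by blast
    then show "continuous_on (U \<times> {0..1}) (\<lambda>z. blinfun_apply (case z of (x, t) \<Rightarrow> fx x t) i)"
      by (rule continuous_on_eq) (auto simp: fx)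
  qed
  have "((\<lambda>x. integral (cbox 0 1) (\<lambda>t. F (x, t))) has_derivative
      blinfun_apply (integral (cbox 0 1) (fx x))) (at x within U)"
  proof (rule leibniz_rule)
    show "((\<lambda>x. F (x, t)) has_derivative blinfun_apply (fx x t)) (at x within U)"
      if "x \<in> U" "t \<in> cbox 0 1" for x t
      using d[of x t] fx[of x t] that has_derivative_at_withinI by auto
    show "(\<lambda>t. F (x, t)) integrable_on cbox 0 1" if "x \<in> U" for x
      using that by (intro integrable_continuous continuous_on_compose2[OF cF] continuous_intros) auto
  qed (use cfx x U in auto)
  moreover have "blinfun_apply (integral (cbox 0 1) (fx x)) =
      (\<lambda>h. integral {0..1} (\<lambda>t. frechet_derivative F (at (x, t)) (h, 0)))"
  proof
    fix h
    have "continuous_on {0..1} (\<lambda>t. case (x, t) of (x, t) \<Rightarrow> fx x t)"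
      using x by (intro continuous_on_compose2[OF cfx] continuous_intros) auto
    then have "(fx x) integrable_on cbox 0 1" by (intro integrable_continuous) simp
    then have "blinfun_apply (integral (cbox 0 1) (fx x)) h =
        integral (cbox 0 1) ((\<lambda>B. blinfun_apply B h) \<circ> fx x)"
      by (rule integral_linear[symmetric]) (rule blinfun.bounded_linear_left)
    also have "\<dots> = integral {0..1} (\<lambda>t. frechet_derivative F (at (x, t)) (h, 0))"
      by (simp, rule integral_cong) (use fx x in auto)
    finally show "blinfun_apply (integral (cbox 0 1) (fx x)) h =
        integral {0..1} (\<lambda>t. frechet_derivative F (at (x, t)) (h, 0))" .
  qed
  moreover have "at x within U = at x" by (rule at_within_open[OF x U(1)])
  ultimately show ?thesis by simp
qed

text \<open>The derivative is an integral of the same kind, with \<open>F\<close> replaced by a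
  directional derivative of \<open>F\<close>; hence the induction over all \<open>F\<close>.\<close>

lemma smooth_on_parametric_integral:
  fixes F :: "'a::euclidean_space \<times> real \<Rightarrow> 'c::euclidean_space"
  assumes F: "smooth_on W F" "open W" and U: "open U" "convex U" "U \<times> {0..1} \<subseteq> W"
  shows "smooth_on U (\<lambda>x. integral {0..1} (\<lambda>t. F (x, t)))"
  unfolding smooth_on_def
proof
  fix k
  show "Ck_on k U (\<lambda>x. integral {0..1} (\<lambda>t. F (x, t)))"
    using F(1)
  proof (induction k arbitrary: F)
    case 0
    have "isCont (\<lambda>x. integral {0..1} (\<lambda>t. F (x, t))) x" if "x \<in> U" for x
      by (rule has_derivative_continuous[OF has_derivative_parametric_integral[OF 0 F(2) U that]])
    then show ?case by (simp add: continuous_at_imp_continuous_on)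
  next
    case (Suc k)
    show ?case
      by (rule Ck_on_SucI[OF U(1) has_derivative_parametric_integral[OF Suc.prems F(2) U]])
         (auto intro!: Suc.IH smooth_on_frechet_derivative Suc.prems F(2))
  qed
qed

text \<open>
  One Picard step along the rays from \<open>x0\<close>. Because the connection is flat, the Poincare homotopy
  formula expresses the defect of the new approximation through the defect \<open>E\<close> of the old one.
\<close>

lemma Picard_step:
  fixes A :: "'a::euclidean_space \<Rightarrow> 'a \<Rightarrow>\<^sub>L 'b::euclidean_space \<Rightarrow>\<^sub>L 'b"
  assumes A: "smooth_on S A" "open S" and r: "ball x0 r \<subseteq> S"
    and flat: "\<And>x h k v. x \<in> S \<Longrightarrow>
      frechet_derivative A (at x) k h v + A x h (A x k v) = frechet_derivative A (at x) h k v + A x k (A x h v)"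
    and Phi: "smooth_on (ball x0 r) \<Phi>"
    and T: "\<And>x. T x = v0 + integral {0..1} (\<lambda>t. A (x0 + t *\<^sub>R (x - x0)) (x - x0) (\<Phi> (x0 + t *\<^sub>R (x - x0))))"
    and E: "\<And>y k. E y k = frechet_derivative \<Phi> (at y) k - A y k (\<Phi> y)"
  shows "smooth_on (ball x0 r) T"
    and "x \<in> ball x0 r \<Longrightarrow> frechet_derivative T (at x) k - A x k (\<Phi> x) =
      integral {0..1} (\<lambda>t. t *\<^sub>R (A (x0 + t *\<^sub>R (x - x0)) (x - x0) (E (x0 + t *\<^sub>R (x - x0)) k)
                          - A (x0 + t *\<^sub>R (x - x0)) k (E (x0 + t *\<^sub>R (x - x0)) (x - x0))))"
proof -
  define y where "y = (\<lambda>z::'a \<times> real. x0 + snd z *\<^sub>R (fst z - x0))"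
  \<comment> \<open>Pairs whose ray point lies in the ball. This set is open and contains the ball
    times [0, 1], so the integrand is smooth up to both ends of the parameter interval.\<close>
  define W where "W = y -` ball x0 r"
  define F where "F = (\<lambda>z. A (y z) (fst z - x0) (\<Phi> (y z)))"
  have W: "open W" unfolding W_def y_def
    by (intro open_vimage open_ball continuous_intros)
  have ball: "x0 + t *\<^sub>R (x - x0) \<in> ball x0 r" if "x \<in> ball x0 r" "t \<in> {0..1}" for x t
  proof -
    have "norm (t *\<^sub>R (x - x0)) \<le> 1 * norm (x - x0)"
      unfolding norm_scaleR using that by (intro mult_right_mono) auto
    then show ?thesis using that by (simp add: dist_norm norm_minus_commute)
  qed
  have UW: "ball x0 r \<times> {0..1} \<subseteq> W"
    using ball by (auto simp: W_def y_def)
  have fst: "smooth_on W (fst :: 'a \<times> real \<Rightarrow> 'a)" and snd: "smooth_on W (snd :: 'a \<times> real \<Rightarrow> real)"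
    using smooth_on_linear[OF _ W] bounded_linear_fst bounded_linear_snd by blast+
  have sy: "smooth_on W y" unfolding y_def
    by (intro smooth_on_add smooth_on_scaleR smooth_on_diff smooth_on_const fst snd W)
  have "smooth_on W F" unfolding F_def
    by (intro smooth_on_bilinear[OF bounded_bilinear_blinfun_apply W] smooth_on_diff fst smooth_on_const W
        smooth_on_compose[OF sy A(1) _ W] smooth_on_compose[OF sy Phi _ W])
       (use r in \<open>auto simp: W_def\<close>)
  note F = this W
  have "smooth_on (ball x0 r) (\<lambda>x. v0 + integral {0..1} (\<lambda>t. F (x, t)))"
    by (intro smooth_on_add smooth_on_const smooth_on_parametric_integral[OF F] UW) auto
  then show sT: "smooth_on (ball x0 r) T"
    by (rule smooth_on_cong) (simp_all add: T F_def y_def)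
  assume x: "x \<in> ball x0 r"
  define w where "w = x - x0"
  define Y where "Y = (\<lambda>t. x0 + t *\<^sub>R w)"
  define DA where "DA = (\<lambda>x. frechet_derivative A (at x))"
  define D\<Phi> where "D\<Phi> = (\<lambda>x. frechet_derivative \<Phi> (at x))"
  have Y: "Y t \<in> ball x0 r" "Y t \<in> S" if "t \<in> {0..1}" for t
    using ball[OF x that] r by (auto simp: Y_def w_def)
  have yY: "y (x, t) = Y t" for t by (simp add: y_def Y_def w_def)
  have dA: "(A has_derivative DA (Y t)) (at (Y t))" if "t \<in> {0..1}" for t
    unfolding DA_def by (rule smooth_on_has_derivative[OF A(1) Y(2)[OF that]])
  have d\<Phi>: "(\<Phi> has_derivative D\<Phi> (Y t)) (at (Y t))" if "t \<in> {0..1}" for t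
    unfolding D\<Phi>_def by (rule smooth_on_has_derivative[OF Phi Y(1)[OF that]])
  have DF: "frechet_derivative F (at (x, t)) (k, 0) =
      t *\<^sub>R DA (Y t) k w (\<Phi> (Y t)) + A (Y t) k (\<Phi> (Y t)) + t *\<^sub>R A (Y t) w (D\<Phi> (Y t) k)"
    if t: "t \<in> {0..1}" for t
  proof -
    have dy: "(y has_derivative (\<lambda>h. snd h *\<^sub>R w + t *\<^sub>R fst h)) (at (x, t))"
      unfolding y_def w_def by (auto intro!: derivative_eq_intros simp: algebra_simps)
    have dA': "((\<lambda>z. A (y z)) has_derivative (\<lambda>h. DA (Y t) (snd h *\<^sub>R w + t *\<^sub>R fst h))) (at (x, t))"
      by (rule has_derivative_compose[where f=y and x="(x, t)" and s=UNIV, OF dy]) (use dA[OF t] in \<open>simp add: yY\<close>)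
    have d\<Phi>': "((\<lambda>z. \<Phi> (y z)) has_derivative (\<lambda>h. D\<Phi> (Y t) (snd h *\<^sub>R w + t *\<^sub>R fst h))) (at (x, t))"
      by (rule has_derivative_compose[where f=y and x="(x, t)" and s=UNIV, OF dy]) (use d\<Phi>[OF t] in \<open>simp add: yY\<close>)
    have dfst: "((\<lambda>z. fst z - x0) has_derivative fst) (at (x, t))"
      by (auto intro!: derivative_eq_intros)
    note d = blinfun.FDERIV[OF blinfun.FDERIV[OF dA' dfst] d\<Phi>']
    interpret A: linear "DA (Y t)" using dA[OF t] has_derivative_linear by blast
    interpret P: linear "D\<Phi> (Y t)" using d\<Phi>[OF t] has_derivative_linear by blast
    show ?thesis
      unfolding F_def frechet_derivative_at[OF d, symmetric]
      by (simp add: yY A.scaleR P.scaleR blinfun.scaleR_left blinfun.scaleR_right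
          blinfun.add_left blinfun.zero_left blinfun.zero_right A.zero P.zero algebra_simps)
         (simp add: w_def)
  qed
  have "((\<lambda>x. v0 + integral {0..1} (\<lambda>t. F (x, t))) has_derivative
      (\<lambda>h. 0 + integral {0..1} (\<lambda>t. frechet_derivative F (at (x, t)) (h, 0)))) (at x)"
    by (rule has_derivative_add[OF has_derivative_const
          has_derivative_parametric_integral[OF F open_ball convex_ball UW x]])
  then have "(T has_derivative (\<lambda>h. 0 + integral {0..1} (\<lambda>t. frechet_derivative F (at (x, t)) (h, 0)))) (at x)"
    by (rule has_derivative_transform_within_open[OF _ open_ball x]) (simp add: T F_def y_def)
  then have T': "frechet_derivative T (at x) k = integral {0..1} (\<lambda>t. frechet_derivative F (at (x, t)) (k, 0))"
    using frechet_derivative_at[symmetric] by fastforce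
  \<comment> \<open>The t-derivative of t A(Y t) k (\<Phi> (Y t)). Its integral over [0, 1] is A x k
    (\<Phi> x), so the left side of the claim becomes a single integral.\<close>
  define G where "G = (\<lambda>t. A (Y t) k (\<Phi> (Y t)) + t *\<^sub>R (DA (Y t) w k (\<Phi> (Y t)) + A (Y t) k (D\<Phi> (Y t) w)))"
  have "((\<lambda>t. t *\<^sub>R A (Y t) k (\<Phi> (Y t))) has_vector_derivative G t) (at t within {0..1})"
    if t: "t \<in> {0..1}" for t
  proof -
    have dy: "(Y has_derivative (\<lambda>h. h *\<^sub>R w)) (at t)"
      unfolding Y_def by (auto intro!: derivative_eq_intros)
    have dA': "((\<lambda>z. A (Y z)) has_derivative (\<lambda>h. DA (Y t) (h *\<^sub>R w))) (at t)"
      by (rule has_derivative_compose[where f=Y and x=t and s=UNIV, OF dy]) (use dA[OF t] in simp)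
    have d\<Phi>': "((\<lambda>z. \<Phi> (Y z)) has_derivative (\<lambda>h. D\<Phi> (Y t) (h *\<^sub>R w))) (at t)"
      by (rule has_derivative_compose[where f=Y and x=t and s=UNIV, OF dy]) (use d\<Phi>[OF t] in simp)
    note d = has_derivative_scaleR[OF has_derivative_ident blinfun.FDERIV[OF blinfun.FDERIV[OF dA' has_derivative_const[of k]] d\<Phi>']]
    interpret A: linear "DA (Y t)" using dA[OF t] has_derivative_linear by blast
    interpret P: linear "D\<Phi> (Y t)" using d\<Phi>[OF t] has_derivative_linear by blast
    show ?thesis unfolding has_vector_derivative_def
      by (rule has_derivative_at_withinI, rule has_derivative_eq_rhs[OF d])
         (auto simp: G_def A.scaleR P.scaleR blinfun.scaleR_left blinfun.scaleR_right
            blinfun.add_left blinfun.zero_left blinfun.zero_right algebra_simps)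
  qed
  then have "(G has_integral (1 *\<^sub>R A (Y 1) k (\<Phi> (Y 1)) - 0 *\<^sub>R A (Y 0) k (\<Phi> (Y 0)))) {0..1}"
    by (intro fundamental_theorem_of_calculus) auto
  then have G: "(G has_integral A x k (\<Phi> x)) {0..1}" by (simp add: Y_def w_def)
  have "continuous_on {0..1} (\<lambda>t. frechet_derivative F (at (x, t)) (k, 0))"
    by (rule continuous_on_compose2[OF smooth_on_continuous_on[OF smooth_on_frechet_derivative[OF F]],
          where f="\<lambda>t. (x, t)"])
       (use UW x in \<open>auto intro!: continuous_intros\<close>)
  then have "(\<lambda>t. frechet_derivative F (at (x, t)) (k, 0)) integrable_on {0..1}"
    by (rule integrable_continuous_real)
  then have "frechet_derivative T (at x) k - A x k (\<Phi> x) =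
      integral {0..1} (\<lambda>t. frechet_derivative F (at (x, t)) (k, 0) - G t)"
    unfolding T' using G by (simp add: integral_diff has_integral_integrable integral_unique)
  also have "\<dots> = integral {0..1} (\<lambda>t. t *\<^sub>R (A (Y t) w (E (Y t) k) - A (Y t) k (E (Y t) w)))"
  proof (rule integral_cong)
    fix t :: real assume t: "t \<in> {0..1}"
    \<comment> \<open>Flatness trades the derivative of \<open>A\<close> along k for the one along
      w, which cancels against \<open>G\<close>. The two quadratic terms left over complete the
      derivatives of \<Phi> to the defects \<open>E\<close>.\<close>
    have q: "DA (Y t) k w (\<Phi> (Y t)) = DA (Y t) w k (\<Phi> (Y t)) + A (Y t) k (A (Y t) w (\<Phi> (Y t)))
        - A (Y t) w (A (Y t) k (\<Phi> (Y t)))"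
      using flat[OF Y(2)[OF t], of k w "\<Phi> (Y t)"] unfolding DA_def by (simp add: algebra_simps)
    show "frechet_derivative F (at (x, t)) (k, 0) - G t =
        t *\<^sub>R (A (Y t) w (E (Y t) k) - A (Y t) k (E (Y t) w))"
      unfolding DF[OF t] G_def E q by (simp add: D\<Phi>_def blinfun.diff_right algebra_simps)
  qed
  finally show "frechet_derivative T (at x) k - A x k (\<Phi> x) =
      integral {0..1} (\<lambda>t. t *\<^sub>R (A (x0 + t *\<^sub>R (x - x0)) (x - x0) (E (x0 + t *\<^sub>R (x - x0)) k)
                          - A (x0 + t *\<^sub>R (x - x0)) k (E (x0 + t *\<^sub>R (x - x0)) (x - x0))))"
    unfolding Y_def w_def .
qed

text \<open>A fixed point of the Picard map solves the equation along rays only; that it solves it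
  in all directions is where flatness enters. By \<open>Picard_step\<close> the defect of an iterate
  is controlled by the defect of its predecessor and by the last increment, so defects tend to zero
  uniformly, and the derivatives of the iterates converge together with the iterates.\<close>

theorem flat_connection_parallel_section:
  fixes A :: "'a::euclidean_space \<Rightarrow> 'a \<Rightarrow>\<^sub>L 'b::euclidean_space \<Rightarrow>\<^sub>L 'b"
  assumes A: "smooth_on S A" "open S" and x0: "x0 \<in> S"
    and flat: "\<And>x h k v. x \<in> S \<Longrightarrow>
      frechet_derivative A (at x) k h v + A x h (A x k v) = frechet_derivative A (at x) h k v + A x k (A x h v)"
  obtains r \<Phi> where "r > 0" "ball x0 r \<subseteq> S" "\<Phi> x0 = v0" "smooth_on (ball x0 r) \<Phi>"
    "\<And>x. x \<in> ball x0 r \<Longrightarrow> (\<Phi> has_derivative (\<lambda>h. A x h (\<Phi> x))) (at x)"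
proof -
  obtain r0 where r0: "r0 > 0" "cball x0 r0 \<subseteq> S"
    using A(2) x0 open_contains_cball by blast
  have "compact (A ` cball x0 r0)"
    using smooth_on_continuous_on[OF A(1)] r0 continuous_on_subset
    by (intro compact_continuous_image) auto
  then obtain K where K: "K > 0" "\<And>x. x \<in> cball x0 r0 \<Longrightarrow> norm (A x) \<le> K"
    using compact_imp_bounded bounded_pos by (metis imageI)
  \<comment> \<open>K r \<le> 1/8 makes the increments shrink by at least 1/4. The defects shrink by
    1/2: two curvature terms contribute 1/8 each and the increment contributes 1/4.\<close>
  define r where "r = min r0 (1 / (8 * K))"
  define U where "U = ball x0 r"
  have r: "r > 0" "K * r \<le> 1 / 8" using r0 K by (auto simp: r_def min_def field_simps)
  have U: "U \<subseteq> S" "open U" "convex U" "x0 \<in> U" using r0 r by (auto simp: U_def r_def)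
  have KA: "norm (A x) \<le> K" if "x \<in> U" for x using that K(2)[of x] by (auto simp: U_def r_def)
  have Kb: "norm (A x h v) \<le> K * norm h * norm v" if "x \<in> U" for x h v
  proof -
    have "norm (A x h v) \<le> norm (A x h) * norm v" by (rule norm_blinfun)
    also have "\<dots> \<le> norm (A x) * norm h * norm v" by (intro mult_right_mono norm_blinfun) auto
    also have "\<dots> \<le> K * norm h * norm v" by (intro mult_right_mono KA that) auto
    finally show ?thesis .
  qed
  define Y where "Y = (\<lambda>x t. x0 + t *\<^sub>R (x - x0))"
  define T where "T = (\<lambda>\<Phi> x. v0 + integral {0..1} (\<lambda>t. A (Y x t) (x - x0) (\<Phi> (Y x t))))"
  define \<Phi> where "\<Phi> = rec_nat (\<lambda>x. v0) (\<lambda>m. T)"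
  have \<Phi>: "\<Phi> 0 = (\<lambda>x. v0)" "\<Phi> (Suc m) = T (\<Phi> m)" for m by (simp_all add: \<Phi>_def)
  define E where "E = (\<lambda>m y k. frechet_derivative (\<Phi> m) (at y) k - A y k (\<Phi> m y))"
  have rS: "ball x0 r \<subseteq> S" using U by (simp add: U_def)
  note step = Picard_step[OF A rS flat, folded U_def]
  have sm: "smooth_on U (\<Phi> m)" for m
  proof (induction m)
    case (Suc m)
    show ?case unfolding \<Phi>(2)
      by (rule step(1)[OF _ Suc]) (auto simp: T_def Y_def)
  qed (simp add: \<Phi> smooth_on_const U)
  have YU: "Y x t \<in> U" if "x \<in> U" "t \<in> {0..1}" for x t
  proof -
    have "norm (t *\<^sub>R (x - x0)) \<le> 1 * norm (x - x0)"
      unfolding norm_scaleR using that by (intro mult_right_mono) auto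
    then show ?thesis using that by (simp add: Y_def U_def dist_norm norm_minus_commute)
  qed
  have w: "norm (x - x0) \<le> r" if "x \<in> U" for x using that by (simp add: U_def dist_norm norm_minus_commute)
  have cY: "continuous_on {0..1} (Y x)" for x unfolding Y_def by (intro continuous_intros)
  have cA: "continuous_on {0..1} (\<lambda>t. A (Y x t))" if "x \<in> U" for x
    by (rule continuous_on_compose2[OF smooth_on_continuous_on[OF A(1)] cY]) (use YU U that in auto)
  have c\<Phi>: "continuous_on {0..1} (\<lambda>t. \<Phi> m (Y x t))" if "x \<in> U" for x m
    by (rule continuous_on_compose2[OF smooth_on_continuous_on[OF sm] cY]) (use YU that in auto)
  define D where "D = norm v0"
  have d: "norm (\<Phi> (Suc m) x - \<Phi> m x) \<le> D * (1 / 4) ^ m" if "x \<in> U" for x m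
    using that
  proof (induction m arbitrary: x)
    case 0
    have "norm (integral {0..1} (\<lambda>t. A (Y x t) (x - x0) v0)) \<le> (K * r * D) * (1 - 0)"
    proof (rule integral_bound)
      show "norm (A (Y x t) (x - x0) v0) \<le> K * r * D" if "t \<in> {0..1}" for t
        unfolding D_def
        by (rule order_trans[OF Kb[OF YU[OF 0 that]]]) (use w[OF 0] K in \<open>auto intro!: mult_right_mono\<close>)
    qed (auto intro!: continuous_intros cA 0)
    also have "\<dots> \<le> 1 * D"
      using mult_right_mono[of "K * r" 1 D] r by (simp add: D_def)
    finally show ?case by (simp add: \<Phi> T_def)
  next
    case (Suc m)
    have i: "(\<lambda>t. A (Y x t) (x - x0) (\<Phi> m (Y x t))) integrable_on {0..1}" for m
      by (intro integrable_continuous_real continuous_intros cA c\<Phi> Suc.prems)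
    have "\<Phi> (Suc (Suc m)) x - \<Phi> (Suc m) x = integral {0..1} (\<lambda>t. A (Y x t) (x - x0) (\<Phi> (Suc m) (Y x t)))
        - integral {0..1} (\<lambda>t. A (Y x t) (x - x0) (\<Phi> m (Y x t)))"
      unfolding \<Phi>(2)[of "Suc m"] by (subst (2) \<Phi>(2)) (simp add: T_def)
    also have "\<dots> = integral {0..1} (\<lambda>t. A (Y x t) (x - x0) (\<Phi> (Suc m) (Y x t)) - A (Y x t) (x - x0) (\<Phi> m (Y x t)))"
      by (rule integral_diff[OF i i, symmetric])
    also have "norm \<dots> \<le> (K * r * (D * (1 / 4) ^ m)) * (1 - 0)"
    proof (rule integral_bound)
      show "norm (A (Y x t) (x - x0) (\<Phi> (Suc m) (Y x t)) - A (Y x t) (x - x0) (\<Phi> m (Y x t)))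
          \<le> K * r * (D * (1 / 4) ^ m)" if "t \<in> {0..1}" for t
        unfolding blinfun.diff_right[symmetric]
        by (rule order_trans[OF Kb[OF YU[OF Suc.prems that]]])
           (use w[OF Suc.prems] K Suc.IH[OF YU[OF Suc.prems that]] r in \<open>auto intro!: mult_mono\<close>)
    qed (auto intro!: continuous_intros cA c\<Phi> Suc.prems)
    also have "\<dots> \<le> 1 / 4 * (D * (1 / 4) ^ m)"
      using mult_right_mono[of "K * r" "1 / 4" "D * (1 / 4) ^ m"] r by (simp add: D_def)
    finally show ?case by (simp add: mult_ac)
  qed
  \<comment> \<open>Large enough for the first defect, which is at most K D, and such that K D = C/4
    absorbs the increment term of the induction step.\<close>
  define C where "C = 4 * K * D"
  have e: "norm (E m x k) \<le> C * (1 / 2) ^ m * norm k" if "x \<in> U" for x m k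
    using that
  proof (induction m arbitrary: x k)
    case 0
    have "E 0 x k = - A x k v0" by (simp add: E_def \<Phi> frechet_derivative_const)
    then have "norm (E 0 x k) \<le> K * norm k * D" using Kb[OF 0] by (simp add: D_def)
    also have "\<dots> \<le> C * (1 / 2) ^ 0 * norm k" using K by (simp add: C_def D_def mult_ac)
    finally show ?case .
  next
    case (Suc m)
    define R where "R = frechet_derivative (\<Phi> (Suc m)) (at x) k - A x k (\<Phi> m x)"
    have R: "R = integral {0..1} (\<lambda>t. t *\<^sub>R (A (Y x t) (x - x0) (E m (Y x t) k)
                          - A (Y x t) k (E m (Y x t) (x - x0))))"
      unfolding R_def \<Phi>(2) Y_def
      by (rule step(2)[OF _ sm]) (use Suc.prems in \<open>auto simp: E_def T_def Y_def\<close>)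
    have cE: "continuous_on {0..1} (\<lambda>t. E m (Y x t) h)" for h
      unfolding E_def
      by (intro continuous_intros cA c\<Phi> Suc.prems
          continuous_on_compose2[OF smooth_on_continuous_on[OF smooth_on_frechet_derivative[OF sm U(2)]] cY])
         (use YU Suc.prems in auto)
    have b: "K * norm w * norm (E m y z) \<le> 1 / 8 * (C * (1 / 2) ^ m) * norm k"
      if "norm w * norm z \<le> r * norm k" "y \<in> U" for w y z
    proof -
      have "K * norm w * norm (E m y z) \<le> K * norm w * (C * (1 / 2) ^ m * norm z)"
        using K Suc.IH[OF that(2)] by (intro mult_left_mono) auto
      also have "\<dots> = K * (norm w * norm z) * (C * (1 / 2) ^ m)" by (simp add: mult_ac)
      also have "\<dots> \<le> K * (r * norm k) * (C * (1 / 2) ^ m)"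
        using K that by (intro mult_right_mono mult_left_mono) (auto simp: C_def D_def)
      also have "\<dots> = (K * r) * (C * (1 / 2) ^ m * norm k)" by (simp add: mult_ac)
      also have "\<dots> \<le> 1 / 8 * (C * (1 / 2) ^ m * norm k)"
        using r K by (intro mult_right_mono) (auto simp: C_def D_def)
      finally show ?thesis by simp
    qed
    have "norm R \<le> (1 / 4 * (C * (1 / 2) ^ m) * norm k) * (1 - 0)"
      unfolding R
    proof (rule integral_bound)
      fix t :: real assume t: "t \<in> {0..1}"
      note y = YU[OF Suc.prems t]
      have w': "norm (x - x0) * norm k \<le> r * norm k" "norm k * norm (x - x0) \<le> r * norm k"
        using mult_right_mono[OF w[OF Suc.prems] norm_ge_zero[of k]] by (simp_all add: mult.commute)
      have "norm (t *\<^sub>R (A (Y x t) (x - x0) (E m (Y x t) k) - A (Y x t) k (E m (Y x t) (x - x0))))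
          \<le> 1 * norm (A (Y x t) (x - x0) (E m (Y x t) k) - A (Y x t) k (E m (Y x t) (x - x0)))"
        unfolding norm_scaleR using t by (intro mult_right_mono) auto
      also have "\<dots> \<le> norm (A (Y x t) (x - x0) (E m (Y x t) k)) + norm (A (Y x t) k (E m (Y x t) (x - x0)))"
        using norm_triangle_ineq4 by simp
      also have "\<dots> \<le> K * norm (x - x0) * norm (E m (Y x t) k) + K * norm k * norm (E m (Y x t) (x - x0))"
        by (intro add_mono Kb y)
      also have "\<dots> \<le> 1 / 8 * (C * (1 / 2) ^ m) * norm k + 1 / 8 * (C * (1 / 2) ^ m) * norm k"
        by (intro add_mono b w' y)
      finally show "norm (t *\<^sub>R (A (Y x t) (x - x0) (E m (Y x t) k) - A (Y x t) k (E m (Y x t) (x - x0))))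
          \<le> 1 / 4 * (C * (1 / 2) ^ m) * norm k" by (simp add: mult_ac)
    qed (auto intro!: continuous_intros cA cE Suc.prems)
    moreover have "norm (A x k (\<Phi> (Suc m) x - \<Phi> m x)) \<le> 1 / 4 * (C * (1 / 2) ^ m) * norm k"
    proof -
      have "norm (A x k (\<Phi> (Suc m) x - \<Phi> m x)) \<le> K * norm k * (D * (1 / 4) ^ m)"
        by (rule order_trans[OF Kb[OF Suc.prems]]) (use K d[OF Suc.prems] in \<open>auto intro!: mult_left_mono\<close>)
      also have "\<dots> \<le> K * norm k * (D * (1 / 2) ^ m)"
        using K by (intro mult_left_mono power_mono) (auto simp: D_def)
      finally show ?thesis by (simp add: C_def mult_ac)
    qed
    \<comment> \<open>The defect is measured with the new iterate, whereas \<open>R\<close> still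
      uses the old one; the difference is \<open>A\<close> applied to the increment.\<close>
    moreover have ER: "E (Suc m) x k = R - A x k (\<Phi> (Suc m) x - \<Phi> m x)"
      by (simp add: E_def R_def blinfun.diff_right)
    ultimately have "norm (E (Suc m) x k) \<le>
        1 / 4 * (C * (1 / 2) ^ m) * norm k + 1 / 4 * (C * (1 / 2) ^ m) * norm k"
      unfolding ER using norm_triangle_ineq4[of R "A x k (\<Phi> (Suc m) x - \<Phi> m x)"]
      by (simp only: mult_1_right diff_zero)
    then show ?case by (simp add: mult_ac)
  qed
  have "uniform_limit U (\<lambda>n x. \<Sum>i<n. \<Phi> (Suc i) x - \<Phi> i x) (\<lambda>x. suminf (\<lambda>i. \<Phi> (Suc i) x - \<Phi> i x)) sequentially"
    by (rule Weierstrass_m_test[where M="\<lambda>m. D * (1 / 4) ^ m"]) (auto intro!: d summable_mult summable_geometric)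
  then have "uniform_limit U (\<lambda>n x. v0 + (\<Sum>i<n. \<Phi> (Suc i) x - \<Phi> i x))
      (\<lambda>x. v0 + suminf (\<lambda>i. \<Phi> (Suc i) x - \<Phi> i x)) sequentially"
    by (intro uniform_limit_intros)
  moreover have "v0 + (\<Sum>i<n. \<Phi> (Suc i) x - \<Phi> i x) = \<Phi> n x" for n x
    using sum_lessThan_telescope[of "\<lambda>i. \<Phi> i x" n] by (simp add: \<Phi>(1))
  ultimately obtain \<Psi> where \<Psi>: "uniform_limit U \<Phi> \<Psi> sequentially" by auto
  have lim: "(\<lambda>n. \<Phi> n x) \<longlonglongrightarrow> \<Psi> x" if "x \<in> U" for x
    using tendsto_uniform_limitI[OF \<Psi> that] .
  have x0': "\<Phi> n x0 = v0" for n
    by (cases n) (simp_all add: \<Phi> T_def blinfun.zero_left blinfun.zero_right)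
  \<comment> \<open>Vanishing defects and uniform convergence of \<Phi> give uniform convergence of
    the derivatives, as the theorem on differentiating a sequence requires.\<close>
  have "\<exists>g. \<forall>x\<in>U. (\<lambda>n. \<Phi> n x) \<longlonglongrightarrow> g x \<and> (g has_derivative (\<lambda>h. A x h (\<Psi> x))) (at x within U)"
  proof (rule has_derivative_sequence[where f=\<Phi> and f'="\<lambda>n x. frechet_derivative (\<Phi> n) (at x)",
        OF U(3) _ _ U(4) lim[OF U(4)]])
    show "(\<Phi> n has_derivative frechet_derivative (\<Phi> n) (at x)) (at x within U)" if "x \<in> U" for n x
      using smooth_on_has_derivative[OF sm that] has_derivative_at_withinI by blast
    fix \<epsilon> :: real assume \<epsilon>: "\<epsilon> > 0"
    have "(\<lambda>m. C * (1 / 2) ^ m) \<longlonglongrightarrow> C * 0" by (intro tendsto_intros) auto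
    then have "\<forall>\<^sub>F m in sequentially. C * (1 / 2) ^ m < \<epsilon> / 2"
      using \<epsilon> by (intro order_tendstoD) auto
    moreover have "\<forall>\<^sub>F m in sequentially. \<forall>x\<in>U. dist (\<Phi> m x) (\<Psi> x) < \<epsilon> / 2 / K"
      using uniform_limitD[OF \<Psi>] \<epsilon> K by simp
    ultimately show "\<forall>\<^sub>F n in sequentially. \<forall>x\<in>U. \<forall>h.
        norm (frechet_derivative (\<Phi> n) (at x) h - A x h (\<Psi> x)) \<le> \<epsilon> * norm h"
    proof eventually_elim
      case (elim m)
      show ?case
      proof (intro ballI allI)
        fix x h assume x: "x \<in> U"
        have "frechet_derivative (\<Phi> m) (at x) h - A x h (\<Psi> x) = E m x h + A x h (\<Phi> m x - \<Psi> x)"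
          by (simp add: E_def blinfun.diff_right)
        also have "norm \<dots> \<le> norm (E m x h) + norm (A x h (\<Phi> m x - \<Psi> x))" by (rule norm_triangle_ineq)
        also have "\<dots> \<le> \<epsilon> / 2 * norm h + K * norm h * (\<epsilon> / 2 / K)"
        proof (rule add_mono)
          have "norm (E m x h) \<le> C * (1 / 2) ^ m * norm h" by (rule e[OF x])
          also have "\<dots> \<le> \<epsilon> / 2 * norm h" using elim(1) by (intro mult_right_mono) auto
          finally show "norm (E m x h) \<le> \<epsilon> / 2 * norm h" .
          have "norm (A x h (\<Phi> m x - \<Psi> x)) \<le> K * norm h * norm (\<Phi> m x - \<Psi> x)" by (rule Kb[OF x])
          also have "\<dots> \<le> K * norm h * (\<epsilon> / 2 / K)"
            using elim(2) x K by (intro mult_left_mono) (auto simp: dist_norm less_imp_le)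
          finally show "norm (A x h (\<Phi> m x - \<Psi> x)) \<le> K * norm h * (\<epsilon> / 2 / K)" .
        qed
        also have "\<dots> = \<epsilon> * norm h" using K by (simp add: field_simps)
        finally show "norm (frechet_derivative (\<Phi> m) (at x) h - A x h (\<Psi> x)) \<le> \<epsilon> * norm h" .
      qed
    qed
  qed
  then obtain g where g: "\<And>x. x \<in> U \<Longrightarrow> (\<lambda>n. \<Phi> n x) \<longlonglongrightarrow> g x"
    "\<And>x. x \<in> U \<Longrightarrow> (g has_derivative (\<lambda>h. A x h (\<Psi> x))) (at x within U)" by blast
  have g\<Psi>: "\<Psi> x = g x" if "x \<in> U" for x using LIMSEQ_unique[OF lim[OF that] g(1)[OF that]] .
  have dg: "(g has_derivative (\<lambda>h. A x h (g x))) (at x)" if "x \<in> U" for x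
    using g(2)[OF that] g\<Psi>[OF that] at_within_open[OF that U(2)] by simp
  \<comment> \<open>Bootstrap: the derivative of g is \<open>A\<close> applied to g, hence as
    regular as g itself.\<close>
  have "Ck_on n U g" for n
  proof (induction n)
    case 0
    have "isCont g x" if "x \<in> U" for x by (rule has_derivative_continuous[OF dg[OF that]])
    then show ?case by (simp add: continuous_at_imp_continuous_on)
  next
    case (Suc n)
    have "Ck_on n U A" using smooth_on_subset[OF A(1) U(1)] by (rule smooth_onD)
    then show ?case
      by (intro Ck_on_SucI[OF U(2) dg] Ck_on_bilinear[OF bounded_bilinear_blinfun_apply U(2)]
          Ck_on_const U(2) Suc) auto
  qed
  then have "smooth_on (ball x0 r) g" by (simp add: smooth_on_def U_def)
  moreover have "g x0 = v0" using g(1)[OF U(4)] x0' LIMSEQ_unique[of "\<lambda>n. v0"] by auto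
  ultimately show thesis using that[of r g] r(1) rS dg by (auto simp: U_def)
qed

lemma bounded_linear_Blinfun:
  fixes T :: "'m::euclidean_space \<Rightarrow> 'x::real_normed_vector \<Rightarrow> 'y::real_normed_vector"
  assumes "\<And>m. bounded_linear (T m)" "\<And>x. linear (\<lambda>m. T m x)"
  shows "bounded_linear (\<lambda>m. Blinfun (T m))"
  by (intro linear_conv_bounded_linear[THEN iffD1] linearI blinfun_eqI)
     (simp_all add: bounded_linear_Blinfun_apply[OF assms(1)] linear_add[OF assms(2)]
        linear_scale[OF assms(2)] blinfun.add_left blinfun.scaleR_left)

text \<open>\<open>M\<close> holds the four component matrices of a matrix-valued 1-form; they are
  packed into the type that \<open>flat_connection_parallel_section\<close> expects.\<close>

definition connection_form :: "complex ^ 4 ^ 4 ^ 4 \<Rightarrow> (real ^ 4) \<Rightarrow>\<^sub>L (complex ^ 4) \<Rightarrow>\<^sub>L (complex ^ 4)" where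
  "connection_form M = Blinfun (\<lambda>h. Blinfun (\<lambda>v. \<Sum>a\<in>UNIV. h $ a *\<^sub>R (M $ a *v v)))"

lemma matrix_vector_mult_scaleR:
  fixes M :: "complex ^ 'n ^ 'm"
  shows "(c *\<^sub>R M) *v v = c *\<^sub>R (M *v v)" "M *v (c *\<^sub>R v) = c *\<^sub>R (M *v v)"
  by (simp_all add: vec_eq_iff matrix_vector_mult_def scaleR_sum_right)

lemma connection_form:
  shows "bounded_linear connection_form"
    and "connection_form M h v = (\<Sum>a\<in>UNIV. h $ a *\<^sub>R (M $ a *v v))"
proof -
  have 1: "bounded_linear (\<lambda>v. \<Sum>a\<in>UNIV. h $ a *\<^sub>R (M $ a *v v))"
    for M :: "complex ^ 4 ^ 4 ^ 4" and h :: "real ^ 4"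
    by (intro linear_conv_bounded_linear[THEN iffD1] linearI)
       (simp_all add: matrix_vector_mult_scaleR matrix_vector_right_distrib sum.distrib
          scaleR_right_distrib scaleR_sum_right mult.commute)
  have 2: "bounded_linear (\<lambda>h. Blinfun (\<lambda>v. \<Sum>a\<in>UNIV. h $ a *\<^sub>R (M $ a *v v)))"
    for M :: "complex ^ 4 ^ 4 ^ 4"
    by (rule bounded_linear_Blinfun[OF 1], rule linearI)
       (simp_all add: scaleR_left_distrib sum.distrib scaleR_sum_right)
  show "bounded_linear connection_form"
    unfolding connection_form_def
  proof (rule bounded_linear_Blinfun[OF 2], rule linearI)
    show "Blinfun (\<lambda>v. \<Sum>a\<in>UNIV. h $ a *\<^sub>R ((M + N) $ a *v v)) =
        Blinfun (\<lambda>v. \<Sum>a\<in>UNIV. h $ a *\<^sub>R (M $ a *v v)) + Blinfun (\<lambda>v. \<Sum>a\<in>UNIV. h $ a *\<^sub>R (N $ a *v v))"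
      for h and M N :: "complex ^ 4 ^ 4 ^ 4"
      by (rule blinfun_eqI) (simp only: bounded_linear_Blinfun_apply[OF 1] blinfun.add_left, simp only:
           vector_add_component matrix_vector_mult_add_rdistrib scaleR_right_distrib sum.distrib)
    show "Blinfun (\<lambda>v. \<Sum>a\<in>UNIV. h $ a *\<^sub>R ((c *\<^sub>R M) $ a *v v)) =
        c *\<^sub>R Blinfun (\<lambda>v. \<Sum>a\<in>UNIV. h $ a *\<^sub>R (M $ a *v v))"
      for h c and M :: "complex ^ 4 ^ 4 ^ 4"
      by (rule blinfun_eqI)
         (simp only: bounded_linear_Blinfun_apply[OF 1] blinfun.scaleR_left, simp only: vector_scaleR_component
           matrix_vector_mult_scaleR scaleR_sum_right scaleR_scaleR mult.commute)
  qed
  show "connection_form M h v = (\<Sum>a\<in>UNIV. h $ a *\<^sub>R (M $ a *v v))"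
    by (simp add: connection_form_def bounded_linear_Blinfun_apply[OF 2] bounded_linear_Blinfun_apply[OF 1])
qed

text \<open>The hypothesis \<open>flat\<close> is the integrability condition that equality of the
  mixed partial derivatives of a solution imposes. This is the form in which concrete systems are
  solved later.\<close>

theorem flat_matrix_connection:
  fixes Om :: "4 \<Rightarrow> real ^ 4 \<Rightarrow> complex ^ 4 ^ 4"
  assumes Om: "\<And>a. smooth_on S (Om a)" "open S" and x0: "x0 \<in> S"
    and flat: "\<And>x a b. x \<in> S \<Longrightarrow>
      pd b (Om a) x + Om a x ** Om b x = pd a (Om b) x + Om b x ** Om a x"
  obtains r \<Phi> where "r > 0" "ball x0 r \<subseteq> S" "\<Phi> x0 = v0" "smooth_on (ball x0 r) \<Phi>"
    "\<And>x a. x \<in> ball x0 r \<Longrightarrow> pd a \<Phi> x = Om a x *v \<Phi> x"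
proof -
  define V where "V = (\<lambda>x. \<chi> a. Om a x)"
  have V: "smooth_on S V" unfolding V_def by (intro smooth_on_vec Om)
  have cf: "smooth_on S (\<lambda>x. connection_form (V x))"
    by (rule smooth_on_bounded_linear[OF connection_form(1) Om(2) V])
  have D: "frechet_derivative (\<lambda>x. connection_form (V x)) (at x) k h v =
      (\<Sum>a\<in>UNIV. \<Sum>b\<in>UNIV. (h $ a * k $ b) *\<^sub>R (pd b (Om a) x *v v))" if x: "x \<in> S" for x k h v
  proof -
    have "(V has_derivative (\<lambda>w. \<Sum>b\<in>UNIV. w $ b *\<^sub>R pd b V x)) (at x)"
      by (rule has_derivative_pd[OF smooth_on_differentiable[OF V x]])
    from bounded_linear.has_derivative[OF connection_form(1) this]
    have "frechet_derivative (\<lambda>x. connection_form (V x)) (at x) k =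
        connection_form (\<Sum>b\<in>UNIV. k $ b *\<^sub>R pd b V x)"
      by (subst frechet_derivative_at[symmetric]) auto
    moreover have "pd b V x $ a = pd b (Om a) x" for a b
      using pd_nth[OF smooth_on_differentiable[OF V x], of b a] by (simp add: V_def)
    moreover have "(\<Sum>b\<in>UNIV. k $ b *\<^sub>R pd b (Om a) x) *v v = (\<Sum>b\<in>UNIV. k $ b *\<^sub>R (pd b (Om a) x *v v))" for a
    proof -
      interpret linear "\<lambda>M. M *v v"
        by (rule linearI) (simp_all add: matrix_vector_mult_add_rdistrib matrix_vector_mult_scaleR)
      show ?thesis by (simp add: sum matrix_vector_mult_scaleR)
    qed
    ultimately show ?thesis
      by (simp add: connection_form(2) scaleR_sum_right)
  qed
  have AA: "connection_form (V x) h (connection_form (V x) k v) =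
      (\<Sum>a\<in>UNIV. \<Sum>b\<in>UNIV. (h $ a * k $ b) *\<^sub>R ((Om a x ** Om b x) *v v))" for x h k v
  proof -
    interpret linear "\<lambda>v. Om a x *v v" for a
      by (rule linearI) (simp_all add: matrix_vector_right_distrib matrix_vector_mult_scaleR)
    show ?thesis
      by (simp add: connection_form(2) V_def sum scale scaleR_sum_right matrix_vector_mul_assoc)
  qed
  have *: "(\<Sum>a\<in>UNIV. \<Sum>b\<in>UNIV. (h $ a * k $ b) *\<^sub>R (pd b (Om a) x *v v)) +
      (\<Sum>a\<in>UNIV. \<Sum>b\<in>UNIV. (h $ a * k $ b) *\<^sub>R ((Om a x ** Om b x) *v v)) =
      (\<Sum>a\<in>UNIV. \<Sum>b\<in>UNIV. (h $ a * k $ b) *\<^sub>R ((pd b (Om a) x + Om a x ** Om b x) *v v))" for x h k v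
    by (simp add: sum.distrib matrix_vector_mult_add_rdistrib scaleR_right_distrib)
  have F: "frechet_derivative (\<lambda>x. connection_form (V x)) (at x) k h v +
        connection_form (V x) h (connection_form (V x) k v) =
      frechet_derivative (\<lambda>x. connection_form (V x)) (at x) h k v +
        connection_form (V x) k (connection_form (V x) h v)" if x: "x \<in> S" for x h k v
    unfolding D[OF x] AA * by (subst (2) sum.swap) (simp add: flat[OF x] mult.commute)
  obtain r \<Phi> where r: "r > 0" "ball x0 r \<subseteq> S" "\<Phi> x0 = v0" "smooth_on (ball x0 r) \<Phi>"
    "\<And>x. x \<in> ball x0 r \<Longrightarrow> (\<Phi> has_derivative (\<lambda>h. connection_form (V x) h (\<Phi> x))) (at x)"
    using flat_connection_parallel_section[OF cf Om(2) x0 F] by blast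
  have "pd a \<Phi> x = Om a x *v \<Phi> x" if "x \<in> ball x0 r" for x a
    using pd_eqI[OF r(5)[OF that], of a]
    by (simp add: connection_form(2) V_def axis_def if_distrib[of "\<lambda>c. c *\<^sub>R _"] cong: if_cong)
  then show thesis using that r by blast
qed

section \<open>Smooth matrix inverses and the inverse function theorem\<close>

lemma smooth_on_det:
  fixes M :: "'a::euclidean_space \<Rightarrow> real ^ 'n ^ 'n"
  assumes "smooth_on S M" "open S"
  shows "smooth_on S (\<lambda>x. det (M x))"
  unfolding det_def by (intro smooth_on_sum smooth_on_mult smooth_on_prod smooth_on_nth smooth_on_const assms)

lemma
  fixes M :: "'a::semiring_1 ^ 'n ^ 'm"
  assumes "invertible M"
  shows matrix_inv_right: "M ** matrix_inv M = mat 1" and matrix_inv_left: "matrix_inv M ** M = mat 1"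
  using someI_ex[OF assms[unfolded invertible_def]] by (simp_all add: matrix_inv_def)

text \<open>Cramer's rule shows the entries of the inverse as quotients of determinants, from which
  their smoothness can be read off.\<close>

lemma matrix_inv_cramer:
  fixes M :: "real ^ 'n ^ 'n"
  assumes "det M \<noteq> 0"
  shows "matrix_inv M $ k $ j = det (\<chi> i l. if l = k then axis j 1 $ i else M $ i $ l) / det M"
proof -
  have "M *v (\<chi> k. matrix_inv M $ k $ j) = axis j 1"
    using matrix_inv_right[of M] assms
    by (simp add: invertible_det_nz vec_eq_iff matrix_vector_mult_def matrix_matrix_mult_def mat_def axis_def)
  then have "(\<chi> k. matrix_inv M $ k $ j) = (\<chi> k. det (\<chi> i l. if l = k then axis j 1 $ i else M $ i $ l) / det M)"
    using cramer[OF assms] by blast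
  then show ?thesis by (simp add: vec_eq_iff)
qed

lemma smooth_on_matrix_inv:
  fixes M :: "'a::euclidean_space \<Rightarrow> real ^ 'n ^ 'n"
  assumes "smooth_on S M" "open S" "\<And>x. x \<in> S \<Longrightarrow> det (M x) \<noteq> 0"
  shows "smooth_on S (\<lambda>x. matrix_inv (M x))"
proof -
  have "smooth_on S (\<lambda>x. if l = k then c else M x $ i $ l)" for l k i c
    using assms(1,2) by (cases "l = k") (auto intro!: smooth_on_nth smooth_on_const)
  then have "smooth_on S (\<lambda>x. \<chi> k j. det (\<chi> i l. if l = k then axis j 1 $ i else M x $ i $ l) / det (M x))"
    by (intro smooth_on_vec smooth_on_divide smooth_on_det assms)
  then show ?thesis
    by (rule smooth_on_cong) (use assms in \<open>simp_all add: vec_eq_iff matrix_inv_cramer\<close>)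
qed

text \<open>The inverse function theorem supplies a differentiable inverse \<psi>. Its derivative is
  the inverse Jacobian composed with \<psi>, so each class C^k of \<psi> implies the next
  one.\<close>

theorem smooth_inverse_function:
  fixes \<phi> :: "real ^ 'n \<Rightarrow> real ^ 'n"
  assumes \<phi>: "smooth_on S \<phi>" "open S" "x0 \<in> S"
    and inj: "\<And>w. frechet_derivative \<phi> (at x0) w = 0 \<Longrightarrow> w = 0"
  obtains U \<psi> where "open U" "x0 \<in> U" "U \<subseteq> S" "open (\<phi> ` U)" "smooth_on (\<phi> ` U) \<psi>"
    "\<And>x. x \<in> U \<Longrightarrow> \<psi> (\<phi> x) = x"
proof -
  define D where "D = (\<lambda>x. Blinfun (frechet_derivative \<phi> (at x)))"
  have d: "(\<phi> has_derivative frechet_derivative \<phi> (at x)) (at x)" if "x \<in> S" for x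
    using smooth_on_has_derivative[OF \<phi>(1) that] .
  have D: "blinfun_apply (D x) = frechet_derivative \<phi> (at x)" if "x \<in> S" for x
    unfolding D_def by (rule bounded_linear_Blinfun_apply[OF has_derivative_bounded_linear[OF d[OF that]]])
  have contD: "continuous_on S D"
  proof (rule continuous_on_blinfun_componentwise)
    fix i :: "real ^ 'n"
    show "continuous_on S (\<lambda>x. D x i)"
      by (rule continuous_on_eq[OF smooth_on_continuous_on[OF smooth_on_frechet_derivative[OF \<phi>(1,2)]]])
         (simp add: D)
  qed
  have lin0: "linear (frechet_derivative \<phi> (at x0))" using d[OF \<phi>(3)] has_derivative_linear by blast
  have "inj (frechet_derivative \<phi> (at x0))"
    using inj linear_injective_0[OF lin0] by blast
  then obtain L where L: "linear L" "L \<circ> frechet_derivative \<phi> (at x0) = id"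
    using linear_injective_left_inverse[OF lin0] by blast
  have LD: "Blinfun L o\<^sub>L D x0 = id_blinfun"
    by (rule blinfun_eqI)
       (use L in \<open>simp add: D[OF \<phi>(3)] bounded_linear_Blinfun_apply linear_conv_bounded_linear fun_eq_iff\<close>)
  have dD: "(\<phi> has_derivative blinfun_apply (D x)) (at x)" if "x \<in> S" for x
    using d[OF that] D[OF that] by simp
  obtain U V \<psi> \<psi>' where U: "open U" "U \<subseteq> S" "x0 \<in> U" "open V" "homeomorphism U V \<phi> \<psi>"
    and \<psi>: "\<And>y. y \<in> V \<Longrightarrow> (\<psi> has_derivative \<psi>' y) (at y)"
    and bij: "\<And>y. y \<in> V \<Longrightarrow> \<psi>' y = inv (blinfun_apply (D (\<psi> y)))"
      "\<And>y. y \<in> V \<Longrightarrow> bij (blinfun_apply (D (\<psi> y)))"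
  proof (rule inverse_function_theorem[OF \<phi>(2) dD contD \<phi>(3) LD])
    fix U V g g'
    assume a: "open U" "U \<subseteq> S" "x0 \<in> U" "open V" "\<phi> x0 \<in> V" "homeomorphism U V \<phi> g"
      "\<And>y. y \<in> V \<Longrightarrow> (g has_derivative g' y) (at y)"
      "\<And>y. y \<in> V \<Longrightarrow> g' y = inv (blinfun_apply (D (g y)))"
      "\<And>y. y \<in> V \<Longrightarrow> bij (blinfun_apply (D (g y)))"
    show thesis by (rule that[OF a(1-4,6-9)])
  qed
  have V: "V = \<phi> ` U" using homeomorphism_image1[OF U(5)] by simp
  have inv: "\<psi> (\<phi> x) = x" if "x \<in> U" for x using homeomorphism_apply1[OF U(5) that] .
  have VU: "\<psi> y \<in> U" if "y \<in> V" for y using homeomorphism_image2[OF U(5)] that by auto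
  define J where "J = (\<lambda>x. matrix (frechet_derivative \<phi> (at x)))"
  have J: "frechet_derivative \<phi> (at x) w = J x *v w" if "x \<in> S" for x w
    unfolding J_def using matrix_vector_mul(2)[OF has_derivative_linear[OF d[OF that]]]
    by (metis has_derivative_linear d that matrix_works linear_matrix_vector_mul_eq)
  have sJ: "smooth_on S J"
    unfolding J_def matrix_def
    by (intro smooth_on_vec smooth_on_nth smooth_on_frechet_derivative \<phi>)
  have invJ: "invertible (J (\<psi> y))" if "y \<in> V" for y
  proof -
    have "blinfun_apply (D (\<psi> y)) = (*v) (J (\<psi> y))"
      using J D VU[OF that] U(2) by (auto simp: fun_eq_iff)
    then have "inj ((*v) (J (\<psi> y)))" using bij(2)[OF that] by (simp add: bij_def)
    then show ?thesis using invertible_left_inverse matrix_left_invertible_injective by blast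
  qed
  have \<psi>': "\<psi>' y w = matrix_inv (J (\<psi> y)) *v w" if "y \<in> V" for y w
  proof -
    have "blinfun_apply (D (\<psi> y)) (matrix_inv (J (\<psi> y)) *v w) = w"
      using J D VU[OF that] U(2) matrix_inv_right[OF invJ[OF that]]
      by (metis matrix_vector_mul_assoc matrix_vector_mul_lid subsetD)
    then show ?thesis using bij[OF that] by (metis bij_inv_eq_iff)
  qed
  have "smooth_on {x \<in> S. det (J x) \<noteq> 0} (\<lambda>x. matrix_inv (J x))"
  proof (rule smooth_on_matrix_inv)
    have "open (S \<inter> (\<lambda>x. det (J x)) -` (- {0}))"
      by (rule continuous_open_preimage[OF smooth_on_continuous_on[OF smooth_on_det[OF sJ \<phi>(2)]] \<phi>(2)])
         (simp add: open_Compl)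
    then show "open {x \<in> S. det (J x) \<noteq> 0}" by (simp add: vimage_def Int_def)
  qed (auto intro: smooth_on_subset[OF sJ])
  then have K: "Ck_on k {x \<in> S. det (J x) \<noteq> 0} (\<lambda>x. matrix_inv (J x))" for k by (rule smooth_onD)
  have "Ck_on k V \<psi>" for k
  proof (induction k)
    case 0
    have "isCont \<psi> y" if "y \<in> V" for y by (rule has_derivative_continuous[OF \<psi>[OF that]])
    then show ?case by (simp add: continuous_at_imp_continuous_on)
  next
    case (Suc k)
    show ?case
    proof (rule Ck_on_SucI[OF U(4) \<psi>])
      fix e :: "real ^ 'n"
      have "Ck_on k V (\<lambda>y. matrix_inv (J (\<psi> y)))"
        by (rule Ck_on_compose[OF _ U(4) Suc K])
           (use VU U(2) invJ in \<open>auto simp: invertible_det_nz\<close>)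
      then have "Ck_on k V (\<lambda>y. matrix_inv (J (\<psi> y)) *v e)"
        by (rule Ck_on_bounded_linear[rotated 2])
           (auto intro!: U linear_conv_bounded_linear[THEN iffD1] linearI
              simp: matrix_vector_mult_add_rdistrib scaleR_matrix_vector_assoc)
      then show "Ck_on k V (\<lambda>y. \<psi>' y e)"
        by (subst Ck_on_cong[OF U(4)]) (simp_all add: \<psi>')
    qed
  qed
  then have "smooth_on V \<psi>" by (simp add: smooth_on_def)
  then show thesis using U V inv by (intro that[of U \<psi>]) auto
qed

section \<open>Null tetrads and self-duality at a point\<close>

lemma UNIV4: "UNIV = {0, 1, 2, 3::4}"
proof -
  have "(4::4) = 0" by simp
  then show ?thesis unfolding UNIV_4 by (simp only: insert_commute)
qed

lemma exhaust4: "i = 0 \<or> i = 1 \<or> i = 2 \<or> i = (3::4)"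
  using UNIV4 by auto

lemma sum4: "(\<Sum>i\<in>UNIV. f i) = f 0 + f 1 + f 2 + f (3::4)"
  unfolding UNIV4 by (simp add: ac_simps)

text \<open>Laplace expansion along the first two rows: six products of complementary 2x2 minors,
  the pattern of \<open>alt4\<close>. The indices are 0 to 3, as in \<open>minkowski\<close> and
  \<open>levi_civita\<close>.\<close>

lemma det4:
  fixes A :: "'a::comm_ring_1 ^ 4 ^ 4"
  shows "det A =
    (A$0$0 * A$1$1 - A$0$1 * A$1$0) * (A$2$2 * A$3$3 - A$2$3 * A$3$2)
    - (A$0$0 * A$1$2 - A$0$2 * A$1$0) * (A$2$1 * A$3$3 - A$2$3 * A$3$1)
    + (A$0$0 * A$1$3 - A$0$3 * A$1$0) * (A$2$1 * A$3$2 - A$2$2 * A$3$1)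
    + (A$0$1 * A$1$2 - A$0$2 * A$1$1) * (A$2$0 * A$3$3 - A$2$3 * A$3$0)
    - (A$0$1 * A$1$3 - A$0$3 * A$1$1) * (A$2$0 * A$3$2 - A$2$2 * A$3$0)
    + (A$0$2 * A$1$3 - A$0$3 * A$1$2) * (A$2$0 * A$3$1 - A$2$1 * A$3$0)"
proof -
  have f0: "finite {1, 2, 3::4}" "0 \<notin> {1, 2, 3::4}" by auto
  have f1: "finite {2, 3::4}" "1 \<notin> {2, 3::4}" by auto
  have f2: "finite {3::4}" "2 \<notin> {3::4}" by auto
  show ?thesis
    unfolding det_def UNIV4
    unfolding sum_over_permutations_insert[OF f0]
    unfolding sum_over_permutations_insert[OF f1]
    unfolding sum_over_permutations_insert[OF f2]
    unfolding permutes_sing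
    by (simp add: sign_swap_id sign_id permutation_swap_id sign_compose permutation_compose
        Transposition.transpose_def)
       (simp add: algebra_simps)
qed

definition rows4 :: "'b \<Rightarrow> 'b \<Rightarrow> 'b \<Rightarrow> 'b \<Rightarrow> 'b ^ 4" where
  "rows4 p q r t = (\<chi> i. if i = 0 then p else if i = 1 then q else if i = 2 then r else t)"

lemma rows4 [simp]:
  "rows4 p q r t $ 0 = p" "rows4 p q r t $ 1 = q" "rows4 p q r t $ 2 = r" "rows4 p q r t $ 3 = t"
  by (simp_all add: rows4_def)

text \<open>The minor of the columns \<open>a, b, c, d\<close>, by Laplace expansion along two columns.\<close>

definition alt4 ::
  "'a::comm_ring_1 ^ 4 \<Rightarrow> 'a ^ 4 \<Rightarrow> 'a ^ 4 \<Rightarrow> 'a ^ 4 \<Rightarrow> 4 \<Rightarrow> 4 \<Rightarrow> 4 \<Rightarrow> 4 \<Rightarrow> 'a" where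
  "alt4 p q r t a b c d =
     wedge p q $ a $ b * wedge r t $ c $ d - wedge p r $ a $ b * wedge q t $ c $ d
   + wedge p t $ a $ b * wedge q r $ c $ d + wedge q r $ a $ b * wedge p t $ c $ d
   - wedge q t $ a $ b * wedge p r $ c $ d + wedge r t $ a $ b * wedge p q $ c $ d"

lemma alt4_cols: "alt4 p q r t a b c d = det (rows4
   (\<chi> j. rows4 p q r t $ j $ a) (\<chi> j. rows4 p q r t $ j $ b)
   (\<chi> j. rows4 p q r t $ j $ c) (\<chi> j. rows4 p q r t $ j $ d))"
  unfolding det4 alt4_def wedge_def by (simp add: algebra_simps)

definition cmat :: "real ^ 'n ^ 'm \<Rightarrow> complex ^ 'n ^ 'm" where
  "cmat A = (\<chi> i j. complex_of_real (A $ i $ j))"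

lemma cmat_nth [simp]: "cmat A $ i $ j = complex_of_real (A $ i $ j)"
  by (simp add: cmat_def)

lemma cvec_nth [simp]: "cvec l $ i = complex_of_real (l $ i)"
  by (simp add: cvec_def)

lemma cmat_mult: "cmat (A ** B) = cmat A ** cmat B"
  by (simp add: vec_eq_iff matrix_matrix_mult_def)

lemma cmat_transpose: "cmat (transpose A) = transpose (cmat A)"
  by (simp add: vec_eq_iff transpose_def)

lemma cmat_1: "cmat (mat 1) = mat 1"
  by (simp add: vec_eq_iff mat_def)

lemma det_cmat: "det (cmat A) = complex_of_real (det A)"
  by (simp add: det_def)

text \<open>The product of the two determinants is the determinant of a matrix product, and
  multiplying by rows of unit vectors selects the columns a, b, c, d.\<close>

lemma levi_civita_det:
  "complex_of_real (levi_civita a b c d) * det (rows4 p q r t) = alt4 p q r t a b c d"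
proof -
  let ?P = "rows4 (axis a 1) (axis b 1) (axis c 1) (axis d 1) :: real ^ 4 ^ 4"
  have "levi_civita a b c d = det ?P"
    unfolding levi_civita_def by (rule arg_cong[of _ _ det]) (simp add: rows4_def vec_eq_iff)
  then have "complex_of_real (levi_civita a b c d) * det (rows4 p q r t) =
      det (cmat ?P ** transpose (rows4 p q r t))"
    by (simp add: det_mul det_cmat)
  also have "cmat ?P ** transpose (rows4 p q r t) = rows4
   (\<chi> j. rows4 p q r t $ j $ a) (\<chi> j. rows4 p q r t $ j $ b)
   (\<chi> j. rows4 p q r t $ j $ c) (\<chi> j. rows4 p q r t $ j $ d)"
    by (simp add: vec_eq_iff matrix_matrix_mult_def transpose_def rows4_def axis_def
        if_distrib[of "\<lambda>z. z * _"] if_distrib[of complex_of_real] if_distrib[of "\<lambda>v. v $ _"] cong: if_cong)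
  finally show ?thesis by (simp add: alt4_cols)
qed

lemma det_minkowski: "det minkowski = -1"
  by (simp add: det4 minkowski_def)

lemma spacetime_det:
  assumes "spacetime M g" "x \<in> M"
  shows "det (g x) < 0"
proof -
  obtain e where e: "\<And>a b. e a \<bullet> (g x *v e b) = minkowski $ a $ b"
    using assms unfolding spacetime_def by blast
  define E where "E = (\<chi> i a. e a $ i)"
  have "transpose E ** g x ** E = minkowski"
    by (simp add: vec_eq_iff E_def e[symmetric] matrix_matrix_mult_def matrix_vector_mult_def
        transpose_def inner_vec_def sum4 algebra_simps)
  then have "det E * det (g x) * det E = -1"
    using det_mul[of "transpose E ** g x" E] det_mul[of "transpose E" "g x"] det_minkowski by simp
  then have "det (g x) * (det E)\<^sup>2 < 0" by (simp add: power2_eq_square mult_ac)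
  then show ?thesis by (simp add: mult_less_0_iff)
qed

lemma ginv:
  assumes "spacetime M g" "x \<in> M"
  shows "g x ** ginv g x = mat 1" "ginv g x ** g x = mat 1"
    and "transpose (g x) = g x" "transpose (ginv g x) = ginv g x"
proof -
  have inv: "invertible (g x)" using spacetime_det[OF assms] by (simp add: invertible_det_nz)
  show 1: "g x ** ginv g x = mat 1" and 2: "ginv g x ** g x = mat 1"
    unfolding ginv_def using matrix_inv_right[OF inv] matrix_inv_left[OF inv] by auto
  show 3: "transpose (g x) = g x" using assms by (simp add: spacetime_def)
  have "transpose (ginv g x) ** g x = mat 1"
    using arg_cong[OF 1, of transpose] by (simp add: matrix_transpose_mul 3 transpose_mat)
  then have "transpose (ginv g x) ** g x ** ginv g x = ginv g x" by simp
  then show "transpose (ginv g x) = ginv g x" by (simp add: matrix_mul_assoc[symmetric] 1)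
qed

text \<open>
  \<open>null_tetrad G N l n z w\<close>: in applications \<open>l, n\<close> are real, \<open>w\<close> is the conjugate of \<open>z\<close> and
  \<open>N = |s|\<^sup>2\<close>; the determinant condition fixes the orientation so that \<open>l \<and> z\<close> is self-dual.
\<close>

definition null_tetrad ::
  "real ^ 4 ^ 4 \<Rightarrow> complex \<Rightarrow> complex ^ 4 \<Rightarrow> complex ^ 4 \<Rightarrow> complex ^ 4 \<Rightarrow> complex ^ 4 \<Rightarrow> bool" where
  "null_tetrad G N l n z w \<longleftrightarrow> N \<noteq> 0 \<and>
     (\<forall>a b. N * complex_of_real (G $ a $ b) = - l $ a * n $ b - n $ a * l $ b + z $ a * w $ b + w $ a * z $ b) \<and>
     det (rows4 l n z w) = - \<i> * N\<^sup>2 * complex_of_real (sqrt (- det G))"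

definition sharp ::
  "(real ^ 4 \<Rightarrow> real ^ 4 ^ 4) \<Rightarrow> real ^ 4 \<Rightarrow> complex ^ 4 \<Rightarrow> 4 \<Rightarrow> complex" where
  "sharp g x p a = (\<Sum>b\<in>UNIV. complex_of_real (ginv g x $ a $ b) * p $ b)"

text \<open>Algebra at one point. The locale does not make \<open>l\<close> and \<open>n\<close>
  real or \<open>w\<close> the conjugate of \<open>z\<close>; such assumptions are added in the
  lemmas that need them, and the rest is complex bilinear.\<close>

locale tetrad_at =
  fixes g :: "real ^ 4 \<Rightarrow> real ^ 4 ^ 4" and x :: "real ^ 4" and M and N l n z w
  assumes st: "spacetime M g" "x \<in> M" and tetrad: "null_tetrad (g x) N l n z w"
begin

lemma N: "N \<noteq> 0" using tetrad by (simp add: null_tetrad_def)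

lemma metric: "complex_of_real (g x $ a $ b) =
    (- l $ a * n $ b - n $ a * l $ b + z $ a * w $ b + w $ a * z $ b) / N"
  using tetrad by (simp add: null_tetrad_def field_simps)

lemma cinner_sym: "cinner g x p q = cinner g x q p"
proof -
  have *: "ginv g x $ a $ b = ginv g x $ b $ a" for a b
    using arg_cong[OF ginv(4)[OF st], of "\<lambda>M. M $ b $ a"] by (simp add: transpose_def)
  have "cinner g x q p = (\<Sum>b\<in>UNIV. \<Sum>a\<in>UNIV. complex_of_real (ginv g x $ b $ a) * q $ b * p $ a)"
    unfolding cinner_def ..
  also have "\<dots> = (\<Sum>b\<in>UNIV. \<Sum>a\<in>UNIV. complex_of_real (ginv g x $ a $ b) * p $ a * q $ b)"
    by (intro sum.cong refl) (subst *, simp only: mult_ac)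
  finally show ?thesis unfolding cinner_def by (subst sum.swap) simp
qed

lemma independent:
  assumes "\<And>a. c0 * l $ a + c1 * n $ a + c2 * z $ a + c3 * w $ a = 0"
  shows "c0 = 0 \<and> c1 = 0 \<and> c2 = 0 \<and> c3 = 0"
proof -
  let ?R = "rows4 l n z w" and ?c = "\<chi> i. if i = 0 then c0 else if i = 1 then c1 else if i = 2 then c2 else c3 :: complex ^ 4"
  have "det ?R \<noteq> 0"
    using tetrad spacetime_det[OF st] by (simp add: null_tetrad_def)
  then have "invertible (transpose ?R)" by (simp add: invertible_det_nz)
  then have inj: "inj ((*v) (transpose ?R))" by (rule inj_matrix_vector_mult)
  have "(transpose ?R *v ?c) $ a = c0 * l $ a + c1 * n $ a + c2 * z $ a + c3 * w $ a" for a
    unfolding matrix_vector_mult_def transpose_def sum4 by (simp add: mult.commute)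
  then have "transpose ?R *v ?c = transpose ?R *v 0"
    unfolding vec_eq_iff assms by simp
  then have "?c = 0" by (rule injD[OF inj])
  then have "?c $ 0 = 0" "?c $ 1 = 0" "?c $ 2 = 0" "?c $ 3 = 0" by simp_all
  then show ?thesis by simp
qed

text \<open>The vector dual to \<open>p\<close>, contracted with the metric written through the
  tetrad, returns N p.\<close>

lemma expand: "N * p $ a = - cinner g x n p * l $ a - cinner g x l p * n $ a
    + cinner g x w p * z $ a + cinner g x z p * w $ a"
proof -
  define P where "P = (\<lambda>b. \<Sum>c\<in>UNIV. complex_of_real (ginv g x $ b $ c) * p $ c)"
  have c: "cinner g x q p = (\<Sum>b\<in>UNIV. q $ b * P b)" for q
    unfolding cinner_def P_def sum_distrib_left by (simp only: mult_ac)
  have "(\<Sum>b\<in>UNIV. complex_of_real (g x $ a $ b) * complex_of_real (ginv g x $ b $ c)) =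
      complex_of_real ((g x ** ginv g x) $ a $ c)" for c
    by (simp add: matrix_matrix_mult_def)
  then have *: "(\<Sum>b\<in>UNIV. complex_of_real (g x $ a $ b) * complex_of_real (ginv g x $ b $ c)) =
      (if c = a then 1 else 0)" for c
    by (simp add: ginv(1)[OF st] mat_def)
  have "(\<Sum>b\<in>UNIV. complex_of_real (g x $ a $ b) * P b) = p $ a"
    unfolding P_def sum_distrib_left mult.assoc[symmetric]
    by (subst sum.swap) (simp add: * if_distrib[of "\<lambda>z. z * _"] flip: sum_distrib_right cong: if_cong)
  then have "N * p $ a = (\<Sum>b\<in>UNIV. N * complex_of_real (g x $ a $ b) * P b)"
    by (simp only: sum_distrib_left[symmetric] mult.assoc)
  also have "\<dots> = (\<Sum>b\<in>UNIV. (- l $ a * n $ b - n $ a * l $ b + z $ a * w $ b + w $ a * z $ b) * P b)"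
    using N by (simp add: metric)
  also have "\<dots> = - cinner g x n p * l $ a - cinner g x l p * n $ a
    + cinner g x w p * z $ a + cinner g x z p * w $ a"
    by (simp add: c sum4 algebra_simps)
  finally show ?thesis .
qed

text \<open>Each member of the tetrad is expanded by \<open>expand\<close>; comparing coefficients
  yields all inner products at once, so they need not be part of \<open>null_tetrad\<close>.\<close>

lemma cinner_tetrad:
  shows "cinner g x l l = 0" "cinner g x n n = 0" "cinner g x z z = 0" "cinner g x w w = 0"
    "cinner g x l n = - N" "cinner g x n l = - N" "cinner g x z w = N" "cinner g x w z = N"
    "cinner g x l z = 0" "cinner g x z l = 0" "cinner g x l w = 0" "cinner g x w l = 0"
    "cinner g x n z = 0" "cinner g x z n = 0" "cinner g x n w = 0" "cinner g x w n = 0"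
proof -
  have L: "cinner g x n l + N = 0 \<and> cinner g x l l = 0 \<and> - cinner g x w l = 0 \<and> - cinner g x z l = 0"
    by (rule independent) (use expand[of l] in \<open>simp add: algebra_simps\<close>)
  have n: "cinner g x n n = 0 \<and> cinner g x l n + N = 0 \<and> - cinner g x w n = 0 \<and> - cinner g x z n = 0"
    by (rule independent) (use expand[of n] in \<open>simp add: algebra_simps\<close>)
  have z: "cinner g x n z = 0 \<and> cinner g x l z = 0 \<and> N - cinner g x w z = 0 \<and> - cinner g x z z = 0"
    by (rule independent) (use expand[of z] in \<open>simp add: algebra_simps\<close>)
  have w: "cinner g x n w = 0 \<and> cinner g x l w = 0 \<and> - cinner g x w w = 0 \<and> N - cinner g x z w = 0"
    by (rule independent) (use expand[of w] in \<open>simp add: algebra_simps\<close>)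
  show "cinner g x l l = 0" "cinner g x n n = 0" "cinner g x z z = 0" "cinner g x w w = 0"
    "cinner g x l n = - N" "cinner g x n l = - N" "cinner g x z w = N" "cinner g x w z = N"
    "cinner g x l z = 0" "cinner g x z l = 0" "cinner g x l w = 0" "cinner g x w l = 0"
    "cinner g x n z = 0" "cinner g x z n = 0" "cinner g x n w = 0" "cinner g x w n = 0"
    using L n z w by (simp_all add: eq_neg_iff_add_eq_0)
qed

text \<open>Independence of the sixteen tensor products of the tetrad: the means by which tensor
  identities are turned into scalar equations below.\<close>

lemma independent2:
  assumes "\<And>a b. (c00 * l $ a + c01 * n $ a + c02 * z $ a + c03 * w $ a) * l $ b
      + (c10 * l $ a + c11 * n $ a + c12 * z $ a + c13 * w $ a) * n $ b
      + (c20 * l $ a + c21 * n $ a + c22 * z $ a + c23 * w $ a) * z $ b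
      + (c30 * l $ a + c31 * n $ a + c32 * z $ a + c33 * w $ a) * w $ b = 0"
  shows "c00 = 0 \<and> c01 = 0 \<and> c02 = 0 \<and> c03 = 0 \<and> c10 = 0 \<and> c11 = 0 \<and> c12 = 0 \<and> c13 = 0 \<and>
    c20 = 0 \<and> c21 = 0 \<and> c22 = 0 \<and> c23 = 0 \<and> c30 = 0 \<and> c31 = 0 \<and> c32 = 0 \<and> c33 = 0"
proof -
  have *: "c00 * l $ a + c01 * n $ a + c02 * z $ a + c03 * w $ a = 0 \<and>
      c10 * l $ a + c11 * n $ a + c12 * z $ a + c13 * w $ a = 0 \<and>
      c20 * l $ a + c21 * n $ a + c22 * z $ a + c23 * w $ a = 0 \<and>
      c30 * l $ a + c31 * n $ a + c32 * z $ a + c33 * w $ a = 0" for a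
    by (rule independent) (rule assms)
  show ?thesis
    using independent[of c00 c01 c02 c03] independent[of c10 c11 c12 c13]
      independent[of c20 c21 c22 c23] independent[of c30 c31 c32 c33] * by blast
qed

lemma expansion:
  obtains c0 c1 c2 c3 where "\<And>a. p a = c0 * l $ a + c1 * n $ a + c2 * z $ a + c3 * w $ a"
proof
  show "p a = (- cinner g x n (\<chi> a. p a) / N) * l $ a + (- cinner g x l (\<chi> a. p a) / N) * n $ a
    + (cinner g x w (\<chi> a. p a) / N) * z $ a + (cinner g x z (\<chi> a. p a) / N) * w $ a" for a
    using expand[of "\<chi> a. p a" a] N by (simp add: field_simps)
qed

text \<open>\<open>levi_civita\<close> times the tetrad determinant is \<open>alt4\<close>. The
  orientation condition gives this determinant the value -i N^2 sqrt(- det g), whose square root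
  factor is the one in \<open>vol\<close>; dividing leaves i/N^2.\<close>

lemma vol_alt4: "complex_of_real (vol g x a b c d) = \<i> / N\<^sup>2 * alt4 l n z w a b c d"
proof -
  let ?r = "complex_of_real (sqrt (- det (g x)))"
  have d: "det (rows4 l n z w) = - \<i> * N\<^sup>2 * ?r" using tetrad by (simp add: null_tetrad_def)
  have r: "?r \<noteq> 0" using spacetime_det[OF st] by simp
  have "complex_of_real (levi_civita a b c d) * (- \<i> * N\<^sup>2 * ?r) = alt4 l n z w a b c d"
    using levi_civita_det[of a b c d l n z w] by (simp add: d)
  then have "complex_of_real (levi_civita a b c d) * ?r = \<i> / N\<^sup>2 * alt4 l n z w a b c d"
    using N r by (simp add: field_simps) (metis (no_types) mult.left_commute mult.commute i_squared mult_minus1_right minus_mult_right mult.assoc mult_minus_left minus_minus)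
  then show ?thesis by (simp add: vol_def mult.commute)
qed

abbreviation "up \<equiv> sharp g x"

lemma up: "(\<Sum>a\<in>UNIV. q $ a * up p a) = cinner g x q p" "(\<Sum>a\<in>UNIV. up p a * q $ a) = cinner g x q p"
  unfolding cinner_def sharp_def sum_distrib_left sum_distrib_right by (simp_all only: mult_ac)

lemma up_metric: "(\<Sum>m\<in>UNIV. up p m * complex_of_real (g x $ m $ c)) = p $ c"
proof -
  have "(\<Sum>m\<in>UNIV. up p m * complex_of_real (g x $ m $ c)) =
      (\<Sum>m\<in>UNIV. up p m * ((- l $ m * n $ c - n $ m * l $ c + z $ m * w $ c + w $ m * z $ c) / N))"
    by (simp add: metric)
  also have "\<dots> = (- (\<Sum>m\<in>UNIV. up p m * l $ m) * n $ c - (\<Sum>m\<in>UNIV. up p m * n $ m) * l $ c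
      + (\<Sum>m\<in>UNIV. up p m * z $ m) * w $ c + (\<Sum>m\<in>UNIV. up p m * w $ m) * z $ c) / N"
    by (simp add: sum4 add_divide_distrib diff_divide_distrib algebra_simps)
  also have "\<dots> = p $ c" using expand[of p c] N by (simp add: up field_simps)
  finally show ?thesis .
qed

lemma calG_contract:
  "(\<Sum>m\<in>UNIV. up p m * calG g x m a b c) =
   (p $ b * complex_of_real (g x $ a $ c) - p $ c * complex_of_real (g x $ a $ b)
     + (\<Sum>m\<in>UNIV. up p m * alt4 l n z w m a b c) / N\<^sup>2) / 2"
proof -
  have "(\<Sum>m\<in>UNIV. up p m * calG g x m a b c) =
    ((\<Sum>m\<in>UNIV. up p m * complex_of_real (g x $ m $ b)) * complex_of_real (g x $ a $ c)
     - (\<Sum>m\<in>UNIV. up p m * complex_of_real (g x $ m $ c)) * complex_of_real (g x $ a $ b)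
     + (\<Sum>m\<in>UNIV. up p m * alt4 l n z w m a b c) / N\<^sup>2) / 2"
    unfolding calG_def vol_alt4
    by (simp add: sum4 algebra_simps add_divide_distrib diff_divide_distrib)
  then show ?thesis by (simp add: up_metric)
qed

lemma alt4_contract:
  "(\<Sum>m\<in>UNIV. up p m * alt4 l n z w m a b c) =
    cinner g x l p * (n $ a * wedge z w $ b $ c - z $ a * wedge n w $ b $ c + w $ a * wedge n z $ b $ c)
  - cinner g x n p * (l $ a * wedge z w $ b $ c - z $ a * wedge l w $ b $ c + w $ a * wedge l z $ b $ c)
  + cinner g x z p * (l $ a * wedge n w $ b $ c - n $ a * wedge l w $ b $ c + w $ a * wedge l n $ b $ c)
  - cinner g x w p * (l $ a * wedge n z $ b $ c - n $ a * wedge l z $ b $ c + z $ a * wedge l n $ b $ c)"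
proof -
  have "(\<Sum>m\<in>UNIV. up p m * alt4 l n z w m a b c) =
    (\<Sum>m\<in>UNIV. up p m * l $ m) * (n $ a * wedge z w $ b $ c - z $ a * wedge n w $ b $ c + w $ a * wedge n z $ b $ c)
  - (\<Sum>m\<in>UNIV. up p m * n $ m) * (l $ a * wedge z w $ b $ c - z $ a * wedge l w $ b $ c + w $ a * wedge l z $ b $ c)
  + (\<Sum>m\<in>UNIV. up p m * z $ m) * (l $ a * wedge n w $ b $ c - n $ a * wedge l w $ b $ c + w $ a * wedge l n $ b $ c)
  - (\<Sum>m\<in>UNIV. up p m * w $ m) * (l $ a * wedge n z $ b $ c - n $ a * wedge l z $ b $ c + z $ a * wedge l n $ b $ c)"
    unfolding alt4_def sum_distrib_right sum_subtractf[symmetric] sum.distrib[symmetric]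
    by (rule sum.cong[OF refl]) (simp add: wedge_def algebra_simps)
  then show ?thesis by (simp add: up)
qed

end

text \<open>For electric and magnetic vectors e, b that are orthogonal with the same square K, the
  vector u = (e x b)/K is the unit direction of propagation. The conclusions are, in components, u x
  e = b, u x b = -e, the completeness relation of the basis u, e/sqrt K, b/sqrt K, and the triple
  product.\<close>

lemma orthonormal_triple:
  fixes e1 e2 e3 b1 b2 b3 K :: real
  assumes K: "K = e1 * e1 + e2 * e2 + e3 * e3" "K = b1 * b1 + b2 * b2 + b3 * b3" "K > 0"
    and eb: "e1 * b1 + e2 * b2 + e3 * b3 = 0"
    and u: "u1 = (e2 * b3 - e3 * b2) / K" "u2 = (e3 * b1 - e1 * b3) / K" "u3 = (e1 * b2 - e2 * b1) / K"
  shows "u2 * e3 - u3 * e2 = b1" "u3 * e1 - u1 * e3 = b2" "u1 * e2 - u2 * e1 = b3"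
    "u2 * b3 - u3 * b2 = - e1" "u3 * b1 - u1 * b3 = - e2" "u1 * b2 - u2 * b1 = - e3"
    "u1 * u1 + (e1 * e1 + b1 * b1) / K = 1" "u2 * u2 + (e2 * e2 + b2 * b2) / K = 1"
    "u3 * u3 + (e3 * e3 + b3 * b3) / K = 1" "u1 * u2 + (e1 * e2 + b1 * b2) / K = 0"
    "u1 * u3 + (e1 * e3 + b1 * b3) / K = 0" "u2 * u3 + (e2 * e3 + b2 * b3) / K = 0"
    "u1 * (e2 * b3 - e3 * b2) + u2 * (e3 * b1 - e1 * b3) + u3 * (e1 * b2 - e2 * b1) = K"
proof -
  have u': "K * u1 = e2 * b3 - e3 * b2" "K * u2 = e3 * b1 - e1 * b3" "K * u3 = e1 * b2 - e2 * b1"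
    using K(3) u by simp_all
  have cancel: "y = z" if "K * y = K * z" for y z using that K(3) by simp
  have cancel2: "y + a / K = z" if "K * K * y + K * a = K * K * z" for y z a
    using that K(3) by (simp add: field_simps) (metis (no_types) less_irrefl mult.assoc mult.commute
        mult_left_cancel ring_class.ring_distribs(1))
  show "u2 * e3 - u3 * e2 = b1" "u3 * e1 - u1 * e3 = b2" "u1 * e2 - u2 * e1 = b3"
    "u2 * b3 - u3 * b2 = - e1" "u3 * b1 - u1 * b3 = - e2" "u1 * b2 - u2 * b1 = - e3"
    by (rule cancel, use u' K(1,2) eb in algebra)+
  show "u1 * u1 + (e1 * e1 + b1 * b1) / K = 1" "u2 * u2 + (e2 * e2 + b2 * b2) / K = 1"
    "u3 * u3 + (e3 * e3 + b3 * b3) / K = 1" "u1 * u2 + (e1 * e2 + b1 * b2) / K = 0"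
    "u1 * u3 + (e1 * e3 + b1 * b3) / K = 0" "u2 * u3 + (e2 * e3 + b2 * b3) / K = 0"
    by (rule cancel2, use u' K(1,2) eb in algebra)+
  show "u1 * (e2 * b3 - e3 * b2) + u2 * (e3 * b1 - e1 * b3) + u3 * (e1 * b2 - e2 * b1) = K"
    by (rule cancel, use u' K(1,2) eb in algebra)
qed

lemma oriented_frame:
  assumes "spacetime M g" "x \<in> M"
  obtains E :: "real ^ 4 ^ 4" where "transpose E ** g x ** E = minkowski" "det E > 0"
proof -
  obtain e where e: "\<And>a b. e a \<bullet> (g x *v e b) = minkowski $ a $ b"
    using assms unfolding spacetime_def by blast
  \<comment> \<open>Multiplying one spatial frame vector by \<epsilon> = 1 or -1 keeps the frame
    orthonormal and flips the sign of its determinant, so one of the two choices is positively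
    oriented.\<close>
  define F where "F = (\<lambda>\<epsilon>::real. \<chi> i a. (if a = 1 then \<epsilon> else 1) * e a $ i)"
  have F: "transpose (F \<epsilon>) ** g x ** F \<epsilon> = minkowski" if "\<epsilon> * \<epsilon> = 1" for \<epsilon>
  proof -
    have "(transpose (F \<epsilon>) ** g x ** F \<epsilon>) $ a $ b =
        (if a = 1 then \<epsilon> else 1) * (if b = 1 then \<epsilon> else 1) * (e a \<bullet> (g x *v e b))" for a b
      by (simp add: F_def matrix_matrix_mult_def matrix_vector_mult_def
        transpose_def inner_vec_def sum4 algebra_simps)
    then show ?thesis unfolding e using that by (simp add: vec_eq_iff minkowski_def)
  qed
  have d: "det (F (- 1)) = - det (F 1)" by (simp add: det4 F_def algebra_simps)
  have "det (F 1) * det (g x) * det (F 1) = -1"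
    using arg_cong[OF F[of 1], of det] by (simp add: det_mul det_minkowski)
  then have "det (F 1) \<noteq> 0" by auto
  then show thesis using that[OF F[of 1]] that[OF F[of "- 1"]] d by (cases "det (F 1) > 0") auto
qed

text \<open>The full contraction is the trace of X^T Y, and the mutually inverse frame changes
  cancel by cyclicity of the trace.\<close>

lemma trace_frame:
  fixes P Q X Y :: "'a::comm_ring_1 ^ 4 ^ 4"
  assumes "P ** Q = mat 1"
  shows "(\<Sum>a\<in>UNIV. \<Sum>b\<in>UNIV. (transpose P ** X ** P) $ a $ b * (Q ** Y ** transpose Q) $ a $ b) =
    (\<Sum>a\<in>UNIV. \<Sum>b\<in>UNIV. X $ a $ b * Y $ a $ b)"
proof -
  have tr: "(\<Sum>a\<in>UNIV. \<Sum>b\<in>UNIV. X $ a $ b * Y $ a $ b) = trace (transpose X ** Y)" for X Y :: "'a ^ 4 ^ 4"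
    unfolding trace_def matrix_matrix_mult_def transpose_def
    by (subst sum.swap) simp
  have "transpose (transpose P ** X ** P) ** (Q ** Y ** transpose Q) =
      transpose P ** (transpose X ** (P ** Q) ** Y ** transpose Q)"
    by (simp add: matrix_transpose_mul matrix_mul_assoc)
  also have "\<dots> = transpose P ** (transpose X ** Y ** transpose Q)" by (simp add: assms)
  also have "trace \<dots> = trace (transpose X ** Y ** transpose Q ** transpose P)"
    by (subst trace_mul_sym) (simp add: matrix_mul_assoc)
  also have "transpose X ** Y ** transpose Q ** transpose P = transpose X ** Y"
    using arg_cong[OF assms, of transpose]
    by (simp add: matrix_transpose_mul transpose_mat matrix_mul_assoc[symmetric])
  finally show ?thesis unfolding tr .
qed

text \<open>In an oriented orthonormal coframe a two-form is a pair of vectors e, b, and its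
  self-dual part is the complex vector F = (e - i b)/sqrt 2. Nullity is F.F = 0, that is |e| = |b|
  and e.b = 0. Then \<open>l\<close> points along the time covector plus the unit vector of e x b,
  \<open>m\<close> along F, and \<open>n\<close> along the opposite null direction.\<close>

lemma null_two_form_decomposition:
  assumes st: "spacetime M g" "x \<in> M" and AT: "transpose (A x) = - A x" and A0: "A x \<noteq> 0"
    and null: "(\<Sum>a\<in>UNIV. \<Sum>b\<in>UNIV. \<Sum>c\<in>UNIV. \<Sum>d\<in>UNIV.
        complex_of_real (ginv g x $ a $ c) * complex_of_real (ginv g x $ b $ d)
        * selfdual g A x $ a $ b * selfdual g A x $ c $ d) = 0"
  obtains l n :: "real ^ 4" and m :: "complex ^ 4"
  where "selfdual g A x = wedge (cvec l) m"
    "null_tetrad (g x) 1 (cvec l) (cvec n) m (\<chi> a. cnj (m $ a))"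
proof -
  obtain E where E: "transpose E ** g x ** E = minkowski" "det E > 0"
    using oriented_frame[OF st] .
  define th where "th = matrix_inv E"
  have inv: "E ** th = mat 1" "th ** E = mat 1"
    using matrix_inv_right[of E] matrix_inv_left[of E] E(2) by (auto simp: invertible_det_nz th_def)
  have invT: "transpose th ** transpose E = mat 1" "transpose E ** transpose th = mat 1"
    using arg_cong[OF inv(1), of transpose] arg_cong[OF inv(2), of transpose]
    by (simp_all add: matrix_transpose_mul transpose_mat)
  have g: "g x = transpose th ** minkowski ** th"
    unfolding E(1)[symmetric] matrix_mul_assoc invT(1)
    by (simp add: matrix_mul_assoc[symmetric] inv(1))
  have mm: "minkowski ** minkowski = mat 1"
    by (simp add: vec_eq_iff matrix_matrix_mult_def mat_def minkowski_def sum4 if_distrib[of "\<lambda>z. z * _"] cong: if_cong)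
      (use exhaust4 in blast)
  have H: "ginv g x = E ** minkowski ** transpose E"
  proof -
    have "g x ** (E ** minkowski ** transpose E) =
        transpose th ** (minkowski ** (th ** E) ** minkowski) ** transpose E"
      unfolding g by (simp only: matrix_mul_assoc)
    also have "\<dots> = mat 1" by (simp add: inv mm invT)
    finally have "ginv g x ** (g x ** (E ** minkowski ** transpose E)) = ginv g x" by simp
    then show ?thesis by (simp add: matrix_mul_assoc ginv(2)[OF st])
  qed
  have detth: "det th = sqrt (- det (g x))"
  proof -
    have "det th * det E = 1" using arg_cong[OF inv(2), of det] by (simp add: det_mul)
    then have "det th > 0" using E(2) by (metis zero_less_mult_pos2 zero_less_one)
    moreover have "det (g x) = - (det th)\<^sup>2"
      unfolding g by (simp add: det_mul det_minkowski power2_eq_square)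
    ultimately show ?thesis by simp
  qed
  define Ah where "Ah = transpose E ** A x ** E"
  have A: "A x = transpose th ** Ah ** th"
    unfolding Ah_def matrix_mul_assoc invT(1) by (simp add: matrix_mul_assoc[symmetric] inv(1))
  have "transpose Ah = transpose E ** transpose (A x) ** E"
    unfolding Ah_def by (simp add: matrix_transpose_mul matrix_mul_assoc)
  also have "\<dots> = - Ah"
    unfolding Ah_def AT by (simp add: vec_eq_iff matrix_matrix_mult_def sum_negf)
  finally have anti0: "transpose Ah $ a $ b = (- Ah) $ a $ b" for a b by simp
  have anti: "Ah $ b $ a = - Ah $ a $ b" for a b
    using anti0[of a b] by (simp only: transpose_def vec_lambda_beta vector_uminus_component)
  define e1 e2 e3 b1 b2 b3 where eb_def: "e1 = Ah $ 0 $ 1" "e2 = Ah $ 0 $ 2" "e3 = Ah $ 0 $ 3"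
    "b1 = Ah $ 2 $ 3" "b2 = - Ah $ 1 $ 3" "b3 = Ah $ 1 $ 2"
  have "Ah $ a $ a = 0" for a using anti[of a a] by simp
  then have Ah: "Ah $ 0 $ 0 = 0" "Ah $ 1 $ 1 = 0" "Ah $ 2 $ 2 = 0" "Ah $ 3 $ 3 = 0"
    "Ah $ 0 $ 1 = e1" "Ah $ 0 $ 2 = e2" "Ah $ 0 $ 3 = e3" "Ah $ 2 $ 3 = b1" "Ah $ 1 $ 3 = - b2" "Ah $ 1 $ 2 = b3"
    "Ah $ 1 $ 0 = - e1" "Ah $ 2 $ 0 = - e2" "Ah $ 3 $ 0 = - e3" "Ah $ 3 $ 2 = - b1" "Ah $ 3 $ 1 = b2" "Ah $ 2 $ 1 = - b3"
    using anti[of 0 1] anti[of 0 2] anti[of 0 3] anti[of 2 3] anti[of 1 3] anti[of 1 2] by (simp_all add: eb_def)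
  define t where "t = (\<lambda>i::4. cvec (th $ i))"
  have rows: "rows4 (t 0) (t 1) (t 2) (t 3) = cmat th"
    by (simp add: vec_eq_iff rows4_def t_def) (use exhaust4 in blast)
  have vol: "complex_of_real (vol g x a b c d) = alt4 (t 0) (t 1) (t 2) (t 3) a b c d" for a b c d
    using levi_civita_det[of a b c d "t 0" "t 1" "t 2" "t 3"]
    by (simp add: rows det_cmat vol_def detth mult.commute)
  define B where "B = minkowski ** Ah ** minkowski"
  have B: "B $ i $ j = (if i = 0 then -1 else 1) * (if j = 0 then -1 else 1) * Ah $ i $ j" for i j
    unfolding B_def using exhaust4[of i] exhaust4[of j]
    by (auto simp: matrix_matrix_mult_def minkowski_def sum4)
  define U where "U = ginv g x ** A x ** transpose (ginv g x)"
  have "U = E ** (minkowski ** (transpose E ** transpose th) ** Ah ** (th ** E) ** minkowski) ** transpose E"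
    unfolding U_def ginv(4)[OF st] unfolding H A by (simp only: matrix_mul_assoc)
  then have U: "U = E ** B ** transpose E" by (simp add: inv invT B_def)
  have thU: "th ** U ** transpose th = B"
    unfolding U by (metis inv(2) invT(2) matrix_mul_assoc matrix_mul_lid matrix_mul_rid)
  have key: "(\<Sum>c\<in>UNIV. \<Sum>d\<in>UNIV. wedge (t i) (t j) $ c $ d * complex_of_real (U $ c $ d)) =
      complex_of_real (B $ i $ j - B $ j $ i)" for i j
  proof -
    have Bth: "B $ i $ j = (\<Sum>c\<in>UNIV. \<Sum>d\<in>UNIV. th $ i $ c * th $ j $ d * U $ c $ d)" for i j
      unfolding thU[symmetric] matrix_matrix_mult_def transpose_def vec_lambda_beta sum_distrib_right
      by (subst sum.swap) (intro sum.cong refl, simp add: mult_ac)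
    have "complex_of_real (B $ i $ j) = (\<Sum>c\<in>UNIV. \<Sum>d\<in>UNIV. t i $ c * t j $ d * complex_of_real (U $ c $ d))" for i j
      unfolding Bth t_def by simp
    then show ?thesis
      unfolding of_real_diff wedge_def
      by (simp only: sum_subtractf[symmetric] vec_lambda_beta) (intro sum.cong refl, simp add: algebra_simps)
  qed
  \<comment> \<open>The Hodge dual acts as (e, b) -> (b, -e).\<close>
  have hodge: "complex_of_real (hodge g A x $ a $ b) =
     b1 * wedge (t 0) (t 1) $ a $ b + b2 * wedge (t 0) (t 2) $ a $ b + b3 * wedge (t 0) (t 3) $ a $ b
   - e1 * wedge (t 2) (t 3) $ a $ b + e2 * wedge (t 1) (t 3) $ a $ b - e3 * wedge (t 1) (t 2) $ a $ b" for a b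
  proof -
    have "complex_of_real (hodge g A x $ a $ b) =
        (\<Sum>c\<in>UNIV. \<Sum>d\<in>UNIV. alt4 (t 0) (t 1) (t 2) (t 3) a b c d * complex_of_real (U $ c $ d)) / 2"
      by (simp add: hodge_def vol[symmetric] U_def)
    also have "(\<Sum>c\<in>UNIV. \<Sum>d\<in>UNIV. alt4 (t 0) (t 1) (t 2) (t 3) a b c d * complex_of_real (U $ c $ d)) =
       wedge (t 0) (t 1) $ a $ b * complex_of_real (B $ 2 $ 3 - B $ 3 $ 2)
     - wedge (t 0) (t 2) $ a $ b * complex_of_real (B $ 1 $ 3 - B $ 3 $ 1)
     + wedge (t 0) (t 3) $ a $ b * complex_of_real (B $ 1 $ 2 - B $ 2 $ 1)
     + wedge (t 1) (t 2) $ a $ b * complex_of_real (B $ 0 $ 3 - B $ 3 $ 0)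
     - wedge (t 1) (t 3) $ a $ b * complex_of_real (B $ 0 $ 2 - B $ 2 $ 0)
     + wedge (t 2) (t 3) $ a $ b * complex_of_real (B $ 0 $ 1 - B $ 1 $ 0)"
      unfolding key[symmetric] alt4_def sum_distrib_left sum.distrib[symmetric] sum_subtractf[symmetric]
      by (intro sum.cong refl) (simp add: algebra_simps)
    finally have h: "complex_of_real (hodge g A x $ a $ b) = \<dots> / 2" .
    show ?thesis unfolding h B Ah by (simp add: add_divide_distrib diff_divide_distrib)
  qed
  have A': "complex_of_real (A x $ a $ b) =
     e1 * wedge (t 0) (t 1) $ a $ b + e2 * wedge (t 0) (t 2) $ a $ b + e3 * wedge (t 0) (t 3) $ a $ b
   + b1 * wedge (t 2) (t 3) $ a $ b - b2 * wedge (t 1) (t 3) $ a $ b + b3 * wedge (t 1) (t 2) $ a $ b" for a b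
    unfolding A by (simp add: matrix_matrix_mult_def transpose_def sum4 Ah wedge_def t_def algebra_simps)
  define F1 F2 F3 where F_def: "F1 = (complex_of_real e1 - \<i> * complex_of_real b1) / complex_of_real (sqrt 2)"
    "F2 = (complex_of_real e2 - \<i> * complex_of_real b2) / complex_of_real (sqrt 2)"
    "F3 = (complex_of_real e3 - \<i> * complex_of_real b3) / complex_of_real (sqrt 2)"
  have S: "selfdual g A x $ a $ b =
     F1 * (wedge (t 0) (t 1) $ a $ b + \<i> * wedge (t 2) (t 3) $ a $ b)
   + F2 * (wedge (t 0) (t 2) $ a $ b - \<i> * wedge (t 1) (t 3) $ a $ b)
   + F3 * (wedge (t 0) (t 3) $ a $ b + \<i> * wedge (t 1) (t 2) $ a $ b)" for a b
    unfolding selfdual_def F_def by (simp add: hodge A' add_divide_distrib diff_divide_distrib algebra_simps)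
  define Sh :: "complex ^ 4 ^ 4" where "Sh = rows4 (rows4 0 F1 F2 F3) (rows4 (- F1) 0 (\<i> * F3) (- \<i> * F2))
    (rows4 (- F2) (- \<i> * F3) 0 (\<i> * F1)) (rows4 (- F3) (\<i> * F2) (- \<i> * F1) 0)"
  have S': "selfdual g A x = transpose (cmat th) ** Sh ** cmat th"
    by (simp add: vec_eq_iff S matrix_matrix_mult_def transpose_def sum4 Sh_def wedge_def t_def algebra_simps)
  have "cmat (ginv g x) ** selfdual g A x ** transpose (cmat (ginv g x)) =
     cmat E ** (cmat minkowski ** cmat (transpose E ** transpose th) ** Sh ** cmat (th ** E) ** cmat minkowski) ** transpose (cmat E)"
    unfolding S' cmat_transpose[symmetric] ginv(4)[OF st] unfolding H cmat_mult by (simp only: matrix_mul_assoc)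
  then have HS: "cmat (ginv g x) ** selfdual g A x ** transpose (cmat (ginv g x)) =
     cmat E ** (cmat minkowski ** Sh ** cmat minkowski) ** transpose (cmat E)"
    by (simp add: inv invT cmat_1)
  have "0 = (\<Sum>a\<in>UNIV. \<Sum>b\<in>UNIV. selfdual g A x $ a $ b *
      (cmat (ginv g x) ** selfdual g A x ** transpose (cmat (ginv g x))) $ a $ b)"
    unfolding null[symmetric] matrix_matrix_mult_def transpose_def
    by (intro sum.cong refl, simp add: sum_distrib_left sum_distrib_right, subst sum.swap)
       (simp add: mult_ac)
  also have "\<dots> = (\<Sum>a\<in>UNIV. \<Sum>b\<in>UNIV. Sh $ a $ b * (cmat minkowski ** Sh ** cmat minkowski) $ a $ b)"
    unfolding HS by (subst S', rule trace_frame) (simp add: cmat_mult[symmetric] inv cmat_1)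
  also have "\<dots> = - 4 * (F1 * F1 + F2 * F2 + F3 * F3)"
    by (simp add: sum4 matrix_matrix_mult_def Sh_def minkowski_def algebra_simps)
  finally have "0 = - 4 * (F1 * F1 + F2 * F2 + F3 * F3)" .
  moreover have "X = 0" if "0 = - 4 * X" for X :: complex using that by simp
  ultimately have FF: "F1 * F1 + F2 * F2 + F3 * F3 = 0" by blast
  have "F * F = complex_of_real ((e * e - b * b) / 2) - \<i> * complex_of_real (e * b)"
    if "F = (complex_of_real e - \<i> * complex_of_real b) / complex_of_real (sqrt 2)" for F e b
    unfolding that by (simp add: field_simps power2_eq_square[symmetric] flip: of_real_power of_real_mult)
      (simp add: complex_eq_iff power2_eq_square)
  from this[OF F_def(1)] this[OF F_def(2)] this[OF F_def(3)] FF
  have eb: "e1 * e1 + e2 * e2 + e3 * e3 = b1 * b1 + b2 * b2 + b3 * b3" "e1 * b1 + e2 * b2 + e3 * b3 = 0"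
    by (simp_all add: complex_eq_iff)
  define K where "K = e1 * e1 + e2 * e2 + e3 * e3"
  have K: "K > 0"
  proof (rule ccontr)
    assume "\<not> K > 0"
    moreover have "e1 * e1 \<ge> 0" "e2 * e2 \<ge> 0" "e3 * e3 \<ge> 0" "b1 * b1 \<ge> 0" "b2 * b2 \<ge> 0" "b3 * b3 \<ge> 0" by simp_all
    ultimately have "e1 * e1 = 0" "e2 * e2 = 0" "e3 * e3 = 0" "b1 * b1 = 0" "b2 * b2 = 0" "b3 * b3 = 0"
      using eb unfolding K_def by linarith+
    then have "e1 = 0" "e2 = 0" "e3 = 0" "b1 = 0" "b2 = 0" "b3 = 0" by simp_all
    then have "A x $ a $ b = 0" for a b using A'[of a b] by simp
    then show False using A0 by (simp add: vec_eq_iff)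
  qed
  define u1 u2 u3 where u_def: "u1 = (e2 * b3 - e3 * b2) / K" "u2 = (e3 * b1 - e1 * b3) / K" "u3 = (e1 * b2 - e2 * b1) / K"
  note o = orthonormal_triple[OF K_def eb(1)[folded K_def] K eb(2) u_def]
  define r where "r = sqrt K"
  have r: "r > 0" "r * r = K" using K by (simp_all add: r_def)
  define l n where ln_def: "l = r *\<^sub>R (th $ 0 + u1 *\<^sub>R th $ 1 + u2 *\<^sub>R th $ 2 + u3 *\<^sub>R th $ 3)"
    "n = (1 / (2 * r)) *\<^sub>R (th $ 0 - u1 *\<^sub>R th $ 1 - u2 *\<^sub>R th $ 2 - u3 *\<^sub>R th $ 3)"
  define m where "m = (\<chi> a. (F1 * t 1 $ a + F2 * t 2 $ a + F3 * t 3 $ a) / complex_of_real r)"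
  have uF: "u2 * F3 - u3 * F2 = \<i> * F1" "u3 * F1 - u1 * F3 = \<i> * F2" "u1 * F2 - u2 * F1 = \<i> * F3"
    using o(1-6) by (simp_all add: F_def complex_eq_iff field_simps)
  define rc where "rc = complex_of_real r"
  have rc: "rc \<noteq> 0" "rc * rc = complex_of_real K" using r by (simp_all add: rc_def flip: of_real_mult)
  define l' n' where l'_def: "l' = (\<lambda>a. t 0 $ a + u1 * t 1 $ a + u2 * t 2 $ a + u3 * t 3 $ a)"
    and n'_def: "n' = (\<lambda>a. t 0 $ a - u1 * t 1 $ a - u2 * t 2 $ a - u3 * t 3 $ a)"
  define m' where "m' = (\<lambda>a. F1 * t 1 $ a + F2 * t 2 $ a + F3 * t 3 $ a)"
  have l: "cvec l $ a = rc * l' a" for a by (simp add: ln_def l'_def t_def rc_def)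
  have n: "cvec n $ a = n' a / (2 * rc)" for a by (simp add: ln_def n'_def t_def rc_def)
  have m: "m $ a = m' a / rc" for a by (simp add: m_def m'_def rc_def)
  have tc: "cnj (t i $ a) = t i $ a" for i a by (simp add: t_def)
  have sd: "selfdual g A x = wedge (cvec l) m"
  proof -
    have "wedge (cvec l) m $ a $ b = l' a * m' b - l' b * m' a" for a b
      using rc by (simp add: wedge_def l m del: cvec_nth)
    moreover have "l' a * m' b - l' b * m' a =
        F1 * wedge (t 0) (t 1) $ a $ b + F2 * wedge (t 0) (t 2) $ a $ b + F3 * wedge (t 0) (t 3) $ a $ b
      + (u1 * F2 - u2 * F1) * wedge (t 1) (t 2) $ a $ b - (u3 * F1 - u1 * F3) * wedge (t 1) (t 3) $ a $ b
      + (u2 * F3 - u3 * F2) * wedge (t 2) (t 3) $ a $ b" for a b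
      by (simp add: l'_def m'_def wedge_def algebra_simps)
    ultimately show ?thesis unfolding uF by (simp add: vec_eq_iff S algebra_simps)
  qed
  have FF': "F * cnj F' + cnj F * F' = complex_of_real (e * e' + b * b')"
    "F * cnj F' - F' * cnj F = \<i> * complex_of_real (e * b' - e' * b)"
    if "F = (complex_of_real e - \<i> * complex_of_real b) / complex_of_real (sqrt 2)"
      "F' = (complex_of_real e' - \<i> * complex_of_real b') / complex_of_real (sqrt 2)" for F F' e e' b b'
    unfolding that by (simp_all add: complex_eq_iff field_simps)
  have gt: "complex_of_real (g x $ a $ b) = - t 0 $ a * t 0 $ b + t 1 $ a * t 1 $ b + t 2 $ a * t 2 $ b + t 3 $ a * t 3 $ b" for a b
    unfolding g by (simp add: matrix_matrix_mult_def transpose_def sum4 minkowski_def t_def)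
  have metric: "complex_of_real (g x $ a $ b) = - cvec l $ a * cvec n $ b - cvec n $ a * cvec l $ b
      + m $ a * cnj (m $ b) + cnj (m $ a) * m $ b" for a b
  proof -
    define d where "d = (\<lambda>e b e' b' u u'. complex_of_real (u * u' + (e * e' + b * b') / K))"
    have "- cvec l $ a * cvec n $ b - cvec n $ a * cvec l $ b = - (l' a * n' b + n' a * l' b) / 2"
      using rc by (simp add: l n field_simps del: cvec_nth)
    also have "\<dots> = - t 0 $ a * t 0 $ b + (u1 * t 1 $ a + u2 * t 2 $ a + u3 * t 3 $ a) * (u1 * t 1 $ b + u2 * t 2 $ b + u3 * t 3 $ b)"
      by (simp add: l'_def n'_def field_simps)
    finally have 1: "- cvec l $ a * cvec n $ b - cvec n $ a * cvec l $ b = \<dots>" .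
    have "m $ a * cnj (m $ b) + cnj (m $ a) * m $ b = (m' a * cnj (m' b) + cnj (m' a) * m' b) / complex_of_real K"
      by (simp add: m rc(2)[symmetric] add_divide_distrib rc_def)
    also have "m' a * cnj (m' b) + cnj (m' a) * m' b =
       (F1 * cnj F1 + cnj F1 * F1) * t 1 $ a * t 1 $ b + (F2 * cnj F2 + cnj F2 * F2) * t 2 $ a * t 2 $ b
     + (F3 * cnj F3 + cnj F3 * F3) * t 3 $ a * t 3 $ b
     + (F1 * cnj F2 + cnj F1 * F2) * (t 1 $ a * t 2 $ b + t 2 $ a * t 1 $ b)
     + (F1 * cnj F3 + cnj F1 * F3) * (t 1 $ a * t 3 $ b + t 3 $ a * t 1 $ b)
     + (F2 * cnj F3 + cnj F2 * F3) * (t 2 $ a * t 3 $ b + t 3 $ a * t 2 $ b)"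
      by (simp add: m'_def tc algebra_simps)
    also have "\<dots> = complex_of_real (e1 * e1 + b1 * b1) * t 1 $ a * t 1 $ b + complex_of_real (e2 * e2 + b2 * b2) * t 2 $ a * t 2 $ b
     + complex_of_real (e3 * e3 + b3 * b3) * t 3 $ a * t 3 $ b
     + complex_of_real (e1 * e2 + b1 * b2) * (t 1 $ a * t 2 $ b + t 2 $ a * t 1 $ b)
     + complex_of_real (e1 * e3 + b1 * b3) * (t 1 $ a * t 3 $ b + t 3 $ a * t 1 $ b)
     + complex_of_real (e2 * e3 + b2 * b3) * (t 2 $ a * t 3 $ b + t 3 $ a * t 2 $ b)"
      unfolding FF'(1)[OF F_def(1) F_def(1)] FF'(1)[OF F_def(2) F_def(2)] FF'(1)[OF F_def(3) F_def(3)]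
        FF'(1)[OF F_def(1) F_def(2)] FF'(1)[OF F_def(1) F_def(3)] FF'(1)[OF F_def(2) F_def(3)] ..
    finally have 2: "m $ a * cnj (m $ b) + cnj (m $ a) * m $ b = \<dots> / complex_of_real K" .
    have eq: "- cvec l $ a * cvec n $ b - cvec n $ a * cvec l $ b + m $ a * cnj (m $ b) + cnj (m $ a) * m $ b =
      - t 0 $ a * t 0 $ b + d e1 b1 e1 b1 u1 u1 * t 1 $ a * t 1 $ b + d e2 b2 e2 b2 u2 u2 * t 2 $ a * t 2 $ b
      + d e3 b3 e3 b3 u3 u3 * t 3 $ a * t 3 $ b
      + d e1 b1 e2 b2 u1 u2 * (t 1 $ a * t 2 $ b + t 2 $ a * t 1 $ b)
      + d e1 b1 e3 b3 u1 u3 * (t 1 $ a * t 3 $ b + t 3 $ a * t 1 $ b)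
      + d e2 b2 e3 b3 u2 u3 * (t 2 $ a * t 3 $ b + t 3 $ a * t 2 $ b)"
      unfolding add.assoc[of _ "m $ a * cnj (m $ b)"] 1 2 d_def
      by (simp add: add_divide_distrib algebra_simps)
    show ?thesis unfolding gt eq d_def o by simp
  qed
  \<comment> \<open>The tetrad in terms of the coframe. Its determinant reduces to the triple
    product of u, e, b, which makes it -i and proves the orientation condition.\<close>
  define Lh :: "complex ^ 4 ^ 4" where
    "Lh = rows4 (rows4 rc (rc * u1) (rc * u2) (rc * u3)) (rows4 (1 / (2 * rc)) (- u1 / (2 * rc)) (- u2 / (2 * rc)) (- u3 / (2 * rc)))
      (rows4 0 (F1 / rc) (F2 / rc) (F3 / rc)) (rows4 0 (cnj F1 / rc) (cnj F2 / rc) (cnj F3 / rc))"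
  have "rows4 (cvec l) (cvec n) m (\<chi> a. cnj (m $ a)) $ i = (Lh ** cmat th) $ i" for i
  proof -
    have "cnj rc = rc" by (simp add: rc_def)
    then show ?thesis using exhaust4[of i] rc
      by (auto simp: vec_eq_iff matrix_matrix_mult_def sum4 l n m l'_def n'_def m'_def t_def Lh_def field_simps
        simp del: cvec_nth) (auto simp: field_simps)
  qed
  then have "rows4 (cvec l) (cvec n) m (\<chi> a. cnj (m $ a)) = Lh ** cmat th" by (simp add: vec_eq_iff)
  then have "det (rows4 (cvec l) (cvec n) m (\<chi> a. cnj (m $ a))) = det Lh * complex_of_real (sqrt (- det (g x)))"
    by (simp add: det_mul det_cmat detth)
  moreover have "det Lh = - \<i>"
  proof -
    have "det Lh = - (u1 * (F2 * cnj F3 - F3 * cnj F2) - u2 * (F1 * cnj F3 - F3 * cnj F1)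
        + u3 * (F1 * cnj F2 - F2 * cnj F1)) / (rc * rc)"
      using rc(1) by (simp add: det4 Lh_def field_simps)
    also have "\<dots> = - \<i> * complex_of_real ((u1 * (e2 * b3 - e3 * b2) + u2 * (e3 * b1 - e1 * b3) + u3 * (e1 * b2 - e2 * b1)) / K)"
      unfolding FF'(2)[OF F_def(2,3)] FF'(2)[OF F_def(1,3)] FF'(2)[OF F_def(1,2)] rc(2)
      using K by (simp add: field_simps)
    also have "\<dots> = - \<i>" unfolding o using K by simp
    finally show ?thesis .
  qed
  ultimately have "null_tetrad (g x) 1 (cvec l) (cvec n) m (\<chi> a. cnj (m $ a))"
    unfolding null_tetrad_def using metric by simp
  with sd show thesis by (rule that)
qed

section \<open>Covariant derivatives\<close>

text \<open>\<open>nabla1\<close> is restricted to real 1-forms; the frame contains complex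
  ones.\<close>

definition nab ::
  "(real ^ 4 \<Rightarrow> real ^ 4 ^ 4) \<Rightarrow> (real ^ 4 \<Rightarrow> 'b::real_normed_vector ^ 4) \<Rightarrow> real ^ 4 \<Rightarrow> 4 \<Rightarrow> 4 \<Rightarrow> 'b"
  where
  "nab g Z x a b = pd a (\<lambda>y. Z y $ b) x - (\<Sum>k\<in>UNIV. christoffel g k a b x *\<^sub>R Z x $ k)"

lemma nabla1_eq_nab: "nabla1 = nab"
  by (simp add: fun_eq_iff nabla1_def nab_def)

definition vcnj :: "complex ^ 4 \<Rightarrow> complex ^ 4" where
  "vcnj v = (\<chi> a. cnj (v $ a))"

lemma vcnj_nth [simp]: "vcnj v $ a = cnj (v $ a)"
  by (simp add: vcnj_def)

lemma spacetime_open: "spacetime M g \<Longrightarrow> open M"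
  by (simp add: spacetime_def)

lemma spacetime_smooth: "spacetime M g \<Longrightarrow> smooth_on M (\<lambda>x. g x $ a $ b)"
  by (intro smooth_on_nth) (auto simp: spacetime_def)

lemma spacetime_subset: "spacetime M g \<Longrightarrow> open U \<Longrightarrow> U \<subseteq> M \<Longrightarrow> spacetime U g"
  using smooth_on_subset[of M g U] by (auto simp: spacetime_def)

lemma spacetime_sym: "spacetime M g \<Longrightarrow> x \<in> M \<Longrightarrow> g x $ a $ b = g x $ b $ a"
  using arg_cong[OF ginv(3), of M g x "\<lambda>m. m $ b $ a"] by (simp add: transpose_def)

lemma smooth_on_ginv: "spacetime M g \<Longrightarrow> smooth_on M (\<lambda>x. ginv g x $ a $ b)"
  unfolding ginv_def using spacetime_det
  by (intro smooth_on_nth smooth_on_matrix_inv) (force simp: spacetime_def)+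

lemma smooth_on_christoffel: "spacetime M g \<Longrightarrow> smooth_on M (christoffel g c a b)"
  unfolding christoffel_def
  by (intro smooth_on_divide smooth_on_sum smooth_on_mult smooth_on_ginv smooth_on_add
      smooth_on_diff smooth_on_pd spacetime_smooth smooth_on_const) (auto intro: spacetime_open)

lemma christoffel_sym:
  assumes "spacetime M g" "x \<in> M"
  shows "christoffel g c a b x = christoffel g c b a x"
proof -
  have "pd d (\<lambda>y. g y $ a $ b) x = pd d (\<lambda>y. g y $ b $ a) x" for d
    by (rule pd_cong[OF spacetime_open[OF assms(1)] assms(2) spacetime_sym[OF assms(1)]])
  then show ?thesis unfolding christoffel_def by (simp add: add.commute)
qed

text \<open>Lowering the upper index turns each sum into a Christoffel symbol of the first kind; in
  the sum of the two all derivatives but one cancel.\<close>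

lemma metric_compatible:
  assumes "spacetime M g" "x \<in> M"
  shows "pd a (\<lambda>y. g y $ b $ c) x =
    (\<Sum>k\<in>UNIV. christoffel g k a b x * g x $ k $ c) + (\<Sum>k\<in>UNIV. christoffel g k a c x * g x $ b $ k)"
proof -
  have sym: "pd d (\<lambda>y. g y $ a $ b) x = pd d (\<lambda>y. g y $ b $ a) x" for d a b
    by (rule pd_cong[OF spacetime_open[OF assms(1)] assms(2) spacetime_sym[OF assms(1)]])
  define P where "P = (\<lambda>a b d. pd a (\<lambda>y. g y $ b $ d) x + pd b (\<lambda>y. g y $ a $ d) x - pd d (\<lambda>y. g y $ a $ b) x)"
  have low: "(\<Sum>k\<in>UNIV. christoffel g k a b x * g x $ k $ c) = P a b c / 2" for a b c
  proof -
    have "(\<Sum>k\<in>UNIV. ginv g x $ k $ d * g x $ k $ c) = (g x ** ginv g x) $ c $ d" for d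
      unfolding matrix_matrix_mult_def vec_lambda_beta
      by (intro sum.cong refl) (subst spacetime_sym[OF assms], simp add: mult.commute)
    then have *: "(\<Sum>k\<in>UNIV. ginv g x $ k $ d * g x $ k $ c) = (if c = d then 1 else 0)" for d
      by (simp add: ginv(1)[OF assms] mat_def)
    have "(\<Sum>k\<in>UNIV. christoffel g k a b x * g x $ k $ c) =
        (\<Sum>k\<in>UNIV. \<Sum>d\<in>UNIV. ginv g x $ k $ d * g x $ k $ c * P a b d) / 2"
      unfolding christoffel_def P_def sum_divide_distrib sum_distrib_right
      by (intro sum.cong refl) (simp add: sum_distrib_right)
    also have "(\<Sum>k\<in>UNIV. \<Sum>d\<in>UNIV. ginv g x $ k $ d * g x $ k $ c * P a b d) =
        (\<Sum>d\<in>UNIV. (\<Sum>k\<in>UNIV. ginv g x $ k $ d * g x $ k $ c) * P a b d)"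
      unfolding sum_distrib_right by (rule sum.swap)
    also have "\<dots> = P a b c" unfolding * by (simp add: if_distrib[of "\<lambda>z. z * _"] cong: if_cong)
    finally show ?thesis .
  qed
  have "(\<Sum>k\<in>UNIV. christoffel g k a c x * g x $ b $ k) = (\<Sum>k\<in>UNIV. christoffel g k a c x * g x $ k $ b)"
    by (intro sum.cong refl) (subst spacetime_sym[OF assms], simp)
  then have e: "(\<Sum>k\<in>UNIV. christoffel g k a c x * g x $ b $ k) = P a c b / 2" using low by simp
  show ?thesis unfolding e low P_def using sym[of a c b] by (simp add: field_simps)
qed

lemma nab_antisym:
  assumes "spacetime M g" "x \<in> M"
  shows "nab g Z x a b - nab g Z x b a = pd a (\<lambda>y. Z y $ b) x - pd b (\<lambda>y. Z y $ a) x"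
  unfolding nab_def by (simp add: christoffel_sym[OF assms, of _ a b])

lemma nab_cvec:
  assumes "\<And>b. (\<lambda>y. l y $ b) differentiable at x"
  shows "nab g (\<lambda>y. cvec (l y)) x a b = complex_of_real (nab g l x a b)"
  unfolding nab_def by (simp add: pd_of_real assms scaleR_conv_of_real)

lemma nab_vcnj:
  assumes "\<And>b. (\<lambda>y. Z y $ b) differentiable at x"
  shows "nab g (\<lambda>y. vcnj (Z y)) x a b = cnj (nab g Z x a b)"
  unfolding nab_def by (simp add: pd_cnj assms)

lemma nab_cong:
  assumes "open V" "x \<in> V" "\<And>y b. y \<in> V \<Longrightarrow> Z y $ b = Z' y $ b"
  shows "nab g Z x a b = nab g Z' x a b"
  unfolding nab_def using pd_cong[OF assms(1,2), of "\<lambda>y. Z y $ b" "\<lambda>y. Z' y $ b"] assms by simp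

lemma nab_scale:
  fixes Z :: "real ^ 4 \<Rightarrow> complex ^ 4"
  assumes "\<And>b. (\<lambda>y. Z y $ b) differentiable at x"
  shows "nab g (\<lambda>y. c *s Z y) x a b = c * nab g Z x a b"
  unfolding nab_def
  by (simp add: pd_bounded_linear[OF bounded_linear_mult_right] assms right_diff_distrib sum_distrib_left)

text \<open>The Leibniz rule for h S = p \<and> q. The factor \<open>h\<close> stays on the left
  since the application is s* S = l \<and> Z, where dividing by s* would bring in derivatives of a
  quotient.\<close>

lemma nabla2_wedge:
  fixes h :: "real ^ 4 \<Rightarrow> complex" and S :: "real ^ 4 \<Rightarrow> complex ^ 4 ^ 4"
  assumes V: "open V" "x \<in> V" "\<And>y b c. y \<in> V \<Longrightarrow> h y * S y $ b $ c = wedge (p y) (q y) $ b $ c"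
    and d: "h differentiable at x" "\<And>b c. (\<lambda>y. S y $ b $ c) differentiable at x"
      "\<And>b. (\<lambda>y. p y $ b) differentiable at x" "\<And>b. (\<lambda>y. q y $ b) differentiable at x"
  shows "h x * nabla2 g S x a b c + pd a h x * S x $ b $ c =
    nab g p x a b * q x $ c + p x $ b * nab g q x a c - nab g p x a c * q x $ b - p x $ c * nab g q x a b"
proof -
  have "pd a (\<lambda>y. h y * S y $ b $ c) x = pd a (\<lambda>y. p y $ b * q y $ c - p y $ c * q y $ b) x"
    by (rule pd_cong[OF V(1,2)]) (simp add: V(3) wedge_def)
  then have 1: "h x * pd a (\<lambda>y. S y $ b $ c) x + pd a h x * S x $ b $ c =
      p x $ b * pd a (\<lambda>y. q y $ c) x + pd a (\<lambda>y. p y $ b) x * q x $ c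
      - (p x $ c * pd a (\<lambda>y. q y $ b) x + pd a (\<lambda>y. p y $ c) x * q x $ b)"
    by (simp add: pd_mult pd_diff d differentiable_mult)
  have 2: "h x * S x $ b $ c = p x $ b * q x $ c - p x $ c * q x $ b" for b c
    using V(3)[OF V(2)] by (simp add: wedge_def)
  have 3: "h x * (\<Sum>k\<in>UNIV. christoffel g k a b x *\<^sub>R S x $ k $ c) =
      (\<Sum>k\<in>UNIV. christoffel g k a b x *\<^sub>R p x $ k) * q x $ c - p x $ c * (\<Sum>k\<in>UNIV. christoffel g k a b x *\<^sub>R q x $ k)"
    "h x * (\<Sum>k\<in>UNIV. christoffel g k a c x *\<^sub>R S x $ b $ k) =
      p x $ b * (\<Sum>k\<in>UNIV. christoffel g k a c x *\<^sub>R q x $ k) - (\<Sum>k\<in>UNIV. christoffel g k a c x *\<^sub>R p x $ k) * q x $ b"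
    unfolding sum_distrib_left sum_distrib_right sum_subtractf[symmetric]
    by (intro sum.cong refl, simp only: mult_scaleR_right 2, simp add: scaleR_conv_of_real algebra_simps)+
  have "h x * nabla2 g S x a b c + pd a h x * S x $ b $ c =
      (h x * pd a (\<lambda>y. S y $ b $ c) x + pd a h x * S x $ b $ c)
      - h x * (\<Sum>k\<in>UNIV. christoffel g k a b x *\<^sub>R S x $ k $ c)
      - h x * (\<Sum>k\<in>UNIV. christoffel g k a c x *\<^sub>R S x $ b $ k)"
    unfolding nabla2_def by (simp add: algebra_simps)
  also have "\<dots> = nab g p x a b * q x $ c + p x $ b * nab g q x a c - nab g p x a c * q x $ b - p x $ c * nab g q x a b"
    unfolding 1 3 nab_def by (simp add: algebra_simps)
  finally show ?thesis .
qed

section \<open>Regularity of the self-dual part and its codifferential\<close>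

lemma smooth_on_hodge:
  assumes "spacetime M g" "smooth_on M A"
  shows "smooth_on M (\<lambda>x. hodge g A x $ a $ b)"
proof -
  have o: "open M" using assms(1) by (rule spacetime_open)
  have "(ginv g x ** A x ** transpose (ginv g x)) $ c $ d =
      (\<Sum>k\<in>UNIV. (\<Sum>j\<in>UNIV. ginv g x $ c $ j * A x $ j $ k) * ginv g x $ d $ k)" for x c d
    by (simp add: matrix_matrix_mult_def transpose_def)
  then have "(\<lambda>x. hodge g A x $ a $ b) = (\<lambda>x. (\<Sum>c\<in>UNIV. \<Sum>d\<in>UNIV.
     sqrt (- det (g x)) * levi_civita a b c d *
      (\<Sum>k\<in>UNIV. (\<Sum>j\<in>UNIV. ginv g x $ c $ j * A x $ j $ k) * ginv g x $ d $ k)) / 2)"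
    by (simp add: hodge_def vol_def fun_eq_iff)
  moreover have "smooth_on M (\<lambda>x. (\<Sum>c\<in>UNIV. \<Sum>d\<in>UNIV.
     sqrt (- det (g x)) * levi_civita a b c d *
      (\<Sum>k\<in>UNIV. (\<Sum>j\<in>UNIV. ginv g x $ c $ j * A x $ j $ k) * ginv g x $ d $ k)) / 2)"
    using assms spacetime_det[OF assms(1)]
    by (intro smooth_on_divide smooth_on_sum smooth_on_mult smooth_on_const smooth_on_sqrt o
        smooth_on_minus smooth_on_det smooth_on_ginv smooth_on_nth[OF o smooth_on_nth[OF o assms(2)]])
       (auto simp: spacetime_def)
  ultimately show ?thesis by simp
qed

lemma smooth_on_selfdual:
  assumes "spacetime M g" "smooth_on M A"
  shows "smooth_on M (\<lambda>x. selfdual g A x $ a $ b)"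
  unfolding selfdual_def vec_lambda_beta
  using spacetime_open[OF assms(1)]
  by (intro smooth_on_divide smooth_on_diff smooth_on_mult smooth_on_const smooth_on_of_real
      smooth_on_hodge assms smooth_on_nth) auto

lemma smooth_on_codiff:
  fixes T :: "real ^ 4 \<Rightarrow> 'b::real_normed_vector ^ 4 ^ 4"
  assumes "spacetime M g" "\<And>a b. smooth_on M (\<lambda>x. T x $ a $ b)"
  shows "smooth_on M (\<lambda>x. codiff g T x $ c)"
  unfolding codiff_def nabla2_def vec_lambda_beta
  by (intro smooth_on_minus smooth_on_sum smooth_on_scaleR smooth_on_diff smooth_on_ginv[OF assms(1)]
      smooth_on_pd assms smooth_on_christoffel[OF assms(1)] spacetime_open[OF assms(1)])

lemma pd_real_imaginary:
  fixes u v :: "real ^ 4 \<Rightarrow> real"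
  assumes "u differentiable at x" "v differentiable at x"
  shows "pd a (\<lambda>y. (complex_of_real (u y) - \<i> * complex_of_real (v y)) / complex_of_real (sqrt 2)) x =
    (complex_of_real (pd a u x) - \<i> * complex_of_real (pd a v x)) / complex_of_real (sqrt 2)"
proof -
  have L: "bounded_linear (\<lambda>z. (complex_of_real (fst z) - \<i> * complex_of_real (snd z)) / complex_of_real (sqrt 2))"
    by (intro linear_conv_bounded_linear[THEN iffD1] linearI)
       (simp_all add: add_divide_distrib diff_divide_distrib scaleR_conv_of_real algebra_simps)
  have "((\<lambda>y. (u y, v y)) has_derivative
      (\<lambda>w. (frechet_derivative u (at x) w, frechet_derivative v (at x) w))) (at x)"
    using assms frechet_derivative_works by (intro has_derivative_Pair) blast+
  from pd_eqI[OF bounded_linear.has_derivative[OF L this]]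
  show ?thesis by (simp add: pd_def)
qed

text \<open>The two codifferentials whose Killing property is assumed are the real and, up to sign,
  the imaginary part of one complex 1-form, apart from a factor sqrt 2.\<close>

lemma codiff_selfdual:
  assumes "spacetime M g" "smooth_on M A" "x \<in> M"
  shows "codiff g (selfdual g A) x $ c =
    (complex_of_real (codiff g A x $ c) - \<i> * complex_of_real (codiff g (hodge g A) x $ c)) / complex_of_real (sqrt 2)"
proof -
  have o: "open M" using assms(1) by (rule spacetime_open)
  have d: "(\<lambda>y. A y $ a $ b) differentiable at x" "(\<lambda>y. hodge g A y $ a $ b) differentiable at x" for a b
    using smooth_on_differentiable[OF smooth_on_nth[OF o smooth_on_nth[OF o assms(2)]] assms(3)]
      smooth_on_differentiable[OF smooth_on_hodge[OF assms(1,2)] assms(3)] by auto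
  have pd: "pd a (\<lambda>y. selfdual g A y $ b $ c) x =
      (complex_of_real (pd a (\<lambda>y. A y $ b $ c) x) - \<i> * complex_of_real (pd a (\<lambda>y. hodge g A y $ b $ c) x)) / complex_of_real (sqrt 2)" for a b c
    unfolding selfdual_def vec_lambda_beta by (rule pd_real_imaginary[OF d])
  have n: "nabla2 g (selfdual g A) x a b c =
      (complex_of_real (nabla2 g A x a b c) - \<i> * complex_of_real (nabla2 g (hodge g A) x a b c)) / complex_of_real (sqrt 2)" for a b c
    unfolding nabla2_def pd
    by (simp add: selfdual_def sum4 scaleR_conv_of_real add_divide_distrib diff_divide_distrib algebra_simps)
  show ?thesis unfolding codiff_def vec_lambda_beta n scaleR_conv_of_real sum4
    by (simp add: algebra_simps add_divide_distrib diff_divide_distrib)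
qed

context tetrad_at
begin

lemma up_wedge: "(\<Sum>b\<in>UNIV. \<Sum>c\<in>UNIV. up p b * up q c * (r $ b * t $ c - r $ c * t $ b)) =
    cinner g x r p * cinner g x t q - cinner g x t p * cinner g x r q"
proof -
  have "(\<Sum>b\<in>UNIV. \<Sum>c\<in>UNIV. up p b * up q c * (r $ b * t $ c - r $ c * t $ b)) =
    (\<Sum>b\<in>UNIV. \<Sum>c\<in>UNIV. (up p b * r $ b) * (up q c * t $ c)) -
    (\<Sum>b\<in>UNIV. \<Sum>c\<in>UNIV. (up p b * t $ b) * (up q c * r $ c))"
    unfolding sum_subtractf[symmetric] by (intro sum.cong refl) (simp add: algebra_simps)
  then show ?thesis unfolding sum_product[symmetric] up by simp
qed

lemma up_wedge': "(\<Sum>b\<in>UNIV. \<Sum>c\<in>UNIV. up p b * up q c * wedge r t $ b $ c) =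
    cinner g x r p * cinner g x t q - cinner g x t p * cinner g x r q"
  using up_wedge[of p q r t] by (simp add: wedge_def)

text \<open>\<open>calG\<close> projects onto self-dual two-forms, and l \<and> z is self-dual: the
  metric half and the volume half of \<open>calG\<close> contribute equally. This forces the
  codifferential to be orthogonal to \<open>l\<close> and \<open>z\<close>.\<close>

lemma calG_null_contract:
  "(\<Sum>b\<in>UNIV. \<Sum>c\<in>UNIV. up l b * up z c * (\<Sum>m\<in>UNIV. up p m * calG g x m a b c)) =
    cinner g x l p * z $ a - cinner g x z p * l $ a"
proof -
  have g1: "(\<Sum>b\<in>UNIV. \<Sum>c\<in>UNIV. up l b * up z c * (p $ b * complex_of_real (g x $ a $ c))) = cinner g x l p * z $ a"
  proof -
    have "(\<Sum>b\<in>UNIV. \<Sum>c\<in>UNIV. up l b * up z c * (p $ b * complex_of_real (g x $ a $ c))) =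
        (\<Sum>b\<in>UNIV. up l b * p $ b) * (\<Sum>c\<in>UNIV. up z c * complex_of_real (g x $ c $ a))"
      unfolding sum_product by (intro sum.cong refl) (simp add: mult_ac metric)
    then show ?thesis by (simp add: up up_metric cinner_sym[of p])
  qed
  have g2: "(\<Sum>b\<in>UNIV. \<Sum>c\<in>UNIV. up l b * up z c * (p $ c * complex_of_real (g x $ a $ b))) = cinner g x z p * l $ a"
  proof -
    have "(\<Sum>b\<in>UNIV. \<Sum>c\<in>UNIV. up l b * up z c * (p $ c * complex_of_real (g x $ a $ b))) =
        (\<Sum>b\<in>UNIV. up l b * complex_of_real (g x $ b $ a)) * (\<Sum>c\<in>UNIV. up z c * p $ c)"
      unfolding sum_product by (intro sum.cong refl) (simp add: mult_ac metric)
    then show ?thesis by (simp add: up up_metric cinner_sym[of p])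
  qed
  define W where "W = (\<lambda>r t. \<Sum>b\<in>UNIV. \<Sum>c\<in>UNIV. up l b * up z c * wedge r t $ b $ c)"
  have W: "W r t = cinner g x r l * cinner g x t z - cinner g x t l * cinner g x r z" for r t
    unfolding W_def by (rule up_wedge')
  have "(\<Sum>b\<in>UNIV. \<Sum>c\<in>UNIV. up l b * up z c * (\<Sum>m\<in>UNIV. up p m * alt4 l n z w m a b c)) =
      cinner g x l p * (n $ a * W z w - z $ a * W n w + w $ a * W n z)
  - cinner g x n p * (l $ a * W z w - z $ a * W l w + w $ a * W l z)
  + cinner g x z p * (l $ a * W n w - n $ a * W l w + w $ a * W l n)
  - cinner g x w p * (l $ a * W n z - n $ a * W l z + z $ a * W l n)"
    unfolding alt4_contract W_def sum_distrib_left sum.distrib[symmetric] sum_subtractf[symmetric]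
    by (intro sum.cong refl) (simp add: algebra_simps)
  also have "\<dots> = N\<^sup>2 * (cinner g x l p * z $ a - cinner g x z p * l $ a)"
    unfolding W by (simp add: cinner_tetrad power2_eq_square algebra_simps)
  finally have a: "(\<Sum>b\<in>UNIV. \<Sum>c\<in>UNIV. up l b * up z c * (\<Sum>m\<in>UNIV. up p m * alt4 l n z w m a b c)) = \<dots>" .
  have split: "(\<Sum>b\<in>UNIV. \<Sum>c\<in>UNIV. up l b * up z c * ((f1 b c - f2 b c + f3 b c / N\<^sup>2) / 2)) =
    ((\<Sum>b\<in>UNIV. \<Sum>c\<in>UNIV. up l b * up z c * f1 b c) - (\<Sum>b\<in>UNIV. \<Sum>c\<in>UNIV. up l b * up z c * f2 b c)
      + (\<Sum>b\<in>UNIV. \<Sum>c\<in>UNIV. up l b * up z c * f3 b c) / N\<^sup>2) / 2" for f1 f2 f3 :: "4 \<Rightarrow> 4 \<Rightarrow> complex"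
    unfolding sum_divide_distrib sum.distrib[symmetric] sum_subtractf[symmetric]
    by (intro sum.cong refl) (simp add: add_divide_distrib diff_divide_distrib algebra_simps)
  have "(\<Sum>b\<in>UNIV. \<Sum>c\<in>UNIV. up l b * up z c * (\<Sum>m\<in>UNIV. up p m * calG g x m a b c)) =
    ((\<Sum>b\<in>UNIV. \<Sum>c\<in>UNIV. up l b * up z c * (p $ b * complex_of_real (g x $ a $ c)))
   - (\<Sum>b\<in>UNIV. \<Sum>c\<in>UNIV. up l b * up z c * (p $ c * complex_of_real (g x $ a $ b)))
   + (\<Sum>b\<in>UNIV. \<Sum>c\<in>UNIV. up l b * up z c * (\<Sum>m\<in>UNIV. up p m * alt4 l n z w m a b c)) / N\<^sup>2) / 2"
    unfolding calG_contract split ..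
  also have "\<dots> = cinner g x l p * z $ a - cinner g x z p * l $ a"
    unfolding g1 g2 a using N by simp
  finally show ?thesis .
qed

text \<open>The right side of the CKY equation, once the codifferential is known to be a multiple of
  \<open>z\<close>, written in the self-dual two-forms of the tetrad.\<close>

lemma calG_z:
  "(\<Sum>m\<in>UNIV. up z m * calG g x m a b c) =
    (2 * n $ a * wedge l z $ b $ c + z $ a * (wedge z w $ b $ c - wedge l n $ b $ c)) / (2 * N)"
  unfolding calG_contract alt4_contract metric using N
  by (simp add: cinner_tetrad wedge_def field_simps power2_eq_square)

end

lemma cinner_combine:
  "cinner g x (\<chi> b. \<alpha> * p $ b + \<beta> * q $ b) r = \<alpha> * cinner g x p r + \<beta> * cinner g x q r"
  "cinner g x r (\<chi> b. \<alpha> * p $ b + \<beta> * q $ b) = \<alpha> * cinner g x r p + \<beta> * cinner g x r q"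
  unfolding cinner_def sum_distrib_left sum.distrib[symmetric]
  by (intro sum.cong refl, simp add: algebra_simps)+

lemma cinner_scale:
  "cinner g x (\<alpha> *s p) r = \<alpha> * cinner g x p r" "cinner g x r (\<alpha> *s p) = \<alpha> * cinner g x r p"
  unfolding cinner_def sum_distrib_left by (intro sum.cong refl, simp add: mult_ac)+

lemma (in tetrad_at) wedge_sharp:
  "(\<Sum>c\<in>UNIV. wedge p q $ b $ c * up r c) = p $ b * cinner g x q r - q $ b * cinner g x p r"
proof -
  have "(\<Sum>c\<in>UNIV. wedge p q $ b $ c * up r c) =
      p $ b * (\<Sum>c\<in>UNIV. q $ c * up r c) - q $ b * (\<Sum>c\<in>UNIV. p $ c * up r c)"
    unfolding sum_distrib_left sum_subtractf[symmetric]
    by (intro sum.cong refl) (simp add: wedge_def algebra_simps)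
  then show ?thesis by (simp add: up)
qed

lemma smooth_on_sharp:
  assumes "spacetime M g" "U \<subseteq> M" "open U" "\<And>b. smooth_on U (\<lambda>x. p x $ b)"
  shows "smooth_on U (\<lambda>x. sharp g x (p x) a)"
  unfolding sharp_def
  by (intro smooth_on_sum smooth_on_mult smooth_on_of_real assms smooth_on_subset[OF smooth_on_ginv[OF assms(1)] assms(2)])

lemma smooth_on_cinner:
  assumes "spacetime M g" "U \<subseteq> M" "open U" "\<And>b. smooth_on U (\<lambda>x. p x $ b)" "\<And>b. smooth_on U (\<lambda>x. q x $ b)"
  shows "smooth_on U (\<lambda>x. cinner g x (p x) (q x))"
  unfolding cinner_def
  by (intro smooth_on_sum smooth_on_mult smooth_on_of_real assms smooth_on_subset[OF smooth_on_ginv[OF assms(1)] assms(2)])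

section \<open>The spinor frame of a null conformal Killing-Yano tensor\<close>

text \<open>
  In spinor language the self-dual form is \<open>\<kappa>\<^sub>A \<kappa>\<^sub>B \<epsilon>\<^sub>A\<^sub>'\<^sub>B\<^sub>'\<close> with
  \<open>\<nabla>\<^sub>A\<^sub>A\<^sub>' \<kappa>\<^sub>B = \<epsilon>\<^sub>A\<^sub>B \<pi>\<^sub>A\<^sub>'\<close> and
  \<open>\<nabla>\<^sub>A\<^sub>A\<^sub>' \<pi>\<^sub>B\<^sub>' = lam \<epsilon>\<^sub>A\<^sub>'\<^sub>B\<^sub>' \<kappa>\<^sub>A\<close>. With \<open>\<tau>\<close> the conjugate of \<open>\<pi>\<close>, the 1-forms
  are \<open>l = \<kappa> \<kappa>*\<close>, \<open>Z = \<kappa> \<pi>\<close>, \<open>n = \<tau> \<pi>\<close>, and \<open>s = \<kappa>\<^sub>A \<tau>\<^sup>A\<close>.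
\<close>

locale spinor_frame =
  fixes U :: "(real ^ 4) set" and g :: "real ^ 4 \<Rightarrow> real ^ 4 ^ 4"
    and l n :: "real ^ 4 \<Rightarrow> real ^ 4" and Z :: "real ^ 4 \<Rightarrow> complex ^ 4"
    and s :: "real ^ 4 \<Rightarrow> complex" and lam :: "real ^ 4 \<Rightarrow> real"
  assumes st: "spacetime U g"
    and smooth: "smooth_on U l" "smooth_on U n" "smooth_on U Z" "smooth_on U s" "smooth_on U lam"
    and tet: "x \<in> U \<Longrightarrow> null_tetrad (g x) (s x * cnj (s x)) (cvec (l x)) (cvec (n x)) (Z x) (vcnj (Z x))"
    and nab_l: "x \<in> U \<Longrightarrow> complex_of_real (nab g l x a b) =
      (Z x $ a * cnj (Z x $ b) - cvec (n x) $ a * cvec (l x) $ b) / s x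
      + (cnj (Z x $ a) * Z x $ b - cvec (n x) $ a * cvec (l x) $ b) / cnj (s x)"
    and nab_Z: "x \<in> U \<Longrightarrow> nab g Z x a b =
      (Z x $ a * cvec (n x) $ b - cvec (n x) $ a * Z x $ b) / s x
      + lam x * (cvec (l x) $ a * Z x $ b - Z x $ a * cvec (l x) $ b) / cnj (s x)"
    and nab_n: "x \<in> U \<Longrightarrow> complex_of_real (nab g n x a b) =
      lam x * ((cvec (l x) $ a * cvec (n x) $ b - cnj (Z x $ a) * Z x $ b) / s x
      + (cvec (l x) $ a * cvec (n x) $ b - Z x $ a * cnj (Z x $ b)) / cnj (s x))"
    and ds: "x \<in> U \<Longrightarrow> pd a s x = - cvec (n x) $ a + lam x * cvec (l x) $ a"
    and dlam: "x \<in> U \<Longrightarrow> \<exists>c. \<forall>a. pd a lam x = c * l x $ a"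

text \<open>A null rotation about \<open>l\<close> combined with a scaling of \<open>z\<close>. Once
  \<open>Z\<close> is prescribed, the metric leaves only this \<open>n'\<close>. The sign \<sigma>
  is shared by \<open>l'\<close> and \<open>n'\<close>, so it cancels in the metric and in the
  determinant.\<close>

lemma (in tetrad_at) null_rotation:
  fixes l' :: "real ^ 4" and \<sigma> :: real and \<gamma> \<delta> :: complex
  assumes "N = 1" "w = vcnj z" "l = cvec lr" "n = cvec nr" "\<sigma> * \<sigma> = 1" "\<gamma> \<noteq> 0"
    and l': "\<And>b. l' $ b = \<sigma> * lr $ b" and Z: "\<And>b. Z $ b = \<gamma> * z $ b + \<delta> * l $ b"
    and n': "\<And>b. n' $ b = \<sigma> * ((cmod \<gamma>)\<^sup>2 * nr $ b + 2 * Re (\<gamma> * cnj \<delta> * z $ b) + (cmod \<delta>)\<^sup>2 * lr $ b)"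
  shows "null_tetrad (g x) (\<gamma> * cnj \<gamma>) (cvec l') (cvec n') Z (vcnj Z)"
proof -
  define sc where "sc = complex_of_real \<sigma>"
  have sc: "sc * sc = 1" using assms(5) by (simp add: sc_def flip: of_real_mult)
  have lc: "cnj (l $ b) = l $ b" "cvec l' $ b = sc * l $ b" for b by (simp_all add: assms(3) l' sc_def)
  have nc: "cvec n' $ b = sc * (\<gamma> * cnj \<gamma> * n $ b + \<gamma> * cnj \<delta> * z $ b + cnj \<gamma> * \<delta> * w $ b + \<delta> * cnj \<delta> * l $ b)" for b
  proof -
    have "complex_of_real (2 * Re (\<gamma> * cnj \<delta> * z $ b)) = \<gamma> * cnj \<delta> * z $ b + cnj \<gamma> * \<delta> * w $ b"
      using complex_add_cnj[of "\<gamma> * cnj \<delta> * z $ b"] by (simp add: assms(2))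
    then show ?thesis
      unfolding cvec_nth n' of_real_mult of_real_add sc_def[symmetric]
      by (simp add: assms(3,4) complex_norm_square of_real_power[symmetric] del: of_real_power)
  qed
  have Zc: "vcnj Z $ b = cnj \<gamma> * w $ b + cnj \<delta> * l $ b" for b by (simp add: Z lc assms(2))
  have "(\<gamma> * cnj \<gamma>) * complex_of_real (g x $ a $ b) =
     - cvec l' $ a * cvec n' $ b - cvec n' $ a * cvec l' $ b + Z $ a * vcnj Z $ b + vcnj Z $ a * Z $ b" for a b
  proof -
    have "- cvec l' $ a * cvec n' $ b - cvec n' $ a * cvec l' $ b =
      - (sc * sc) * (l $ a * (\<gamma> * cnj \<gamma> * n $ b + \<gamma> * cnj \<delta> * z $ b + cnj \<gamma> * \<delta> * w $ b + \<delta> * cnj \<delta> * l $ b)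
       + (\<gamma> * cnj \<gamma> * n $ a + \<gamma> * cnj \<delta> * z $ a + cnj \<gamma> * \<delta> * w $ a + \<delta> * cnj \<delta> * l $ a) * l $ b)"
      unfolding lc nc by (simp add: algebra_simps)
    then show ?thesis unfolding sc Zc Z metric assms(1) by (simp add: algebra_simps)
  qed
  moreover have "det (rows4 (cvec l') (cvec n') Z (vcnj Z)) = - \<i> * (\<gamma> * cnj \<gamma>)\<^sup>2 * complex_of_real (sqrt (- det (g x)))"
  proof -
    define L :: "complex ^ 4 ^ 4" where "L = rows4 (rows4 sc 0 0 0)
      (rows4 (sc * (\<delta> * cnj \<delta>)) (sc * (\<gamma> * cnj \<gamma>)) (sc * (\<gamma> * cnj \<delta>)) (sc * (cnj \<gamma> * \<delta>)))
      (rows4 \<delta> 0 \<gamma> 0) (rows4 (cnj \<delta>) 0 0 (cnj \<gamma>))"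
    have "rows4 (cvec l') (cvec n') Z (vcnj Z) $ i = (L ** rows4 l n z w) $ i" for i
      using exhaust4[of i]
      by (auto simp: vec_eq_iff matrix_matrix_mult_def sum4 lc nc Z Zc L_def algebra_simps simp del: cvec_nth vcnj_nth)
    then have "rows4 (cvec l') (cvec n') Z (vcnj Z) = L ** rows4 l n z w" by (simp add: vec_eq_iff)
    then have "det (rows4 (cvec l') (cvec n') Z (vcnj Z)) = det L * det (rows4 l n z w)" by (simp add: det_mul)
    also have "det L = (sc * sc) * (\<gamma> * cnj \<gamma>)\<^sup>2" by (simp add: det4 L_def power2_eq_square algebra_simps)
    finally show ?thesis using tetrad sc by (simp add: null_tetrad_def assms(1))
  qed
  ultimately show ?thesis using assms(6) by (simp add: null_tetrad_def)
qed

text \<open>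
  The connection is read off from three identities: the derivative of \<open>s* S = l \<and> Z\<close>, the
  Killing equation for \<open>Z\<close>, and metric compatibility. Here \<open>X, Y, F, sig\<close> stand for
  \<open>\<nabla>l, \<nabla>n, \<nabla>Z\<close> and \<open>d s*\<close>.
\<close>

lemma (in tetrad_at) connection_coefficients:
  fixes X Y F :: "4 \<Rightarrow> 4 \<Rightarrow> complex" and sig :: "4 \<Rightarrow> complex" and r :: complex
  assumes N': "N = r * cnj r" and w: "w = vcnj z"
    and real: "\<And>a. cnj (l $ a) = l $ a" "\<And>a. cnj (n $ a) = n $ a" "\<And>a b. cnj (X a b) = X a b"
    and E1: "\<And>a b c. - (2 * n $ a * wedge l z $ b $ c + z $ a * (wedge z w $ b $ c - wedge l n $ b $ c)) / r
        + sig a * wedge l z $ b $ c / cnj r = X a b * z $ c + l $ b * F a c - X a c * z $ b - l $ c * F a b"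
    and E2: "\<And>a b. F a b + F b a = 0"
    and E3: "\<And>a b c. (sig a * r + cnj (sig a) * cnj r) * complex_of_real (g x $ b $ c) =
        - X a b * n $ c - l $ b * Y a c - Y a b * l $ c - n $ b * X a c
        + F a b * w $ c + z $ b * cnj (F a c) + cnj (F a b) * z $ c + w $ b * F a c"
  shows "\<exists>q. \<forall>a b. F a b = (z $ a * n $ b - n $ a * z $ b) / r + q * (l $ a * z $ b - z $ a * l $ b) / cnj r
    \<and> X a b = (z $ a * w $ b - n $ a * l $ b) / r + (w $ a * z $ b - n $ a * l $ b) / cnj r
    \<and> sig a = - n $ a + q * l $ a
    \<and> Y a b = (q / cnj r + cnj q / r) * l $ a * n $ b - cnj q / r * w $ a * z $ b - q / cnj r * z $ a * w $ b"
proof -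
  have r: "r \<noteq> 0" using N N' by auto
  have wc: "cnj (z $ a) = w $ a" "cnj (w $ a) = z $ a" for a by (simp_all add: w)
  have ex: "\<exists>c. \<forall>a b. P a b = c 0 a * l $ b + c 1 a * n $ b + c 2 a * z $ b + c (3::nat) a * w $ b" for P :: "4 \<Rightarrow> 4 \<Rightarrow> complex"
  proof -
    have "\<exists>c0 c1 c2 c3. \<forall>b. P a b = c0 * l $ b + c1 * n $ b + c2 * z $ b + c3 * w $ b" for a
      by (rule expansion[of "P a"]) blast
    then obtain c0 c1 c2 c3 where "\<And>a b. P a b = c0 a * l $ b + c1 a * n $ b + c2 a * z $ b + c3 a * w $ b"
      by metis
    then show ?thesis
      by (intro exI[of _ "\<lambda>i. if i = 0 then c0 else if i = 1 then c1 else if i = 2 then c2 else c3"]) simp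
  qed
  obtain cX where "\<And>a b. X a b = cX 0 a * l $ b + cX 1 a * n $ b + cX 2 a * z $ b + cX (3::nat) a * w $ b" using ex[of X] by auto
  then obtain x0 x1 x2 x3 where X: "\<And>a b. X a b = x0 a * l $ b + x1 a * n $ b + x2 a * z $ b + x3 a * w $ b" by blast
  obtain y where "\<And>a b. Y a b = y 0 a * l $ b + y 1 a * n $ b + y 2 a * z $ b + y (3::nat) a * w $ b" using ex[of Y] by auto
  then obtain y0 y1 y2 y3 where Y: "\<And>a b. Y a b = y0 a * l $ b + y1 a * n $ b + y2 a * z $ b + y3 a * w $ b" by blast
  obtain f where "\<And>a b. F a b = f 0 a * l $ b + f 1 a * n $ b + f 2 a * z $ b + f (3::nat) a * w $ b" using ex[of F] by auto
  then obtain f0 f1 f2 f3 where F: "\<And>a b. F a b = f0 a * l $ b + f1 a * n $ b + f2 a * z $ b + f3 a * w $ b" by blast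
  have Xr: "x0 a - cnj (x0 a) = 0 \<and> x1 a - cnj (x1 a) = 0 \<and> x2 a - cnj (x3 a) = 0 \<and> x3 a - cnj (x2 a) = 0" for a
    by (rule independent) (use real(3)[of a] in \<open>simp add: X real wc algebra_simps\<close>)
  \<comment> \<open>The skew pair b, c of \<open>E1\<close> is expanded in the tetrad. This leaves
    undetermined the \<open>l\<close> and \<open>z\<close> components of \<open>F\<close>; the
    component \<open>x2\<close> of \<open>X\<close> follows from reality.\<close>
  have c1: "x1 a = 0 \<and> f3 a = 0 \<and> f1 a = z $ a / r \<and> x3 a = z $ a / r \<and>
      x0 a = sig a / cnj r - 2 * n $ a / r - f2 a" for a
  proof -
    have "(0::complex) = 0 \<and> f1 a - z $ a / r = 0 \<and> (x0 a + f2 a + 2 * n $ a / r - sig a / cnj r) = 0 \<and> f3 a = 0 \<and>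
        - (f1 a - z $ a / r) = 0 \<and> (0::complex) = 0 \<and> x1 a = 0 \<and> (0::complex) = 0 \<and>
        - (x0 a + f2 a + 2 * n $ a / r - sig a / cnj r) = 0 \<and> - x1 a = 0 \<and> (0::complex) = 0 \<and> - (x3 a - z $ a / r) = 0 \<and>
        - f3 a = 0 \<and> (0::complex) = 0 \<and> x3 a - z $ a / r = 0 \<and> 0 = (0::complex)"
    proof (rule independent2)
      fix b c
      show "(0 * l $ b + (f1 a - z $ a / r) * n $ b + (x0 a + f2 a + 2 * n $ a / r - sig a / cnj r) * z $ b + f3 a * w $ b) * l $ c
        + (- (f1 a - z $ a / r) * l $ b + 0 * n $ b + x1 a * z $ b + 0 * w $ b) * n $ c
        + (- (x0 a + f2 a + 2 * n $ a / r - sig a / cnj r) * l $ b + - x1 a * n $ b + 0 * z $ b + - (x3 a - z $ a / r) * w $ b) * z $ c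
        + (- f3 a * l $ b + 0 * n $ b + (x3 a - z $ a / r) * z $ b + 0 * w $ b) * w $ c = 0"
        using E1[of a b c] unfolding X F wedge_def vec_lambda_beta
        by (simp add: add_divide_distrib diff_divide_distrib algebra_simps)
    qed
    moreover have "x = C - B - y" if "x + y + B - C = 0" for x y B C :: complex
      using that by (simp add: algebra_simps)
    ultimately have "x1 a = 0" "f3 a = 0" "f1 a - z $ a / r = 0" "x3 a - z $ a / r = 0"
      "x0 a = sig a / cnj r - 2 * n $ a / r - f2 a" by blast+
    then show ?thesis by (simp only: right_minus_eq simp_thms)
  qed
  have f1: "f1 a = z $ a / r" and x1: "x1 a = 0" and f3: "f3 a = 0" and x3: "x3 a = z $ a / r" for a
    using c1[of a] by blast+
  have Xr: "x0 a = cnj (x0 a)" "x2 a = cnj (x3 a)" for a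
    using Xr[of a] unfolding right_minus_eq by blast+
  have x2: "x2 a = w $ a / cnj r" for a unfolding Xr(2)[of a] using c1[of a] by (simp add: wc)
  obtain p0 p1 p2 p3 where p: "\<And>a. f0 a = p0 * l $ a + p1 * n $ a + p2 * z $ a + p3 * w $ a"
    using expansion[of f0] by blast
  obtain q0 q1 q2 q3 where q: "\<And>a. f2 a = q0 * l $ a + q1 * n $ a + q2 * z $ a + q3 * w $ a"
    using expansion[of f2] by blast
  \<comment> \<open>The Killing equation makes \<open>F\<close> skew, so that a single coefficient
    of the 32 complex ones in \<open>f0\<close> and \<open>f2\<close> and their expansions remains
    free.\<close>
  have c2: "p0 = 0 \<and> p1 = 0 \<and> p2 = - q0 \<and> p3 = 0 \<and> q1 = - 1 / r \<and> q2 = 0 \<and> q3 = 0"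
  proof -
    have "2 * p0 = 0 \<and> p1 = 0 \<and> p2 + q0 = 0 \<and> p3 = 0 \<and> p1 = 0 \<and> (0::complex) = 0 \<and> 1 / r + q1 = 0 \<and> (0::complex) = 0 \<and>
       p2 + q0 = 0 \<and> 1 / r + q1 = 0 \<and> 2 * q2 = 0 \<and> q3 = 0 \<and> p3 = 0 \<and> (0::complex) = 0 \<and> q3 = 0 \<and> 0 = (0::complex)"
    proof (rule independent2)
      fix a b
      show "(2 * p0 * l $ a + p1 * n $ a + (p2 + q0) * z $ a + p3 * w $ a) * l $ b
        + (p1 * l $ a + 0 * n $ a + (1 / r + q1) * z $ a + 0 * w $ a) * n $ b
        + ((p2 + q0) * l $ a + (1 / r + q1) * n $ a + 2 * q2 * z $ a + q3 * w $ a) * z $ b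
        + (p3 * l $ a + 0 * n $ a + q3 * z $ a + 0 * w $ a) * w $ b = 0"
        using E2[of a b] c1[of a] c1[of b] unfolding F p q by (simp add: algebra_simps)
    qed
    then show ?thesis by (simp add: eq_neg_iff_add_eq_0 add.commute)
  qed
  \<comment> \<open>The remaining free coefficient, scaled by r* so that it becomes the coefficient
    of \<open>l\<close> in the differential of s*.\<close>
  define Q where "Q = q0 * cnj r"
  have q0: "q0 = Q / cnj r" using r by (simp add: Q_def)
  have f0: "f0 a = - Q / cnj r * z $ a" and f2: "f2 a = - n $ a / r + Q / cnj r * l $ a" for a
    using c2 unfolding p q by (simp_all add: q0)
  define D where "D = (\<lambda>a. sig a / cnj r + cnj (sig a) / r)"
  have c3: "y0 a = 0 \<and> y1 a = D a - x0 a \<and> y2 a = cnj (f0 a) \<and> y3 a = f0 a \<and> D a = f2 a + cnj (f2 a)" for a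
  proof -
    have D: "(sig a * r + cnj (sig a) * cnj r) * complex_of_real (g x $ b $ c) =
        D a * (- l $ b * n $ c - n $ b * l $ c + z $ b * w $ c + w $ b * z $ c)" for b c
      unfolding metric N' D_def using r by (simp add: field_simps)
    have "2 * y0 a = 0 \<and> x0 a + y1 a - D a = 0 \<and> y2 a - cnj (f0 a) = 0 \<and> y3 a - f0 a = 0 \<and>
       x0 a + y1 a - D a = 0 \<and> (0::complex) = 0 \<and> (0::complex) = 0 \<and> (0::complex) = 0 \<and>
       y2 a - cnj (f0 a) = 0 \<and> (0::complex) = 0 \<and> (0::complex) = 0 \<and> D a - (f2 a + cnj (f2 a)) = 0 \<and>
       y3 a - f0 a = 0 \<and> (0::complex) = 0 \<and> D a - (f2 a + cnj (f2 a)) = 0 \<and> 0 = (0::complex)"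
    proof (rule independent2)
      fix b c
      show "(2 * y0 a * l $ b + (x0 a + y1 a - D a) * n $ b + (y2 a - cnj (f0 a)) * z $ b + (y3 a - f0 a) * w $ b) * l $ c
        + ((x0 a + y1 a - D a) * l $ b + 0 * n $ b + 0 * z $ b + 0 * w $ b) * n $ c
        + ((y2 a - cnj (f0 a)) * l $ b + 0 * n $ b + 0 * z $ b + (D a - (f2 a + cnj (f2 a))) * w $ b) * z $ c
        + ((y3 a - f0 a) * l $ b + 0 * n $ b + (D a - (f2 a + cnj (f2 a))) * z $ b + 0 * w $ b) * w $ c = 0"
        using E3[of a b c] unfolding D X Y F f1 x1 f3 x3 x2
        by (simp add: real wc algebra_simps)
    qed
    moreover have "y = C - x" if "x + y - C = 0" for x y C :: complex
      using that by (simp add: algebra_simps)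
    ultimately have "2 * y0 a = 0" "y1 a = D a - x0 a" "y2 a - cnj (f0 a) = 0" "y3 a - f0 a = 0"
      "D a - (f2 a + cnj (f2 a)) = 0" by blast+
    then show ?thesis unfolding right_minus_eq by simp
  qed
  \<comment> \<open>Reality of \<open>x0\<close> and the z, w component of metric compatibility are
    two linear equations for \<open>sig\<close> and its conjugate.\<close>
  have sig: "sig a = - n $ a + Q * l $ a" for a
  proof -
    have x0: "x0 a = sig a / cnj r - 2 * n $ a / r - f2 a" using c1[of a] by blast
    have "cnj (x0 a) = cnj (sig a) / r - 2 * n $ a / cnj r - cnj (f2 a)" unfolding x0 by (simp add: real)
    then have 1: "sig a / cnj r - 2 * n $ a / r - f2 a = cnj (sig a) / r - 2 * n $ a / cnj r - cnj (f2 a)"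
      using Xr(1)[of a] x0 by metis
    have 2: "sig a / cnj r + cnj (sig a) / r = f2 a + cnj (f2 a)" using c3[of a] by (simp add: D_def)
    have "2 * A = B - D + 2 * f" if "A - B - f = C - D - h" "A + C = f + h" for A B C D f h :: complex
      using that by algebra
    from this[OF 1 2] have "2 * sig a / cnj r = 2 * n $ a / r - 2 * n $ a / cnj r + 2 * f2 a" by simp
    then have "2 * sig a / cnj r = 2 * (- n $ a + Q * l $ a) / cnj r"
      unfolding f2 by (simp add: add_divide_distrib diff_divide_distrib algebra_simps)
    moreover have "y = z" if "2 * y / cnj r = 2 * z / cnj r" for y z using that r by simp
    ultimately show ?thesis by blast
  qed
  have x0: "x0 a = - n $ a / r - n $ a / cnj r" for a
    using c1[of a] unfolding sig f2 by (simp add: add_divide_distrib diff_divide_distrib algebra_simps)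
  have y1: "y1 a = (Q / cnj r + cnj Q / r) * l $ a" for a
    using c3[of a] unfolding x0 f2 by (simp add: real add_divide_distrib diff_divide_distrib algebra_simps)
  show ?thesis
  proof (intro exI[of _ Q] allI conjI)
    fix a b
    show "F a b = (z $ a * n $ b - n $ a * z $ b) / r + Q * (l $ a * z $ b - z $ a * l $ b) / cnj r"
      using c1[of a] unfolding F f0 f2 by (simp add: add_divide_distrib diff_divide_distrib algebra_simps)
    show "X a b = (z $ a * w $ b - n $ a * l $ b) / r + (w $ a * z $ b - n $ a * l $ b) / cnj r"
      using c1[of a] unfolding X x0 x2 by (simp add: add_divide_distrib diff_divide_distrib algebra_simps)
    show "Y a b = (Q / cnj r + cnj Q / r) * l $ a * n $ b - cnj Q / r * w $ a * z $ b - Q / cnj r * z $ a * w $ b"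
      using c3[of a] unfolding Y y1 f0 by (simp add: wc algebra_simps)
  qed (rule sig)
qed

text \<open>The pointwise decompositions depend on choices at each point and need not be smooth. A
  single row of the self-dual form near \<open>p\<close> yields smooth formulas for the direction
  and scale of \<open>l\<close>; the codifferential supplies \<open>Z\<close>, and the metric then
  determines \<open>n\<close>. The pointwise tetrads serve only to verify these formulas.\<close>

theorem null_CKY_spinor_frame:
  assumes stM: "spacetime M g" and cky: "CKY_on M g A" and null: "null_on M g A"
    and ik: "independent_Killing_codiffs_on M g A" and p: "p \<in> M"
  obtains U l n Z s lam where "p \<in> U" "U \<subseteq> M" "spinor_frame U g l n Z s lam"
    "\<And>x a b. x \<in> U \<Longrightarrow> cnj (s x) * selfdual g A x $ a $ b = wedge (cvec (l x)) (Z x) $ a $ b"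
proof -
  have o: "open M" using stM by (rule spacetime_open)
  have A: "smooth_on M A" "\<And>x. x \<in> M \<Longrightarrow> transpose (A x) = - A x"
    using cky by (auto simp: CKY_on_def two_form_on_def)
  define S where "S = selfdual g A"
  have smS: "smooth_on M (\<lambda>x. S x $ a $ b)" for a b
    unfolding S_def by (rule smooth_on_selfdual[OF stM A(1)])
  define Zc where "Zc = codiff g S"
  have smZc: "smooth_on M (\<lambda>x. Zc x $ a)" for a
    unfolding Zc_def by (rule smooth_on_codiff[OF stM smS])
  have CK: "3 * nabla2 g S x a b c = 2 * (\<Sum>m\<in>UNIV. sharp g x (Zc x) m * calG g x m a b c)" if "x \<in> M" for x a b c
    using cky that by (simp add: CKY_on_def sharp_def Zc_def S_def)
  have dec: "\<exists>l0 n0 m0. S x = wedge (cvec l0) m0 \<and> null_tetrad (g x) 1 (cvec l0) (cvec n0) m0 (vcnj m0)"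
    if x: "x \<in> M" for x
  proof -
    have "A x \<noteq> 0" and "(\<Sum>a\<in>UNIV. \<Sum>b\<in>UNIV. \<Sum>c\<in>UNIV. \<Sum>d\<in>UNIV.
        complex_of_real (ginv g x $ a $ c) * complex_of_real (ginv g x $ b $ d)
        * selfdual g A x $ a $ b * selfdual g A x $ c $ d) = 0"
      using null x by (auto simp: null_on_def)
    from null_two_form_decomposition[OF stM x A(2)[OF x] this]
    show ?thesis unfolding S_def vcnj_def by metis
  qed
  obtain lp np mp where lp: "null_tetrad (g p) 1 (cvec lp) (cvec np) mp (vcnj mp)" "S p = wedge (cvec lp) mp"
    using dec[OF p] by blast
  obtain i where i: "lp $ i \<noteq> 0"
  proof -
    interpret tetrad_at g p M 1 "cvec lp" "cvec np" mp "vcnj mp"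
      using stM p lp by unfold_locales
    show thesis using independent[of 1 0 0 0] that by auto
  qed
  \<comment> \<open>A row of S = l \<and> m is a combination of m and l, and its Hermitian square is
    l_i^2. Positivity of this square near \<open>p\<close> replaces the choice of a nonzero
    component of \<open>l\<close>.\<close>
  define mu where "mu = (\<lambda>x. S x $ i)"
  define c where "c = (\<lambda>x. cinner g x (mu x) (vcnj (mu x)))"
  have mu: "mu x = (\<chi> b. complex_of_real (l0 $ i) * m0 $ b + (- (m0 $ i)) * cvec l0 $ b)"
    if "S x = wedge (cvec l0) m0" for x l0 m0
    unfolding mu_def that by (simp add: wedge_def vec_eq_iff)
  have vmu: "vcnj (mu x) = (\<chi> b. complex_of_real (l0 $ i) * vcnj m0 $ b + (- cnj (m0 $ i)) * cvec l0 $ b)"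
    if "S x = wedge (cvec l0) m0" for x l0 m0
    unfolding mu[OF that] by (simp add: vec_eq_iff)
  have c: "c x = complex_of_real ((l0 $ i)\<^sup>2)"
    if x: "x \<in> M" and S: "S x = wedge (cvec l0) m0" and T: "null_tetrad (g x) 1 (cvec l0) (cvec n0) m0 (vcnj m0)" for x l0 n0 m0
  proof -
    interpret tetrad_at g x M 1 "cvec l0" "cvec n0" m0 "vcnj m0" using stM x T by unfold_locales
    show ?thesis unfolding c_def vmu[OF S] unfolding mu[OF S] cinner_combine by (simp add: cinner_tetrad power2_eq_square)
  qed
  define U1 where "U1 = {x \<in> M. Re (c x) > 0}"
  have smmu: "smooth_on M (\<lambda>x. mu x $ b)" for b unfolding mu_def by (rule smS)
  have smc: "smooth_on M c" unfolding c_def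
    by (intro smooth_on_cinner[OF stM _ o] smmu) (auto simp: vcnj_def intro!: smooth_on_cnj o smmu)
  have U1: "open U1" "U1 \<subseteq> M" "p \<in> U1"
  proof -
    have "open (M \<inter> (\<lambda>x. Re (c x)) -` {0<..})"
      by (rule continuous_open_preimage[OF smooth_on_continuous_on[OF smooth_on_Re[OF o smc]] o]) simp
    then show "open U1" by (simp add: U1_def vimage_def Int_def)
    show "p \<in> U1" using c[OF p lp(2,1)] p i by (simp add: U1_def)
  qed (auto simp: U1_def)
  have st1: "spacetime U1 g" using spacetime_subset[OF stM] U1 by auto
  \<comment> \<open>Contracting S with the conjugate row gives l_b l_i, so the quotient is l_b /
    l_i, which does not depend on the sign of \<open>l\<close>.\<close>
  define kr where "kr = (\<lambda>y. \<chi> b. Re (\<Sum>c\<in>UNIV. S y $ b $ c * sharp g y (vcnj (mu y)) c) / Re (c y))"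
  have kr: "kr x $ b = l0 $ b / l0 $ i" and li: "l0 $ i \<noteq> 0"
    if x: "x \<in> U1" and S: "S x = wedge (cvec l0) m0" and T: "null_tetrad (g x) 1 (cvec l0) (cvec n0) m0 (vcnj m0)" for x l0 n0 m0 b
  proof -
    have xM: "x \<in> M" using x U1 by auto
    interpret tetrad_at g x M 1 "cvec l0" "cvec n0" m0 "vcnj m0" using stM xM T by unfold_locales
    have cx: "c x = complex_of_real ((l0 $ i)\<^sup>2)" by (rule c[OF xM S T])
    then show li: "l0 $ i \<noteq> 0" using x by (auto simp: U1_def)
    have e: "(\<Sum>c\<in>UNIV. S x $ b $ c * sharp g x (vcnj (mu x)) c) = complex_of_real (l0 $ b * l0 $ i)"
      unfolding S wedge_sharp vmu[OF S] cinner_combine by (simp add: cinner_tetrad)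
    then show "kr x $ b = l0 $ b / l0 $ i"
      using li unfolding kr_def vec_lambda_beta e cx by (simp add: power2_eq_square)
  qed
  have sm1: "smooth_on U1 (\<lambda>x. S x $ a $ b)" "smooth_on U1 (\<lambda>x. mu x $ b)" "smooth_on U1 c"
    "smooth_on U1 (\<lambda>x. Zc x $ b)" for a b
    using smooth_on_subset[OF _ U1(2)] smS smmu smc smZc by blast+
  have cpos: "Re (c x) > 0" if "x \<in> U1" for x using that by (simp add: U1_def)
  have smkr: "smooth_on U1 (\<lambda>x. kr x $ b)" for b
    unfolding kr_def vec_lambda_beta
    by (intro smooth_on_divide smooth_on_Re smooth_on_sum smooth_on_mult sm1 U1(1)
        smooth_on_sharp[OF stM U1(2,1)]) (auto simp: vcnj_def less_imp_neq[OF cpos, symmetric] intro!: smooth_on_cnj U1 sm1)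
  have Sk: "S x = wedge (cvec (kr x)) (mu x)" if x: "x \<in> U1" for x
  proof -
    obtain l0 n0 m0 where T: "S x = wedge (cvec l0) m0" "null_tetrad (g x) 1 (cvec l0) (cvec n0) m0 (vcnj m0)"
      using dec x U1 by blast
    show ?thesis unfolding mu[OF T(1)] using li[OF x T]
      by (simp add: vec_eq_iff T(1) wedge_def kr[OF x T] field_simps)
  qed
  have pw: "\<exists>l0 n0 m0 \<gamma> \<delta>. S x = wedge (cvec l0) m0 \<and> null_tetrad (g x) 1 (cvec l0) (cvec n0) m0 (vcnj m0) \<and>
      \<gamma> \<noteq> 0 \<and> (\<forall>b. Zc x $ b = - 3 * (\<gamma> * m0 $ b + \<delta> * cvec l0 $ b))" if x: "x \<in> U1" for x
  proof -
    have xM: "x \<in> M" using x U1 by auto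
    obtain l0 n0 m0 where S: "S x = wedge (cvec l0) m0" and T: "null_tetrad (g x) 1 (cvec l0) (cvec n0) m0 (vcnj m0)"
      using dec[OF xM] by blast
    interpret tetrad_at g x M 1 "cvec l0" "cvec n0" m0 "vcnj m0" using stM xM T by unfold_locales
    have k: "cvec (kr x) = (1 / complex_of_real (l0 $ i)) *s cvec l0"
      by (simp add: vec_eq_iff kr[OF x S T])
    \<comment> \<open>The span of l and m is totally null and contains \<open>kr\<close> and
      \<open>mu\<close>. Each term of the derivative of kr \<and> mu still has one undifferentiated
      factor, so contraction with l and m annihilates the left side of the CKY equation.\<close>
    have "cinner g x (cvec l0) (Zc x) * m0 $ a - cinner g x m0 (Zc x) * cvec l0 $ a = 0" for a
    proof -
      define Dk where "Dk = (\<chi> b. nab g (\<lambda>y. cvec (kr y)) x a b)"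
      define Dm where "Dm = (\<chi> b. nab g mu x a b)"
      have d: "(\<lambda>y. S y $ b $ c) differentiable at x" "(\<lambda>y. cvec (kr y) $ b) differentiable at x"
        "(\<lambda>y. mu y $ b) differentiable at x" for b c
        unfolding cvec_nth
        by (rule smooth_on_differentiable[OF _ x], intro sm1 smooth_on_of_real U1 smkr)+
      have n: "nabla2 g S x a b c = (Dk $ b * mu x $ c - Dk $ c * mu x $ b)
          + (cvec (kr x) $ b * Dm $ c - cvec (kr x) $ c * Dm $ b)" for b c
        using nabla2_wedge[where h="\<lambda>y. 1" and S=S and p="\<lambda>y. cvec (kr y)" and q=mu and g=g and a=a and b=b and c=c, OF U1(1) x _ _ d]
        by (simp add: Sk pd_const Dk_def Dm_def del: cvec_nth)
      have "(\<Sum>b\<in>UNIV. \<Sum>c\<in>UNIV. up (cvec l0) b * up m0 c * nabla2 g S x a b c) =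
          (\<Sum>b\<in>UNIV. \<Sum>c\<in>UNIV. up (cvec l0) b * up m0 c * (Dk $ b * mu x $ c - Dk $ c * mu x $ b)) +
          (\<Sum>b\<in>UNIV. \<Sum>c\<in>UNIV. up (cvec l0) b * up m0 c * (cvec (kr x) $ b * Dm $ c - cvec (kr x) $ c * Dm $ b))"
        unfolding n sum.distrib[symmetric] by (intro sum.cong refl) (simp add: distrib_left del: cvec_nth)
      also have "\<dots> = 0"
        unfolding up_wedge mu[OF S] k cinner_combine cinner_scale by (simp add: cinner_tetrad)
      finally have "0 = 3 * (\<Sum>b\<in>UNIV. \<Sum>c\<in>UNIV. up (cvec l0) b * up m0 c * nabla2 g S x a b c)" by simp
      also have "\<dots> = (\<Sum>b\<in>UNIV. \<Sum>c\<in>UNIV. up (cvec l0) b * up m0 c * (3 * nabla2 g S x a b c))"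
        unfolding sum_distrib_left by (intro sum.cong refl) simp
      also have "\<dots> = 2 * (\<Sum>b\<in>UNIV. \<Sum>c\<in>UNIV. up (cvec l0) b * up m0 c * (\<Sum>m\<in>UNIV. up (Zc x) m * calG g x m a b c))"
        unfolding CK[OF xM] sum_distrib_left by (intro sum.cong refl) simp
      finally show ?thesis unfolding calG_null_contract by simp
    qed
    then have "- cinner g x m0 (Zc x) = 0 \<and> (0::complex) = 0 \<and> cinner g x (cvec l0) (Zc x) = 0 \<and> (0::complex) = 0"
      by (intro independent) (simp add: algebra_simps)
    then have Zx: "Zc x $ b = - cinner g x (cvec n0) (Zc x) * cvec l0 $ b + cinner g x (vcnj m0) (Zc x) * m0 $ b" for b
      using expand[of "Zc x" b] by simp
    \<comment> \<open>Otherwise both codifferentials would be multiples of \<open>l\<close>,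
      contrary to the assumed independence.\<close>
    have "cinner g x (vcnj m0) (Zc x) \<noteq> 0"
    proof
      assume z: "cinner g x (vcnj m0) (Zc x) = 0"
      define al where "al = - cinner g x (cvec n0) (Zc x) * complex_of_real (sqrt 2)"
      have "complex_of_real (codiff g A x $ b) - \<i> * complex_of_real (codiff g (hodge g A) x $ b) = al * complex_of_real (l0 $ b)" for b
      proof -
        have e: "Zc x $ b = (complex_of_real (codiff g A x $ b) - \<i> * complex_of_real (codiff g (hodge g A) x $ b)) / complex_of_real (sqrt 2)"
          unfolding Zc_def S_def by (rule codiff_selfdual[OF stM A(1) xM])
        have "Zc x $ b = - cinner g x (cvec n0) (Zc x) * complex_of_real (l0 $ b)" using Zx[of b] by (simp add: z)
        then have "(complex_of_real (codiff g A x $ b) - \<i> * complex_of_real (codiff g (hodge g A) x $ b)) / complex_of_real (sqrt 2)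
            = (al / complex_of_real (sqrt 2)) * complex_of_real (l0 $ b)" unfolding e al_def by simp
        then show ?thesis by simp
      qed
      then have "codiff g A x $ b = Re al * l0 $ b \<and> - codiff g (hodge g A) x $ b = Im al * l0 $ b" for b
        by (simp add: complex_eq_iff)
      then have "codiff g A x $ b = Re al * l0 $ b \<and> codiff g (hodge g A) x $ b = - Im al * l0 $ b" for b
        by (metis minus_equation_iff minus_mult_left)
      then have "wedge (codiff g A x) (codiff g (hodge g A) x) = 0"
        by (simp add: wedge_def vec_eq_iff)
      then show False using ik xM by (auto simp: independent_Killing_codiffs_on_def)
    qed
    then show ?thesis using S T Zx
      by (intro exI[of _ l0] exI[of _ n0] exI[of _ m0] exI[of _ "- cinner g x (vcnj m0) (Zc x) / 3"]
          exI[of _ "cinner g x (cvec n0) (Zc x) / 3"]) simp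
  qed
  \<comment> \<open>In a spinor frame the codifferential of the self-dual form is -3 kappa pi; the
    factor extracts kappa pi.\<close>
  define Z where "Z = (\<lambda>y. (- 1 / 3) *s Zc y)"
  define t where "t = (\<lambda>y. sqrt (Re (c y)))"
  define l where "l = (\<lambda>y. \<chi> b. t y * kr y $ b)"
  \<comment> \<open>If Z = \<gamma> m + \<delta> l, this is \<gamma>* times the sign of l_i, as s* S
    = l \<and> Z requires after \<open>l\<close> has been made positive at index i.\<close>
  define s where "s = (\<lambda>y. (\<Sum>c\<in>UNIV. S y $ i $ c * sharp g y (vcnj (Z y)) c) / complex_of_real (t y))"
  define Nf where "Nf = (\<lambda>y. Re (s y * cnj (s y)))"
  \<comment> \<open>The i, i entry of the metric relation is solved for n_i; the b, i entries then
    give the other components of \<open>n\<close>. Division by l_i is legitimate near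
    \<open>p\<close>.\<close>
  define ni where "ni = (\<lambda>y. (2 * Re (Z y $ i * cnj (Z y $ i)) - Nf y * g y $ i $ i) / (2 * l y $ i))"
  define n where "n = (\<lambda>y. \<chi> b. (2 * Re (Z y $ b * cnj (Z y $ i)) - Nf y * g y $ b $ i - l y $ b * ni y) / l y $ i)"
  have pw2: "null_tetrad (g x) (s x * cnj (s x)) (cvec (l x)) (cvec (n x)) (Z x) (vcnj (Z x)) \<and>
      (\<forall>b c. cnj (s x) * S x $ b $ c = wedge (cvec (l x)) (Z x) $ b $ c) \<and> l x $ i > 0" if x: "x \<in> U1" for x
  proof -
    have xM: "x \<in> M" using x U1 by auto
    obtain l0 n0 m0 \<gamma> \<delta> where S: "S x = wedge (cvec l0) m0" and T: "null_tetrad (g x) 1 (cvec l0) (cvec n0) m0 (vcnj m0)"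
      and \<gamma>: "\<gamma> \<noteq> 0" and Zc: "\<And>b. Zc x $ b = - 3 * (\<gamma> * m0 $ b + \<delta> * cvec l0 $ b)"
      using pw[OF x] by blast
    interpret tetrad_at g x M 1 "cvec l0" "cvec n0" m0 "vcnj m0" using stM xM T by unfold_locales
    define \<sigma> where "\<sigma> = \<bar>l0 $ i\<bar> / l0 $ i"
    have l0: "l0 $ i \<noteq> 0" by (rule li[OF x S T])
    have \<sigma>: "\<sigma> * \<sigma> = 1" "l0 $ i / \<bar>l0 $ i\<bar> = \<sigma>" using l0 by (auto simp: \<sigma>_def field_simps)
    have tx: "t x = \<bar>l0 $ i\<bar>" unfolding t_def c[OF xM S T] by simp
    have lx: "l x $ b = \<sigma> * l0 $ b" for b by (simp add: l_def tx kr[OF x S T] \<sigma>_def)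
    have Zx: "Z x $ b = \<gamma> * m0 $ b + \<delta> * cvec l0 $ b" for b by (simp add: Z_def Zc algebra_simps)
    have vZ: "vcnj (Z x) = (\<chi> b. cnj \<gamma> * vcnj m0 $ b + cnj \<delta> * cvec l0 $ b)" by (simp add: vec_eq_iff Zx)
    have "(\<Sum>c\<in>UNIV. S x $ i $ c * sharp g x (vcnj (Z x)) c) = complex_of_real (l0 $ i) * cnj \<gamma>"
      unfolding S wedge_sharp vZ cinner_combine by (simp add: cinner_tetrad)
    then have sx: "s x = complex_of_real \<sigma> * cnj \<gamma>" unfolding s_def tx \<sigma>(2)[symmetric] by simp
    have ss: "s x * cnj (s x) = \<gamma> * cnj \<gamma>"
    proof -
      have "s x * cnj (s x) = complex_of_real (\<sigma> * \<sigma>) * (\<gamma> * cnj \<gamma>)" by (simp add: sx)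
      then show ?thesis unfolding \<sigma> by simp
    qed
    define n' where "n' = (\<chi> b. \<sigma> * ((cmod \<gamma>)\<^sup>2 * n0 $ b + 2 * Re (\<gamma> * cnj \<delta> * m0 $ b) + (cmod \<delta>)\<^sup>2 * l0 $ b))"
    have T': "null_tetrad (g x) (\<gamma> * cnj \<gamma>) (cvec (l x)) (cvec n') (Z x) (vcnj (Z x))"
      by (rule null_rotation[OF refl refl refl refl \<sigma>(1) \<gamma> lx Zx]) (simp add: n'_def)
    have lpos: "l x $ i > 0" using l0 by (simp add: lx \<sigma>_def)
    have m: "Nf x * g x $ a $ b = - l x $ a * n' $ b - n' $ a * l x $ b + 2 * Re (Z x $ a * cnj (Z x $ b))" for a b
    proof -
      have "(\<gamma> * cnj \<gamma>) * complex_of_real (g x $ a $ b) = - cvec (l x) $ a * cvec n' $ b - cvec n' $ a * cvec (l x) $ b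
          + Z x $ a * cnj (Z x $ b) + cnj (Z x $ a) * Z x $ b" using T' by (simp add: null_tetrad_def)
      then have "Re ((\<gamma> * cnj \<gamma>) * complex_of_real (g x $ a $ b)) = Re (- cvec (l x) $ a * cvec n' $ b - cvec n' $ a * cvec (l x) $ b
          + Z x $ a * cnj (Z x $ b) + cnj (Z x $ a) * Z x $ b)" by simp
      then show ?thesis unfolding Nf_def ss by (simp add: algebra_simps)
    qed
    have "ni x = n' $ i" unfolding ni_def m using lpos by (simp add: field_simps)
    then have "n x = n'" using lpos m by (simp add: vec_eq_iff n_def field_simps)
    then have "null_tetrad (g x) (s x * cnj (s x)) (cvec (l x)) (cvec (n x)) (Z x) (vcnj (Z x))"
      using T' ss by simp
    moreover have "cnj (s x) * S x $ b $ c = wedge (cvec (l x)) (Z x) $ b $ c" for b c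
      by (simp add: S wedge_def lx Zx sx algebra_simps)
    ultimately show ?thesis using lpos by blast
  qed
  have smZ: "smooth_on U1 (\<lambda>x. Z x $ b)" for b
    unfolding Z_def by (simp, intro smooth_on_mult smooth_on_const smooth_on_divide smooth_on_minus sm1 U1) simp_all
  have smt: "smooth_on U1 t" unfolding t_def by (intro smooth_on_sqrt smooth_on_Re sm1 U1 cpos)
  have sml: "smooth_on U1 (\<lambda>x. l x $ b)" for b
    unfolding l_def vec_lambda_beta by (intro smooth_on_mult smt smkr U1)
  have sms: "smooth_on U1 s" unfolding s_def
    by (intro smooth_on_divide smooth_on_sum smooth_on_mult smooth_on_of_real smt sm1 U1 smooth_on_sharp[OF stM U1(2,1)])
       (auto simp: vcnj_def t_def less_imp_neq[OF cpos, symmetric] intro!: smooth_on_cnj U1 smZ)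
  have lne: "l x $ i \<noteq> 0" if "x \<in> U1" for x using pw2[OF that] by auto
  have smni: "smooth_on U1 ni" unfolding ni_def Nf_def
    by (intro smooth_on_divide smooth_on_diff smooth_on_mult smooth_on_const smooth_on_Re smooth_on_cnj smZ sml sms U1 spacetime_smooth[OF st1])
       (simp add: lne)
  have smn: "smooth_on U1 (\<lambda>x. n x $ b)" for b unfolding n_def vec_lambda_beta Nf_def
    by (intro smooth_on_divide smooth_on_diff smooth_on_mult smooth_on_const smooth_on_Re smooth_on_cnj smZ sml sms smni U1 spacetime_smooth[OF st1])
       (simp add: lne)
  have sne: "s x \<noteq> 0" if "x \<in> U1" for x using pw2[OF that] by (auto simp: null_tetrad_def)
  have killing: "nab g Z x a b + nab g Z x b a = 0" if x: "x \<in> U1" for x a b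
  proof -
    have xM: "x \<in> M" using x U1 by auto
    have d: "(\<lambda>y. codiff g A y $ b) differentiable at x" "(\<lambda>y. codiff g (hodge g A) y $ b) differentiable at x" for b
      using smooth_on_differentiable[OF smooth_on_codiff[OF stM] xM] smooth_on_hodge[OF stM A(1)]
        smooth_on_nth[OF o smooth_on_nth[OF o A(1)]] by blast+
    have pd: "pd a (\<lambda>y. Zc y $ b) x = (complex_of_real (pd a (\<lambda>y. codiff g A y $ b) x) -
        \<i> * complex_of_real (pd a (\<lambda>y. codiff g (hodge g A) y $ b) x)) / complex_of_real (sqrt 2)" for a b
      unfolding pd_real_imaginary[OF d, symmetric]
      by (rule pd_cong[OF o xM]) (simp add: Zc_def S_def codiff_selfdual[OF stM A(1)])
    have n: "nab g Zc x a b = (complex_of_real (nab g (codiff g A) x a b) -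
        \<i> * complex_of_real (nab g (codiff g (hodge g A)) x a b)) / complex_of_real (sqrt 2)" for a b
      unfolding nab_def pd
      by (simp add: Zc_def S_def codiff_selfdual[OF stM A(1) xM] sum4 scaleR_conv_of_real
          add_divide_distrib diff_divide_distrib algebra_simps)
    have k: "nab g (codiff g A) x a b = - nab g (codiff g A) x b a"
      "nab g (codiff g (hodge g A)) x a b = - nab g (codiff g (hodge g A)) x b a"
      using ik xM by (auto simp: independent_Killing_codiffs_on_def Killing_on_def nabla1_eq_nab eq_neg_iff_add_eq_0)
    have "nab g Zc x a b + nab g Zc x b a = 0" unfolding n[of a b] k n[of b a] by (simp add: add_divide_distrib diff_divide_distrib)
    moreover have "nab g Z x a b = (- 1 / 3) * nab g Zc x a b" for a b
      unfolding Z_def by (rule nab_scale) (rule smooth_on_differentiable[OF smZc xM])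
    ultimately show ?thesis by (simp add: add_divide_distrib[symmetric] flip: minus_add_distrib) (metis add_eq_0_iff)
  qed
  have conn: "\<exists>q. \<forall>a b. nab g Z x a b = (Z x $ a * cvec (n x) $ b - cvec (n x) $ a * Z x $ b) / s x
        + q * (cvec (l x) $ a * Z x $ b - Z x $ a * cvec (l x) $ b) / cnj (s x)
    \<and> complex_of_real (nab g l x a b) = (Z x $ a * vcnj (Z x) $ b - cvec (n x) $ a * cvec (l x) $ b) / s x
        + (vcnj (Z x) $ a * Z x $ b - cvec (n x) $ a * cvec (l x) $ b) / cnj (s x)
    \<and> cnj (pd a s x) = - cvec (n x) $ a + q * cvec (l x) $ a
    \<and> complex_of_real (nab g n x a b) = (q / cnj (s x) + cnj q / s x) * cvec (l x) $ a * cvec (n x) $ b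
        - cnj q / s x * vcnj (Z x) $ a * Z x $ b - q / cnj (s x) * Z x $ a * vcnj (Z x) $ b" if x: "x \<in> U1" for x
  proof -
    have xM: "x \<in> M" using x U1 by auto
    interpret tetrad_at g x M "s x * cnj (s x)" "cvec (l x)" "cvec (n x)" "Z x" "vcnj (Z x)"
      using stM xM pw2[OF x] by unfold_locales auto
    have d: "s differentiable at x" "(\<lambda>y. cnj (s y)) differentiable at x" "(\<lambda>y. S y $ b $ c) differentiable at x"
      "(\<lambda>y. l y $ b) differentiable at x" "(\<lambda>y. n y $ b) differentiable at x" "(\<lambda>y. Z y $ b) differentiable at x"
      "(\<lambda>y. complex_of_real (l y $ b)) differentiable at x" "(\<lambda>y. complex_of_real (n y $ b)) differentiable at x"
      "(\<lambda>y. cnj (Z y $ b)) differentiable at x" "(\<lambda>y. complex_of_real (g y $ b $ c)) differentiable at x"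
      "(\<lambda>y. g y $ b $ c) differentiable at x" for b c
      by (rule smooth_on_differentiable[OF _ x], intro smooth_on_cnj smooth_on_of_real sms sm1 sml smn smZ U1 spacetime_smooth[OF st1])+
    have w: "nab g (\<lambda>y. cvec (l y)) x a b = complex_of_real (nab g l x a b)" for a b by (rule nab_cvec[OF d(4)])
    note nW = nabla2_wedge[where h="\<lambda>y. cnj (s y)" and S=S and p="\<lambda>y. cvec (l y)" and q=Z and g=g, OF U1(1) x]
    have E1: "cnj (s x) * nabla2 g S x a b c + cnj (pd a s x) * S x $ b $ c =
        complex_of_real (nab g l x a b) * Z x $ c + cvec (l x) $ b * nab g Z x a c
        - complex_of_real (nab g l x a c) * Z x $ b - cvec (l x) $ c * nab g Z x a b" for a b c
      using nW[of a b c] pw2 d by (simp add: w pd_cnj)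
    have nS: "nabla2 g S x a b c = - (2 * cvec (n x) $ a * wedge (cvec (l x)) (Z x) $ b $ c
        + Z x $ a * (wedge (Z x) (vcnj (Z x)) $ b $ c - wedge (cvec (l x)) (cvec (n x)) $ b $ c)) / (s x * cnj (s x))" for a b c
    proof -
      have "up (Zc x) m = - 3 * up (Z x) m" for m
        unfolding sharp_def sum_distrib_left by (intro sum.cong refl) (simp add: Z_def)
      then have "3 * nabla2 g S x a b c = - 6 * (\<Sum>m\<in>UNIV. up (Z x) m * calG g x m a b c)"
        unfolding CK[OF xM] by (simp add: sum_distrib_left mult.assoc flip: sum_negf)
      moreover have "u = - 2 * v" if "3 * u = - 6 * v" for u v :: complex
        using that by algebra
      ultimately have "nabla2 g S x a b c = - 2 * (\<Sum>m\<in>UNIV. up (Z x) m * calG g x m a b c)" by blast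
      moreover have half: "- 2 * (u / (2 * v)) = - u / v" for u v :: complex by simp
      ultimately show ?thesis unfolding calG_z half by blast
    qed
    define rl where "rl = complex_of_real"
    show ?thesis
      unfolding rl_def[symmetric]
    proof (rule connection_coefficients[where X="\<lambda>a b. rl (nab g l x a b)" and Y="\<lambda>a b. rl (nab g n x a b)" and F="nab g Z x"
          and sig="\<lambda>a. cnj (pd a s x)" and r="s x", OF refl refl])
      show "nab g Z x a b + nab g Z x b a = 0" for a b by (rule killing[OF x])
      have sS: "S x $ b $ c = wedge (cvec (l x)) (Z x) $ b $ c / cnj (s x)" for b c
        using pw2[OF x] sne[OF x] by (simp add: field_simps)
      show "- (2 * cvec (n x) $ a * wedge (cvec (l x)) (Z x) $ b $ c
          + Z x $ a * (wedge (Z x) (vcnj (Z x)) $ b $ c - wedge (cvec (l x)) (cvec (n x)) $ b $ c)) / s x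
        + cnj (pd a s x) * wedge (cvec (l x)) (Z x) $ b $ c / cnj (s x) =
        rl (nab g l x a b) * Z x $ c + cvec (l x) $ b * nab g Z x a c - rl (nab g l x a c) * Z x $ b - cvec (l x) $ c * nab g Z x a b" for a b c
        unfolding rl_def E1[symmetric] nS unfolding sS using sne[OF x] by simp
      define G where "G = (\<lambda>y b c. - cvec (l y) $ b * cvec (n y) $ c - cvec (n y) $ b * cvec (l y) $ c
          + Z y $ b * vcnj (Z y) $ c + vcnj (Z y) $ b * Z y $ c)"
      have G: "s y * cnj (s y) * complex_of_real (g y $ b $ c) = G y b c" if "y \<in> U1" for y b c
        using pw2[OF that] by (simp add: null_tetrad_def G_def)
      show "(cnj (pd a s x) * s x + cnj (cnj (pd a s x)) * cnj (s x)) * complex_of_real (g x $ b $ c) =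
        - rl (nab g l x a b) * cvec (n x) $ c - cvec (l x) $ b * rl (nab g n x a c) - rl (nab g n x a b) * cvec (l x) $ c - cvec (n x) $ b * rl (nab g l x a c)
        + nab g Z x a b * vcnj (Z x) $ c + Z x $ b * cnj (nab g Z x a c) + cnj (nab g Z x a b) * Z x $ c + vcnj (Z x) $ b * nab g Z x a c" for a b c
      proof -
        have "pd a (\<lambda>y. s y * cnj (s y) * complex_of_real (g y $ b $ c)) x = pd a (\<lambda>y. G y b c) x"
          by (rule pd_cong[OF U1(1) x G])
        moreover have "pd a (\<lambda>y. s y * cnj (s y) * complex_of_real (g y $ b $ c)) x =
            (cnj (pd a s x) * s x + pd a s x * cnj (s x)) * complex_of_real (g x $ b $ c)
            + s x * cnj (s x) * complex_of_real (pd a (\<lambda>y. g y $ b $ c) x)"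
          by (simp add: pd_mult pd_cnj pd_of_real d differentiable_mult algebra_simps)
        moreover have "s x * cnj (s x) * complex_of_real (pd a (\<lambda>y. g y $ b $ c) x) =
            (\<Sum>k\<in>UNIV. complex_of_real (christoffel g k a b x) * G x k c) + (\<Sum>k\<in>UNIV. complex_of_real (christoffel g k a c x) * G x b k)"
          unfolding metric_compatible[OF stM xM] of_real_add of_real_sum of_real_mult G[OF x, symmetric] distrib_left sum_distrib_left
          by (intro arg_cong2[of _ _ _ _ "(+)"] sum.cong refl) (simp_all only: mult_ac)
        moreover have "pd a (\<lambda>y. G y b c) x = - complex_of_real (pd a (\<lambda>y. l y $ b) x) * cvec (n x) $ c - cvec (l x) $ b * complex_of_real (pd a (\<lambda>y. n y $ c) x)
            - complex_of_real (pd a (\<lambda>y. n y $ b) x) * cvec (l x) $ c - cvec (n x) $ b * complex_of_real (pd a (\<lambda>y. l y $ c) x)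
            + pd a (\<lambda>y. Z y $ b) x * cnj (Z x $ c) + Z x $ b * cnj (pd a (\<lambda>y. Z y $ c) x)
            + cnj (pd a (\<lambda>y. Z y $ b) x) * Z x $ c + cnj (Z x $ b) * pd a (\<lambda>y. Z y $ c) x"
          unfolding G_def by (simp add: pd_mult pd_add pd_diff pd_minus pd_cnj pd_of_real d differentiable_mult
              differentiable_add differentiable_diff differentiable_minus algebra_simps)
        ultimately have "(cnj (pd a s x) * s x + pd a s x * cnj (s x)) * complex_of_real (g x $ b $ c) =
            - complex_of_real (pd a (\<lambda>y. l y $ b) x) * cvec (n x) $ c - cvec (l x) $ b * complex_of_real (pd a (\<lambda>y. n y $ c) x)
            - complex_of_real (pd a (\<lambda>y. n y $ b) x) * cvec (l x) $ c - cvec (n x) $ b * complex_of_real (pd a (\<lambda>y. l y $ c) x)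
            + pd a (\<lambda>y. Z y $ b) x * cnj (Z x $ c) + Z x $ b * cnj (pd a (\<lambda>y. Z y $ c) x)
            + cnj (pd a (\<lambda>y. Z y $ b) x) * Z x $ c + cnj (Z x $ b) * pd a (\<lambda>y. Z y $ c) x
            - ((\<Sum>k\<in>UNIV. complex_of_real (christoffel g k a b x) * G x k c) + (\<Sum>k\<in>UNIV. complex_of_real (christoffel g k a c x) * G x b k))"
          by (simp add: algebra_simps)
        then show ?thesis unfolding rl_def complex_cnj_cnj nab_def G_def sum4
          by (simp add: scaleR_conv_of_real algebra_simps)
      qed
    qed (simp_all add: rl_def)
  qed
  \<comment> \<open>A nonzero component of l \<and> Z at \<open>p\<close> is needed to solve
    smoothly for the coefficient q, so far known only to exist point by point.\<close>
  have "\<exists>i0 j0. wedge (cvec (l p)) (Z p) $ i0 $ j0 \<noteq> 0"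
  proof (rule ccontr)
    assume "\<not> ?thesis"
    moreover have "cnj (s p) * S p $ b $ c = wedge (cvec (l p)) (Z p) $ b $ c" for b c
      using pw2[OF U1(3)] by blast
    ultimately have "cnj (s p) * S p $ b $ c = 0" for b c by presburger
    then have S0: "S p $ b $ c = 0" for b c using sne[OF U1(3)] by simp
    have "mu p = 0" by (simp add: mu_def vec_eq_iff S0)
    then have "c p = 0" by (simp add: c_def cinner_def)
    then show False using cpos[OF U1(3)] by simp
  qed
  then obtain i0 j0 where ij: "wedge (cvec (l p)) (Z p) $ i0 $ j0 \<noteq> 0" by blast
  define W where "W = (\<lambda>x. wedge (cvec (l x)) (Z x) $ i0 $ j0)"
  have smW: "smooth_on U1 W" unfolding W_def wedge_def vec_lambda_beta cvec_nth
    by (intro smooth_on_diff smooth_on_mult smooth_on_of_real sml smZ U1)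
  define U where "U = {x \<in> U1. W x \<noteq> 0}"
  have U: "open U" "U \<subseteq> U1" "p \<in> U"
  proof -
    have "open (U1 \<inter> W -` (- {0}))"
      by (rule continuous_open_preimage[OF smooth_on_continuous_on[OF smW] U1(1)]) (simp add: open_Compl)
    then show "open U" by (simp add: U_def vimage_def Int_def)
  qed (use ij U1 in \<open>auto simp: U_def W_def\<close>)
  have stU: "spacetime U g" using spacetime_subset[OF st1] U by auto
  \<comment> \<open>The i0, j0 component of the formula for \<nabla>Z, solved for q.\<close>
  define Q where "Q = (\<lambda>x. cnj (s x) * (nab g Z x i0 j0
      - (Z x $ i0 * cvec (n x) $ j0 - cvec (n x) $ i0 * Z x $ j0) / s x) / W x)"
  have conn: "nab g Z x a b = (Z x $ a * cvec (n x) $ b - cvec (n x) $ a * Z x $ b) / s x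
        + Q x * (cvec (l x) $ a * Z x $ b - Z x $ a * cvec (l x) $ b) / cnj (s x)"
    "complex_of_real (nab g l x a b) = (Z x $ a * vcnj (Z x) $ b - cvec (n x) $ a * cvec (l x) $ b) / s x
        + (vcnj (Z x) $ a * Z x $ b - cvec (n x) $ a * cvec (l x) $ b) / cnj (s x)"
    "cnj (pd a s x) = - cvec (n x) $ a + Q x * cvec (l x) $ a"
    "complex_of_real (nab g n x a b) = (Q x / cnj (s x) + cnj (Q x) / s x) * cvec (l x) $ a * cvec (n x) $ b
        - cnj (Q x) / s x * vcnj (Z x) $ a * Z x $ b - Q x / cnj (s x) * Z x $ a * vcnj (Z x) $ b"
    if x: "x \<in> U" for x a b
  proof -
    have x1: "x \<in> U1" and W: "W x \<noteq> 0" using x by (auto simp: U_def)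
    obtain q where q: "\<forall>a b. nab g Z x a b = (Z x $ a * cvec (n x) $ b - cvec (n x) $ a * Z x $ b) / s x
        + q * (cvec (l x) $ a * Z x $ b - Z x $ a * cvec (l x) $ b) / cnj (s x)
    \<and> complex_of_real (nab g l x a b) = (Z x $ a * vcnj (Z x) $ b - cvec (n x) $ a * cvec (l x) $ b) / s x
        + (vcnj (Z x) $ a * Z x $ b - cvec (n x) $ a * cvec (l x) $ b) / cnj (s x)
    \<and> cnj (pd a s x) = - cvec (n x) $ a + q * cvec (l x) $ a
    \<and> complex_of_real (nab g n x a b) = (q / cnj (s x) + cnj q / s x) * cvec (l x) $ a * cvec (n x) $ b
        - cnj q / s x * vcnj (Z x) $ a * Z x $ b - q / cnj (s x) * Z x $ a * vcnj (Z x) $ b"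
      using conn[OF x1] by blast
    have w: "cvec (l x) $ i0 * Z x $ j0 - Z x $ i0 * cvec (l x) $ j0 = W x" by (simp add: W_def wedge_def)
    have "nab g Z x i0 j0 - (Z x $ i0 * cvec (n x) $ j0 - cvec (n x) $ i0 * Z x $ j0) / s x = q * W x / cnj (s x)"
      using q[rule_format, of i0 j0] unfolding w by simp
    then have "Q x = q" unfolding Q_def using W sne[OF x1] by simp
    then show "nab g Z x a b = (Z x $ a * cvec (n x) $ b - cvec (n x) $ a * Z x $ b) / s x
        + Q x * (cvec (l x) $ a * Z x $ b - Z x $ a * cvec (l x) $ b) / cnj (s x)"
    "complex_of_real (nab g l x a b) = (Z x $ a * vcnj (Z x) $ b - cvec (n x) $ a * cvec (l x) $ b) / s x
        + (vcnj (Z x) $ a * Z x $ b - cvec (n x) $ a * cvec (l x) $ b) / cnj (s x)"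
    "cnj (pd a s x) = - cvec (n x) $ a + Q x * cvec (l x) $ a"
    "complex_of_real (nab g n x a b) = (Q x / cnj (s x) + cnj (Q x) / s x) * cvec (l x) $ a * cvec (n x) $ b
        - cnj (Q x) / s x * vcnj (Z x) $ a * Z x $ b - Q x / cnj (s x) * Z x $ a * vcnj (Z x) $ b"
      using q by blast+
  qed
  have smU: "smooth_on U (\<lambda>x. l x $ b)" "smooth_on U (\<lambda>x. n x $ b)" "smooth_on U (\<lambda>x. Z x $ b)" "smooth_on U s" "smooth_on U W" for b
    using smooth_on_subset[OF _ U(2)] sml smn smZ sms smW by blast+
  have neU: "s x \<noteq> 0" "W x \<noteq> 0" if "x \<in> U" for x using that sne U by (auto simp: U_def)
  have smQ: "smooth_on U Q" unfolding Q_def nab_def cvec_nth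
    by (intro smooth_on_divide smooth_on_diff smooth_on_mult smooth_on_of_real smooth_on_cnj smooth_on_pd smooth_on_sum
        smooth_on_scaleR smooth_on_christoffel[OF stU] smU U neU) auto
  have dQ: "Q x = cnj (Q x) \<and> (\<exists>d. \<forall>a. cnj (pd a Q x) = d * cvec (l x) $ a)" if x: "x \<in> U" for x
  proof -
    have xM: "x \<in> M" "x \<in> U1" using x U U1 by auto
    interpret tetrad_at g x M "s x * cnj (s x)" "cvec (l x)" "cvec (n x)" "Z x" "vcnj (Z x)"
      using stM xM pw2[OF xM(2)] by unfold_locales auto
    have d: "Q differentiable at x" "s differentiable at x"
      "(\<lambda>y. l y $ b) differentiable at x" "(\<lambda>y. n y $ b) differentiable at x" "(\<lambda>y. cnj (Q y)) differentiable at x"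
      "(\<lambda>y. complex_of_real (l y $ b)) differentiable at x" "(\<lambda>y. complex_of_real (n y $ b)) differentiable at x" for b
      by (rule smooth_on_differentiable[OF _ x], intro smooth_on_cnj smooth_on_of_real smU smQ U)+
    have ds: "pd a s y = - cvec (n y) $ a + cnj (Q y) * cvec (l y) $ a" if "y \<in> U" for y a
      using arg_cong[OF conn(3)[OF that, of a], of cnj] by simp
    have dds: "pd b (pd a s) x = - complex_of_real (pd b (\<lambda>y. n y $ a) x) + cnj (Q x) * complex_of_real (pd b (\<lambda>y. l y $ a) x)
        + cnj (pd b Q x) * cvec (l x) $ a" for a b
    proof -
      have "pd b (pd a s) x = pd b (\<lambda>y. - complex_of_real (n y $ a) + cnj (Q y) * complex_of_real (l y $ a)) x"
        by (rule pd_cong[OF U(1) x]) (simp add: ds)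
      then show ?thesis
        by (simp add: pd_add pd_diff pd_minus pd_mult pd_cnj pd_of_real d differentiable_add
            differentiable_diff differentiable_minus differentiable_mult)
    qed
    have sym: "- complex_of_real (nab g n x b a) + complex_of_real (nab g n x a b)
        + cnj (Q x) * (complex_of_real (nab g l x b a) - complex_of_real (nab g l x a b))
        + cnj (pd b Q x) * cvec (l x) $ a - cnj (pd a Q x) * cvec (l x) $ b = 0" for a b
    proof -
      have "nab g n x b a - nab g n x a b = pd b (\<lambda>y. n y $ a) x - pd a (\<lambda>y. n y $ b) x"
        "nab g l x b a - nab g l x a b = pd b (\<lambda>y. l y $ a) x - pd a (\<lambda>y. l y $ b) x"
        by (rule nab_antisym[OF stM xM(1)])+
      from arg_cong[OF this(1), of complex_of_real] arg_cong[OF this(2), of complex_of_real]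
      have 1: "- complex_of_real (nab g n x b a) + complex_of_real (nab g n x a b) = - (complex_of_real (pd b (\<lambda>y. n y $ a) x) - complex_of_real (pd a (\<lambda>y. n y $ b) x))"
        and 2: "complex_of_real (nab g l x b a) - complex_of_real (nab g l x a b) = complex_of_real (pd b (\<lambda>y. l y $ a) x) - complex_of_real (pd a (\<lambda>y. l y $ b) x)"
        by (simp_all add: algebra_simps)
      have "pd b (pd a s) x = pd a (pd b s) x" by (rule pd_commute[OF smU(4) U(1) x])
      then show ?thesis unfolding dds 1 2 by (simp add: algebra_simps)
    qed
    obtain d0 d1 d2 d3 where dd: "\<And>a. cnj (pd a Q x) = d0 * cvec (l x) $ a + d1 * cvec (n x) $ a + d2 * Z x $ a + d3 * vcnj (Z x) $ a"
      using expansion[of "\<lambda>a. cnj (pd a Q x)"] by blast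
    define E where "E = (Q x - cnj (Q x)) / cnj (s x)"
    \<comment> \<open>Equality of the mixed derivatives of s. Its Z, Z* component is a multiple of Q
      - Q*, so Q is real; the components containing \<open>l\<close> then show that dQ is parallel
      to \<open>l\<close>.\<close>
    have "(0::complex) = 0 \<and> E + d1 = 0 \<and> d2 = 0 \<and> d3 = 0 \<and> - (E + d1) = 0 \<and> (0::complex) = 0 \<and> (0::complex) = 0 \<and> (0::complex) = 0 \<and>
      - d2 = 0 \<and> (0::complex) = 0 \<and> (0::complex) = 0 \<and> - E = 0 \<and> - d3 = 0 \<and> (0::complex) = 0 \<and> E = 0 \<and> (0::complex) = 0"
    proof (rule independent2)
      fix b a
      show "(0 * cvec (l x) $ b + (E + d1) * cvec (n x) $ b + d2 * Z x $ b + d3 * vcnj (Z x) $ b) * cvec (l x) $ a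
        + (- (E + d1) * cvec (l x) $ b + 0 * cvec (n x) $ b + 0 * Z x $ b + 0 * vcnj (Z x) $ b) * cvec (n x) $ a
        + (- d2 * cvec (l x) $ b + 0 * cvec (n x) $ b + 0 * Z x $ b + - E * vcnj (Z x) $ b) * Z x $ a
        + (- d3 * cvec (l x) $ b + 0 * cvec (n x) $ b + E * Z x $ b + 0 * vcnj (Z x) $ b) * vcnj (Z x) $ a = 0"
        using sym[of b a] unfolding conn(2)[OF x] conn(4)[OF x] dd E_def
        by (simp add: add_divide_distrib diff_divide_distrib algebra_simps del: cvec_nth vcnj_nth)
    qed
    then have "E = 0" "d1 = 0" "d2 = 0" "d3 = 0" by auto
    then show ?thesis using neU[OF x] dd by (auto simp: E_def)
  qed
  define lam where "lam = (\<lambda>x. Re (Q x))"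
  have Q: "Q x = complex_of_real (lam x)" "cnj (Q x) = complex_of_real (lam x)" if "x \<in> U" for x
    using dQ[OF that] by (simp_all add: lam_def complex_eq_iff)
  have "spinor_frame U g l n Z s lam"
  proof
    show "spacetime U g" by (rule stU)
    show "smooth_on U l" "smooth_on U n" "smooth_on U Z" "smooth_on U s" "smooth_on U lam"
      unfolding lam_def using smU smooth_on_Re[OF U(1) smQ] by (simp_all add: smooth_on_vec_iff[OF U(1)])
    fix x a b assume x: "x \<in> U"
    then have x1: "x \<in> U1" using U by auto
    show "null_tetrad (g x) (s x * cnj (s x)) (cvec (l x)) (cvec (n x)) (Z x) (vcnj (Z x))" using pw2[OF x1] by blast
    show "complex_of_real (nab g l x a b) =
      (Z x $ a * cnj (Z x $ b) - cvec (n x) $ a * cvec (l x) $ b) / s x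
      + (cnj (Z x $ a) * Z x $ b - cvec (n x) $ a * cvec (l x) $ b) / cnj (s x)"
      using conn(2)[OF x, of a b] by simp
    show "nab g Z x a b = (Z x $ a * cvec (n x) $ b - cvec (n x) $ a * Z x $ b) / s x
      + lam x * (cvec (l x) $ a * Z x $ b - Z x $ a * cvec (l x) $ b) / cnj (s x)"
      using conn(1)[OF x, of a b] unfolding Q[OF x] .
    show "complex_of_real (nab g n x a b) =
      lam x * ((cvec (l x) $ a * cvec (n x) $ b - cnj (Z x $ a) * Z x $ b) / s x
      + (cvec (l x) $ a * cvec (n x) $ b - Z x $ a * cnj (Z x $ b)) / cnj (s x))"
      unfolding conn(4)[OF x, of a b] Q[OF x]
      by (simp add: add_divide_distrib diff_divide_distrib algebra_simps)
    show "pd a s x = - cvec (n x) $ a + lam x * cvec (l x) $ a"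
      using arg_cong[OF conn(3)[OF x, of a], of cnj] Q[OF x] by simp
    obtain d where d: "\<And>a. cnj (pd a Q x) = d * cvec (l x) $ a" using dQ[OF x] by blast
    have "pd a lam x = Re d * l x $ a" for a
      using arg_cong[OF d[of a], of Re] pd_Re[OF smooth_on_differentiable[OF smQ x]] by (simp add: lam_def)
    then show "\<exists>c. \<forall>a. pd a lam x = c * l x $ a" by blast
  qed
  moreover have "cnj (s x) * selfdual g A x $ a $ b = wedge (cvec (l x)) (Z x) $ a $ b" if "x \<in> U" for x a b
    using pw2[of x] that U by (auto simp: S_def)
  ultimately show thesis using that[of U l n Z s lam] U U1 by auto
qed

section \<open>The Killing-Yano tensor of a spinor frame\<close>

lemma (in tetrad_at) alt4_two_sharps:
  "(\<Sum>c\<in>UNIV. \<Sum>d\<in>UNIV. alt4 l n z w a b c d * (up p c * up q d)) =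
     wedge l n $ a $ b * (cinner g x z p * cinner g x w q - cinner g x w p * cinner g x z q)
   - wedge l z $ a $ b * (cinner g x n p * cinner g x w q - cinner g x w p * cinner g x n q)
   + wedge l w $ a $ b * (cinner g x n p * cinner g x z q - cinner g x z p * cinner g x n q)
   + wedge n z $ a $ b * (cinner g x l p * cinner g x w q - cinner g x w p * cinner g x l q)
   - wedge n w $ a $ b * (cinner g x l p * cinner g x z q - cinner g x z p * cinner g x l q)
   + wedge z w $ a $ b * (cinner g x l p * cinner g x n q - cinner g x n p * cinner g x l q)"
  unfolding up_wedge'[symmetric] alt4_def sum_distrib_left sum.distrib[symmetric] sum_subtractf[symmetric]
  by (intro sum.cong refl) (simp add: algebra_simps)

lemma raise_wedge:
  "(\<Sum>c\<in>UNIV. \<Sum>d\<in>UNIV. complex_of_real (h a c) * complex_of_real (h b d) * wedge p q $ c $ d) =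
   (\<Sum>c\<in>UNIV. complex_of_real (h a c) * p $ c) * (\<Sum>d\<in>UNIV. complex_of_real (h b d) * q $ d)
   - (\<Sum>c\<in>UNIV. complex_of_real (h a c) * q $ c) * (\<Sum>d\<in>UNIV. complex_of_real (h b d) * p $ d)"
  unfolding sum_product sum_subtractf[symmetric]
  by (intro sum.cong refl) (simp add: wedge_def algebra_simps)

text \<open>The Hodge dual multiplies l \<and> z by i and l \<and> w by -i, so A - i *A keeps only
  the first summand.\<close>

lemma (in tetrad_at) hodge_null:
  assumes w: "w = vcnj z" and lr: "l = cvec lr" and r: "N = r * cnj r"
    and A: "\<And>a b. complex_of_real (A x $ a $ b) =
      (wedge l z $ a $ b / cnj r + wedge l w $ a $ b / r) / complex_of_real (sqrt 2)"
  shows "selfdual g A x $ a $ b = wedge l z $ a $ b / cnj r"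
proof -
  have r0: "r \<noteq> 0" using N r by auto
  define U where "U = (\<lambda>c d. complex_of_real ((ginv g x ** A x ** transpose (ginv g x)) $ c $ d))"
  have up2: "(\<Sum>e\<in>UNIV. \<Sum>f\<in>UNIV. complex_of_real (ginv g x $ c $ e) * complex_of_real (ginv g x $ d $ f) * wedge p q $ e $ f) =
      up p c * up q d - up q c * up p d" for c d p q
    unfolding raise_wedge sharp_def ..
  have "U c d = (\<Sum>e\<in>UNIV. \<Sum>f\<in>UNIV. complex_of_real (ginv g x $ c $ e) * complex_of_real (ginv g x $ d $ f) * complex_of_real (A x $ e $ f))" for c d
    unfolding U_def matrix_matrix_mult_def transpose_def
    by (simp add: sum_distrib_right, subst sum.swap) (simp add: mult_ac)
  also have "(\<lambda>c d. \<Sum>e\<in>UNIV. \<Sum>f\<in>UNIV. complex_of_real (ginv g x $ c $ e) * complex_of_real (ginv g x $ d $ f) * complex_of_real (A x $ e $ f)) =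
    (\<lambda>c d. ((\<Sum>e\<in>UNIV. \<Sum>f\<in>UNIV. complex_of_real (ginv g x $ c $ e) * complex_of_real (ginv g x $ d $ f) * wedge l z $ e $ f) / cnj r
      + (\<Sum>e\<in>UNIV. \<Sum>f\<in>UNIV. complex_of_real (ginv g x $ c $ e) * complex_of_real (ginv g x $ d $ f) * wedge l w $ e $ f) / r) / complex_of_real (sqrt 2))"
    unfolding A by (intro ext) (simp add: sum_divide_distrib sum.distrib[symmetric] add_divide_distrib distrib_left)
  finally have U: "U c d = ((up l c * up z d - up z c * up l d) / cnj r + (up l c * up w d - up w c * up l d) / r) / complex_of_real (sqrt 2)" for c d
    unfolding up2 .
  define V where "V = (\<lambda>p q. \<Sum>c\<in>UNIV. \<Sum>d\<in>UNIV. alt4 l n z w a b c d * (up p c * up q d))"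
  have "complex_of_real (hodge g A x $ a $ b) =
      (\<Sum>c\<in>UNIV. \<Sum>d\<in>UNIV. (\<i> / N\<^sup>2 * alt4 l n z w a b c d) * U c d) / 2"
    unfolding vol_alt4[symmetric] U_def by (simp add: hodge_def)
  also have "\<dots> = (\<i> / N\<^sup>2) * ((V l z - V z l) / cnj r + (V l w - V w l) / r) / complex_of_real (sqrt 2) / 2"
    unfolding U V_def sum_divide_distrib sum_distrib_left sum.distrib[symmetric] sum_subtractf[symmetric]
    by (intro sum.cong refl) (simp add: add_divide_distrib diff_divide_distrib algebra_simps)
  also have "\<dots> = \<i> * (wedge l z $ a $ b / cnj r - wedge l w $ a $ b / r) / complex_of_real (sqrt 2)"
    unfolding V_def alt4_two_sharps using N r0
    by (simp add: cinner_tetrad field_simps power2_eq_square)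
  finally have h: "complex_of_real (hodge g A x $ a $ b) = \<dots>" .
  have sq: "complex_of_real (sqrt 2) * complex_of_real (sqrt 2) = 2" by (simp flip: of_real_mult)
  have 2: "(u + v) / t / t - \<i> * (\<i> * (u - v) / t) / t = u" if "t * t = 2" for u v t :: complex
  proof -
    have "t \<noteq> 0" using that by auto
    then have "(u + v) / t / t - \<i> * (\<i> * (u - v) / t) / t = (2 * u) / (t * t)"
      by (simp add: field_simps)
    then show ?thesis using that by simp
  qed
  show ?thesis
    unfolding selfdual_def vec_lambda_beta A h diff_divide_distrib[of _ "\<i> * _"] by (rule 2[OF sq])
qed

lemma (in tetrad_at) null_contraction:
  "(\<Sum>a\<in>UNIV. \<Sum>b\<in>UNIV. \<Sum>c\<in>UNIV. \<Sum>d\<in>UNIV.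
      complex_of_real (ginv g x $ a $ c) * complex_of_real (ginv g x $ b $ d) * wedge l z $ a $ b * wedge l z $ c $ d) = 0"
proof -
  have "(\<Sum>a\<in>UNIV. \<Sum>b\<in>UNIV. \<Sum>c\<in>UNIV. \<Sum>d\<in>UNIV.
      complex_of_real (ginv g x $ a $ c) * complex_of_real (ginv g x $ b $ d) * wedge l z $ a $ b * wedge l z $ c $ d) =
    (\<Sum>a\<in>UNIV. \<Sum>b\<in>UNIV. wedge l z $ a $ b * (\<Sum>c\<in>UNIV. \<Sum>d\<in>UNIV.
      complex_of_real (ginv g x $ a $ c) * complex_of_real (ginv g x $ b $ d) * wedge l z $ c $ d))"
    unfolding sum_distrib_left by (intro sum.cong refl) (simp add: mult_ac)
  also have "\<dots> = (\<Sum>a\<in>UNIV. \<Sum>b\<in>UNIV. wedge l z $ a $ b * (up l a * up z b - up z a * up l b))"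
    unfolding raise_wedge sharp_def ..
  also have "\<dots> = (\<Sum>a\<in>UNIV. \<Sum>b\<in>UNIV. up l a * up z b * wedge l z $ a $ b) - (\<Sum>a\<in>UNIV. \<Sum>b\<in>UNIV. up z a * up l b * wedge l z $ a $ b)"
    unfolding sum_subtractf[symmetric] by (intro sum.cong refl) (simp add: algebra_simps)
  also have "\<dots> = 0" unfolding up_wedge' by (simp add: cinner_tetrad)
  finally show ?thesis .
qed

context spinor_frame
begin

lemma U: "open U" using st by (rule spacetime_open)

lemma smooth_nth: "smooth_on U (\<lambda>x. l x $ a)" "smooth_on U (\<lambda>x. n x $ a)" "smooth_on U (\<lambda>x. Z x $ a)"
  using smooth U smooth_on_nth by blast+

lemma tetrad: "x \<in> U \<Longrightarrow> tetrad_at g x U (s x * cnj (s x)) (cvec (l x)) (cvec (n x)) (Z x) (vcnj (Z x))"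
  unfolding tetrad_at_def using st tet by blast

lemma s_nonzero: "x \<in> U \<Longrightarrow> s x \<noteq> 0"
  using tet[of x] by (auto simp: null_tetrad_def)

lemma differentiable:
  assumes "x \<in> U"
  shows "s differentiable at x" "(\<lambda>y. cnj (s y)) differentiable at x" "lam differentiable at x"
    "(\<lambda>y. l y $ b) differentiable at x" "(\<lambda>y. n y $ b) differentiable at x" "(\<lambda>y. Z y $ b) differentiable at x"
    "(\<lambda>y. complex_of_real (l y $ b)) differentiable at x" "(\<lambda>y. complex_of_real (n y $ b)) differentiable at x"
    "(\<lambda>y. cnj (Z y $ b)) differentiable at x"
  by (rule smooth_on_differentiable[OF _ assms], intro smooth smooth_nth smooth_on_cnj smooth_on_of_real U)+

lemma fundamental:
  assumes x: "x \<in> U" and A: "\<And>a b. cnj (s x) * selfdual g A x $ a $ b = wedge (cvec (l x)) (Z x) $ a $ b"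
  shows "fundamental_at g A x (l x)"
proof -
  interpret tetrad_at g x U "s x * cnj (s x)" "cvec (l x)" "cvec (n x)" "Z x" "vcnj (Z x)" by (rule tetrad[OF x])
  define m where "m = (1 / cnj (s x)) *s Z x"
  have "(\<chi> a. cnj (m $ a)) = (1 / s x) *s vcnj (Z x)" by (simp add: vec_eq_iff m_def)
  moreover have "selfdual g A x = wedge (cvec (l x)) m"
    using A s_nonzero[OF x] by (simp add: vec_eq_iff m_def wedge_def field_simps)
  ultimately show ?thesis unfolding fundamental_at_def using s_nonzero[OF x]
    by (intro conjI exI[of _ m]) (simp_all add: m_def cinner_scale cinner_tetrad)
qed

text \<open>Converse of \<open>null_CKY_spinor_frame\<close>: every spinor frame comes from a CKY
  tensor with the required codifferentials. In the twisting case this produces the tensor that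
  belongs to the new frame.\<close>

lemma Killing_Yano:
  obtains A where "CKY_on U g A" "null_on U g A" "independent_Killing_codiffs_on U g A"
    "\<And>x. x \<in> U \<Longrightarrow> fundamental_at g A x (l x)"
proof -
  \<comment> \<open>The factor sqrt 2 compensates the normalisation of \<open>selfdual\<close>, so
    that the self-dual part is (l \<and> Z)/s*.\<close>
  define A where "A = (\<lambda>x. \<chi> a b. sqrt 2 * Re (wedge (cvec (l x)) (Z x) $ a $ b / cnj (s x)))"
  define S where "S = selfdual g A"
  have smA: "smooth_on U A" unfolding A_def wedge_def vec_lambda_beta cvec_nth using s_nonzero
    by (intro smooth_on_vec smooth_on_mult smooth_on_Re smooth_on_divide smooth_on_diff smooth_on_of_real
        smooth_on_const smooth_on_cnj smooth_nth smooth U) simp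
  have Ac: "complex_of_real (A x $ a $ b) = (wedge (cvec (l x)) (Z x) $ a $ b / cnj (s x)
      + wedge (cvec (l x)) (vcnj (Z x)) $ a $ b / s x) / complex_of_real (sqrt 2)" for x a b
  proof -
    define u where "u = wedge (cvec (l x)) (Z x) $ a $ b / cnj (s x)"
    have c: "wedge (cvec (l x)) (vcnj (Z x)) $ a $ b / s x = cnj u" by (simp add: u_def wedge_def)
    have "complex_of_real (sqrt 2) * complex_of_real (sqrt 2) = 2" by (simp flip: of_real_mult)
    then have "complex_of_real (sqrt 2) = 2 / complex_of_real (sqrt 2)" by (simp add: field_simps)
    then have "complex_of_real (sqrt 2 * Re u) = (2 / complex_of_real (sqrt 2)) * complex_of_real (Re u)"
      by (simp only: of_real_mult)
    then show ?thesis unfolding c u_def[symmetric] complex_add_cnj by (simp add: A_def u_def)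
  qed
  have Sx: "S x $ a $ b = wedge (cvec (l x)) (Z x) $ a $ b / cnj (s x)" if x: "x \<in> U" for x a b
  proof -
    interpret tetrad_at g x U "s x * cnj (s x)" "cvec (l x)" "cvec (n x)" "Z x" "vcnj (Z x)" by (rule tetrad[OF x])
    show ?thesis unfolding S_def by (rule hodge_null[where r="s x" and A=A and lr="l x", OF refl refl refl Ac])
  qed
  have smS: "smooth_on U (\<lambda>x. S x $ a $ b)" for a b unfolding S_def by (rule smooth_on_selfdual[OF spinor_frame.st smA]) (rule spinor_frame_axioms)
  have nS: "nabla2 g S x a b c = - (2 * cvec (n x) $ a * wedge (cvec (l x)) (Z x) $ b $ c
        + Z x $ a * (wedge (Z x) (vcnj (Z x)) $ b $ c - wedge (cvec (l x)) (cvec (n x)) $ b $ c)) / (s x * cnj (s x))"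
    if x: "x \<in> U" for x a b c
  proof -
    have s0: "s x \<noteq> 0" by (rule s_nonzero[OF x])
    have "cnj (s x) * nabla2 g S x a b c + cnj (pd a s x) * S x $ b $ c =
        complex_of_real (nab g l x a b) * Z x $ c + cvec (l x) $ b * nab g Z x a c
        - complex_of_real (nab g l x a c) * Z x $ b - cvec (l x) $ c * nab g Z x a b"
      using nabla2_wedge[where h="\<lambda>y. cnj (s y)" and S=S and p="\<lambda>y. cvec (l y)" and q=Z and g=g and a=a and b=b and c=c, OF U x]
        smooth_on_differentiable[OF smS x] differentiable[OF x] s_nonzero
      by (simp add: Sx nab_cvec pd_cnj)
    then have E: "cnj (s x) * nabla2 g S x a b c = complex_of_real (nab g l x a b) * Z x $ c + cvec (l x) $ b * nab g Z x a c
        - complex_of_real (nab g l x a c) * Z x $ b - cvec (l x) $ c * nab g Z x a b - cnj (pd a s x) * (wedge (cvec (l x)) (Z x) $ b $ c / cnj (s x))"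
      unfolding Sx[OF x] by (simp add: algebra_simps)
    have D: "T = R * inverse c" if "c * T = R" "c \<noteq> 0" for c T R :: complex
      using that by (simp add: field_simps)
    have *: "nabla2 g S x a b c = (complex_of_real (nab g l x a b) * Z x $ c + cvec (l x) $ b * nab g Z x a c
        - complex_of_real (nab g l x a c) * Z x $ b - cvec (l x) $ c * nab g Z x a b
        - cnj (pd a s x) * (wedge (cvec (l x)) (Z x) $ b $ c / cnj (s x))) * inverse (cnj (s x))"
      by (rule D[OF E]) (use s0 in simp)
    show ?thesis unfolding * nab_l[OF x] nab_Z[OF x] ds[OF x] wedge_def divide_inverse inverse_mult_distrib
      by (simp add: algebra_simps)
  qed
  define Zc where "Zc = codiff g S"
  have Zc: "Zc x $ c = - 3 * Z x $ c" if x: "x \<in> U" for x c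
  proof -
    interpret tetrad_at g x U "s x * cnj (s x)" "cvec (l x)" "cvec (n x)" "Z x" "vcnj (Z x)" by (rule tetrad[OF x])
    have C: "cinner g x p q = (\<Sum>a\<in>UNIV. \<Sum>b\<in>UNIV. complex_of_real (ginv g x $ a $ b) * (p $ a * q $ b))" for p q
      by (simp add: cinner_def mult.assoc)
    have "Zc x $ c = (\<Sum>a\<in>UNIV. \<Sum>b\<in>UNIV. complex_of_real (ginv g x $ a $ b) * (2 * cvec (n x) $ a * wedge (cvec (l x)) (Z x) $ b $ c
        + Z x $ a * (wedge (Z x) (vcnj (Z x)) $ b $ c - wedge (cvec (l x)) (cvec (n x)) $ b $ c))) / (s x * cnj (s x))"
      unfolding Zc_def codiff_def vec_lambda_beta nS[OF x] scaleR_conv_of_real sum_divide_distrib sum_negf[symmetric]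
      by (intro sum.cong refl) (simp only: minus_divide_left[symmetric] mult_minus_right minus_minus times_divide_eq_right)
    also have "(\<Sum>a\<in>UNIV. \<Sum>b\<in>UNIV. complex_of_real (ginv g x $ a $ b) * (2 * cvec (n x) $ a * wedge (cvec (l x)) (Z x) $ b $ c
        + Z x $ a * (wedge (Z x) (vcnj (Z x)) $ b $ c - wedge (cvec (l x)) (cvec (n x)) $ b $ c))) =
      2 * Z x $ c * cinner g x (cvec (n x)) (cvec (l x)) - 2 * cvec (l x) $ c * cinner g x (cvec (n x)) (Z x)
      + vcnj (Z x) $ c * cinner g x (Z x) (Z x) - Z x $ c * cinner g x (Z x) (vcnj (Z x))
      - cvec (n x) $ c * cinner g x (Z x) (cvec (l x)) + cvec (l x) $ c * cinner g x (Z x) (cvec (n x))"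
      unfolding C sum_distrib_left sum.distrib[symmetric] sum_subtractf[symmetric]
      by (intro sum.cong refl) (simp add: wedge_def algebra_simps)
    also have "\<dots> = - 3 * (s x * cnj (s x)) * Z x $ c" by (simp add: cinner_tetrad algebra_simps)
    finally show ?thesis using s_nonzero[OF x] by simp
  qed
  \<comment> \<open>The two codifferentials are constant real multiples of Re Z and Im Z, so the
    skewness of \<nabla>Z makes both Killing.\<close>
  have Zr: "codiff g A x $ c = - 3 * sqrt 2 * Re (Z x $ c) \<and> codiff g (hodge g A) x $ c = 3 * sqrt 2 * Im (Z x $ c)"
    if x: "x \<in> U" for x c
  proof -
    have "(complex_of_real (codiff g A x $ c) - \<i> * complex_of_real (codiff g (hodge g A) x $ c)) / complex_of_real (sqrt 2) = - 3 * Z x $ c"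
      using codiff_selfdual[OF st smA x, of c] Zc[OF x, of c] by (simp add: Zc_def S_def)
    then have "complex_of_real (codiff g A x $ c) - \<i> * complex_of_real (codiff g (hodge g A) x $ c) = complex_of_real (- 3 * sqrt 2) * Z x $ c"
      by (simp add: field_simps)
    from arg_cong[OF this, of Re] arg_cong[OF this, of Im] show ?thesis by simp
  qed
  have nabk: "nab g V x a b = k * f (nab g Z x a b)"
    if f: "bounded_linear f" and V: "\<And>y c. y \<in> U \<Longrightarrow> V y $ c = k * f (Z y $ c)" and x: "x \<in> U"
    for f :: "complex \<Rightarrow> real" and V k x a b
  proof -
    interpret f: bounded_linear f by fact
    have L: "bounded_linear (\<lambda>z. k * f z)" by (intro bounded_linear_const_mult f)
    have "pd a (\<lambda>y. V y $ b) x = k * f (pd a (\<lambda>y. Z y $ b) x)"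
      using pd_bounded_linear[OF L differentiable(6)[OF x]] pd_cong[OF U x V] by simp
    then show ?thesis unfolding nab_def
      by (simp add: V[OF x] f.diff f.sum f.scaleR right_diff_distrib sum_distrib_left mult_ac)
  qed
  have killing: "nab g Z x a b + nab g Z x b a = 0" if x: "x \<in> U" for x a b
    unfolding nab_Z[OF x] by (simp add: algebra_simps add_divide_distrib diff_divide_distrib)
  have K: "Killing_on U g (codiff g A)" "Killing_on U g (codiff g (hodge g A))"
  proof -
    have "nab g (codiff g A) x a b = (- 3 * sqrt 2) * Re (nab g Z x a b)" if "x \<in> U" for x a b
      by (rule nabk[OF bounded_linear_Re _ that]) (use Zr in blast)
    moreover have "nab g (codiff g (hodge g A)) x a b = (3 * sqrt 2) * Im (nab g Z x a b)" if "x \<in> U" for x a b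
      by (rule nabk[OF bounded_linear_Im _ that]) (use Zr in blast)
    moreover have "c * Re (nab g Z x a b) + c * Re (nab g Z x b a) = 0" "c * Im (nab g Z x a b) + c * Im (nab g Z x b a) = 0"
      if "x \<in> U" for x a b c
      using killing[OF that, of a b] by (simp_all add: complex_eq_iff flip: distrib_left)
    ultimately show "Killing_on U g (codiff g A)" "Killing_on U g (codiff g (hodge g A))"
      unfolding Killing_on_def nabla1_eq_nab by presburger+
  qed
  have ind: "wedge (codiff g A x) (codiff g (hodge g A) x) \<noteq> 0" if x: "x \<in> U" for x
  proof
    assume 0: "wedge (codiff g A x) (codiff g (hodge g A) x) = 0"
    interpret tetrad_at g x U "s x * cnj (s x)" "cvec (l x)" "cvec (n x)" "Z x" "vcnj (Z x)" by (rule tetrad[OF x])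
    have "Re (Z x $ a) * Im (Z x $ b) = Re (Z x $ b) * Im (Z x $ a)" for a b
    proof -
      have "wedge (codiff g A x) (codiff g (hodge g A) x) $ a $ b = 0" using 0 by simp
      then have "18 * (Re (Z x $ b) * Im (Z x $ a) - Re (Z x $ a) * Im (Z x $ b)) = 0"
        by (simp add: wedge_def Zr[OF x] algebra_simps)
      then show ?thesis by simp
    qed
    then have "0 * cvec (l x) $ a + 0 * cvec (n x) $ a + cnj (Z x $ b) * Z x $ a + (- Z x $ b) * vcnj (Z x) $ a = 0" for a b
      by (simp add: complex_eq_iff algebra_simps)
    then have "Z x $ b = 0" for b using independent[of 0 0 "cnj (Z x $ b)" "- Z x $ b"] by simp
    then have "0 * cvec (l x) $ a + 0 * cvec (n x) $ a + 1 * Z x $ a + 0 * vcnj (Z x) $ a = 0" for a by simp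
    then show False using independent[of 0 0 1 0] by simp
  qed
  have "CKY_on U g A"
    unfolding CKY_on_def two_form_on_def
  proof (intro conjI ballI allI)
    show "smooth_on U A" by (rule smA)
    show "transpose (A x) = - A x" for x
      by (simp add: vec_eq_iff transpose_def A_def wedge_def flip: right_diff_distrib)
         (simp add: algebra_simps diff_divide_distrib)
    fix x a b c assume x: "x \<in> U"
    interpret tetrad_at g x U "s x * cnj (s x)" "cvec (l x)" "cvec (n x)" "Z x" "vcnj (Z x)" by (rule tetrad[OF x])
    have "(\<Sum>n\<in>UNIV. complex_of_real (ginv g x $ m $ n) * codiff g (selfdual g A) x $ n) = - 3 * up (Z x) m" for m
      unfolding S_def[symmetric] Zc_def[symmetric] Zc[OF x] sharp_def sum_distrib_left
      by (intro sum.cong refl) simp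
    then have "2 * (\<Sum>m\<in>UNIV. (\<Sum>n\<in>UNIV. complex_of_real (ginv g x $ m $ n) * codiff g (selfdual g A) x $ n) * calG g x m a b c)
        = - 6 * (\<Sum>m\<in>UNIV. up (Z x) m * calG g x m a b c)"
      by (simp add: sum_distrib_left mult.assoc flip: sum_negf)
    also have "\<dots> = 3 * nabla2 g (selfdual g A) x a b c"
    proof -
      have "- 6 * (k / (2 * N)) = 3 * (- k / N)" for k N :: complex by (cases "N = 0") (simp_all add: field_simps)
      then show ?thesis unfolding calG_z nS[OF x, unfolded S_def] .
    qed
    finally show "3 * nabla2 g (selfdual g A) x a b c =
      2 * (\<Sum>m\<in>UNIV. (\<Sum>n\<in>UNIV. complex_of_real (ginv g x $ m $ n) * codiff g (selfdual g A) x $ n) * calG g x m a b c)" ..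
  qed
  moreover have "null_on U g A"
    unfolding null_on_def
  proof (intro ballI conjI)
    fix x assume x: "x \<in> U"
    interpret tetrad_at g x U "s x * cnj (s x)" "cvec (l x)" "cvec (n x)" "Z x" "vcnj (Z x)" by (rule tetrad[OF x])
    show "A x \<noteq> 0"
    proof
      assume A0: "A x = 0"
      have "S x $ a $ b = 0" for a b by (simp add: S_def selfdual_def hodge_def A0 matrix_matrix_mult_def)
      then have w0: "cvec (l x) $ a * Z x $ b - cvec (l x) $ b * Z x $ a = 0" for a b
        using Sx[OF x, of a b] s_nonzero[OF x] by (simp add: wedge_def)
      then have "Z x $ b = 0" for b
        using independent[of "Z x $ b" 0 "- cvec (l x) $ b" 0] w0 by (simp add: algebra_simps)
      then show False using independent[of 0 0 1 0] by simp
    qed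
    have "(\<Sum>a\<in>UNIV. \<Sum>b\<in>UNIV. \<Sum>c\<in>UNIV. \<Sum>d\<in>UNIV.
        complex_of_real (ginv g x $ a $ c) * complex_of_real (ginv g x $ b $ d) * S x $ a $ b * S x $ c $ d) =
      (\<Sum>a\<in>UNIV. \<Sum>b\<in>UNIV. \<Sum>c\<in>UNIV. \<Sum>d\<in>UNIV.
        complex_of_real (ginv g x $ a $ c) * complex_of_real (ginv g x $ b $ d) * wedge (cvec (l x)) (Z x) $ a $ b * wedge (cvec (l x)) (Z x) $ c $ d) / (cnj (s x) * cnj (s x))"
      unfolding sum_divide_distrib Sx[OF x] by (intro sum.cong refl) simp
    then show "(\<Sum>a\<in>UNIV. \<Sum>b\<in>UNIV. \<Sum>c\<in>UNIV. \<Sum>d\<in>UNIV.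
        complex_of_real (ginv g x $ a $ c) * complex_of_real (ginv g x $ b $ d)
        * selfdual g A x $ a $ b * selfdual g A x $ c $ d) = 0"
      unfolding null_contraction S_def by simp
  qed
  moreover have "independent_Killing_codiffs_on U g A"
    using K ind by (simp add: independent_Killing_codiffs_on_def)
  moreover have "fundamental_at g A x (l x)" if "x \<in> U" for x
    by (rule fundamental[OF that]) (use Sx[OF that] s_nonzero[OF that] in \<open>simp add: S_def\<close>)
  ultimately show thesis by (rule that)
qed

text \<open>The differential of s is a combination of the real 1-forms \<open>n\<close> and
  \<open>l\<close> with real coefficients.\<close>

lemma Im_s_constant:
  assumes "ball p r \<subseteq> U" "x \<in> ball p r" "y \<in> ball p r"
  shows "Im (s x) = Im (s y)"
proof -
  have "((\<lambda>x. Im (s x)) has_derivative (\<lambda>h. 0)) (at x within ball p r)" if "x \<in> ball p r" for x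
  proof -
    have x: "x \<in> U" using that assms(1) by auto
    have "pd a (\<lambda>x. Im (s x)) x = 0" for a
      using pd_Im[OF differentiable(1)[OF x], of a] ds[OF x, of a] by simp
    then show ?thesis
      using has_derivative_pd[OF smooth_on_differentiable[OF smooth_on_Im[OF U smooth(4)] x]]
      by (simp add: has_derivative_at_withinI)
  qed
  then obtain c where "\<And>x. x \<in> ball p r \<Longrightarrow> Im (s x) = c"
    using has_derivative_zero_constant[OF convex_ball, of p r "\<lambda>x. Im (s x)"] by blast
  then show ?thesis using assms by simp
qed

lemma l_nonzero: "x \<in> U \<Longrightarrow> \<exists>i. l x $ i \<noteq> 0"
proof (rule ccontr)
  assume x: "x \<in> U" and 0: "\<nexists>i. l x $ i \<noteq> 0"
  interpret tetrad_at g x U "s x * cnj (s x)" "cvec (l x)" "cvec (n x)" "Z x" "vcnj (Z x)" by (rule tetrad[OF x])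
  show False using independent[of 1 0 0 0] 0 by simp
qed

text \<open>The Z \<and> Z* term carries the twist: its coefficient vanishes exactly when s is
  real.\<close>

lemma curl_l:
  assumes x: "x \<in> U"
  shows "complex_of_real (pd a (\<lambda>y. l y $ b) x - pd b (\<lambda>y. l y $ a) x) =
    (1 / s x + 1 / cnj (s x)) * wedge (cvec (l x)) (cvec (n x)) $ a $ b
    + (1 / s x - 1 / cnj (s x)) * wedge (Z x) (vcnj (Z x)) $ a $ b"
  unfolding nab_antisym[OF st x, symmetric] of_real_diff nab_l[OF x] wedge_def
  by (simp add: add_divide_distrib diff_divide_distrib algebra_simps)

text \<open>With d lam = c l, closedness gives dc \<and> l + c dl = 0. Only dl has a Z \<and> Z*
  component, namely 1/s - 1/s*, which is nonzero under twist; hence c = 0.\<close>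

lemma lam_locally_constant:
  assumes p: "p \<in> U" and twist: "Im (s p) \<noteq> 0"
  obtains r where "r > 0" "ball p r \<subseteq> U" "\<And>x. x \<in> ball p r \<Longrightarrow> lam x = lam p"
    "\<And>x. x \<in> ball p r \<Longrightarrow> Im (s x) = Im (s p)"
proof -
  obtain i where i: "l p $ i \<noteq> 0" using l_nonzero[OF p] by blast
  obtain r1 where r1: "r1 > 0" "ball p r1 \<subseteq> U" using U p openE by blast
  have "open (ball p r1 \<inter> (\<lambda>x. l x $ i) -` (- {0}))"
    by (rule continuous_open_preimage[OF continuous_on_subset[OF smooth_on_continuous_on[OF smooth_nth(1)] r1(2)] open_ball])
       (simp add: open_Compl)
  then obtain r where r: "r > 0" "ball p r \<subseteq> ball p r1 \<inter> (\<lambda>x. l x $ i) -` (- {0})"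
    using i r1 by (metis (no_types, lifting) Compl_iff Int_iff centre_in_ball openE singletonD vimageI)
  \<comment> \<open>\<open>dlam\<close> provides the factor point by point only; the quotient by a
    nonvanishing component of \<open>l\<close> is smooth.\<close>
  define c where "c = (\<lambda>y. pd i lam y / l y $ i)"
  have B: "x \<in> U" "l x $ i \<noteq> 0" "Im (s x) = Im (s p)" if "x \<in> ball p r" for x
  proof -
    show "x \<in> U" "l x $ i \<noteq> 0" using that r r1 by auto
    have "x \<in> ball p r1" using that r by auto
    then show "Im (s x) = Im (s p)" by (rule Im_s_constant[OF r1(2)]) (use r1 in simp)
  qed
  have dl: "pd a lam x = c x * l x $ a" if "x \<in> ball p r" for x a
    using dlam[OF B(1)[OF that]] B(2)[OF that] by (auto simp: c_def)
  have smc: "smooth_on (ball p r) c"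
    unfolding c_def using B smooth_on_subset[OF smooth_on_pd[OF U smooth(5)]] smooth_on_subset[OF smooth_nth(1)]
    by (intro smooth_on_divide) (auto simp: subset_iff)
  have c0: "c x = 0" if x: "x \<in> ball p r" for x
  proof -
    note xU = B(1)[OF x]
    interpret tetrad_at g x U "s x * cnj (s x)" "cvec (l x)" "cvec (n x)" "Z x" "vcnj (Z x)" by (rule tetrad[OF xU])
    have dd: "pd b (pd a lam) x = c x * pd b (\<lambda>y. l y $ a) x + pd b c x * l x $ a" for a b
    proof -
      have "pd b (pd a lam) x = pd b (\<lambda>y. c y * l y $ a) x"
        by (rule pd_cong[OF open_ball x dl])
      then show ?thesis
        using pd_mult[OF smooth_on_differentiable[OF smc x] differentiable(4)[OF xU]] by simp
    qed
    have "c x * (pd b (\<lambda>y. l y $ a) x - pd a (\<lambda>y. l y $ b) x) + pd b c x * l x $ a - pd a c x * l x $ b = 0" for a b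
      using pd_commute_real[OF smooth(5) U xU, of a b] unfolding dd by (simp add: algebra_simps)
    from arg_cong[OF this, of complex_of_real]
    have E: "complex_of_real (c x) * ((1 / s x + 1 / cnj (s x)) * wedge (cvec (l x)) (cvec (n x)) $ b $ a
      + (1 / s x - 1 / cnj (s x)) * wedge (Z x) (vcnj (Z x)) $ b $ a)
      + complex_of_real (pd b c x) * cvec (l x) $ a - complex_of_real (pd a c x) * cvec (l x) $ b = 0" for a b
      unfolding curl_l[OF xU, symmetric] by simp
    obtain d0 d1 d2 d3 where d: "\<And>b. complex_of_real (pd b c x) = d0 * cvec (l x) $ b + d1 * cvec (n x) $ b + d2 * Z x $ b + d3 * vcnj (Z x) $ b"
      using expansion[of "\<lambda>b. complex_of_real (pd b c x)"] by blast
    define e where "e = complex_of_real (c x) * (1 / s x + 1 / cnj (s x))"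
    define f where "f = complex_of_real (c x) * (1 / s x - 1 / cnj (s x))"
    have "(0::complex) = 0 \<and> d1 - e = 0 \<and> d2 = 0 \<and> d3 = 0 \<and> e - d1 = 0 \<and> (0::complex) = 0 \<and> (0::complex) = 0 \<and> (0::complex) = 0 \<and>
      - d2 = 0 \<and> (0::complex) = 0 \<and> (0::complex) = 0 \<and> - f = 0 \<and> - d3 = 0 \<and> (0::complex) = 0 \<and> f = 0 \<and> (0::complex) = 0"
    proof (rule independent2)
      fix b a
      show "(0 * cvec (l x) $ b + (d1 - e) * cvec (n x) $ b + d2 * Z x $ b + d3 * vcnj (Z x) $ b) * cvec (l x) $ a
        + ((e - d1) * cvec (l x) $ b + 0 * cvec (n x) $ b + 0 * Z x $ b + 0 * vcnj (Z x) $ b) * cvec (n x) $ a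
        + (- d2 * cvec (l x) $ b + 0 * cvec (n x) $ b + 0 * Z x $ b + - f * vcnj (Z x) $ b) * Z x $ a
        + (- d3 * cvec (l x) $ b + 0 * cvec (n x) $ b + f * Z x $ b + 0 * vcnj (Z x) $ b) * vcnj (Z x) $ a = 0"
        using E[of b a] unfolding d wedge_def e_def f_def
        by (simp add: algebra_simps del: cvec_nth vcnj_nth)
    qed
    then have "f = 0" by blast
    moreover have "1 / s x - 1 / cnj (s x) \<noteq> 0"
    proof
      assume "1 / s x - 1 / cnj (s x) = 0"
      then have "inverse (s x) = inverse (cnj (s x))" by (simp add: divide_inverse)
      then have "s x = cnj (s x)" by (rule inverse_eq_imp_eq)
      then have "Im (s x) = Im (cnj (s x))" by (rule arg_cong)
      then show False using B(3)[OF x] twist by simp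
    qed
    ultimately show ?thesis by (simp add: f_def)
  qed
  have "(lam has_derivative (\<lambda>h. 0)) (at x within ball p r)" if x: "x \<in> ball p r" for x
    using has_derivative_pd[OF differentiable(3)[OF B(1)[OF x]]] by (simp add: dl[OF x] c0[OF x] has_derivative_at_withinI)
  then obtain k where "\<And>x. x \<in> ball p r \<Longrightarrow> lam x = k"
    using has_derivative_zero_constant[OF convex_ball, of p r lam] by blast
  then have "lam x = lam p" if "x \<in> ball p r" for x using that r(1) by simp
  then show thesis using that[OF r(1)] B by blast
qed

end

section \<open>Removing the twist\<close>

text \<open>
  For constant \<open>lam\<close> the pair \<open>(\<tau>, lam \<kappa>*)\<close> solves the same equations as \<open>(\<kappa>, \<pi>)\<close>, and the general
  solution is \<open>\<kappa>' = a \<kappa> + b \<tau>\<close>, \<open>\<pi>' = p \<pi> + q \<kappa>*\<close> where \<open>(a, b, p, q)\<close> is parallel for a flat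
  connection. The initial value \<open>a = 1, b = 0, p = s, q = 0\<close> makes \<open>s'\<close> real.
  In the identity below a trailing \<open>c\<close> marks a conjugate.
\<close>

lemma spin_metric:
  fixes a b p q ac bc pc qc :: complex
  shows "- (a * ac * l1 + b * bc * n1 + a * bc * z1 + ac * b * w1) * (p * pc * n2 + q * qc * l2 + qc * p * z2 + pc * q * w2)
   - (p * pc * n1 + q * qc * l1 + qc * p * z1 + pc * q * w1) * (a * ac * l2 + b * bc * n2 + a * bc * z2 + ac * b * w2)
   + (a * p * z1 + a * q * l1 + b * p * n1 + b * q * w1) * (ac * pc * w2 + ac * qc * l2 + bc * pc * n2 + bc * qc * z2)
   + (ac * pc * w1 + ac * qc * l1 + bc * pc * n1 + bc * qc * z1) * (a * p * z2 + a * q * l2 + b * p * n2 + b * q * w2)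
   = ((a * pc - b * qc) * (ac * p - bc * q)) * (- l1 * n2 - n1 * l2 + z1 * w2 + w1 * z2)"
  by (simp add: algebra_simps)

lemma nab_combination:
  fixes h0 h1 h2 h3 :: "real ^ 4 \<Rightarrow> complex" and p0 p1 p2 p3 :: "real ^ 4 \<Rightarrow> complex ^ 4"
  assumes "h0 differentiable at x" "h1 differentiable at x" "h2 differentiable at x" "h3 differentiable at x"
    "\<And>b. (\<lambda>y. p0 y $ b) differentiable at x" "\<And>b. (\<lambda>y. p1 y $ b) differentiable at x"
    "\<And>b. (\<lambda>y. p2 y $ b) differentiable at x" "\<And>b. (\<lambda>y. p3 y $ b) differentiable at x"
  shows "nab g (\<lambda>y. \<chi> b. h0 y * p0 y $ b + h1 y * p1 y $ b + h2 y * p2 y $ b + h3 y * p3 y $ b) x a b =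
    (pd a h0 x * p0 x $ b + h0 x * nab g p0 x a b) + (pd a h1 x * p1 x $ b + h1 x * nab g p1 x a b)
    + (pd a h2 x * p2 x $ b + h2 x * nab g p2 x a b) + (pd a h3 x * p3 x $ b + h3 x * nab g p3 x a b)"
  unfolding nab_def
  by (simp add: pd_add pd_mult assms differentiable_add differentiable_mult sum4 scaleR_conv_of_real algebra_simps)

theorem (in spinor_frame) untwisted_frame:
  assumes p0: "p0 \<in> U" and twist: "Im (s p0) \<noteq> 0"
  obtains r l' n' Z' s' where "r > 0" "ball p0 r \<subseteq> U" "spinor_frame (ball p0 r) g l' n' Z' s' lam"
    "\<And>x. x \<in> ball p0 r \<Longrightarrow> Im (s' x) = 0" "\<And>x a. x \<in> ball p0 r \<Longrightarrow> pd a lam x = 0"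
    "\<And>x. x \<in> ball p0 r \<Longrightarrow> Im (s x) \<noteq> 0"
proof -
  obtain r1 where r1: "r1 > 0" "ball p0 r1 \<subseteq> U" "\<And>x. x \<in> ball p0 r1 \<Longrightarrow> lam x = lam p0"
    "\<And>x. x \<in> ball p0 r1 \<Longrightarrow> Im (s x) = Im (s p0)"
    using lam_locally_constant[OF p0 twist] by blast
  define L where "L = complex_of_real (lam p0)"
  have Lc: "cnj L = L" by (simp add: L_def)
  have sU: "x \<in> U" if "x \<in> ball p0 r1" for x using that r1 by auto
  define I where "I = (\<lambda>y. inverse (s y))"
  define J where "J = (\<lambda>y. inverse (cnj (s y)))"
  have smI: "smooth_on U I" and smJ: "smooth_on U J" unfolding I_def J_def using s_nonzero
    by (intro smooth_on_inverse smooth_on_cnj smooth U, simp)+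
  have sI: "s x * I x = 1" "cnj (s x) * J x = 1" "cnj (I x) = J x" "cnj (J x) = I x" if "x \<in> U" for x
    using s_nonzero[OF that] by (simp_all add: I_def J_def)
  have dI: "I differentiable at x" and dJ: "J differentiable at x" if "x \<in> U" for x
    using smI smJ smooth_on_differentiable that by blast+
  have pI: "pd a I x = - (- cvec (n x) $ a + L * cvec (l x) $ a) * (I x * I x)"
    and pJ: "pd a J x = - (- cvec (n x) $ a + L * cvec (l x) $ a) * (J x * J x)" if x: "x \<in> ball p0 r1" for x a
  proof -
    note d = differentiable[OF sU[OF x]] and s0 = s_nonzero[OF sU[OF x]]
    have c: "cnj (s x) \<noteq> 0" using s0 by simp
    have inv: "- k / z\<^sup>2 = - k * (inverse z * inverse z)" for k z :: complex
      by (simp add: divide_inverse power2_eq_square)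
    show "pd a I x = - (- cvec (n x) $ a + L * cvec (l x) $ a) * (I x * I x)"
      "pd a J x = - (- cvec (n x) $ a + L * cvec (l x) $ a) * (J x * J x)"
      unfolding I_def J_def pd_inverse[OF d(1) s0] pd_inverse[OF d(2) c] inv pd_cnj[OF d(1)] ds[OF sU[OF x]] r1(3)[OF x]
      by (simp_all add: L_def)
  qed
  have nl: "complex_of_real (nab g l x a b) = (Z x $ a * cnj (Z x $ b) - cvec (n x) $ a * cvec (l x) $ b) * I x
      + (cnj (Z x $ a) * Z x $ b - cvec (n x) $ a * cvec (l x) $ b) * J x"
    and nZ: "nab g Z x a b = (Z x $ a * cvec (n x) $ b - cvec (n x) $ a * Z x $ b) * I x
      + L * (cvec (l x) $ a * Z x $ b - Z x $ a * cvec (l x) $ b) * J x"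
    and nn: "complex_of_real (nab g n x a b) = L * ((cvec (l x) $ a * cvec (n x) $ b - cnj (Z x $ a) * Z x $ b) * I x
      + (cvec (l x) $ a * cvec (n x) $ b - Z x $ a * cnj (Z x $ b)) * J x)"
    and ds': "pd a s x = - cvec (n x) $ a + L * cvec (l x) $ a"
    if x: "x \<in> ball p0 r1" for x a b
    using nab_l[OF sU[OF x], of a b] nab_Z[OF sU[OF x], of a b] nab_n[OF sU[OF x], of a b] ds[OF sU[OF x], of a]
    unfolding r1(3)[OF x] L_def I_def J_def divide_inverse by blast+
  \<comment> \<open>The system for the vector (a, b, p - a, q - L b). Constant a, b with p = a and q
    = L b describe combinations of the two known solutions, so all derivatives are linear in p - a
    and q - L b, and the first two columns vanish.\<close>
  define Om where "Om = (\<lambda>a y. rows4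
    (rows4 0 0 (- (cvec (n y) $ a * I y)) (- (vcnj (Z y) $ a * I y)))
    (rows4 0 0 (Z y $ a * I y) (cvec (l y) $ a * I y))
    (rows4 0 0 (cvec (n y) $ a * I y - L * (cvec (l y) $ a * J y)) (vcnj (Z y) $ a * I y - vcnj (Z y) $ a * J y))
    (rows4 0 0 (L * (Z y $ a * J y) - L * (Z y $ a * I y)) (cvec (n y) $ a * J y - L * (cvec (l y) $ a * I y))))"
  have smI1: "smooth_on (ball p0 r1) I" "smooth_on (ball p0 r1) J"
    and sm1: "smooth_on (ball p0 r1) (\<lambda>x. l x $ a)" "smooth_on (ball p0 r1) (\<lambda>x. n x $ a)" "smooth_on (ball p0 r1) (\<lambda>x. Z x $ a)" for a
    using smooth_on_subset[OF _ r1(2)] smI smJ smooth_nth by blast+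
  have sr: "smooth_on (ball p0 r1) (\<lambda>y. rows4 (f0 y) (f1 y) (f2 y) (f3 y))"
    if "smooth_on (ball p0 r1) f0" "smooth_on (ball p0 r1) f1" "smooth_on (ball p0 r1) f2" "smooth_on (ball p0 r1) f3"
    for f0 f1 f2 f3 :: "real ^ 4 \<Rightarrow> 'v::real_normed_vector"
  proof -
    have "smooth_on (ball p0 r1) (\<lambda>y. rows4 (f0 y) (f1 y) (f2 y) (f3 y) $ i)" for i
      using that exhaust4[of i] by auto
    then show ?thesis by (simp add: smooth_on_vec_iff)
  qed
  have smOm: "smooth_on (ball p0 r1) (Om a)" for a
    unfolding Om_def cvec_nth vcnj_nth
    by (intro sr smooth_on_minus smooth_on_diff smooth_on_mult smooth_on_of_real smooth_on_cnj smooth_on_const smI1 sm1 open_ball)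
  \<comment> \<open>Zero curvature, entry by entry. First derivatives of the tetrad come from the
    frame equations, Christoffel terms cancel by symmetry, and \<open>L\<close> may be treated as a
    constant because lam is constant here.\<close>
  have flat: "pd b (Om a) x + Om a x ** Om b x = pd a (Om b) x + Om b x ** Om a x" if x: "x \<in> ball p0 r1" for x a b
  proof -
    note d = differentiable[OF sU[OF x]] dI[OF sU[OF x]] dJ[OF sU[OF x]]
    have ent: "pd b (Om a) x $ r $ c = pd b (\<lambda>y. Om a y $ r $ c) x" for a b r c
      using pd_nth[OF smooth_on_differentiable[OF smOm x], of b a r]
        pd_nth[OF smooth_on_differentiable[OF smooth_on_nth[OF open_ball smOm] x], of b a r c] by simp
    define G where "G = (\<lambda>(v :: 4 \<Rightarrow> complex) a b. \<Sum>k\<in>UNIV. complex_of_real (christoffel g k a b x) * v k)"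
    have Gs: "G v b a = G v a b" for v a b unfolding G_def using christoffel_sym[OF st sU[OF x]] by simp
    have pl: "complex_of_real (pd a (\<lambda>y. l y $ b) x) = complex_of_real (nab g l x a b) + G (\<lambda>k. cvec (l x) $ k) a b"
      and pn: "complex_of_real (pd a (\<lambda>y. n y $ b) x) = complex_of_real (nab g n x a b) + G (\<lambda>k. cvec (n x) $ k) a b"
      and pZ: "pd a (\<lambda>y. Z y $ b) x = nab g Z x a b + G (\<lambda>k. Z x $ k) a b" for a b
      unfolding nab_def G_def by (simp_all add: scaleR_conv_of_real)
    have "(pd b (Om a) x + Om a x ** Om b x) $ r $ c = (pd a (Om b) x + Om b x ** Om a x) $ r $ c" for r c
      unfolding vector_add_component ent matrix_matrix_mult_def vec_lambda_beta sum4
      using exhaust4[of r] exhaust4[of c]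
      by (elim disjE; simp add: Om_def pd_const; simp add: pd_minus pd_diff pd_mult pd_cnj pd_of_real pd_const d
          differentiable_mult differentiable_minus differentiable_diff pI[OF x] pJ[OF x] pl pn pZ nl[OF x] nn[OF x] nZ[OF x]
          Lc sI[OF sU[OF x]] Gs[of _ a b]; simp add: algebra_simps)
    then show ?thesis by (simp add: vec_eq_iff)
  qed
  have p1: "p0 \<in> ball p0 r1" using r1 by simp
  \<comment> \<open>In these variables the initial value a = 1, b = 0, p = s, q = 0 has third entry
    p - a = s - 1.\<close>
  obtain r2 \<Phi> where r2: "r2 > 0" "ball p0 r2 \<subseteq> ball p0 r1" "\<Phi> p0 = rows4 1 0 (s p0 - 1) 0" "smooth_on (ball p0 r2) \<Phi>"
    and \<Phi>: "\<And>x a. x \<in> ball p0 r2 \<Longrightarrow> pd a \<Phi> x = Om a x *v \<Phi> x"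
    using flat_matrix_connection[OF smOm open_ball p1 flat, of "rows4 1 0 (s p0 - 1) 0"] by blast
  define a where "a = (\<lambda>x. \<Phi> x $ 0)"
  define b where "b = (\<lambda>x. \<Phi> x $ 1)"
  define p where "p = (\<lambda>x. \<Phi> x $ 0 + \<Phi> x $ 2)"
  define q where "q = (\<lambda>x. \<Phi> x $ 3 + L * \<Phi> x $ 1)"
  \<comment> \<open>The determinant of the change of spinor basis (kappa, tau) -> (kappa', tau'),
    hence the factor between s' and s.\<close>
  define D where "D = (\<lambda>x. a x * cnj (p x) - b x * cnj (q x))"
  have smabpq: "smooth_on (ball p0 r2) a" "smooth_on (ball p0 r2) b" "smooth_on (ball p0 r2) p" "smooth_on (ball p0 r2) q"
    unfolding a_def b_def p_def q_def
    by (intro smooth_on_add smooth_on_mult smooth_on_const smooth_on_nth r2 open_ball)+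
  have smD: "smooth_on (ball p0 r2) D" unfolding D_def
    by (intro smooth_on_diff smooth_on_mult smooth_on_cnj smabpq open_ball)
  have Dp: "D p0 = cnj (s p0)" by (simp add: D_def a_def b_def p_def q_def r2)
  have "open (ball p0 r2 \<inter> D -` (- {0}))"
    by (rule continuous_open_preimage[OF smooth_on_continuous_on[OF smD] open_ball]) (simp add: open_Compl)
  moreover have "p0 \<in> ball p0 r2 \<inter> D -` (- {0})" using r2 Dp s_nonzero[OF p0] by simp
  ultimately obtain r where r: "r > 0" "ball p0 r \<subseteq> ball p0 r2 \<inter> D -` (- {0})" using openE by blast
  have B: "x \<in> U" "x \<in> ball p0 r1" "x \<in> ball p0 r2" "D x \<noteq> 0" if "x \<in> ball p0 r" for x
    using that r(2) r2(2) r1(2) by blast+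
  have BU: "ball p0 r \<subseteq> U" using B by blast
  \<comment> \<open>The products kappa' kappa'*, tau' pi' and kappa' pi', expanded in the old
    tetrad; the first two are written through real parts to be real by construction.\<close>
  define l' where "l' = (\<lambda>y. \<chi> i. Re (a y * cnj (a y)) * l y $ i + Re (b y * cnj (b y)) * n y $ i + 2 * Re (a y * cnj (b y) * Z y $ i))"
  define n' where "n' = (\<lambda>y. \<chi> i. Re (p y * cnj (p y)) * n y $ i + Re (q y * cnj (q y)) * l y $ i + 2 * Re (cnj (q y) * p y * Z y $ i))"
  define Z' where "Z' = (\<lambda>y. \<chi> i. a y * p y * Z y $ i + a y * q y * cvec (l y) $ i + b y * p y * cvec (n y) $ i + b y * q y * vcnj (Z y) $ i)"
  define s' where "s' = (\<lambda>y. D y * s y)"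
  have mc: "complex_of_real (Re (u * cnj u)) = u * cnj u" for u by (simp add: complex_eq_iff)
  have l': "cvec (l' y) $ i = a y * cnj (a y) * cvec (l y) $ i + b y * cnj (b y) * cvec (n y) $ i
      + a y * cnj (b y) * Z y $ i + cnj (a y) * b y * vcnj (Z y) $ i" for y i
    unfolding l'_def cvec_nth vec_lambda_beta of_real_add of_real_mult[of _ "_ $ _"] mc complex_add_cnj[symmetric] by simp
  have n': "cvec (n' y) $ i = p y * cnj (p y) * cvec (n y) $ i + q y * cnj (q y) * cvec (l y) $ i
      + cnj (q y) * p y * Z y $ i + cnj (p y) * q y * vcnj (Z y) $ i" for y i
    unfolding n'_def cvec_nth vec_lambda_beta of_real_add of_real_mult[of _ "_ $ _"] mc complex_add_cnj[symmetric] by (simp add: mult.commute)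
  have Z': "Z' y $ i = a y * p y * Z y $ i + a y * q y * cvec (l y) $ i + b y * p y * cvec (n y) $ i + b y * q y * vcnj (Z y) $ i"
    "vcnj (Z' y) $ i = cnj (a y) * cnj (p y) * vcnj (Z y) $ i + cnj (a y) * cnj (q y) * cvec (l y) $ i
      + cnj (b y) * cnj (p y) * cvec (n y) $ i + cnj (b y) * cnj (q y) * Z y $ i" for y i
    by (simp_all add: Z'_def)
  have Dc: "cnj (D y) = cnj (a y) * p y - cnj (b y) * q y" for y by (simp add: D_def)
  have sm: "smooth_on (ball p0 r) (\<lambda>x. l x $ i)" "smooth_on (ball p0 r) (\<lambda>x. n x $ i)" "smooth_on (ball p0 r) (\<lambda>x. Z x $ i)"
    "smooth_on (ball p0 r) s" "smooth_on (ball p0 r) lam" "smooth_on (ball p0 r) a" "smooth_on (ball p0 r) b" "smooth_on (ball p0 r) p"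
    "smooth_on (ball p0 r) q" "smooth_on (ball p0 r) D" for i
    using smooth_on_subset[OF _ BU] smooth_nth smooth smooth_on_subset[of "ball p0 r2" _ "ball p0 r"] smabpq smD r by blast+
  have dab: "pd i a x = - ((p x - a x) * cvec (n x) $ i + (q x - L * b x) * vcnj (Z x) $ i) * I x"
    "pd i b x = ((p x - a x) * Z x $ i + (q x - L * b x) * cvec (l x) $ i) * I x"
    "pd i p x = - (L * (p x - a x) * cvec (l x) $ i + (q x - L * b x) * vcnj (Z x) $ i) * J x"
    "pd i q x = (L * (p x - a x) * Z x $ i + (q x - L * b x) * cvec (n x) $ i) * J x" if x: "x \<in> ball p0 r" for x i
  proof -
    have c: "pd i (\<lambda>y. \<Phi> y $ k) x = (Om i x *v \<Phi> x) $ k" for k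
      using pd_nth[OF smooth_on_differentiable[OF r2(4) B(3)[OF x]], of i k] \<Phi>[OF B(3)[OF x]] by simp
    have d: "(\<lambda>y. \<Phi> y $ k) differentiable at x" for k
      by (rule smooth_on_differentiable[OF smooth_on_nth[OF open_ball r2(4)] B(3)[OF x]])
    show "pd i a x = - ((p x - a x) * cvec (n x) $ i + (q x - L * b x) * vcnj (Z x) $ i) * I x"
    "pd i b x = ((p x - a x) * Z x $ i + (q x - L * b x) * cvec (l x) $ i) * I x"
    "pd i p x = - (L * (p x - a x) * cvec (l x) $ i + (q x - L * b x) * vcnj (Z x) $ i) * J x"
    "pd i q x = (L * (p x - a x) * Z x $ i + (q x - L * b x) * cvec (n x) $ i) * J x"
      unfolding a_def b_def p_def q_def
      by (simp_all add: pd_add pd_mult pd_const d c matrix_vector_mult_def sum4 Om_def algebra_simps)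
  qed
  have frame: "spinor_frame (ball p0 r) g l' n' Z' s' lam"
  proof
    show "spacetime (ball p0 r) g" by (rule spacetime_subset[OF st open_ball BU])
    have "smooth_on (ball p0 r) (\<lambda>x. l' x $ i)" "smooth_on (ball p0 r) (\<lambda>x. n' x $ i)" "smooth_on (ball p0 r) (\<lambda>x. Z' x $ i)" for i
      unfolding l'_def n'_def Z'_def vec_lambda_beta cvec_nth vcnj_nth
      by (intro smooth_on_add smooth_on_mult smooth_on_Re smooth_on_cnj smooth_on_of_real smooth_on_const sm open_ball)+
    then show "smooth_on (ball p0 r) l'" "smooth_on (ball p0 r) n'" "smooth_on (ball p0 r) Z'" by (simp_all add: smooth_on_vec_iff)
    show "smooth_on (ball p0 r) s'" unfolding s'_def by (intro smooth_on_mult sm open_ball)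
    show "smooth_on (ball p0 r) lam" by (rule sm)
    fix x c d assume x: "x \<in> ball p0 r"
    note xU = B(1)[OF x] and x1 = B(2)[OF x]
    interpret T: tetrad_at g x U "s x * cnj (s x)" "cvec (l x)" "cvec (n x)" "Z x" "vcnj (Z x)" by (rule tetrad[OF xU])
    have lamL: "complex_of_real (lam x) = L" using r1(3)[OF x1] by (simp add: L_def)
    have dd: "a differentiable at x" "b differentiable at x" "p differentiable at x" "q differentiable at x"
      "(\<lambda>y. cnj (a y)) differentiable at x" "(\<lambda>y. cnj (b y)) differentiable at x" "(\<lambda>y. cnj (p y)) differentiable at x" "(\<lambda>y. cnj (q y)) differentiable at x"
      "(\<lambda>y. l' y $ i) differentiable at x" "(\<lambda>y. n' y $ i) differentiable at x" for i
      unfolding l'_def n'_def vec_lambda_beta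
      by (rule smooth_on_differentiable[OF _ x],
          intro smooth_on_cnj smooth_on_add smooth_on_mult smooth_on_Re smooth_on_const sm open_ball)+
    note d = differentiable[OF xU]
    \<comment> \<open>Each frame equation reduces to a polynomial identity once the factor D is
      cancelled: D in the terms with 1/s', its conjugate in those with 1/s'*.\<close>
    have sD: "u / s' x = v * I x" if "u = D x * v" for u v
      unfolding s'_def that I_def using B(4)[OF x] s_nonzero[OF xU] by (simp add: field_simps)
    have sDc: "u / cnj (s' x) = v * J x" if "u = cnj (D x) * v" for u v
      unfolding s'_def that J_def using B(4)[OF x] s_nonzero[OF xU] by (simp add: field_simps)
    have nc: "nab g (\<lambda>y. cvec (l y)) x c d = complex_of_real (nab g l x c d)" "nab g (\<lambda>y. cvec (n y)) x c d = complex_of_real (nab g n x c d)"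
      "nab g (\<lambda>y. vcnj (Z y)) x c d = cnj (nab g Z x c d)" for c d
      by (rule nab_cvec nab_vcnj, rule d)+
    show "pd c s' x = - cvec (n' x) $ c + complex_of_real (lam x) * cvec (l' x) $ c"
    proof -
      have "pd c s' x = (pd c a x * cnj (p x) + a x * cnj (pd c p x) - pd c b x * cnj (q x) - b x * cnj (pd c q x)) * s x + D x * pd c s x"
        unfolding s'_def D_def by (simp add: pd_mult pd_diff pd_cnj dd d differentiable_mult differentiable_diff algebra_simps)
      also have "\<dots> = (s x * I x) * (- ((p x - a x) * cvec (n x) $ c + (q x - L * b x) * vcnj (Z x) $ c) * cnj (p x)
          - a x * (L * (cnj (p x) - cnj (a x)) * cvec (l x) $ c + (cnj (q x) - L * cnj (b x)) * Z x $ c)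
          - ((p x - a x) * Z x $ c + (q x - L * b x) * cvec (l x) $ c) * cnj (q x)
          - b x * (L * (cnj (p x) - cnj (a x)) * vcnj (Z x) $ c + (cnj (q x) - L * cnj (b x)) * cvec (n x) $ c))
          + (a x * cnj (p x) - b x * cnj (q x)) * (- cvec (n x) $ c + L * cvec (l x) $ c)"
        unfolding dab[OF x] ds'[OF x1] D_def by (simp add: sI[OF xU] Lc algebra_simps)
      finally show ?thesis unfolding sI(1)[OF xU] l' n' lamL by (simp add: algebra_simps)
    qed
    show "\<exists>k. \<forall>i. pd i lam x = k * l' x $ i"
    proof -
      have "pd i lam x = pd i (\<lambda>y. lam p0) x" for i by (rule pd_cong[OF open_ball x1 r1(3)])
      then show ?thesis by (intro exI[of _ 0]) (simp add: pd_const)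
    qed
    show "complex_of_real (nab g l' x c d) = (Z' x $ c * cnj (Z' x $ d) - cvec (n' x) $ c * cvec (l' x) $ d) / s' x
      + (cnj (Z' x $ c) * Z' x $ d - cvec (n' x) $ c * cvec (l' x) $ d) / cnj (s' x)"
    proof -
      have "complex_of_real (nab g l' x c d) = nab g (\<lambda>y. cvec (l' y)) x c d" by (rule nab_cvec[OF dd(9), symmetric])
      also have "\<dots> = nab g (\<lambda>y. \<chi> i. (a y * cnj (a y)) * cvec (l y) $ i + (b y * cnj (b y)) * cvec (n y) $ i
          + (a y * cnj (b y)) * Z y $ i + (cnj (a y) * b y) * vcnj (Z y) $ i) x c d"
        by (rule nab_cong[OF open_ball x]) (simp add: l' del: cvec_nth vcnj_nth)
      also have "\<dots> = ((pd c a x * cnj (a x) + a x * cnj (pd c a x)) * cvec (l x) $ d + a x * cnj (a x) * complex_of_real (nab g l x c d))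
        + ((pd c b x * cnj (b x) + b x * cnj (pd c b x)) * cvec (n x) $ d + b x * cnj (b x) * complex_of_real (nab g n x c d))
        + ((pd c a x * cnj (b x) + a x * cnj (pd c b x)) * Z x $ d + a x * cnj (b x) * nab g Z x c d)
        + ((cnj (pd c a x) * b x + cnj (a x) * pd c b x) * vcnj (Z x) $ d + cnj (a x) * b x * cnj (nab g Z x c d))"
        by (subst nab_combination) (simp_all add: nc pd_mult pd_cnj dd d differentiable_mult algebra_simps)
      also have "\<dots> = (p x * cnj (a x) * (Z x $ c * vcnj (Z x) $ d - cvec (n x) $ c * cvec (l x) $ d) + p x * cnj (b x) * (Z x $ c * cvec (n x) $ d - cvec (n x) $ c * Z x $ d)
          + q x * cnj (a x) * (cvec (l x) $ c * vcnj (Z x) $ d - vcnj (Z x) $ c * cvec (l x) $ d) + q x * cnj (b x) * (cvec (l x) $ c * cvec (n x) $ d - vcnj (Z x) $ c * Z x $ d)) * I x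
        + (cnj (p x) * a x * (vcnj (Z x) $ c * Z x $ d - cvec (n x) $ c * cvec (l x) $ d) + cnj (p x) * b x * (vcnj (Z x) $ c * cvec (n x) $ d - cvec (n x) $ c * vcnj (Z x) $ d)
          + cnj (q x) * a x * (cvec (l x) $ c * Z x $ d - Z x $ c * cvec (l x) $ d) + cnj (q x) * b x * (cvec (l x) $ c * cvec (n x) $ d - Z x $ c * vcnj (Z x) $ d)) * J x"
        unfolding dab[OF x] nl[OF x1] nn[OF x1] nZ[OF x1] by (simp add: sI[OF xU] Lc algebra_simps)
      also have "\<dots> = (Z' x $ c * vcnj (Z' x) $ d - cvec (n' x) $ c * cvec (l' x) $ d) / s' x
          + (vcnj (Z' x) $ c * Z' x $ d - cvec (n' x) $ c * cvec (l' x) $ d) / cnj (s' x)"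
        unfolding l' n' Z' by (intro arg_cong2[of _ _ _ _ "(+)"] sD[symmetric] sDc[symmetric]) (unfold Dc, unfold D_def, (simp only: algebra_simps)+)
      finally show ?thesis by simp
    qed
    show "complex_of_real (nab g n' x c d) = complex_of_real (lam x) * ((cvec (l' x) $ c * cvec (n' x) $ d - cnj (Z' x $ c) * Z' x $ d) / s' x
      + (cvec (l' x) $ c * cvec (n' x) $ d - Z' x $ c * cnj (Z' x $ d)) / cnj (s' x))"
    proof -
      have "complex_of_real (nab g n' x c d) = nab g (\<lambda>y. cvec (n' y)) x c d" by (rule nab_cvec[OF dd(10), symmetric])
      also have "\<dots> = nab g (\<lambda>y. \<chi> i. (p y * cnj (p y)) * cvec (n y) $ i + (q y * cnj (q y)) * cvec (l y) $ i
          + (cnj (q y) * p y) * Z y $ i + (cnj (p y) * q y) * vcnj (Z y) $ i) x c d"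
        by (rule nab_cong[OF open_ball x]) (simp add: n' del: cvec_nth vcnj_nth)
      also have "\<dots> = ((pd c p x * cnj (p x) + p x * cnj (pd c p x)) * cvec (n x) $ d + p x * cnj (p x) * complex_of_real (nab g n x c d))
        + ((pd c q x * cnj (q x) + q x * cnj (pd c q x)) * cvec (l x) $ d + q x * cnj (q x) * complex_of_real (nab g l x c d))
        + ((cnj (pd c q x) * p x + cnj (q x) * pd c p x) * Z x $ d + cnj (q x) * p x * nab g Z x c d)
        + ((cnj (pd c p x) * q x + cnj (p x) * pd c q x) * vcnj (Z x) $ d + cnj (p x) * q x * cnj (nab g Z x c d))"
        by (subst nab_combination) (simp_all add: nc pd_mult pd_cnj dd d differentiable_mult algebra_simps)
      also have "\<dots> = L * ((cnj (a x) * p x * (cvec (l x) $ c * cvec (n x) $ d - vcnj (Z x) $ c * Z x $ d) + cnj (a x) * q x * (cvec (l x) $ c * vcnj (Z x) $ d - vcnj (Z x) $ c * cvec (l x) $ d)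
          + cnj (b x) * p x * (Z x $ c * cvec (n x) $ d - cvec (n x) $ c * Z x $ d) + cnj (b x) * q x * (Z x $ c * vcnj (Z x) $ d - cvec (n x) $ c * cvec (l x) $ d)) * I x
        + (a x * cnj (p x) * (cvec (l x) $ c * cvec (n x) $ d - Z x $ c * vcnj (Z x) $ d) + a x * cnj (q x) * (cvec (l x) $ c * Z x $ d - Z x $ c * cvec (l x) $ d)
          + b x * cnj (p x) * (vcnj (Z x) $ c * cvec (n x) $ d - cvec (n x) $ c * vcnj (Z x) $ d) + b x * cnj (q x) * (vcnj (Z x) $ c * Z x $ d - cvec (n x) $ c * cvec (l x) $ d)) * J x)"
        unfolding dab[OF x] nl[OF x1] nn[OF x1] nZ[OF x1] by (simp add: sI[OF xU] Lc algebra_simps)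
      also have "\<dots> = L * ((cvec (l' x) $ c * cvec (n' x) $ d - vcnj (Z' x) $ c * Z' x $ d) / s' x
          + (cvec (l' x) $ c * cvec (n' x) $ d - Z' x $ c * vcnj (Z' x) $ d) / cnj (s' x))"
        unfolding l' n' Z' by (intro arg_cong2[of _ _ _ _ "(*)"] arg_cong2[of _ _ _ _ "(+)"] refl sD[symmetric] sDc[symmetric]) (unfold Dc, unfold D_def, (simp only: algebra_simps)+)
      finally show ?thesis unfolding lamL by simp
    qed
    show "nab g Z' x c d = (Z' x $ c * cvec (n' x) $ d - cvec (n' x) $ c * Z' x $ d) / s' x
      + complex_of_real (lam x) * (cvec (l' x) $ c * Z' x $ d - Z' x $ c * cvec (l' x) $ d) / cnj (s' x)"
    proof -
      have "nab g Z' x c d = nab g (\<lambda>y. \<chi> i. (a y * p y) * Z y $ i + (a y * q y) * cvec (l y) $ i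
          + (b y * p y) * cvec (n y) $ i + (b y * q y) * vcnj (Z y) $ i) x c d"
        by (rule nab_cong[OF open_ball x]) (simp add: Z' del: cvec_nth vcnj_nth)
      also have "\<dots> = ((pd c a x * p x + a x * pd c p x) * Z x $ d + a x * p x * nab g Z x c d)
        + ((pd c a x * q x + a x * pd c q x) * cvec (l x) $ d + a x * q x * complex_of_real (nab g l x c d))
        + ((pd c b x * p x + b x * pd c p x) * cvec (n x) $ d + b x * p x * complex_of_real (nab g n x c d))
        + ((pd c b x * q x + b x * pd c q x) * vcnj (Z x) $ d + b x * q x * cnj (nab g Z x c d))"
        by (subst nab_combination) (simp_all add: nc pd_mult pd_cnj dd d differentiable_mult algebra_simps)
      also have "\<dots> = (p x * p x * (Z x $ c * cvec (n x) $ d - cvec (n x) $ c * Z x $ d)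
          + p x * q x * (Z x $ c * vcnj (Z x) $ d - cvec (n x) $ c * cvec (l x) $ d + cvec (l x) $ c * cvec (n x) $ d - vcnj (Z x) $ c * Z x $ d)
          + q x * q x * (cvec (l x) $ c * vcnj (Z x) $ d - vcnj (Z x) $ c * cvec (l x) $ d)) * I x
        + L * ((a x * a x * (cvec (l x) $ c * Z x $ d - Z x $ c * cvec (l x) $ d)
          + a x * b x * (cvec (l x) $ c * cvec (n x) $ d - Z x $ c * vcnj (Z x) $ d + vcnj (Z x) $ c * Z x $ d - cvec (n x) $ c * cvec (l x) $ d)
          + b x * b x * (vcnj (Z x) $ c * cvec (n x) $ d - cvec (n x) $ c * vcnj (Z x) $ d)) * J x)"
        unfolding dab[OF x] nl[OF x1] nn[OF x1] nZ[OF x1] by (simp add: sI[OF xU] Lc algebra_simps)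
      also have "\<dots> = (Z' x $ c * cvec (n' x) $ d - cvec (n' x) $ c * Z' x $ d) / s' x
          + L * ((cvec (l' x) $ c * Z' x $ d - Z' x $ c * cvec (l' x) $ d) / cnj (s' x))"
        unfolding l' n' Z' by (intro arg_cong2[of _ _ _ _ "(*)"] arg_cong2[of _ _ _ _ "(+)"] refl sD[symmetric] sDc[symmetric]) (unfold Dc, unfold D_def, (simp only: algebra_simps)+)
      finally show ?thesis unfolding lamL by simp
    qed
    show "null_tetrad (g x) (s' x * cnj (s' x)) (cvec (l' x)) (cvec (n' x)) (Z' x) (vcnj (Z' x))"
      unfolding null_tetrad_def
    proof (intro conjI allI)
      show "s' x * cnj (s' x) \<noteq> 0" using B(4)[OF x] s_nonzero[OF xU] by (simp add: s'_def)
      show "s' x * cnj (s' x) * complex_of_real (g x $ i $ j) = - cvec (l' x) $ i * cvec (n' x) $ j - cvec (n' x) $ i * cvec (l' x) $ j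
          + Z' x $ i * vcnj (Z' x) $ j + vcnj (Z' x) $ i * Z' x $ j" for i j
        unfolding l' n' Z' spin_metric T.metric s'_def
        using s_nonzero[OF xU] by (simp add: Dc D_def)
      \<comment> \<open>The change of tetrad is the tensor product of the 2x2 spinor change with its
        conjugate, which explains the determinant |D|^4.\<close>
      define K :: "complex ^ 4 ^ 4" where "K = rows4
        (rows4 (a x * cnj (a x)) (b x * cnj (b x)) (a x * cnj (b x)) (cnj (a x) * b x))
        (rows4 (q x * cnj (q x)) (p x * cnj (p x)) (cnj (q x) * p x) (cnj (p x) * q x))
        (rows4 (a x * q x) (b x * p x) (a x * p x) (b x * q x))
        (rows4 (cnj (a x) * cnj (q x)) (cnj (b x) * cnj (p x)) (cnj (b x) * cnj (q x)) (cnj (a x) * cnj (p x)))"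
      have "rows4 (cvec (l' x)) (cvec (n' x)) (Z' x) (vcnj (Z' x)) $ i $ j = (K ** rows4 (cvec (l x)) (cvec (n x)) (Z x) (vcnj (Z x))) $ i $ j" for i j
        using exhaust4[of i]
        by (elim disjE) (simp_all add: matrix_matrix_mult_def sum4 K_def l' n' Z' del: cvec_nth vcnj_nth)
      then have "rows4 (cvec (l' x)) (cvec (n' x)) (Z' x) (vcnj (Z' x)) = K ** rows4 (cvec (l x)) (cvec (n x)) (Z x) (vcnj (Z x))"
        by (simp add: vec_eq_iff)
      moreover have "det K = (D x * cnj (D x))\<^sup>2"
        unfolding Dc unfolding D_def det4 K_def by (simp add: power2_eq_square algebra_simps)
      ultimately show "det (rows4 (cvec (l' x)) (cvec (n' x)) (Z' x) (vcnj (Z' x))) = - \<i> * (s' x * cnj (s' x))\<^sup>2 * complex_of_real (sqrt (- det (g x)))"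
        using T.tetrad by (simp add: null_tetrad_def det_mul s'_def power_mult_distrib)
    qed
  qed
  have "Im (s' x) = Im (s' p0)" if "x \<in> ball p0 r" for x
    by (rule spinor_frame.Im_s_constant[OF frame order_refl that]) (use r in simp)
  \<comment> \<open>At \<open>p0\<close> the initial value gives s' = s* s; constancy of Im s'
    spreads reality over the ball.\<close>
  moreover have "Im (s' p0) = 0" by (simp add: s'_def Dp mult.commute)
  moreover have "pd i lam x = 0" if "x \<in> ball p0 r" for x i
    using pd_cong[where a=i, OF open_ball B(2)[OF that] r1(3)] by (simp add: pd_const)
  ultimately show thesis using that[OF r(1) BU frame] r1(4)[OF B(2)] twist by simp
qed

section \<open>The Ricci tensor of a frame with real \<open>s\<close>\<close>

lemma (in tetrad_at) tetrad_dual_zero: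
  assumes "(\<Sum>d\<in>UNIV. D d * l $ d) = 0" "(\<Sum>d\<in>UNIV. D d * n $ d) = 0"
    "(\<Sum>d\<in>UNIV. D d * z $ d) = 0" "(\<Sum>d\<in>UNIV. D d * w $ d) = 0"
  shows "D d = 0"
proof -
  let ?R = "rows4 l n z w" and ?D = "\<chi> d. D d"
  have "det ?R \<noteq> 0" using tetrad N spacetime_det[OF st] by (simp add: null_tetrad_def)
  then obtain B where B: "B ** ?R = mat 1" using invertible_det_nz invertible_def by blast
  have "(?R *v ?D) $ i = 0" for i
    using exhaust4[of i] assms by (auto simp: matrix_vector_mult_def mult.commute)
  then have "?R *v ?D = 0" by (simp add: vec_eq_iff)
  then have "B *v (?R *v ?D) = 0" by simp
  then have "?D = 0" by (simp add: matrix_vector_mul_assoc B)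
  then show ?thesis by (simp add: vec_eq_iff)
qed

text \<open>The component R^d_acb, with c and b the pair of derivative indices; \<open>ricci\<close>
  is its contraction of d with c.\<close>

definition riemann ::
  "(real ^ 4 \<Rightarrow> real ^ 4 ^ 4) \<Rightarrow> real ^ 4 \<Rightarrow> 4 \<Rightarrow> 4 \<Rightarrow> 4 \<Rightarrow> 4 \<Rightarrow> real" where
  "riemann g x d a c b = pd c (christoffel g d a b) x - pd b (christoffel g d a c) x
     + (\<Sum>e\<in>UNIV. christoffel g d c e x * christoffel g e a b x - christoffel g d b e x * christoffel g e a c x)"

lemma ricci_riemann: "ricci g x $ a $ b = (\<Sum>c\<in>UNIV. riemann g x c a c b)"
  by (simp add: ricci_def riemann_def sum.distrib)

text \<open>The Ricci identity for a 1-form. The first covariant derivative is passed as a field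
  \<open>T\<close>, so that the explicit expression known from the frame can be
  differentiated.\<close>

lemma nab_commutator:
  fixes e :: "real ^ 4 \<Rightarrow> complex ^ 4"
  assumes st: "spacetime U g" "x \<in> U" and e: "\<And>b. smooth_on U (\<lambda>y. e y $ b)"
    and T: "\<And>y a b. y \<in> U \<Longrightarrow> nab g e y a b = T y $ a $ b"
  shows "nabla2 g T x c b a - nabla2 g T x b c a = - (\<Sum>d\<in>UNIV. complex_of_real (riemann g x d a c b) * e x $ d)"
proof -
  note U = spacetime_open[OF st(1)]
  define G where "G = (\<lambda>k a b. complex_of_real (christoffel g k a b x))"
  define DG where "DG = (\<lambda>c k a b. complex_of_real (pd c (christoffel g k a b) x))"
  have Gs: "G k a b = G k b a" for k a b unfolding G_def christoffel_sym[OF st, of k a b] ..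
  have DGs: "DG c k a b = DG c k b a" for c k a b
  proof -
    have "pd c (christoffel g k a b) x = pd c (christoffel g k b a) x"
      by (rule pd_cong[OF U st(2)], rule christoffel_sym[OF st(1)])
    then show ?thesis by (simp add: DG_def)
  qed
  have d: "(\<lambda>y. e y $ k) differentiable at x" "christoffel g k b a differentiable at x"
    "(\<lambda>y. complex_of_real (christoffel g k b a y)) differentiable at x" "pd b (\<lambda>y. e y $ k) differentiable at x" for k a b
    by (rule smooth_on_differentiable[OF _ st(2)], intro e smooth_on_of_real smooth_on_pd smooth_on_christoffel[OF st(1)] U)+
  have de: "pd c (\<lambda>y. e y $ k) x = T x $ c $ k + (\<Sum>m\<in>UNIV. G m c k * e x $ m)" for c k
    using T[OF st(2), of c k] unfolding nab_def G_def by (simp add: scaleR_conv_of_real algebra_simps)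
  have dT: "pd c (\<lambda>y. T y $ b $ a) x = pd c (pd b (\<lambda>y. e y $ a)) x
      - (\<Sum>k\<in>UNIV. DG c k b a * e x $ k + G k b a * pd c (\<lambda>y. e y $ k) x)" for c b a
  proof -
    have "pd c (\<lambda>y. T y $ b $ a) x =
        pd c (\<lambda>y. pd b (\<lambda>z. e z $ a) y - (\<Sum>k\<in>UNIV. complex_of_real (christoffel g k b a y) * e y $ k)) x"
      by (rule pd_cong[OF U st(2)]) (simp add: T[symmetric] nab_def scaleR_conv_of_real)
    also have "\<dots> = pd c (pd b (\<lambda>y. e y $ a)) x - (\<Sum>k\<in>UNIV. DG c k b a * e x $ k + G k b a * pd c (\<lambda>y. e y $ k) x)"
      by (simp add: pd_diff pd_sum pd_mult pd_of_real d differentiable_sum differentiable_mult G_def DG_def add.commute)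
    finally show ?thesis .
  qed
  have R: "complex_of_real (riemann g x d a c b) = DG c d a b - DG b d a c + (\<Sum>m\<in>UNIV. G d c m * G m a b - G d b m * G m a c)" for d
    by (simp add: riemann_def G_def DG_def)
  have nb: "nabla2 g T x c b a = pd c (\<lambda>y. T y $ b $ a) x - (\<Sum>k\<in>UNIV. G k c b * T x $ k $ a) - (\<Sum>k\<in>UNIV. G k c a * T x $ b $ k)" for c b a
    by (simp add: nabla2_def G_def scaleR_conv_of_real)
  show ?thesis
    unfolding R nb dT de pd_commute[where a=c and b=b, OF e U st(2)]
      Gs[of _ a b] Gs[of _ a c] Gs[of _ c b] DGs[of _ _ a b] DGs[of _ _ a c]
    by (simp add: sum4 algebra_simps)
qed

text \<open>Covers the shape shared by the derivatives of the frame members and of ds: a multiple of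
  the metric plus two products. The metric itself contributes nothing, being parallel.\<close>

lemma nabla2_combination:
  fixes h0 h1 h2 :: "real ^ 4 \<Rightarrow> complex" and p q r t :: "real ^ 4 \<Rightarrow> complex ^ 4"
  assumes st: "spacetime U g" "x \<in> U"
    and h: "h0 differentiable at x" "h1 differentiable at x" "h2 differentiable at x"
    and p: "\<And>b. (\<lambda>y. p y $ b) differentiable at x" "\<And>b. (\<lambda>y. q y $ b) differentiable at x"
      "\<And>b. (\<lambda>y. r y $ b) differentiable at x" "\<And>b. (\<lambda>y. t y $ b) differentiable at x"
  shows "nabla2 g (\<lambda>y. \<chi> b a. h0 y * complex_of_real (g y $ b $ a) + h1 y * (p y $ b * q y $ a)
      + h2 y * (r y $ b * t y $ a)) x c b a =
    pd c h0 x * complex_of_real (g x $ b $ a)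
    + pd c h1 x * (p x $ b * q x $ a) + h1 x * (nab g p x c b * q x $ a + p x $ b * nab g q x c a)
    + pd c h2 x * (r x $ b * t x $ a) + h2 x * (nab g r x c b * t x $ a + r x $ b * nab g t x c a)"
proof -
  have g: "(\<lambda>y. g y $ b $ a) differentiable at x" "(\<lambda>y. complex_of_real (g y $ b $ a)) differentiable at x" for b a
    by (rule smooth_on_differentiable[OF _ st(2)], intro smooth_on_of_real spacetime_smooth[OF st(1)] spacetime_open[OF st(1)])+
  have dg: "pd c (\<lambda>y. complex_of_real (g y $ b $ a)) x =
      (\<Sum>k\<in>UNIV. complex_of_real (christoffel g k c b x) * complex_of_real (g x $ k $ a))
      + (\<Sum>k\<in>UNIV. complex_of_real (christoffel g k c a x) * complex_of_real (g x $ b $ k))"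
    by (simp add: pd_of_real g metric_compatible[OF st])
  show ?thesis unfolding nabla2_def nab_def
    by (simp add: pd_add pd_mult h p g dg differentiable_add differentiable_mult sum4 scaleR_conv_of_real algebra_simps)
qed

lemma (in spinor_frame) spinor_frame_subset:
  assumes "open V" "V \<subseteq> U"
  shows "spinor_frame V g l n Z s lam"
proof
  show "spacetime V g" by (rule spacetime_subset[OF st assms])
  show "smooth_on V l" "smooth_on V n" "smooth_on V Z" "smooth_on V s" "smooth_on V lam"
    using smooth smooth_on_subset assms(2) by blast+
qed (use assms(2) in \<open>blast intro: tet nab_l nab_Z nab_n ds dlam\<close>)+

locale real_frame = spinor_frame +
  assumes real: "x \<in> U \<Longrightarrow> cnj (s x) = s x"
begin

text \<open>
  With \<open>\<sigma> = ds\<close> and \<open>P = \<nabla>\<sigma> = 2 lam s g + k l l\<close>, each of \<open>e = l, Z, Z*\<close> satisfies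
  \<open>R\<^sup>d\<^sub>a\<^sub>c\<^sub>b e\<^sub>d = (e\<^sub>b P\<^sub>c\<^sub>a - e\<^sub>c P\<^sub>b\<^sub>a) / s\<close>, and \<open>e = n\<close> satisfies the same equation up to a
  multiple of \<open>k\<close>. This determines the curvature tensor.
\<close>

theorem ricci_real_frame:
  assumes x: "x \<in> U" and k: "\<And>a. pd a lam x = k * l x $ a"
  shows "ricci g x $ a $ b = - 6 * lam x * g x $ a $ b - 2 * k / Re (s x) * l x $ a * l x $ b"
proof -
  define i where "i = (\<lambda>y. inverse (s y))"
  define lc where "lc = (\<lambda>y. cvec (l y))"
  define nc where "nc = (\<lambda>y. cvec (n y))"
  define Zc where "Zc = (\<lambda>y. vcnj (Z y))"
  define la where "la = (\<lambda>y. complex_of_real (lam y))"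
  define \<sigma> where "\<sigma> = (\<lambda>y. \<chi> a. la y * lc y $ a - nc y $ a)"
  define dl where "dl = (\<lambda>y. \<chi> a. complex_of_real (pd a lam y))"
  have sm: "smooth_on U s" "smooth_on U i" "smooth_on U la" "smooth_on U (\<lambda>y. lc y $ a)" "smooth_on U (\<lambda>y. nc y $ a)"
    "smooth_on U (\<lambda>y. Z y $ a)" "smooth_on U (\<lambda>y. Zc y $ a)" "smooth_on U (\<lambda>y. \<sigma> y $ a)" "smooth_on U (\<lambda>y. dl y $ a)" for a
    unfolding i_def la_def \<sigma>_def lc_def nc_def Zc_def dl_def vec_lambda_beta cvec_nth vcnj_nth
    by (intro smooth smooth_nth smooth_on_inverse smooth_on_of_real smooth_on_cnj smooth_on_diff smooth_on_mult smooth_on_pd U s_nonzero | assumption)+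
  note d = sm[THEN smooth_on_differentiable]
  have si: "s y * i y = 1" "i y * s y = 1" "cnj (i y) = i y" "cnj (s y) = s y" if "y \<in> U" for y
    using s_nonzero[OF that] real[OF that] by (simp_all add: i_def)
  have ds': "pd a s y = \<sigma> y $ a" if "y \<in> U" for y a
    using ds[OF that, of a] by (simp add: \<sigma>_def la_def lc_def nc_def)
  have di: "pd a i y = - \<sigma> y $ a * (i y * i y)" if "y \<in> U" for y a
    unfolding i_def pd_inverse[OF d(1)[OF that] s_nonzero[OF that]] ds'[OF that]
    by (simp add: divide_inverse power2_eq_square)
  have dla: "pd a la y = dl y $ a" if "y \<in> U" for y a
    unfolding la_def dl_def using differentiable(3)[OF that] by (simp add: pd_of_real)
  have rc: "cnj (lc y $ a) = lc y $ a" "cnj (nc y $ a) = nc y $ a" "cnj (la y) = la y" "cnj (\<sigma> y $ a) = \<sigma> y $ a" for y a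
    by (simp_all add: lc_def nc_def la_def \<sigma>_def)
  have T: "tetrad_at g y U (s y * s y) (lc y) (nc y) (Z y) (Zc y)" if "y \<in> U" for y
    using tetrad[OF that] unfolding real[OF that] lc_def nc_def Zc_def .
  have sg: "s y * complex_of_real (g y $ a $ b) =
      (- lc y $ a * nc y $ b - nc y $ a * lc y $ b + Z y $ a * Zc y $ b + Zc y $ a * Z y $ b) * i y" if "y \<in> U" for y a b
    unfolding tetrad_at.metric[OF T[OF that]] i_def using s_nonzero[OF that] by (simp add: divide_inverse)
  \<comment> \<open>The metric absorbs the Z Z* terms. This brings \<nabla>l to the form \<alpha> s
    g + (\<sigma> e - e \<sigma>)/s, which Z and Z* satisfy with \<alpha> = 0.\<close>
  have nl: "nab g lc y a b = (1 * s y) * complex_of_real (g y $ a $ b) + i y * (\<sigma> y $ a * lc y $ b) + (- i y) * (lc y $ a * \<sigma> y $ b)"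
    if y: "y \<in> U" for y a b
    unfolding lc_def nab_cvec[OF differentiable(4)[OF y]] nab_l[OF y] mult_1 sg[OF y]
    by (simp add: real[OF y] divide_inverse i_def \<sigma>_def lc_def nc_def Zc_def algebra_simps)
  have nZ: "nab g Z y a b = (0 * s y) * complex_of_real (g y $ a $ b) + i y * (\<sigma> y $ a * Z y $ b) + (- i y) * (Z y $ a * \<sigma> y $ b)"
    if y: "y \<in> U" for y a b
    unfolding nab_Z[OF y]
    by (simp add: real[OF y] divide_inverse i_def \<sigma>_def lc_def nc_def la_def algebra_simps)
  have nZc: "nab g Zc y a b = (0 * s y) * complex_of_real (g y $ a $ b) + i y * (\<sigma> y $ a * Zc y $ b) + (- i y) * (Zc y $ a * \<sigma> y $ b)"
    if y: "y \<in> U" for y a b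
    unfolding Zc_def nab_vcnj[OF differentiable(6)[OF y]] nZ[OF y] by (simp add: rc si[OF y])
  have n\<sigma>: "nab g \<sigma> y a b = (2 * la y * s y) * complex_of_real (g y $ a $ b) + 1 * (dl y $ a * lc y $ b) + 0 * (lc y $ a * lc y $ b)"
    if y: "y \<in> U" for y a b
  proof -
    have "nab g \<sigma> y a b = nab g (\<lambda>y. \<chi> b. (- 1) * nc y $ b + la y * lc y $ b + 0 * lc y $ b + 0 * lc y $ b) y a b"
      by (rule nab_cong[OF U y]) (simp add: \<sigma>_def)
    also have "\<dots> = - nab g nc y a b + (dl y $ a * lc y $ b + la y * nab g lc y a b)"
      by (subst nab_combination) (simp_all add: d[OF y] dla[OF y] pd_const)
    also have "\<dots> = (2 * la y) * (s y * complex_of_real (g y $ a $ b)) + dl y $ a * lc y $ b"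
      unfolding nl[OF y] mult_1 sg[OF y] nc_def nab_cvec[OF differentiable(5)[OF y]] nab_n[OF y]
      by (simp add: real[OF y] divide_inverse i_def \<sigma>_def lc_def nc_def Zc_def la_def algebra_simps)
    finally show ?thesis by (simp add: mult.assoc)
  qed
  define P where "P = (\<lambda>a b. nab g \<sigma> x a b)"
  define G where "G = (\<lambda>a b. complex_of_real (g x $ a $ b))"
  have Gs: "G a b = G b a" for a b unfolding G_def using spacetime_sym[OF st x] by simp
  define kc where "kc = complex_of_real k"
  have dlx: "dl x $ a = kc * lc x $ a" for a by (simp add: dl_def k kc_def lc_def)
  have P: "P a b = (2 * la x * s x) * G a b + kc * (lc x $ a * lc x $ b)" for a b
    unfolding P_def n\<sigma>[OF x] G_def dlx by simp
  have Ps: "P a b = P b a" for a b unfolding P using Gs[of a b] by simp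
  have iP: "i x * P a b = 2 * la x * G a b + kc * i x * (lc x $ a * lc x $ b)" for a b
  proof -
    have "i x * P a b = (i x * s x) * (2 * la x * G a b) + kc * i x * (lc x $ a * lc x $ b)"
      unfolding P by (simp add: algebra_simps)
    then show ?thesis by (simp add: si[OF x])
  qed
  have neg: "u = q - p" if "p - q = - u" for p q u :: complex
    using arg_cong[OF that, of uminus] by simp
  \<comment> \<open>One computation for l, Z and Z*: the terms with \<alpha> cancel in the
    commutator, since each is compensated by the metric part of \<nabla>e.\<close>
  have K: "(\<Sum>d\<in>UNIV. complex_of_real (riemann g x d a c b) * e x $ d) = e x $ b * (i x * P c a) - e x $ c * (i x * P b a)"
    if e: "\<And>a. smooth_on U (\<lambda>y. e y $ a)"
      and E: "\<And>y a b. y \<in> U \<Longrightarrow> nab g e y a b = (\<alpha> * s y) * complex_of_real (g y $ a $ b) + i y * (\<sigma> y $ a * e y $ b) + (- i y) * (e y $ a * \<sigma> y $ b)"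
    for e :: "real ^ 4 \<Rightarrow> complex ^ 4" and \<alpha> a b c
  proof -
    define T where "T = (\<lambda>y. \<chi> b a. (\<alpha> * s y) * complex_of_real (g y $ b $ a) + i y * (\<sigma> y $ b * e y $ a) + (- i y) * (e y $ b * \<sigma> y $ a))"
    define L where "L = (\<lambda>a b. nab g e x a b)"
    have iL: "i x * L a b = \<alpha> * G a b + (i x * i x) * (\<sigma> x $ a * e x $ b - e x $ a * \<sigma> x $ b)" for a b
    proof -
      have "i x * L a b = (i x * s x) * (\<alpha> * G a b) + (i x * i x) * (\<sigma> x $ a * e x $ b - e x $ a * \<sigma> x $ b)"
        unfolding L_def E[OF x] G_def by (simp add: algebra_simps)
      then show ?thesis by (simp add: si[OF x])
    qed
    have ed: "(\<lambda>y. e y $ a) differentiable at x" for a by (rule smooth_on_differentiable[OF e x])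
    have "nabla2 g T x c b a = (\<alpha> * \<sigma> x $ c) * G b a + (- \<sigma> x $ c * (i x * i x)) * (\<sigma> x $ b * e x $ a)
        + i x * (P c b * e x $ a + \<sigma> x $ b * L c a) + (\<sigma> x $ c * (i x * i x)) * (e x $ b * \<sigma> x $ a)
        + (- i x) * (L c b * \<sigma> x $ a + e x $ b * P c a)" for a b c
      unfolding T_def
      by (subst nabla2_combination[OF st x])
        (simp_all add: d[OF x] ed differentiable_mult differentiable_minus pd_mult pd_minus pd_const ds'[OF x] di[OF x] G_def P_def L_def)
    note N0 = this
    have N: "nabla2 g T x c b a = (\<alpha> * \<sigma> x $ c) * G b a + (- \<sigma> x $ c * (i x * i x)) * (\<sigma> x $ b * e x $ a)
        + (i x * P c b) * e x $ a + \<sigma> x $ b * (i x * L c a) + (\<sigma> x $ c * (i x * i x)) * (e x $ b * \<sigma> x $ a)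
        - (i x * L c b) * \<sigma> x $ a - e x $ b * (i x * P c a)" for a b c
      unfolding N0 by (simp add: algebra_simps)
    have "nabla2 g T x c b a - nabla2 g T x b c a = - (\<Sum>d\<in>UNIV. complex_of_real (riemann g x d a c b) * e x $ d)"
      by (rule nab_commutator[OF st x e]) (simp add: T_def E)
    then have "(\<Sum>d\<in>UNIV. complex_of_real (riemann g x d a c b) * e x $ d) = nabla2 g T x b c a - nabla2 g T x c b a"
      by (rule neg)
    also have "\<dots> = e x $ b * (i x * P c a) - e x $ c * (i x * P b a)"
      unfolding N iL Ps[of c b] Gs[of c b] by (simp add: algebra_simps)
    finally show ?thesis .
  qed
  \<comment> \<open>The commutator applied to ds. The second derivatives of lam drop out by
    symmetry, and its first derivative leaves the extra terms in k. Since n = lam l - \<sigma>, the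
    equation for n follows.\<close>
  have K\<sigma>: "(\<Sum>d\<in>UNIV. complex_of_real (riemann g x d a c b) * \<sigma> x $ d) =
      \<sigma> x $ b * (i x * P c a) - \<sigma> x $ c * (i x * P b a) - kc * s x * (lc x $ c * G b a - lc x $ b * G c a)" for a b c
  proof -
    define T where "T = (\<lambda>y. \<chi> b a. (2 * la y * s y) * complex_of_real (g y $ b $ a) + 1 * (dl y $ b * lc y $ a) + 0 * (lc y $ b * lc y $ a))"
    define D where "D = (\<lambda>a b. nab g dl x a b)"
    have "pd a (\<lambda>y. dl y $ b) x = pd b (\<lambda>y. dl y $ a) x" for a b
    proof -
      have "(\<lambda>y. dl y $ b) = (\<lambda>y. complex_of_real (pd b lam y))" for b by (simp add: dl_def)
      then show ?thesis
        using pd_commute_real[OF smooth(5) U x, of a b] smooth_on_differentiable[OF smooth_on_pd[OF U smooth(5)] x]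
        by (simp add: pd_of_real)
    qed
    then have Ds: "D a b = D b a" for a b using nab_antisym[OF st x, of dl a b] by (simp add: D_def)
    have N: "nabla2 g T x c b a = 2 * (la x * \<sigma> x $ c + dl x $ c * s x) * G b a + D c b * lc x $ a
        + dl x $ b * (s x * G c a + i x * (\<sigma> x $ c * lc x $ a - lc x $ c * \<sigma> x $ a))" for a b c
      unfolding T_def
      by (subst nabla2_combination[OF st x])
        (simp_all add: d[OF x] differentiable_mult pd_mult pd_const ds'[OF x] dla[OF x] G_def D_def nl[OF x] algebra_simps)
    have "nabla2 g T x c b a - nabla2 g T x b c a = - (\<Sum>d\<in>UNIV. complex_of_real (riemann g x d a c b) * \<sigma> x $ d)"
      by (rule nab_commutator[OF st x sm(8)]) (simp add: T_def n\<sigma>)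
    then have "(\<Sum>d\<in>UNIV. complex_of_real (riemann g x d a c b) * \<sigma> x $ d) = nabla2 g T x b c a - nabla2 g T x c b a"
      by (rule neg)
    also have "\<dots> = \<sigma> x $ b * (i x * P c a) - \<sigma> x $ c * (i x * P b a) - kc * s x * (lc x $ c * G b a - lc x $ b * G c a)"
      unfolding N iP dlx Ds[of c b] by (simp add: algebra_simps)
    finally show ?thesis .
  qed
  have Kl: "(\<Sum>d\<in>UNIV. complex_of_real (riemann g x d a c b) * lc x $ d) = lc x $ b * (i x * P c a) - lc x $ c * (i x * P b a)" for a b c
    by (rule K[where \<alpha>=1, OF sm(4) nl])
  have KZ: "(\<Sum>d\<in>UNIV. complex_of_real (riemann g x d a c b) * Z x $ d) = Z x $ b * (i x * P c a) - Z x $ c * (i x * P b a)" for a b c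
    by (rule K[where \<alpha>=0, OF sm(6) nZ])
  have KZc: "(\<Sum>d\<in>UNIV. complex_of_real (riemann g x d a c b) * Zc x $ d) = Zc x $ b * (i x * P c a) - Zc x $ c * (i x * P b a)" for a b c
    by (rule K[where \<alpha>=0, OF sm(7) nZc])
  have Kn: "(\<Sum>d\<in>UNIV. complex_of_real (riemann g x d a c b) * nc x $ d) =
      nc x $ b * (i x * P c a) - nc x $ c * (i x * P b a) + kc * s x * (lc x $ c * G b a - lc x $ b * G c a)" for a b c
  proof -
    have "(\<Sum>d\<in>UNIV. complex_of_real (riemann g x d a c b) * nc x $ d) =
        la x * (\<Sum>d\<in>UNIV. complex_of_real (riemann g x d a c b) * lc x $ d) - (\<Sum>d\<in>UNIV. complex_of_real (riemann g x d a c b) * \<sigma> x $ d)"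
      unfolding sum_distrib_left sum_subtractf[symmetric] by (intro sum.cong refl) (simp add: \<sigma>_def algebra_simps)
    also have "\<dots> = nc x $ b * (i x * P c a) - nc x $ c * (i x * P b a) + kc * s x * (lc x $ c * G b a - lc x $ b * G c a)"
      unfolding Kl K\<sigma> by (simp add: \<sigma>_def algebra_simps)
    finally show ?thesis .
  qed
  interpret t: tetrad_at g x U "s x * s x" "lc x" "nc x" "Z x" "Zc x" by (rule T[OF x])
  \<comment> \<open>A vector annihilated by the four tetrad members is zero, so the contractions
    determine the curvature. The last term is a multiple of the vector of l because that vector
    pairs only with n among the tetrad members.\<close>
  have R: "complex_of_real (riemann g x d a c b) = (if d = b then i x * P c a else 0) - (if d = c then i x * P b a else 0)
      - kc * i x * (lc x $ c * G b a - lc x $ b * G c a) * t.up (lc x) d" for a b c d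
  proof -
    define W where "W = lc x $ c * G b a - lc x $ b * G c a"
    define D where "D = (\<lambda>d. complex_of_real (riemann g x d a c b) - ((if d = b then i x * P c a else 0) - (if d = c then i x * P b a else 0)
      - kc * i x * W * t.up (lc x) d))"
    have SD: "(\<Sum>d\<in>UNIV. D d * e $ d) = (\<Sum>d\<in>UNIV. complex_of_real (riemann g x d a c b) * e $ d)
        - (i x * P c a * e $ b - i x * P b a * e $ c - kc * i x * W * cinner g x e (lc x))" for e
    proof -
      have 1: "(\<Sum>d\<in>UNIV. (if d = b then A else 0) * e $ d) = A * e $ b" for A b by (simp add: mult_delta_left)
      have "(\<Sum>d\<in>UNIV. D d * e $ d) = (\<Sum>d\<in>UNIV. complex_of_real (riemann g x d a c b) * e $ d)
        - ((\<Sum>d\<in>UNIV. (if d = b then i x * P c a else 0) * e $ d) - (\<Sum>d\<in>UNIV. (if d = c then i x * P b a else 0) * e $ d)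
          - kc * i x * W * (\<Sum>d\<in>UNIV. t.up (lc x) d * e $ d))"
        unfolding D_def left_diff_distrib sum_subtractf sum_distrib_left by (simp only: mult.assoc)
      then show ?thesis unfolding 1 t.up(2) .
    qed
    have "kc * i x * W * (s x * s x) = kc * (i x * s x) * (s x * W)" by (simp only: mult_ac)
    then have kW: "kc * i x * W * (s x * s x) = kc * s x * W" by (simp add: si[OF x])
    have "D d = 0"
    proof (rule t.tetrad_dual_zero)
      show "(\<Sum>d\<in>UNIV. D d * lc x $ d) = 0" unfolding SD Kl t.cinner_tetrad by (simp add: mult.commute)
      show "(\<Sum>d\<in>UNIV. D d * Z x $ d) = 0" unfolding SD KZ t.cinner_tetrad by (simp add: mult.commute)
      show "(\<Sum>d\<in>UNIV. D d * Zc x $ d) = 0" unfolding SD KZc t.cinner_tetrad by (simp add: mult.commute)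
      show "(\<Sum>d\<in>UNIV. D d * nc x $ d) = 0"
        unfolding SD Kn[where a=a and b=b and c=c, folded W_def] t.cinner_tetrad mult_minus_right kW by (simp add: mult.commute)
    qed
    then show ?thesis by (simp add: D_def W_def)
  qed
  have "complex_of_real (ricci g x $ a $ b) = i x * P b a - 4 * (i x * P b a)
      - kc * i x * ((\<Sum>c\<in>UNIV. lc x $ c * t.up (lc x) c) * G b a - lc x $ b * (\<Sum>c\<in>UNIV. t.up (lc x) c * G c a))"
  proof -
    have "complex_of_real (ricci g x $ a $ b) = (\<Sum>c\<in>UNIV. (if c = b then i x * P c a else 0) - i x * P b a
        - kc * i x * (lc x $ c * t.up (lc x) c * G b a - lc x $ b * (t.up (lc x) c * G c a)))"
      unfolding ricci_riemann of_real_sum by (intro sum.cong refl, subst R) (simp add: algebra_simps)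
    also have "\<dots> = (\<Sum>c\<in>UNIV. (if c = b then i x * P c a else 0)) - (\<Sum>c\<in>(UNIV :: 4 set). i x * P b a)
      - kc * i x * ((\<Sum>c\<in>UNIV. lc x $ c * t.up (lc x) c) * G b a - lc x $ b * (\<Sum>c\<in>UNIV. t.up (lc x) c * G c a))"
      unfolding sum_distrib_right sum_distrib_left[of "lc x $ b"] sum_distrib_left[of "kc * i x"] sum_subtractf[symmetric] ..
    also have "(\<Sum>c\<in>UNIV. (if c = b then i x * P c a else 0)) = i x * P b a" by simp
    also have "(\<Sum>c\<in>(UNIV :: 4 set). i x * P b a) = 4 * (i x * P b a)" by simp
    finally show ?thesis .
  qed
  also have "(\<Sum>c\<in>UNIV. lc x $ c * t.up (lc x) c) = 0" by (simp add: t.up t.cinner_tetrad)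
  also have "(\<Sum>c\<in>UNIV. t.up (lc x) c * G c a) = lc x $ a" unfolding G_def by (rule t.up_metric)
  also have "i x * P b a - 4 * (i x * P b a) - kc * i x * (0 * G b a - lc x $ b * lc x $ a) =
      - 6 * la x * G a b - 2 * (kc * i x) * (lc x $ a * lc x $ b)"
    by (subst iP)+ (simp add: Gs[of b a] algebra_simps)
  also have "\<dots> = complex_of_real (- 6 * lam x * g x $ a $ b - 2 * k / Re (s x) * l x $ a * l x $ b)"
  proof -
    have "s x = complex_of_real (Re (s x))" using real[OF x] by (simp add: complex_eq_iff)
    then have "i x = complex_of_real (1 / Re (s x))" unfolding i_def by (metis inverse_eq_divide of_real_inverse)
    then show ?thesis by (simp add: la_def G_def kc_def lc_def)
  qed
  finally show ?thesis by (simp only: of_real_eq_iff)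
qed

end

section \<open>Coordinates\<close>

text \<open>A primitive as a parallel section (\<xi>, 0, 0, 1): the connection matrix has the single
  entry \<omega> in its upper right corner. Products of such matrices vanish, so flatness is
  closedness. The last component of the solution is constant, hence 1.\<close>

lemma closed_form_exact:
  fixes \<omega> :: "4 \<Rightarrow> real ^ 4 \<Rightarrow> complex"
  assumes \<omega>: "\<And>a. smooth_on S (\<omega> a)" and S: "open S" "x0 \<in> S"
    and closed: "\<And>x a b. x \<in> S \<Longrightarrow> pd b (\<omega> a) x = pd a (\<omega> b) x"
  obtains r \<xi> where "r > 0" "ball x0 r \<subseteq> S" "smooth_on (ball x0 r) \<xi>" "\<And>x a. x \<in> ball x0 r \<Longrightarrow> pd a \<xi> x = \<omega> a x"
proof -
  define Om :: "4 \<Rightarrow> real ^ 4 \<Rightarrow> complex ^ 4 ^ 4" where "Om = (\<lambda>a y. rows4 (rows4 0 0 0 (\<omega> a y)) 0 0 0)"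
  have ent: "Om a y $ r $ c = (if r = 0 \<and> c = 3 then \<omega> a y else 0)" for a y r c
    using exhaust4[of r] exhaust4[of c] by (auto simp: Om_def)
  have smOm: "smooth_on S (Om a)" for a
  proof -
    have "smooth_on S (\<lambda>y. Om a y $ r $ c)" for r c
      by (cases "r = 0 \<and> c = 3") (simp_all only: ent if_True if_False simp_thms \<omega> smooth_on_const[OF S(1)])
    then show ?thesis by (simp add: smooth_on_vec_iff S)
  qed
  have flat: "pd b (Om a) x + Om a x ** Om b x = pd a (Om b) x + Om b x ** Om a x" if x: "x \<in> S" for x a b
  proof -
    have "pd b (Om a) x $ r $ c = pd b (\<lambda>y. Om a y $ r $ c) x" for a b r c
      using pd_nth[OF smooth_on_differentiable[OF smOm x], of b a r]
        pd_nth[OF smooth_on_differentiable[OF smooth_on_nth[OF S(1) smOm] x], of b a r c] by simp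
    moreover have "pd b (\<lambda>y. Om a y $ r $ c) x = pd a (\<lambda>y. Om b y $ r $ c) x" for r c
      by (cases "r = 0 \<and> c = 3") (simp_all only: ent if_True if_False simp_thms closed[OF x, of b a] pd_const)
    moreover have "Om a x ** Om b x = 0" for a b
      by (simp add: vec_eq_iff matrix_matrix_mult_def ent sum4)
    ultimately show ?thesis by (simp add: vec_eq_iff)
  qed
  obtain r \<Phi> where r: "r > 0" "ball x0 r \<subseteq> S" and \<Phi>: "\<Phi> x0 = rows4 0 0 0 1" "smooth_on (ball x0 r) \<Phi>"
    and d: "\<And>x a. x \<in> ball x0 r \<Longrightarrow> pd a \<Phi> x = Om a x *v \<Phi> x"
    using flat_matrix_connection[where ?v0.0="rows4 0 0 0 1", OF smOm S flat] by blast
  have dk: "pd a (\<lambda>y. \<Phi> y $ k) x = (if k = 0 then \<omega> a x * \<Phi> x $ 3 else 0)" if x: "x \<in> ball x0 r" for x a k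
    using pd_nth[OF smooth_on_differentiable[OF \<Phi>(2) x], of a k] d[OF x, of a]
    by (simp add: matrix_vector_mult_def ent sum4)
  have nth: "smooth_on (ball x0 r) (\<lambda>y. \<Phi> y $ k)" for k by (intro smooth_on_nth \<Phi> open_ball)
  have one: "\<Phi> x $ 3 = 1" if x: "x \<in> ball x0 r" for x
  proof -
    have "((\<lambda>y. \<Phi> y $ 3) has_derivative (\<lambda>h. 0)) (at y within ball x0 r)" if y: "y \<in> ball x0 r" for y
      using has_derivative_pd[OF smooth_on_differentiable[OF nth y], of 3] dk[OF y, of _ 3]
      by (simp add: has_derivative_at_withinI)
    then obtain c where "\<And>y. y \<in> ball x0 r \<Longrightarrow> \<Phi> y $ 3 = c"
      using has_derivative_zero_constant[OF convex_ball, of x0 r "\<lambda>y. \<Phi> y $ 3"] by blast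
    then have "\<Phi> x $ 3 = \<Phi> x0 $ 3" using x r(1) by simp
    then show ?thesis by (simp add: \<Phi>(1))
  qed
  show thesis using that[OF r nth[of 0]] dk[of _ _ 0] one by simp
qed

lemma pd_real_compose:
  fixes f :: "real \<Rightarrow> real"
  assumes "f differentiable at (u x)" "u differentiable at x"
  shows "pd a (\<lambda>y. f (u y)) x = deriv f (u x) * pd a u x"
proof -
  have "(f has_derivative (\<lambda>h. deriv f (u x) * h)) (at (u x))"
    using assms(1) DERIV_deriv_iff_real_differentiable has_field_derivative_def by blast
  from pd_eqI[OF has_derivative_compose[OF has_derivative_pd[OF assms(2)] this], of a] show ?thesis
    using pd_eqI[OF has_derivative_pd[OF assms(2)], of a] by simp
qed

lemma smooth_on_deriv:
  fixes f :: "real \<Rightarrow> real"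
  assumes "smooth_on S f" "open S"
  shows "smooth_on S (deriv f)"
proof (rule smooth_on_cong[OF smooth_on_frechet_derivative[OF assms, of 1] assms(2)])
  fix t assume t: "t \<in> S"
  have "(f has_derivative (\<lambda>h. deriv f t * h)) (at t)"
    using smooth_on_differentiable[OF assms(1) t] DERIV_deriv_iff_real_differentiable has_field_derivative_def by blast
  from frechet_derivative_at[OF this] show "deriv f t = frechet_derivative f (at t) 1"
    by (metis mult.right_neutral)
qed

text \<open>The point beyond closedness is that 1/s - v depends on u alone on all of
  \<open>V\<close>. For this \<open>V\<close> is cut down until its coordinate image is a ball: the
  slices of constant u are then convex, and u takes its values in an interval.\<close>

theorem (in real_frame) coordinates:
  assumes p: "p \<in> U"
  obtains V u v \<xi> f where "open V" "connected V" "p \<in> V" "V \<subseteq> U" "coordinates_on V u v \<xi>" "smooth_on (u ` V) f"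
    "smooth_on V u" "smooth_on V v" "smooth_on V \<xi>"
    "\<And>x. x \<in> V \<Longrightarrow> v x + f (u x) = 1 / Re (s x)"
    "\<And>x a. x \<in> V \<Longrightarrow> pd a u x = l x $ a / (Re (s x))\<^sup>2"
    "\<And>x a. x \<in> V \<Longrightarrow> pd a v x = n x $ a / (Re (s x))\<^sup>2"
    "\<And>x a. x \<in> V \<Longrightarrow> pd a \<xi> x = Z x $ a / complex_of_real ((Re (s x))\<^sup>2)"
    "\<And>x. x \<in> V \<Longrightarrow> deriv f (u x) = - lam x"
    "\<And>x k. x \<in> V \<Longrightarrow> (\<And>a. pd a lam x = k * l x $ a) \<Longrightarrow> deriv (deriv f) (u x) = - k * (Re (s x))\<^sup>2"
proof -
  define S where "S = (\<lambda>x. Re (s x))"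
  have sS: "s x = complex_of_real (S x)" if "x \<in> U" for x using real[OF that] by (simp add: S_def complex_eq_iff)
  have S0: "S x \<noteq> 0" if "x \<in> U" for x using sS[OF that] s_nonzero[OF that] by auto
  have smS: "smooth_on U S" unfolding S_def by (intro smooth_on_Re smooth U)
  have dS: "pd a S x = - n x $ a + lam x * l x $ a" if x: "x \<in> U" for a x
    unfolding S_def using pd_Re[OF differentiable(1)[OF x], of a] ds[OF x, of a] by simp
  define i where "i = (\<lambda>y. inverse (s y))"
  have smi: "smooth_on U i" unfolding i_def using s_nonzero by (intro smooth_on_inverse smooth U) simp
  have di: "pd a i x = - pd a s x * (i x * i x)" if x: "x \<in> U" for a x
    unfolding i_def pd_inverse[OF differentiable(1)[OF x] s_nonzero[OF x]] by (simp add: divide_inverse power2_eq_square)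
  have iS: "i x * i x = complex_of_real (1 / (S x)\<^sup>2)" if "x \<in> U" for x
    unfolding i_def sS[OF that] by (simp add: power2_eq_square divide_inverse)
  \<comment> \<open>The hypothesis on q says dq = 2 ds \<and> q / s, which is closedness of
    q/s^2.\<close>
  have potential: "\<exists>r \<xi>. r > 0 \<and> ball p r \<subseteq> U \<and> smooth_on (ball p r) \<xi> \<and> (\<forall>x\<in>ball p r. \<forall>a. pd a \<xi> x = q x $ a * (i x * i x))"
    if q: "\<And>a. smooth_on U (\<lambda>x. q x $ a)"
      and c: "\<And>x a b. x \<in> U \<Longrightarrow> nab g q x a b - nab g q x b a = 2 * i x * (pd a s x * q x $ b - pd b s x * q x $ a)"
    for q :: "real ^ 4 \<Rightarrow> complex ^ 4"
  proof -
    have closed: "pd b (\<lambda>x. q x $ a * (i x * i x)) x = pd a (\<lambda>x. q x $ b * (i x * i x)) x" if x: "x \<in> U" for x a b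
    proof -
      note d = smooth_on_differentiable[OF q x] smooth_on_differentiable[OF smi x]
      have e: "pd a (\<lambda>y. q y $ b) x = pd b (\<lambda>y. q y $ a) x + 2 * i x * (pd a s x * q x $ b - pd b s x * q x $ a)"
        using c[OF x, of a b] unfolding nab_antisym[OF st x] by (simp add: algebra_simps)
      show ?thesis by (simp add: pd_mult d differentiable_mult di[OF x] e algebra_simps)
    qed
    have smq: "smooth_on U (\<lambda>x. q x $ a * (i x * i x))" for a by (intro smooth_on_mult q smi U)
    show ?thesis
    proof (rule closed_form_exact[where \<omega>="\<lambda>a x. q x $ a * (i x * i x)", OF smq U p])
      show "pd b (\<lambda>x. q x $ a * (i x * i x)) x = pd a (\<lambda>x. q x $ b * (i x * i x)) x" if "x \<in> U" for x a b
        by (rule closed[OF that])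
      fix r \<xi> assume "r > 0" "ball p r \<subseteq> U" "smooth_on (ball p r) \<xi>"
        "\<And>x a. x \<in> ball p r \<Longrightarrow> pd a \<xi> x = q x $ a * (i x * i x)"
      then show ?thesis by (intro exI[of _ r] exI[of _ \<xi>]) simp
    qed
  qed
  have cl: "nab g (\<lambda>y. cvec (l y)) x a b - nab g (\<lambda>y. cvec (l y)) x b a =
      2 * i x * (pd a s x * cvec (l x) $ b - pd b s x * cvec (l x) $ a)" if x: "x \<in> U" for x a b
    unfolding nab_cvec[OF differentiable(4)[OF x]] nab_l[OF x] ds[OF x] i_def real[OF x] divide_inverse
    by (simp add: algebra_simps)
  have cn: "nab g (\<lambda>y. cvec (n y)) x a b - nab g (\<lambda>y. cvec (n y)) x b a =
      2 * i x * (pd a s x * cvec (n x) $ b - pd b s x * cvec (n x) $ a)" if x: "x \<in> U" for x a b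
    unfolding nab_cvec[OF differentiable(5)[OF x]] nab_n[OF x] ds[OF x] i_def real[OF x] divide_inverse
    by (simp add: algebra_simps)
  have cZ: "nab g Z x a b - nab g Z x b a = 2 * i x * (pd a s x * Z x $ b - pd b s x * Z x $ a)" if x: "x \<in> U" for x a b
    unfolding nab_Z[OF x] ds[OF x] i_def real[OF x] divide_inverse by (simp add: algebra_simps)
  have smc: "smooth_on U (\<lambda>x. cvec (l x) $ a)" "smooth_on U (\<lambda>x. cvec (n x) $ a)" for a
    unfolding cvec_nth by (intro smooth_on_of_real smooth_nth U)+
  obtain r1 \<xi>1 where 1: "r1 > 0" "ball p r1 \<subseteq> U" "smooth_on (ball p r1) \<xi>1" "\<And>x a. x \<in> ball p r1 \<Longrightarrow> pd a \<xi>1 x = cvec (l x) $ a * (i x * i x)"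
    using potential[of "\<lambda>y. cvec (l y)", OF smc(1) cl] by blast
  obtain r2 \<xi>2 where 2: "r2 > 0" "ball p r2 \<subseteq> U" "smooth_on (ball p r2) \<xi>2" "\<And>x a. x \<in> ball p r2 \<Longrightarrow> pd a \<xi>2 x = cvec (n x) $ a * (i x * i x)"
    using potential[of "\<lambda>y. cvec (n y)", OF smc(2) cn] by blast
  obtain r3 \<xi> where 3: "r3 > 0" "ball p r3 \<subseteq> U" "smooth_on (ball p r3) \<xi>" "\<And>x a. x \<in> ball p r3 \<Longrightarrow> pd a \<xi> x = Z x $ a * (i x * i x)"
    using potential[of Z, OF smooth_nth(3) cZ] by blast
  define B where "B = ball p r1 \<inter> ball p r2 \<inter> ball p r3"
  have B: "open B" "p \<in> B" "B \<subseteq> U" "B \<subseteq> ball p r1" "B \<subseteq> ball p r2" "B \<subseteq> ball p r3" using 1 2 3 by (auto simp: B_def)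
  have BU: "x \<in> U" if "x \<in> B" for x using that B(3) by blast
  define u where "u = (\<lambda>x. Re (\<xi>1 x))"
  define v where "v = (\<lambda>x. Re (\<xi>2 x))"
  have sm: "smooth_on B u" "smooth_on B v" "smooth_on B \<xi>"
    unfolding u_def v_def using 1(3) 2(3) 3(3) smooth_on_subset B by (blast intro: smooth_on_Re)+
  note d = sm[THEN smooth_on_differentiable]
  have du: "pd a u x = l x $ a / (S x)\<^sup>2" and dv: "pd a v x = n x $ a / (S x)\<^sup>2"
    and dxi: "pd a \<xi> x = Z x $ a * complex_of_real (1 / (S x)\<^sup>2)" if x: "x \<in> B" for a x
  proof -
    have x': "x \<in> ball p r1" "x \<in> ball p r2" "x \<in> ball p r3" using x B by blast+
    show "pd a u x = l x $ a / (S x)\<^sup>2"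
      unfolding u_def pd_Re[OF smooth_on_differentiable[OF 1(3) x'(1)]] 1(4)[OF x'(1)] iS[OF BU[OF x]] cvec_nth by (simp flip: of_real_mult)
    show "pd a v x = n x $ a / (S x)\<^sup>2"
      unfolding v_def pd_Re[OF smooth_on_differentiable[OF 2(3) x'(2)]] 2(4)[OF x'(2)] iS[OF BU[OF x]] cvec_nth by (simp flip: of_real_mult)
    show "pd a \<xi> x = Z x $ a * complex_of_real (1 / (S x)\<^sup>2)"
      unfolding 3(4)[OF x'(3)] iS[OF BU[OF x]] ..
  qed
  \<comment> \<open>The complex coordinate is split into real and imaginary parts to apply the
    inverse function theorem; the splitting is undone at the end by the linear maps \<open>L\<close>
    and \<open>L'\<close>.\<close>
  define \<phi> :: "real ^ 4 \<Rightarrow> real ^ 4" where "\<phi> = (\<lambda>x. rows4 (u x) (v x) (Re (\<xi> x)) (Im (\<xi> x)))"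
  have sm\<phi>i: "smooth_on B (\<lambda>x. \<phi> x $ j)" for j
    using exhaust4[of j] sm smooth_on_Re[OF B(1) sm(3)] smooth_on_Im[OF B(1) sm(3)] by (auto simp: \<phi>_def)
  have sm\<phi>: "smooth_on B \<phi>" using sm\<phi>i by (simp add: smooth_on_vec_iff B(1))
  have inj: "w = 0" if w: "frechet_derivative \<phi> (at p) w = 0" for w
  proof -
    interpret t: tetrad_at g p U "s p * cnj (s p)" "cvec (l p)" "cvec (n p)" "Z p" "vcnj (Z p)" by (rule tetrad[OF p])
    have z: "(\<Sum>a\<in>UNIV. w $ a * pd a (\<lambda>x. \<phi> x $ j) p) = 0" for j
      using arg_cong[OF w, of "\<lambda>t. t $ j"] pd_nth[OF smooth_on_differentiable[OF sm\<phi> B(2)], of _ j]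
      by (simp add: frechet_derivative_pd[OF smooth_on_differentiable[OF sm\<phi> B(2)]])
    have zl: "(\<Sum>a\<in>UNIV. w $ a * l p $ a) = 0"
      using z[of 0] S0[OF p] by (simp add: \<phi>_def du[OF B(2)] flip: sum_divide_distrib)
    have zn: "(\<Sum>a\<in>UNIV. w $ a * n p $ a) = 0"
      using z[of 1] S0[OF p] by (simp add: \<phi>_def dv[OF B(2)] flip: sum_divide_distrib)
    have zr: "(\<Sum>a\<in>UNIV. w $ a * Re (Z p $ a)) = 0"
      using z[of 2] S0[OF p] by (simp add: \<phi>_def pd_Re[OF d(3)[OF B(2)]] dxi[OF B(2)] flip: sum_divide_distrib)
    have zi: "(\<Sum>a\<in>UNIV. w $ a * Im (Z p $ a)) = 0"
      using z[of 3] S0[OF p] by (simp add: \<phi>_def pd_Im[OF d(3)[OF B(2)]] dxi[OF B(2)] flip: sum_divide_distrib)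
    have "complex_of_real (w $ a) = 0" for a
    proof (rule t.tetrad_dual_zero)
      show "(\<Sum>d\<in>UNIV. complex_of_real (w $ d) * cvec (l p) $ d) = 0" using zl by (simp flip: of_real_mult of_real_sum)
      show "(\<Sum>d\<in>UNIV. complex_of_real (w $ d) * cvec (n p) $ d) = 0" using zn by (simp flip: of_real_mult of_real_sum)
      show "(\<Sum>d\<in>UNIV. complex_of_real (w $ d) * Z p $ d) = 0" "(\<Sum>d\<in>UNIV. complex_of_real (w $ d) * vcnj (Z p) $ d) = 0"
        using zr zi by (simp_all add: complex_eq_iff sum_negf)
    qed
    then show ?thesis by (simp add: vec_eq_iff)
  qed
  obtain V0 \<psi> where V0: "open V0" "p \<in> V0" "V0 \<subseteq> B" "open (\<phi> ` V0)" "smooth_on (\<phi> ` V0) \<psi>" "\<And>x. x \<in> V0 \<Longrightarrow> \<psi> (\<phi> x) = x"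
    using smooth_inverse_function[OF sm\<phi> B(1,2) inj] by blast
  define c where "c = \<phi> p"
  obtain \<epsilon> where \<epsilon>: "\<epsilon> > 0" "ball c \<epsilon> \<subseteq> \<phi> ` V0"
    using V0(2,4) openE[of "\<phi> ` V0" c] unfolding c_def by blast
  define V where "V = V0 \<inter> \<phi> -` ball c \<epsilon>"
  have V: "open V" unfolding V_def
    by (rule continuous_open_preimage[OF continuous_on_subset[OF smooth_on_continuous_on[OF sm\<phi>] V0(3)] V0(1) open_ball])
  have Vx: "x \<in> B" "x \<in> V0" "\<phi> x \<in> ball c \<epsilon>" "\<psi> (\<phi> x) = x" if "x \<in> V" for x
    using that V0 unfolding V_def by blast+
  have inv: "\<psi> y \<in> V" "\<phi> (\<psi> y) = y" if "y \<in> ball c \<epsilon>" for y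
  proof -
    obtain x where "x \<in> V0" "y = \<phi> x" using \<epsilon>(2) \<open>y \<in> ball c \<epsilon>\<close> by blast
    then show "\<psi> y \<in> V" "\<phi> (\<psi> y) = y" using V0(6) \<open>y \<in> ball c \<epsilon>\<close> by (auto simp: V_def)
  qed
  have im: "\<phi> ` V = ball c \<epsilon>" "\<psi> ` ball c \<epsilon> = V" using Vx inv by (auto simp: image_iff) force+
  have sm\<psi>: "smooth_on (ball c \<epsilon>) \<psi>" by (rule smooth_on_subset[OF V0(5) \<epsilon>(2)])
  have conn: "connected V"
    using connected_continuous_image[OF smooth_on_continuous_on[OF sm\<psi>] convex_connected[OF convex_ball]] im(2) by simp
  have pV: "p \<in> V" using V0(2) \<epsilon>(1) by (simp add: V_def c_def)
  have VB: "V \<subseteq> B" using Vx by blast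
  \<comment> \<open>The segment through the centre of the ball along the u-axis; f is read off on
    it.\<close>
  define line where "line = (\<lambda>t. c + (t - c $ 0) *\<^sub>R axis 0 (1::real))"
  have line0: "line t $ 0 = t" for t by (simp add: line_def)
  have lineW: "line t \<in> ball c \<epsilon>" if "\<bar>t - c $ 0\<bar> < \<epsilon>" for t
    using that by (simp add: line_def dist_norm)
  have uV: "u ` V = {t. \<bar>t - c $ 0\<bar> < \<epsilon>}"
  proof (intro equalityI subsetI; clarsimp)
    fix x assume "x \<in> V"
    then have "norm (\<phi> x - c) < \<epsilon>" using Vx(3) by (simp add: dist_norm norm_minus_commute)
    moreover have "\<bar>u x - c $ 0\<bar> = \<bar>(\<phi> x - c) $ 0\<bar>" by (simp add: \<phi>_def)
    ultimately show "\<bar>u x - c $ 0\<bar> < \<epsilon>" using component_le_norm_cart[of "\<phi> x - c" 0] by linarith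
  next
    fix t assume t: "\<bar>t - c $ 0\<bar> < \<epsilon>"
    have "u (\<psi> (line t)) = \<phi> (\<psi> (line t)) $ 0" by (simp add: \<phi>_def)
    also have "\<dots> = t" unfolding inv(2)[OF lineW[OF t]] line0 ..
    finally show "t \<in> u ` V" using inv(1)[OF lineW[OF t]] by (metis image_eqI)
  qed
  have uVo: "open (u ` V)"
  proof -
    have "u ` V = ball (c $ 0) \<epsilon>" unfolding uV by (auto simp: dist_real_def)
    then show ?thesis by simp
  qed
  define h where "h = (\<lambda>x. 1 / S x - v x)"
  have smh: "smooth_on V h" unfolding h_def using S0 BU VB
    by (intro smooth_on_diff smooth_on_divide smooth_on_const smooth_on_subset[OF smS] smooth_on_subset[OF sm(2)] V) blast+
  have dh: "pd a h x = - lam x * pd a u x" if x: "x \<in> V" for a x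
  proof -
    note xB = Vx(1)[OF x]
    note xU = BU[OF xB]
    have "pd a h x = pd a (\<lambda>y. inverse (S y)) x - pd a v x"
      unfolding h_def divide_inverse mult_1
      by (rule pd_diff[OF smooth_on_differentiable[OF smooth_on_inverse[OF U smS S0] xU] d(2)[OF xB]])
    also have "\<dots> = - lam x * pd a u x"
      unfolding pd_inverse[OF smooth_on_differentiable[OF smS xU] S0[OF xU]] dS[OF xU] du[OF xB] dv[OF xB]
      by (simp add: add_divide_distrib diff_divide_distrib)
    finally show ?thesis .
  qed
  define F where "F = (\<lambda>y. h (\<psi> y))"
  define f where "f = (\<lambda>t. F (line t))"
  have smF: "smooth_on (ball c \<epsilon>) F" unfolding F_def
    by (rule smooth_on_compose[OF sm\<psi> smh]) (use im in auto)
  \<comment> \<open>Since dh = -lam du, the function h in these coordinates has a derivative only in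
    the u-direction.\<close>
  have dF: "(F has_derivative (\<lambda>w. - lam (\<psi> y) * w $ 0)) (at y)" if y: "y \<in> ball c \<epsilon>" for y
  proof -
    define \<psi>' where "\<psi>' = frechet_derivative \<psi> (at y)"
    have \<psi>': "(\<psi> has_derivative \<psi>') (at y)" unfolding \<psi>'_def by (rule smooth_on_has_derivative[OF sm\<psi> y])
    note yV = inv(1)[OF y]
    have 1: "((\<lambda>y. u (\<psi> y)) has_derivative (\<lambda>w. \<Sum>a\<in>UNIV. \<psi>' w $ a *\<^sub>R pd a u (\<psi> y))) (at y)"
      by (rule has_derivative_compose[OF \<psi>' has_derivative_pd[OF d(1)[OF Vx(1)[OF yV]]]])
    have 2: "((\<lambda>y. u (\<psi> y)) has_derivative (\<lambda>w. w $ 0)) (at y)"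
    proof (rule has_derivative_transform_within_open[OF _ open_ball y])
      show "((\<lambda>y. y $ 0) has_derivative (\<lambda>w. w $ 0)) (at y)"
        by (rule bounded_linear_imp_has_derivative) (rule bounded_linear_vec_nth)
      show "z $ 0 = u (\<psi> z)" if "z \<in> ball c \<epsilon>" for z
        using arg_cong[OF inv(2)[OF that], of "\<lambda>t. t $ 0"] by (simp add: \<phi>_def)
    qed
    have "(\<Sum>a\<in>UNIV. \<psi>' w $ a *\<^sub>R pd a u (\<psi> y)) = w $ 0" for w
      by (rule fun_cong[OF has_derivative_unique[OF 1 2]])
    moreover have "(F has_derivative (\<lambda>w. \<Sum>a\<in>UNIV. \<psi>' w $ a *\<^sub>R pd a h (\<psi> y))) (at y)"
      unfolding F_def by (rule has_derivative_compose[OF \<psi>' has_derivative_pd[OF smooth_on_differentiable[OF smh yV]]])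
    moreover have "(\<Sum>a\<in>UNIV. \<psi>' w $ a *\<^sub>R pd a h (\<psi> y)) = - lam (\<psi> y) * (\<Sum>a\<in>UNIV. \<psi>' w $ a *\<^sub>R pd a u (\<psi> y))" for w
      unfolding dh[OF yV] sum_distrib_left by (intro sum.cong refl) simp
    ultimately show ?thesis by simp
  qed
  \<comment> \<open>The segment from y to the point of \<open>line\<close> with the same u stays in
    the ball, and F is constant along it.\<close>
  have fib: "F y = f (y $ 0)" if y: "y \<in> ball c \<epsilon>" for y
  proof -
    define y' where "y' = line (y $ 0)"
    have "\<bar>y $ 0 - c $ 0\<bar> < \<epsilon>"
      using component_le_norm_cart[of "y - c" 0] y by (simp add: dist_norm norm_minus_commute)
    then have y': "y' \<in> ball c \<epsilon>" unfolding y'_def by (rule lineW)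
    have z: "y' + \<tau> *\<^sub>R (y - y') \<in> ball c \<epsilon>" if "\<tau> \<in> {0..1}" for \<tau>
      using convexD[OF convex_ball y' y, of "1 - \<tau>" \<tau>] that by (simp add: algebra_simps)
    have "((\<lambda>\<tau>. F (y' + \<tau> *\<^sub>R (y - y'))) has_derivative (\<lambda>h. 0)) (at \<tau> within {0..1})" if \<tau>: "\<tau> \<in> {0..1}" for \<tau>
    proof -
      have "((\<lambda>\<tau>. y' + \<tau> *\<^sub>R (y - y')) has_derivative (\<lambda>h. h *\<^sub>R (y - y'))) (at \<tau>)"
        by (auto intro!: derivative_eq_intros)
      from has_derivative_compose[OF this dF[OF z[OF \<tau>]]]
      show ?thesis by (simp add: y'_def line0 has_derivative_at_withinI)
    qed
    then obtain k where k: "\<And>\<tau>. \<tau> \<in> {0..1} \<Longrightarrow> F (y' + \<tau> *\<^sub>R (y - y')) = k"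
      using has_derivative_zero_constant[of "{0..1::real}" "\<lambda>\<tau>. F (y' + \<tau> *\<^sub>R (y - y'))"] by auto
    show ?thesis using k[of 0] k[of 1] by (simp add: f_def y'_def)
  qed
  have fu: "f (u x) = 1 / S x - v x" if x: "x \<in> V" for x
    using fib[OF Vx(3)[OF x]] Vx(4)[OF x] by (simp add: F_def h_def \<phi>_def)
  have smf: "smooth_on (u ` V) f" unfolding f_def
  proof (rule smooth_on_compose[OF _ smF _ uVo])
    show "smooth_on (u ` V) line" unfolding line_def
    proof (intro smooth_on_add smooth_on_const uVo)
      have "bounded_linear (\<lambda>t::real. t *\<^sub>R axis 0 (1::real) :: real ^ 4)" by (rule bounded_linear_scaleR_left)
      moreover have "smooth_on (u ` V) (\<lambda>t::real. t)" by (rule smooth_on_linear[OF bounded_linear_ident uVo])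
      ultimately show "smooth_on (u ` V) (\<lambda>t. (t - c $ 0) *\<^sub>R axis 0 (1::real) :: real ^ 4)"
        by (intro smooth_on_bounded_linear[of "\<lambda>t. t *\<^sub>R axis 0 (1::real)"] smooth_on_diff smooth_on_const uVo)
    qed
    show "line ` u ` V \<subseteq> ball c \<epsilon>" using lineW unfolding uV by blast
  qed
  have lnz: "\<exists>a. pd a u x \<noteq> 0" if x: "x \<in> V" for x
    using l_nonzero[OF BU[OF Vx(1)[OF x]]] S0[OF BU[OF Vx(1)[OF x]]] by (simp add: du[OF Vx(1)[OF x]])
  have df: "deriv f (u x) = - lam x" if x: "x \<in> V" for x
  proof -
    obtain a where a: "pd a u x \<noteq> 0" using lnz[OF x] by blast
    have "deriv f (u x) * pd a u x = pd a (\<lambda>y. f (u y)) x"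
      by (rule pd_real_compose[symmetric], rule smooth_on_differentiable[OF smf], use x in blast, rule d(1)[OF Vx(1)[OF x]])
    also have "\<dots> = pd a h x" by (rule pd_cong[OF V x]) (simp add: fu h_def)
    finally show ?thesis using mult_right_cancel[OF a] unfolding dh[OF x] by blast
  qed
  have ddf: "deriv (deriv f) (u x) = - k * (S x)\<^sup>2" if x: "x \<in> V" and k: "\<And>a. pd a lam x = k * l x $ a" for x k
  proof -
    obtain a where a: "pd a u x \<noteq> 0" using lnz[OF x] by blast
    have "deriv (deriv f) (u x) * pd a u x = pd a (\<lambda>y. deriv f (u y)) x"
      by (rule pd_real_compose[symmetric], rule smooth_on_differentiable[OF smooth_on_deriv[OF smf uVo]], use x in blast, rule d(1)[OF Vx(1)[OF x]])
    also have "\<dots> = pd a (\<lambda>y. - lam y) x" by (rule pd_cong[OF V x]) (rule df)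
    also have "\<dots> = - (k * l x $ a)" by (simp add: pd_minus differentiable(3)[OF BU[OF Vx(1)[OF x]]] k)
    also have "\<dots> = (- k * (S x)\<^sup>2) * pd a u x"
      using S0[OF BU[OF Vx(1)[OF x]]] by (simp add: du[OF Vx(1)[OF x]])
    finally show ?thesis using mult_right_cancel[OF a] by blast
  qed
  have "coordinates_on V u v \<xi>"
  proof -
    define L where "L = (\<lambda>y :: real ^ 4. (y $ 0, y $ 1, Complex (y $ 2) (y $ 3)))"
    define L' :: "real \<times> real \<times> complex \<Rightarrow> real ^ 4" where "L' = (\<lambda>q. rows4 (fst q) (fst (snd q)) (Re (snd (snd q))) (Im (snd (snd q))))"
    have LL: "L (L' q) = q" "L' (L y) = y" for q y
    proof -
      show "L (L' q) = q" by (simp add: L_def L'_def)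
      have "L' (L y) $ j = y $ j" for j using exhaust4[of j] by (auto simp: L_def L'_def)
      then show "L' (L y) = y" by (simp add: vec_eq_iff)
    qed
    have L: "bounded_linear L" unfolding linear_conv_bounded_linear[symmetric]
      by (rule linearI) (simp_all add: L_def complex_eq_iff)
    have L': "bounded_linear L'" unfolding linear_conv_bounded_linear[symmetric]
    proof (rule linearI)
      have e: "P 0 \<Longrightarrow> P 1 \<Longrightarrow> P 2 \<Longrightarrow> P 3 \<Longrightarrow> (\<forall>j. P j)" for P :: "4 \<Rightarrow> bool" using exhaust4 by metis
      show "L' (q + q') = L' q + L' q'" for q q' unfolding vec_eq_iff by (rule e) (simp_all add: L'_def)
      show "L' (t *\<^sub>R q) = t *\<^sub>R L' q" for t q unfolding vec_eq_iff by (rule e) (simp_all add: L'_def)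
    qed
    have Lphi: "(\<lambda>x. (u x, v x, \<xi> x)) = (\<lambda>x. L (\<phi> x))" by (simp add: L_def \<phi>_def)
    have im': "(\<lambda>x. L (\<phi> x)) ` V = L' -` ball c \<epsilon>"
    proof -
      have "(\<lambda>x. L (\<phi> x)) ` V = L ` ball c \<epsilon>" unfolding im(1)[symmetric] by (simp add: image_image)
      also have "\<dots> = L' -` ball c \<epsilon>"
      proof (intro set_eqI iffI)
        fix q assume "q \<in> L ` ball c \<epsilon>"
        then obtain y where "y \<in> ball c \<epsilon>" "q = L y" by blast
        then show "q \<in> L' -` ball c \<epsilon>" by (simp add: LL del: mem_ball)
      next
        fix q assume "q \<in> L' -` ball c \<epsilon>"
        then have "L (L' q) \<in> L ` ball c \<epsilon>" by blast
        then show "q \<in> L ` ball c \<epsilon>" by (simp only: LL)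
      qed
      finally show ?thesis .
    qed
    have o: "open (L' -` ball c \<epsilon>)"
      by (rule open_vimage[OF open_ball]) (rule linear_continuous_on[OF L'])
    have "smooth_on V (\<lambda>x. L (\<phi> x))"
      by (rule smooth_on_bounded_linear[OF L V smooth_on_subset[OF sm\<phi> VB]])
    moreover have "smooth_on (L' -` ball c \<epsilon>) (\<lambda>q. \<psi> (L' q))"
      by (rule smooth_on_compose[OF smooth_on_linear[OF L' o] sm\<psi> _ o]) blast
    ultimately show ?thesis
      unfolding coordinates_on_def Let_def Lphi im'
      using o Vx(4) by (intro conjI exI[of _ "\<lambda>q. \<psi> (L' q)"]) (simp_all add: LL)
  qed
  moreover have "V \<subseteq> U" using VB B(3) by blast
  moreover have "smooth_on V u" "smooth_on V v" "smooth_on V \<xi>" using sm smooth_on_subset VB by blast+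
  moreover have "pd a \<xi> x = Z x $ a / complex_of_real ((Re (s x))\<^sup>2)" if "x \<in> V" for a x
    using dxi[OF Vx(1)[OF that], of a] by (simp add: S_def)
  moreover have "pd a u x = l x $ a / (Re (s x))\<^sup>2" "pd a v x = n x $ a / (Re (s x))\<^sup>2" if "x \<in> V" for a x
    using du[OF Vx(1)[OF that], of a] dv[OF Vx(1)[OF that], of a] by (simp_all add: S_def)
  moreover have "v x + f (u x) = 1 / Re (s x)" if "x \<in> V" for x using fu[OF that] by (simp add: S_def)
  ultimately show thesis
    using that[of V u v \<xi> f] V conn pV smf df ddf[unfolded S_def] by blast
qed

section \<open>The normal form\<close>

theorem (in real_frame) normal_form:
  assumes p: "p \<in> U"
  obtains V u v \<xi> f where "open V" "connected V" "p \<in> V" "V \<subseteq> U" "coordinates_on V u v \<xi>" "smooth_on (u ` V) f"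
    "\<And>x. x \<in> V \<Longrightarrow> v x + f (u x) \<noteq> 0"
    "\<And>x w. x \<in> V \<Longrightarrow> complex_of_real (w \<bullet> (g x *v w)) = complex_of_real (1 / (v x + f (u x))\<^sup>2) *
      (- 2 * complex_of_real (differential u x w) * complex_of_real (differential v x w)
        + 2 * differential \<xi> x w * differential (\<lambda>y. cnj (\<xi> y)) x w)"
    "\<And>x. x \<in> V \<Longrightarrow> l x = (\<chi> a. pd a u x / (v x + f (u x))\<^sup>2)"
    "\<And>x. x \<in> V \<Longrightarrow> ricci g x = (\<chi> a b. 2 * deriv (deriv f) (u x) * (v x + f (u x)) ^ 3 * l x $ a * l x $ b
      + 6 * deriv f (u x) * g x $ a $ b)"
    "\<And>x. x \<in> V \<Longrightarrow> (\<And>a. pd a lam x = 0) \<Longrightarrow> deriv (deriv f) (u x) = 0"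
proof -
  show thesis
  proof (rule coordinates[OF p])
  fix V u v \<xi> f assume V: "open V" "connected V" "p \<in> V" "V \<subseteq> U" "coordinates_on V u v \<xi>" "smooth_on (u ` V) f"
    and sm: "smooth_on V u" "smooth_on V v" "smooth_on V \<xi>"
    and vf: "\<And>x. x \<in> V \<Longrightarrow> v x + f (u x) = 1 / Re (s x)"
    and du: "\<And>x a. x \<in> V \<Longrightarrow> pd a u x = l x $ a / (Re (s x))\<^sup>2"
    and dv: "\<And>x a. x \<in> V \<Longrightarrow> pd a v x = n x $ a / (Re (s x))\<^sup>2"
    and dxi: "\<And>x a. x \<in> V \<Longrightarrow> pd a \<xi> x = Z x $ a / complex_of_real ((Re (s x))\<^sup>2)"
    and df: "\<And>x. x \<in> V \<Longrightarrow> deriv f (u x) = - lam x"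
    and ddf: "\<And>x k. x \<in> V \<Longrightarrow> (\<And>a. pd a lam x = k * l x $ a) \<Longrightarrow> deriv (deriv f) (u x) = - k * (Re (s x))\<^sup>2"
  have sS: "s x = complex_of_real (Re (s x))" if "x \<in> V" for x using real[of x] that V(4) by (auto simp: complex_eq_iff)
  have S0: "Re (s x) \<noteq> 0" if "x \<in> V" for x
  proof
    assume "Re (s x) = 0"
    then have "s x = 0" using sS[OF that] by simp
    then show False using s_nonzero[of x] that V(4) by blast
  qed
  have 1: "complex_of_real (w \<bullet> (g x *v w)) = complex_of_real (1 / (v x + f (u x))\<^sup>2) *
      (- 2 * complex_of_real (differential u x w) * complex_of_real (differential v x w)
        + 2 * differential \<xi> x w * differential (\<lambda>y. cnj (\<xi> y)) x w)" if x: "x \<in> V" for x w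
  proof -
    define S where "S = complex_of_real (Re (s x))"
    have S: "S \<noteq> 0" "s x = S" "cnj S = S"
    proof -
      show "S \<noteq> 0" using S0[OF x] by (simp add: S_def)
      show "s x = S" unfolding S_def by (rule sS[OF x])
      show "cnj S = S" by (simp add: S_def)
    qed
    interpret t: tetrad_at g x U "s x * cnj (s x)" "cvec (l x)" "cvec (n x)" "Z x" "vcnj (Z x)"
      by (rule tetrad) (use x V(4) in blast)
    note d = sm[THEN smooth_on_differentiable, OF x]
    define W where "W = (\<lambda>p. \<Sum>a\<in>UNIV. complex_of_real (w $ a) * p $ a)"
    have Du: "complex_of_real (differential u x w) = W (cvec (l x)) / S\<^sup>2"
      "complex_of_real (differential v x w) = W (cvec (n x)) / S\<^sup>2"
      "differential \<xi> x w = W (Z x) / S\<^sup>2"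
      "differential (\<lambda>y. cnj (\<xi> y)) x w = W (vcnj (Z x)) / S\<^sup>2"
    proof -
      have dc: "(\<lambda>y. cnj (\<xi> y)) differentiable at x"
        by (rule smooth_on_differentiable[OF smooth_on_cnj[OF V(1) sm(3)] x])
      show "complex_of_real (differential u x w) = W (cvec (l x)) / S\<^sup>2"
        "complex_of_real (differential v x w) = W (cvec (n x)) / S\<^sup>2"
        "differential \<xi> x w = W (Z x) / S\<^sup>2"
        "differential (\<lambda>y. cnj (\<xi> y)) x w = W (vcnj (Z x)) / S\<^sup>2"
        unfolding differential_def W_def frechet_derivative_pd[OF d(1)] frechet_derivative_pd[OF d(2)]
          frechet_derivative_pd[OF d(3)] frechet_derivative_pd[OF dc] pd_cnj[OF d(3)] du[OF x] dv[OF x] dxi[OF x] sum_divide_distrib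
        by (simp_all add: S_def scaleR_conv_of_real)
    qed
    have "complex_of_real (w \<bullet> (g x *v w)) =
        (\<Sum>a\<in>UNIV. \<Sum>b\<in>UNIV. complex_of_real (w $ a) * complex_of_real (w $ b) * complex_of_real (g x $ a $ b))"
      by (simp add: inner_vec_def matrix_vector_mult_def sum_distrib_left mult_ac)
    also have "\<dots> = (\<Sum>a\<in>UNIV. \<Sum>b\<in>UNIV. complex_of_real (w $ a) * complex_of_real (w $ b) *
        ((- cvec (l x) $ a * cvec (n x) $ b - cvec (n x) $ a * cvec (l x) $ b + Z x $ a * vcnj (Z x) $ b + vcnj (Z x) $ a * Z x $ b) / S\<^sup>2))"
      unfolding t.metric S(2,3) power2_eq_square ..
    also have "\<dots> = (- 2 * W (cvec (l x)) * W (cvec (n x)) + 2 * W (Z x) * W (vcnj (Z x))) / S\<^sup>2"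
      unfolding W_def sum4 divide_inverse by (simp add: algebra_simps del: cvec_nth vcnj_nth)
    also have "\<dots> = S\<^sup>2 * (- 2 * (W (cvec (l x)) / S\<^sup>2) * (W (cvec (n x)) / S\<^sup>2) + 2 * (W (Z x) / S\<^sup>2) * (W (vcnj (Z x)) / S\<^sup>2))"
      using S(1) by (simp add: field_simps power2_eq_square)
    finally show ?thesis unfolding Du vf[OF x] by (simp add: S_def power_one_over)
  qed
  have 2: "l x = (\<chi> a. pd a u x / (v x + f (u x))\<^sup>2)" if x: "x \<in> V" for x
    using S0[OF x] by (simp add: vec_eq_iff du[OF x] vf[OF x] power_one_over)
  \<comment> \<open>With v + f = 1/s, f' = -lam and f'' = -k s^2, the coefficient -2k/s of the
    curvature formula becomes 2 f'' (v + f)^3 and -6 lam becomes 6 f'.\<close>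
  have 3: "ricci g x = (\<chi> a b. 2 * deriv (deriv f) (u x) * (v x + f (u x)) ^ 3 * l x $ a * l x $ b
      + 6 * deriv f (u x) * g x $ a $ b)" if x: "x \<in> V" for x
  proof -
    have xU: "x \<in> U" using x V(4) by blast
    obtain k where k: "\<And>a. pd a lam x = k * l x $ a" using dlam[OF xU] by blast
    show ?thesis using S0[OF x]
      by (simp add: vec_eq_iff ricci_real_frame[OF xU k] ddf[OF x k] df[OF x] vf[OF x] power_one_over power2_eq_square power3_eq_cube)
  qed
  have 4: "deriv (deriv f) (u x) = 0" if "x \<in> V" "\<And>a. pd a lam x = 0" for x
    using ddf[OF that(1), of 0] that(2) by simp
  have 5: "v x + f (u x) \<noteq> 0" if "x \<in> V" for x using vf[OF that] S0[OF that] by simp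
  show thesis by (rule that[OF V 5 1 2 3 4]) blast+
  qed
qed

lemma (in spinor_frame) twisting:
  assumes x: "x \<in> U" and im: "Im (s x) \<noteq> 0"
  shows "\<exists>a b c. l x $ a * (pd b (\<lambda>y. l y $ c) x - pd c (\<lambda>y. l y $ b) x)
    + l x $ b * (pd c (\<lambda>y. l y $ a) x - pd a (\<lambda>y. l y $ c) x)
    + l x $ c * (pd a (\<lambda>y. l y $ b) x - pd b (\<lambda>y. l y $ a) x) \<noteq> 0"
proof (rule ccontr)
  assume "\<not> ?thesis"
  then have 0: "l x $ a * (pd b (\<lambda>y. l y $ c) x - pd c (\<lambda>y. l y $ b) x)
    + l x $ b * (pd c (\<lambda>y. l y $ a) x - pd a (\<lambda>y. l y $ c) x)
    + l x $ c * (pd a (\<lambda>y. l y $ b) x - pd b (\<lambda>y. l y $ a) x) = 0" for a b c by blast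
  interpret t: tetrad_at g x U "s x * cnj (s x)" "cvec (l x)" "cvec (n x)" "Z x" "vcnj (Z x)" by (rule tetrad[OF x])
  define \<alpha> where "\<alpha> = 1 / s x + 1 / cnj (s x)"
  define \<beta> where "\<beta> = 1 / s x - 1 / cnj (s x)"
  have "s x \<noteq> cnj (s x)" using im by (simp add: complex_eq_iff)
  then have \<beta>: "\<beta> \<noteq> 0" using s_nonzero[OF x] by (simp add: \<beta>_def field_simps)
  define L where "L = cvec (l x)"
  have cyc: "L $ a * (Z x $ b * vcnj (Z x) $ c - Z x $ c * vcnj (Z x) $ b) + L $ b * (Z x $ c * vcnj (Z x) $ a - Z x $ a * vcnj (Z x) $ c)
      + L $ c * (Z x $ a * vcnj (Z x) $ b - Z x $ b * vcnj (Z x) $ a) = 0" (is "?c = 0") for a b c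
  proof -
    have "L $ a * complex_of_real (pd b (\<lambda>y. l y $ c) x - pd c (\<lambda>y. l y $ b) x)
      + L $ b * complex_of_real (pd c (\<lambda>y. l y $ a) x - pd a (\<lambda>y. l y $ c) x)
      + L $ c * complex_of_real (pd a (\<lambda>y. l y $ b) x - pd b (\<lambda>y. l y $ a) x) = complex_of_real 0"
      unfolding L_def cvec_nth of_real_mult[symmetric] of_real_add[symmetric] 0 ..
    then have "\<beta> * ?c = 0"
      unfolding curl_l[OF x] \<alpha>_def[symmetric] \<beta>_def[symmetric] L_def[symmetric] wedge_def
      by (simp add: algebra_simps del: cvec_nth vcnj_nth)
    then show ?thesis using \<beta> by simp
  qed
  \<comment> \<open>For fixed a, b the cyclic sum is a linear relation among L, Z, Z* in the index
    c; the coefficient of Z* must vanish.\<close>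
  have "L $ a * Z x $ b - L $ b * Z x $ a = 0" for a b
    using t.independent[of "Z x $ a * vcnj (Z x) $ b - Z x $ b * vcnj (Z x) $ a" 0
        "L $ b * vcnj (Z x) $ a - L $ a * vcnj (Z x) $ b" "L $ a * Z x $ b - L $ b * Z x $ a"]
      cyc[of a b] by (simp add: L_def[symmetric] algebra_simps del: cvec_nth vcnj_nth)
  then have "L $ a = 0" for a
    using t.independent[of "- Z x $ a" 0 "L $ a" 0] by (simp add: L_def[symmetric] algebra_simps del: cvec_nth vcnj_nth)
  then show False using l_nonzero[OF x] by (simp add: L_def)
qed

lemma CKY_subset:
  assumes "V \<subseteq> M"
  shows "CKY_on M g A \<Longrightarrow> CKY_on V g A" "null_on M g A \<Longrightarrow> null_on V g A"
    "independent_Killing_codiffs_on M g A \<Longrightarrow> independent_Killing_codiffs_on V g A"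
  using assms smooth_on_subset[of M A V]
  unfolding CKY_on_def two_form_on_def null_on_def independent_Killing_codiffs_on_def Killing_on_def by blast+

theorem theorem1:
  fixes M :: "(real ^ 4) set" and g A :: "real ^ 4 \<Rightarrow> real ^ 4 ^ 4" and p :: "real ^ 4"
  assumes "spacetime M g"
    and "CKY_on M g A"
    and "null_on M g A"
    and "independent_Killing_codiffs_on M g A"
    and "p \<in> M"
  shows "\<exists>U (u :: real ^ 4 \<Rightarrow> real) (v :: real ^ 4 \<Rightarrow> real) (\<xi> :: real ^ 4 \<Rightarrow> complex)
            (f :: real \<Rightarrow> real) (l :: real ^ 4 \<Rightarrow> real ^ 4) (A' :: real ^ 4 \<Rightarrow> real ^ 4 ^ 4).
     open U \<and> connected U \<and> p \<in> U \<and> U \<subseteq> M \<and>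
     coordinates_on U u v \<xi> \<and> smooth_on (u ` U) f \<and>
     (\<forall>x\<in>U. v x + f (u x) \<noteq> 0) \<and>
     (\<forall>x\<in>U. \<forall>w. complex_of_real (w \<bullet> (g x *v w)) =
        complex_of_real (1 / (v x + f (u x))\<^sup>2) *
          (- 2 * complex_of_real (differential u x w) * complex_of_real (differential v x w)
           + 2 * differential \<xi> x w * differential (\<lambda>y. cnj (\<xi> y)) x w)) \<and>
     (\<forall>x\<in>U. l x = (\<chi> a. pd a u x / (v x + f (u x))\<^sup>2)) \<and>
     (\<forall>x\<in>U. ricci g x =
        (\<chi> a b. 2 * deriv (deriv f) (u x) * (v x + f (u x)) ^ 3 * l x $ a * l x $ b
              + 6 * deriv f (u x) * g x $ a $ b)) \<and>
     CKY_on U g A' \<and> null_on U g A' \<and> independent_Killing_codiffs_on U g A' \<and>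
     (\<forall>x\<in>U. fundamental_at g A' x (l x)) \<and>
     ((\<forall>x\<in>U. A' x = A x) \<or> (\<forall>x\<in>U. deriv (deriv f) (u x) = 0) \<and> twisting_on U g A)"
proof -
  obtain U l n Z s lam where U: "p \<in> U" "U \<subseteq> M" and frame: "spinor_frame U g l n Z s lam"
    and A: "\<And>x a b. x \<in> U \<Longrightarrow> cnj (s x) * selfdual g A x $ a $ b = wedge (cvec (l x)) (Z x) $ a $ b"
    using null_CKY_spinor_frame[OF assms] by metis
  interpret F: spinor_frame U g l n Z s lam by (rule frame)
  show ?thesis
  \<comment> \<open>Im s is constant on a ball around \<open>p\<close>, so its value at
    \<open>p\<close> decides which alternative of the conclusion is available.\<close>
  proof (cases "Im (s p) = 0")
    case True
    obtain r where r: "r > 0" "ball p r \<subseteq> U" using openE[OF F.U U(1)] by blast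
    have "cnj (s x) = s x" if "x \<in> ball p r" for x
      using F.Im_s_constant[OF r(2) that, of p] r(1) True by (simp add: complex_eq_iff)
    then interpret R: real_frame "ball p r" g l n Z s lam
      using F.spinor_frame_subset[OF open_ball r(2)] by (simp add: real_frame_def real_frame_axioms_def)
    have pb: "p \<in> ball p r" using r(1) by simp
    show ?thesis
    proof (rule R.normal_form[OF pb])
    fix V u v \<xi> f assume V: "open V" "connected V" "p \<in> V" "V \<subseteq> ball p r" "coordinates_on V u v \<xi>" "smooth_on (u ` V) f"
      and N: "\<And>x. x \<in> V \<Longrightarrow> v x + f (u x) \<noteq> 0"
        "\<And>x w. x \<in> V \<Longrightarrow> complex_of_real (w \<bullet> (g x *v w)) = complex_of_real (1 / (v x + f (u x))\<^sup>2) *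
          (- 2 * complex_of_real (differential u x w) * complex_of_real (differential v x w)
            + 2 * differential \<xi> x w * differential (\<lambda>y. cnj (\<xi> y)) x w)"
        "\<And>x. x \<in> V \<Longrightarrow> l x = (\<chi> a. pd a u x / (v x + f (u x))\<^sup>2)"
        "\<And>x. x \<in> V \<Longrightarrow> ricci g x = (\<chi> a b. 2 * deriv (deriv f) (u x) * (v x + f (u x)) ^ 3 * l x $ a * l x $ b
          + 6 * deriv f (u x) * g x $ a $ b)"
    have VU: "V \<subseteq> U" "V \<subseteq> M" using V(4) r(2) U(2) by blast+
    note C = CKY_subset(1)[OF VU(2) assms(2)] CKY_subset(2)[OF VU(2) assms(3)] CKY_subset(3)[OF VU(2) assms(4)]
    have fa: "fundamental_at g A x (l x)" if "x \<in> V" for x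
      using F.fundamental[of x A] A that VU by blast
    show ?thesis
      by (intro exI[of _ V] exI[of _ u] exI[of _ v] exI[of _ \<xi>] exI[of _ f] exI[of _ l] exI[of _ A] conjI ballI allI)
        (assumption | rule V(1-3,5,6) VU(2) N C fa disjI1 ballI refl)+
    qed
  next
    case False
    obtain r l' n' Z' s' where r: "r > 0" "ball p r \<subseteq> U" and frame': "spinor_frame (ball p r) g l' n' Z' s' lam"
      and s': "\<And>x. x \<in> ball p r \<Longrightarrow> Im (s' x) = 0" and lam: "\<And>x a. x \<in> ball p r \<Longrightarrow> pd a lam x = 0"
      and twist: "\<And>x. x \<in> ball p r \<Longrightarrow> Im (s x) \<noteq> 0"
      using F.untwisted_frame[OF U(1) False] by metis
    have "cnj (s' x) = s' x" if "x \<in> ball p r" for x using s'[OF that] by (simp add: complex_eq_iff)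
    then interpret R: real_frame "ball p r" g l' n' Z' s' lam
      using frame' by (simp add: real_frame_def real_frame_axioms_def)
    obtain A' where A': "CKY_on (ball p r) g A'" "null_on (ball p r) g A'" "independent_Killing_codiffs_on (ball p r) g A'"
      "\<And>x. x \<in> ball p r \<Longrightarrow> fundamental_at g A' x (l' x)"
      using R.Killing_Yano by metis
    have pb: "p \<in> ball p r" using r(1) by simp
    show ?thesis
    proof (rule R.normal_form[OF pb])
    fix V u v \<xi> f assume V: "open V" "connected V" "p \<in> V" "V \<subseteq> ball p r" "coordinates_on V u v \<xi>" "smooth_on (u ` V) f"
      and N: "\<And>x. x \<in> V \<Longrightarrow> v x + f (u x) \<noteq> 0"
        "\<And>x w. x \<in> V \<Longrightarrow> complex_of_real (w \<bullet> (g x *v w)) = complex_of_real (1 / (v x + f (u x))\<^sup>2) *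
          (- 2 * complex_of_real (differential u x w) * complex_of_real (differential v x w)
            + 2 * differential \<xi> x w * differential (\<lambda>y. cnj (\<xi> y)) x w)"
        "\<And>x. x \<in> V \<Longrightarrow> l' x = (\<chi> a. pd a u x / (v x + f (u x))\<^sup>2)"
        "\<And>x. x \<in> V \<Longrightarrow> ricci g x = (\<chi> a b. 2 * deriv (deriv f) (u x) * (v x + f (u x)) ^ 3 * l' x $ a * l' x $ b
          + 6 * deriv f (u x) * g x $ a $ b)"
      and ddf: "\<And>x. x \<in> V \<Longrightarrow> (\<And>a. pd a lam x = 0) \<Longrightarrow> deriv (deriv f) (u x) = 0"
    have VU: "V \<subseteq> U" "V \<subseteq> M" using V(4) r(2) U(2) by blast+
    note C = CKY_subset(1)[OF V(4) A'(1)] CKY_subset(2)[OF V(4) A'(2)] CKY_subset(3)[OF V(4) A'(3)]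
    have z: "deriv (deriv f) (u x) = 0" if "x \<in> V" for x using ddf[OF that] lam that V(4) by blast
    have tw: "twisting_on V g A"
      unfolding twisting_on_def
    \<comment> \<open>Twist concerns the given tensor, hence its own fundamental 1-form
      \<open>l\<close> and not the new \<open>l'\<close>.\<close>
    proof (intro exI[of _ l] conjI ballI)
      show "smooth_on V l" by (rule smooth_on_subset[OF F.smooth(1) VU(1)])
      fix x assume x: "x \<in> V"
      then have xU: "x \<in> U" using VU by blast
      show "fundamental_at g A x (l x)" by (rule F.fundamental[OF xU A[OF xU]])
      show "\<exists>a b c. l x $ a * (pd b (\<lambda>y. l y $ c) x - pd c (\<lambda>y. l y $ b) x)
               + l x $ b * (pd c (\<lambda>y. l y $ a) x - pd a (\<lambda>y. l y $ c) x)
               + l x $ c * (pd a (\<lambda>y. l y $ b) x - pd b (\<lambda>y. l y $ a) x) \<noteq> 0"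
        by (rule F.twisting[OF xU twist]) (use x V(4) in blast)
    qed
    have fa: "fundamental_at g A' x (l' x)" if "x \<in> V" for x using A'(4) that V(4) by blast
    show ?thesis
      by (intro exI[of _ V] exI[of _ u] exI[of _ v] exI[of _ \<xi>] exI[of _ f] exI[of _ l'] exI[of _ A'] conjI ballI allI)
        (assumption | rule V(1-3,5,6) VU(2) N C fa disjI2 conjI ballI z tw)+
    qed
  qed
qed

end
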